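(* Let $m,n\in\mathbb Z_{>0}$ with $m>2n$, and let $\Gamma$ be a congruence subgroup of $\mathrm{Sp}_{2n}(\mathbb Z)$. Then $$\langle f,P_\Gamma f_{1,m}\rangle_{\Gamma\backslash\mathcal H_n}=C_{m,n}\,f(iI_n)\qquad\text{for all }f\in S_m(\Gamma),$$ where $$C_{m,n}=2^{\frac{n(n+3)}2}\pi^{\frac{n(n+1)}2}\prod_{r=1}^n\frac{\Gamma\left(m-\frac{n+r}2\right)}{\Gamma\left(m-\frac{r-1}2\right)}$$ (in the last formula $\Gamma$ denotes the gamma function).
   Context: $\mathcal H_n=\{z=x+iy\in M_n(\mathbb C): z^\top=z,\ y>0\}$ is the Siegel upper half-space. The group $\mathrm{Sp}_{2n}(\mathbb R)=\{g\in\mathrm{GL}_{2n}(\mathbb R):g^\top J_ng=J_n\}$, $J_n=\begin{pmatrix}0&I_n\\-I_n&0\end{pmatrix}$, acts on $\mathcal H_n$ by $g.z=(Az+B)(Cz+D)^{-1}$ for $g=\begin{pmatrix}A&B\\C&D\end{pmatrix}$. For $f:\mathcal H_n\to\mathbb C$ put $(f|_mg)(z)=\det(Cz+D)^{-m}f(g.z)$. A congruence subgroup of $\mathrm{Sp}_{2n}(\mathbb Z)$ is a subgroup of $\mathrm{Sp}_{2n}(\mathbb Z)$ containing $\Gamma_n(N)=\{g\in\mathrm{Sp}_{2n}(\mathbb Z): g\equiv I_{2n}\pmod N\}$ for some $N\in\mathbb Z_{>0}$. $S_m(\Gamma)$ is the space of holomorphic $f:\mathcal H_n\to\mathbb C$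 such that $f|_m\gamma=f$ for all $\gamma\in\Gamma$ and $\sup_{z=x+iy\in\mathcal H_n}|f(z)|(\det y)^{m/2}<\infty$, with the Petersson inner product $$\langle f_1,f_2\rangle_{\Gamma\backslash\mathcal H_n}=\frac1{|\Gamma\cap\{\pm I_{2n}\}|}\int_{\Gamma\backslash\mathcal H_n}f_1(z)\overline{f_2(z)}(\det y)^m\,d\mathsf v(z),\qquad d\mathsf v(z)=(\det y)^{-n-1}\prod_{1\le r\le s\le n}dx_{r,s}\,dy_{r,s}.$$ Here $f_{1,m}(z)=(2i)^{mn}\det(z+iI_n)^{-m}$ for $z\in\mathcal H_n$, and $P_\Gamma f_{1,m}=\sum_{\gamma\in\Gamma}f_{1,m}|_m\gamma$, which for $m>2n$ converges absolutely and uniformly on compact subsets of $\mathcal H_n$ and belongs to $S_m(\Gamma)$. *)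

theory Defs
  imports "HOL-Analysis.Analysis"
begin

text \<open>
  The degree n is the cardinality of an index type of class \<open>{finite, linorder}\<close>; the order is used
  only to index the coordinates \<open>z\<^sub>r\<^sub>s\<close>, \<open>r \<le> s\<close>, of a symmetric matrix. Matrices of size 2n are
  indexed by the sum type, so that the four blocks are given by \<open>Inl\<close> and \<open>Inr\<close>.
\<close>

type_synonym 'n cmat = "complex ^ 'n ^ 'n"
type_synonym 'n rmat2 = "real ^ ('n + 'n) ^ ('n + 'n)"

definition pos_def_matrix :: "real ^ 'n ^ 'n \<Rightarrow> bool" where
  "pos_def_matrix y \<longleftrightarrow> transpose y = y \<and> (\<forall>v. v \<noteq> 0 \<longrightarrow> v \<bullet> (y *v v) > 0)"

definition Im_matrix :: "'n::finite cmat \<Rightarrow> real ^ 'n ^ 'n" where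
  "Im_matrix z = map_matrix Im z"

definition siegel :: "'n::finite cmat set" where
  "siegel = {z. transpose z = z \<and> pos_def_matrix (Im_matrix z)}"

definition sp_J :: "'n::finite rmat2" where
  "sp_J = (\<chi> i j. case (i, j) of
      (Inl a, Inr b) \<Rightarrow> if a = b then 1 else 0
    | (Inr a, Inl b) \<Rightarrow> if a = b then - 1 else 0
    | _ \<Rightarrow> 0)"

definition Sp_real :: "'n::finite rmat2 set" where
  "Sp_real = {g. invertible g \<and> transpose g ** sp_J ** g = sp_J}"

definition Sp_int :: "'n::finite rmat2 set" where
  "Sp_int = {g \<in> Sp_real. \<forall>i j. g $ i $ j \<in> \<int>}"

definition blk_A :: "'n::finite rmat2 \<Rightarrow> 'n cmat" where
  "blk_A g = (\<chi> i j. complex_of_real (g $ Inl i $ Inl j))"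

definition blk_B :: "'n::finite rmat2 \<Rightarrow> 'n cmat" where
  "blk_B g = (\<chi> i j. complex_of_real (g $ Inl i $ Inr j))"

definition blk_C :: "'n::finite rmat2 \<Rightarrow> 'n cmat" where
  "blk_C g = (\<chi> i j. complex_of_real (g $ Inr i $ Inl j))"

definition blk_D :: "'n::finite rmat2 \<Rightarrow> 'n cmat" where
  "blk_D g = (\<chi> i j. complex_of_real (g $ Inr i $ Inr j))"

definition sp_act :: "'n::finite rmat2 \<Rightarrow> 'n cmat \<Rightarrow> 'n cmat" where
  "sp_act g z = (blk_A g ** z + blk_B g) ** matrix_inv (blk_C g ** z + blk_D g)"

definition slash :: "nat \<Rightarrow> ('n::finite cmat \<Rightarrow> complex) \<Rightarrow> 'n rmat2 \<Rightarrow> 'n cmat \<Rightarrow> complex" where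
  "slash m f g z = det (blk_C g ** z + blk_D g) powi (- int m) * f (sp_act g z)"

definition principal_congruence_subgroup :: "nat \<Rightarrow> 'n::finite rmat2 set" where
  "principal_congruence_subgroup N =
     {g \<in> Sp_int. \<forall>i j. (g $ i $ j - mat 1 $ i $ j) / real N \<in> \<int>}"

definition congruence_subgroup :: "'n::finite rmat2 set \<Rightarrow> bool" where
  "congruence_subgroup \<Gamma> \<longleftrightarrow>
     \<Gamma> \<subseteq> Sp_int \<and>
     mat 1 \<in> \<Gamma> \<and> (\<forall>g\<in>\<Gamma>. \<forall>h\<in>\<Gamma>. g ** h \<in> \<Gamma>) \<and> (\<forall>g\<in>\<Gamma>. matrix_inv g \<in> \<Gamma>) \<and>
     (\<exists>N>0. principal_congruence_subgroup N \<subseteq> \<Gamma>)"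

text \<open>
  The half-space is open in the space of symmetric matrices, not in the space of all matrices.
  Holomorphy is therefore complex differentiability within \<^term>\<open>siegel\<close>; only the restriction
  of \<open>D\<close> to symmetric matrices matters.
\<close>

definition siegel_holomorphic :: "('n::finite cmat \<Rightarrow> complex) \<Rightarrow> bool" where
  "siegel_holomorphic f \<longleftrightarrow>
     (\<forall>z\<in>siegel. \<exists>D. (f has_derivative D) (at z within siegel) \<and>
        (\<forall>c w. D (map_matrix ((*) c) w) = c * D w))"

text \<open>Functions on the half-space are total functions whose values outside it are irrelevant.\<close>

definition cusp_forms :: "nat \<Rightarrow> 'n::finite rmat2 set \<Rightarrow> ('n cmat \<Rightarrow> complex) set" where
  "cusp_forms m \<Gamma> = {f. siegel_holomorphic f \<and>
     (\<forall>\<gamma>\<in>\<Gamma>. \<forall>z\<in>siegel. slash m f \<gamma> z = f z) \<and>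
     bdd_above ((\<lambda>z. norm (f z) * det (Im_matrix z) powr (real m / 2)) ` siegel)}"

text \<open>Lebesgue measure on symmetric matrices in the coordinates \<open>x\<^sub>r\<^sub>s, y\<^sub>r\<^sub>s\<close> with \<open>r \<le> s\<close>.\<close>

definition sym_lborel :: "'n::{finite,linorder} cmat measure" where
  "sym_lborel =
     distr (PiM {(r, s). r \<le> s} (\<lambda>_. lborel :: complex measure)) borel
       (\<lambda>a. \<chi> r s. a (min r s, max r s))"

definition siegel_measure :: "'n::{finite,linorder} cmat measure" where
  "siegel_measure = density (restrict_space sym_lborel siegel)
     (\<lambda>z. ennreal (det (Im_matrix z) powi (- int CARD('n) - 1)))"

definition siegel_orbit :: "'n::finite rmat2 set \<Rightarrow> 'n cmat \<Rightarrow> 'n cmat set" where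
  "siegel_orbit \<Gamma> z = (\<lambda>\<gamma>. sp_act \<gamma> z) ` \<Gamma>"

definition siegel_quotient :: "'n::finite rmat2 set \<Rightarrow> 'n cmat set set" where
  "siegel_quotient \<Gamma> = siegel_orbit \<Gamma> ` siegel"

text \<open>
  The measure on the orbit space (with the quotient sigma-algebra) that corresponds to integration
  over a fundamental domain: the measure of a set \<open>E\<close> of orbits is the largest measure of
  a Borel set that lies over \<open>E\<close> and contains at most one point of each orbit. For a discrete group
  the supremum is attained at the part over \<open>E\<close> of any Borel fundamental domain.
\<close>

definition siegel_quotient_measure ::
    "'n::{finite,linorder} rmat2 set \<Rightarrow> 'n cmat set measure" where
  "siegel_quotient_measure \<Gamma> =
     measure_of (siegel_quotient \<Gamma>)
       {E. E \<subseteq> siegel_quotient \<Gamma> \<and> \<Union>E \<in> sets siegel_measure}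
       (\<lambda>E. SUP A \<in> {A \<in> sets siegel_measure. A \<subseteq> \<Union>E \<and> inj_on (siegel_orbit \<Gamma>) A}.
              emeasure siegel_measure A)"

text \<open>
  For forms of weight \<open>m\<close> the integrand is \<open>\<Gamma>\<close>-invariant, so it descends to the orbit space by
  evaluation at an arbitrary representative.
\<close>

definition petersson ::
    "nat \<Rightarrow> 'n::{finite,linorder} rmat2 set \<Rightarrow> ('n cmat \<Rightarrow> complex) \<Rightarrow> ('n cmat \<Rightarrow> complex) \<Rightarrow> complex"
  where
  "petersson m \<Gamma> f\<^sub>1 f\<^sub>2 =
     1 / of_nat (card (\<Gamma> \<inter> {mat 1, - mat 1})) *
     (\<integral>orb. (let z = (SOME z. z \<in> orb) in
        f\<^sub>1 z * cnj (f\<^sub>2 z) * complex_of_real (det (Im_matrix z) ^ m)) \<partial>siegel_quotient_measure \<Gamma>)"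

definition f_one :: "nat \<Rightarrow> 'n::finite cmat \<Rightarrow> complex" where
  "f_one m z = (2 * \<i>) ^ (m * CARD('n)) * det (z + mat \<i>) powi (- int m)"

definition poincare_series ::
    "nat \<Rightarrow> 'n::finite rmat2 set \<Rightarrow> ('n cmat \<Rightarrow> complex) \<Rightarrow> 'n cmat \<Rightarrow> complex" where
  "poincare_series m \<Gamma> f z = (\<Sum>\<^sub>\<infinity>\<gamma>\<in>\<Gamma>. slash m f \<gamma> z)"

definition C_const :: "nat \<Rightarrow> nat \<Rightarrow> real" where
  "C_const m n = 2 powr (real (n * (n + 3)) / 2) * pi powr (real (n * (n + 1)) / 2) *
     (\<Prod>r = 1..n. Gamma (real m - real (n + r) / 2) / Gamma (real m - (real r - 1) / 2))"

end

theory Submission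
  imports Defs "HOL-Complex_Analysis.Complex_Analysis" "HOL-Probability.Probability"
begin

text \<open>
  Put \<open>k(z) = f(z) cnj (f\<^sub>1(z)) (det y)\<^sup>m\<close> with \<open>f\<^sub>1 = f_one m\<close>. Invariance of \<open>f\<close> gives
  \<open>k(\<gamma>z) = f(z) cnj ((f\<^sub>1|\<gamma>)(z)) (det y)\<^sup>m\<close>, so unfolding the Poincare series over a Borel fundamental
  domain turns the Petersson product into the integral of \<open>k\<close> over the whole half-space; the factor
  in front of the product is cancelled by the order of the generic stabilizer. The invariant measure
  is preserved by the rotations \<open>z \<mapsto> (cos \<theta> z + sin \<theta>)(- sin \<theta> z + cos \<theta>)\<inverse>\<close>, and along such an orbit \<open>k\<close>
  is a constant times the boundary values, at \<open>q = exp(2i\<theta>)\<close>, of a function that is holomorphic in the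
  unit disc and whose value at \<open>q = 0\<close> is a multiple of \<open>f(i)\<close>. Averaging over \<open>\<theta>\<close> therefore replaces
  \<open>f\<close> by \<open>f(i) f\<^sub>1\<close>. There remains the integral of \<open>|f\<^sub>1|\<^sup>2 (det y)\<^sup>m\<close>, which is evaluated by splitting off
  one row and column at a time: Schur complements reduce it to one-dimensional Gamma and Beta integrals.
\<close>

text \<open>Two obstacles shape the proof. The first is the invariance of the measure. No Jacobian
  of a matrix substitution is computed: changes of variables are cut into substitutions of single
  complex coordinates, justified by Fubini. The map z -> -1/z is too entangled for this directly, so
  it is reached through partial inversions at one index k, which invert z_kk, scale the rest of row
  k and translate all other entries. Inversion and translations then generate the remaining maps.
  The second is convergence. About f only |f| <= K (det y)^(-m/2) is known, so the kernel k is
  dominated by a multiple of |det(z + i)|^(-m) (det y)^(m/2). The integral of |det(z + i)|^(-2p)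
  (det y)^p is finite for p > n: the case p = m/2 explains the bound m > 2n, and the case p = m
  yields the constant, so one evaluated integral serves both purposes. The inductions behind this
  evaluation run over subsets S of a fixed index type; positive definite matrices keep their full
  size and agree with the identity outside S.\<close>

no_notation fps_nth (infixl "$" 75)

section \<open>Matrix algebra: ring laws, inverses, scalar matrices\<close>

lemma matrix_add_rdistrib': "(A + B) ** C = A ** C + B ** (C :: 'a::semiring_1^'n^'m)"
  by (vector matrix_matrix_mult_def sum.distrib[symmetric] distrib_right)

lemma matrix_diff_ldistrib': "A ** (B - C) = A ** B - A ** (C :: 'a::ring_1^'n^'m)"
  by (vector matrix_matrix_mult_def sum_subtractf[symmetric] right_diff_distrib)

lemma matrix_diff_rdistrib': "(A - B) ** C = A ** C - B ** (C :: 'a::ring_1^'n^'m)"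
  by (vector matrix_matrix_mult_def sum_subtractf[symmetric] left_diff_distrib)

lemma matrix_minus_left: "(- A) ** C = - (A ** (C :: 'a::ring_1^'n^'m))"
  by (vector matrix_matrix_mult_def sum_negf[symmetric])

lemma matrix_minus_right: "A ** (- C) = - (A ** (C :: 'a::ring_1^'n^'m))"
  by (vector matrix_matrix_mult_def sum_negf[symmetric])

lemma transpose_add: "transpose (A + B) = transpose A + transpose B"
  by (vector transpose_def)

lemma transpose_diff: "transpose (A - B) = transpose A - transpose B"
  by (vector transpose_def)

lemma transpose_minus: "transpose (- A) = - transpose A"
  by (vector transpose_def)

lemmas matrix_ring = matrix_add_ldistrib matrix_add_rdistrib' matrix_diff_ldistrib'
  matrix_diff_rdistrib' matrix_minus_left matrix_minus_right

lemma matrix_inv_right: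
  fixes A :: "'a::field^'n^'n"
  assumes "det A \<noteq> 0"
  shows "A ** matrix_inv A = mat 1"
proof -
  have "\<exists>A'. A ** A' = mat 1 \<and> A' ** A = mat 1"
    using assms invertible_det_nz[of A] unfolding invertible_def by blast
  from someI_ex[OF this] show ?thesis unfolding matrix_inv_def by blast
qed

lemma matrix_inv_left:
  fixes A :: "'a::field^'n^'n"
  assumes "det A \<noteq> 0"
  shows "matrix_inv A ** A = mat 1"
  using matrix_inv_right[OF assms] matrix_left_right_inverse by blast

lemma det_right_inverse:
  fixes A B :: "'a::field^'n^'n"
  assumes "A ** B = mat 1"
  shows "det A * det B = 1" "det A \<noteq> 0" "det B \<noteq> 0"
proof -
  show "det A * det B = 1" using assms by (metis det_mul det_I)
  then show "det A \<noteq> 0" "det B \<noteq> 0" by auto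
qed

lemma matrix_inv_unique:
  fixes A B :: "'a::field^'n^'n"
  assumes "A ** B = mat 1"
  shows "matrix_inv A = B"
proof -
  have "matrix_inv A = matrix_inv A ** (A ** B)" using assms by simp
  also have "\<dots> = B"
    using matrix_inv_left[OF det_right_inverse(2)[OF assms]] by (simp add: matrix_mul_assoc)
  finally show ?thesis .
qed

lemma matrix_inv_mul:
  fixes A B :: "'a::field^'n^'n"
  assumes "det A \<noteq> 0" "det B \<noteq> 0"
  shows "matrix_inv (A ** B) = matrix_inv B ** matrix_inv A"
proof (rule matrix_inv_unique)
  have "A ** B ** (matrix_inv B ** matrix_inv A) = A ** (B ** matrix_inv B) ** matrix_inv A"
    by (simp add: matrix_mul_assoc)
  then show "A ** B ** (matrix_inv B ** matrix_inv A) = mat 1"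
    using assms by (simp add: matrix_inv_right)
qed

text \<open>Cramer's rule for the j-th column of the inverse. Having the entries as quotients of
  determinants is what later makes \<open>matrix_inv\<close> measurable, and holomorphic along
  discs.\<close>

lemma matrix_inv_entry:
  fixes A :: "'a::field^'n^'n"
  assumes "det A \<noteq> 0"
  shows "matrix_inv A $ i $ j =
    det (\<chi> a b. if b = i then (if a = j then 1 else 0) else A $ a $ b) / det A"
proof -
  let ?x = "\<chi> a. matrix_inv A $ a $ j"
  have "A *v ?x = (\<chi> a. if a = j then 1 else 0)"
  proof -
    have "(A *v ?x) $ a = (A ** matrix_inv A) $ a $ j" for a
      by (simp add: matrix_vector_mult_def matrix_matrix_mult_def)
    then show ?thesis
      by (simp add: matrix_inv_right[OF assms] mat_def vec_eq_iff)
  qed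
  from cramer[OF assms, THEN iffD1, OF this]
  have "?x $ i = det (\<chi> a b. if b = i then (\<chi> a. if a = j then 1 else 0) $ a else A $ a $ b) / det A"
    by (subst \<open>?x = _\<close>) simp
  also have "(\<chi> a b. if b = i then (\<chi> a. if a = j then 1 else 0) $ a else A $ a $ b) =
      (\<chi> a b. if b = i then (if a = j then 1 else 0) else A $ a $ b)"
    by (simp add: vec_eq_iff)
  finally show ?thesis by simp
qed

lemma matrix_cancel_right:
  fixes A B N :: "'a::field^'n^'n"
  assumes "det N \<noteq> 0" "A ** N = B ** N"
  shows "A = B"
proof -
  have "A ** (N ** matrix_inv N) = B ** (N ** matrix_inv N)"
    using assms(2) by (simp add: matrix_mul_assoc)
  then show ?thesis using matrix_inv_right[OF assms(1)] by simp
qed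

lemma matrix_cancel_left:
  fixes A B N :: "'a::field^'n^'n"
  assumes "det N \<noteq> 0" "N ** A = N ** B"
  shows "A = B"
proof -
  have "(matrix_inv N ** N) ** A = (matrix_inv N ** N) ** B"
    using assms(2) by (simp add: matrix_mul_assoc[symmetric])
  then show ?thesis using matrix_inv_left[OF assms(1)] by simp
qed

lemma mat_commute: "mat c ** A = A ** mat (c::'a::comm_ring_1)"
  by (simp add: matrix_matrix_mult_def mat_def vec_eq_iff if_distrib if_distribR mult.commute cong: if_cong)

lemma mat_mult_entry: "(mat c ** A) $ i $ j = (c::'a::comm_ring_1) * A $ i $ j"
  by (simp add: matrix_matrix_mult_def mat_def if_distrib if_distribR cong: if_cong)

lemma det_mat: "det (mat c :: 'a::comm_ring_1^'n^'n) = c ^ CARD('n)"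
  by (subst det_diagonal) (auto simp: mat_def)

lemma det_nonzero_kernel:
  fixes A :: "'a::field^'n^'n"
  assumes "\<And>x. x \<noteq> 0 \<Longrightarrow> A *v x \<noteq> 0"
  shows "det A \<noteq> 0"
proof -
  have "\<exists>B. B ** A = mat 1"
    unfolding matrix_left_invertible_ker using assms by blast
  then show ?thesis using det_right_inverse by blast
qed

lemma transpose_matrix_inv:
  fixes A :: "'a::field^'n^'n"
  assumes "det A \<noteq> 0"
  shows "transpose (matrix_inv A) = matrix_inv (transpose A)"
  by (metis assms matrix_inv_left matrix_inv_unique matrix_transpose_mul transpose_mat)

subsection \<open>Hermitian forms and the half-space\<close>

abbreviation cm :: "real^'n^'m \<Rightarrow> complex^'n^'m" where
  "cm \<equiv> map_matrix complex_of_real"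

abbreviation cj :: "complex^'n^'m \<Rightarrow> complex^'n^'m" where
  "cj \<equiv> map_matrix cnj"

definition herm :: "complex^'n \<Rightarrow> complex^'n \<Rightarrow> complex" where
  "herm x y = (\<Sum>i\<in>UNIV. cnj (x $ i) * y $ i)"

lemma cm_mult: "cm (A ** B) = cm A ** cm B"
  by (simp add: matrix_matrix_mult_def vec_eq_iff)

lemma cj_mult: "cj (A ** B) = cj A ** cj B"
  by (simp add: matrix_matrix_mult_def vec_eq_iff)

lemma cj_add: "cj (A + B) = cj A + cj B"
  by (simp add: vec_eq_iff)

lemma cm_mat: "cm (mat c) = mat (of_real c)"
  by (simp add: mat_def vec_eq_iff)

lemma cj_mat: "cj (mat c) = mat (cnj c)"
  by (simp add: mat_def vec_eq_iff)

lemma transpose_cm: "transpose (cm A) = cm (transpose A)"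
  by (simp add: transpose_def vec_eq_iff)

lemma transpose_cj: "transpose (cj A) = cj (transpose A)"
  by (simp add: transpose_def vec_eq_iff)

lemma det_cm: "det (cm A) = complex_of_real (det A)"
  by (simp add: det_def)

lemma det_cj: "det (cj A) = cnj (det A)"
  by (simp add: det_def)

lemma herm_adjoint: "herm (A *v x) y = herm x (transpose (cj A) *v y)"
proof -
  have "herm (A *v x) y = (\<Sum>i\<in>UNIV. \<Sum>j\<in>UNIV. cnj (A $ i $ j) * cnj (x $ j) * y $ i)"
    by (simp add: herm_def matrix_vector_mult_def sum_distrib_right)
  also have "\<dots> = (\<Sum>j\<in>UNIV. \<Sum>i\<in>UNIV. cnj (A $ i $ j) * cnj (x $ j) * y $ i)"
    by (rule sum.swap)
  also have "\<dots> = herm x (transpose (cj A) *v y)"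
    by (simp add: herm_def matrix_vector_mult_def transpose_def sum_distrib_left mult_ac del: transpose_matrix_vector)
  finally show ?thesis .
qed

text \<open>For symmetric \<open>M\<close> the terms with Re M_ij cancel in pairs. This links the
  real quadratic form in the definition of \<open>siegel\<close> with the complex form that behaves
  well under linear fractional maps.\<close>

lemma herm_Im_symmetric:
  fixes M :: "complex^'n^'n"
  assumes "transpose M = M"
  shows "Im (herm v (M *v v)) =
    (\<chi> i. Re (v $ i)) \<bullet> (Im_matrix M *v (\<chi> i. Re (v $ i))) +
    (\<chi> i. Im (v $ i)) \<bullet> (Im_matrix M *v (\<chi> i. Im (v $ i)))"
proof -
  have sym: "M $ i $ j = M $ j $ i" for i j
    using arg_cong[OF assms, of "\<lambda>A. A $ j $ i"] by (simp add: transpose_def)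
  \<comment> \<open>The cross term; by symmetry of \<open>M\<close> it equals its mirror image
    \<open>A2\<close>, and the two enter with opposite signs.\<close>
  define A where "A = (\<Sum>i\<in>UNIV. \<Sum>j\<in>UNIV. Re (v $ i) * Im (v $ j) * Re (M $ i $ j))"
  have A2: "A = (\<Sum>i\<in>UNIV. \<Sum>j\<in>UNIV. Im (v $ i) * Re (v $ j) * Re (M $ i $ j))"
  proof -
    have "Re (v $ i) * Im (v $ j) * Re (M $ i $ j) = Im (v $ j) * Re (v $ i) * Re (M $ j $ i)" for i j
      by (subst sym) (rule arg_cong[OF mult.commute])
    then show ?thesis
      unfolding A_def by (subst sum.swap) (simp only:)
  qed
  have "herm v (M *v v) = (\<Sum>i\<in>UNIV. \<Sum>j\<in>UNIV. cnj (v $ i) * (M $ i $ j * v $ j))"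
    by (simp add: herm_def matrix_vector_mult_def sum_distrib_left)
  then have "Im (herm v (M *v v)) =
      (\<Sum>i\<in>UNIV. \<Sum>j\<in>UNIV. Im (cnj (v $ i) * (M $ i $ j * v $ j)))"
    by simp
  also have "\<dots> = (\<Sum>i\<in>UNIV. \<Sum>j\<in>UNIV. Re (v $ i) * (Im (M $ i $ j) * Re (v $ j))) +
      (\<Sum>i\<in>UNIV. \<Sum>j\<in>UNIV. Im (v $ i) * (Im (M $ i $ j) * Im (v $ j))) + (A - A)"
  proof -
    have pt: "Im (cnj (v $ i) * (M $ i $ j * v $ j)) = Re (v $ i) * (Im (M $ i $ j) * Re (v $ j)) +
       Im (v $ i) * (Im (M $ i $ j) * Im (v $ j)) +
       (Re (v $ i) * Im (v $ j) * Re (M $ i $ j) - Im (v $ i) * Re (v $ j) * Re (M $ i $ j))" for i j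
      by (simp add: algebra_simps)
    show ?thesis
      unfolding pt sum.distrib sum_subtractf A_def[symmetric] A2[symmetric] ..
  qed
  finally show ?thesis
    by (simp add: inner_vec_def matrix_vector_mult_def Im_matrix_def sum_distrib_left)
qed

lemma siegel_sym: "z \<in> siegel \<Longrightarrow> transpose z = z"
  by (simp add: siegel_def)

lemma siegel_pos: "z \<in> siegel \<Longrightarrow> pos_def_matrix (Im_matrix z)"
  by (simp add: siegel_def)

lemma siegel_herm:
  assumes "z \<in> siegel" "v \<noteq> 0"
  shows "Im (herm v (z *v v)) > 0"
proof -
  have p: "u \<bullet> (Im_matrix z *v u) \<ge> 0" "u \<noteq> 0 \<Longrightarrow> u \<bullet> (Im_matrix z *v u) > 0" for u
    using siegel_pos[OF assms(1)] unfolding pos_def_matrix_def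
    by (cases "u = 0"; force)+
  from assms(2) have "(\<chi> i. Re (v $ i)) \<noteq> 0 \<or> (\<chi> i. Im (v $ i)) \<noteq> (0 :: real^'a)"
    by (auto simp: vec_eq_iff complex_eq_iff)
  then show ?thesis
    unfolding herm_Im_symmetric[OF siegel_sym[OF assms(1)]]
    using p by (meson add_nonneg_pos add_pos_nonneg)
qed

lemma siegelI:
  assumes "transpose z = z" "\<And>v. v \<noteq> 0 \<Longrightarrow> Im (herm v (z *v v)) > 0"
  shows "z \<in> siegel"
proof -
  have "u \<bullet> (Im_matrix z *v u) > 0" if "u \<noteq> 0" for u
  proof -
    define v :: "complex^'a" where "v = (\<chi> i. complex_of_real (u $ i))"
    have "v \<noteq> 0" using that by (auto simp: v_def vec_eq_iff)
    from assms(2)[OF this] have "Im (herm v (z *v v)) > 0" .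
    moreover have "(\<chi> i. Re (v $ i)) = u" "(\<chi> i. Im (v $ i)) = 0"
      by (auto simp: v_def vec_eq_iff)
    ultimately show ?thesis
      unfolding herm_Im_symmetric[OF assms(1)] by simp
  qed
  moreover have "transpose (Im_matrix z) = Im_matrix z"
    using assms(1) by (simp add: Im_matrix_def transpose_def vec_eq_iff)
  ultimately show ?thesis using assms(1) by (simp add: siegel_def pos_def_matrix_def)
qed

text \<open>With w = P N^(-1) and v = N x, the form of w at v is
  \<open>herm (N *v x) (P *v x)\<close>, so membership can be tested on the pair (P, N) without
  dividing. The symplectic action, the partial inversions and the Cayley discs are all handled by
  this criterion.\<close>

lemma siegel_quotient_mem:
  fixes P N :: "'n::finite cmat"
  assumes sym: "transpose N ** P = transpose P ** N"
    and pos: "\<And>x. x \<noteq> 0 \<Longrightarrow> Im (herm (N *v x) (P *v x)) > 0"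
  shows "det N \<noteq> 0" "P ** matrix_inv N \<in> siegel"
proof -
  show d: "det N \<noteq> 0"
  proof (rule det_nonzero_kernel)
    fix x :: "complex^'n" assume "x \<noteq> 0"
    from pos[OF this] show "N *v x \<noteq> 0" by (auto simp: herm_def)
  qed
  define w where "w = P ** matrix_inv N"
  have wN: "w ** N = P"
    using d by (simp add: w_def matrix_mul_assoc[symmetric] matrix_inv_left)
  show "P ** matrix_inv N \<in> siegel"
    unfolding w_def[symmetric]
  proof (rule siegelI)
    have "transpose N ** transpose w ** N = transpose N ** w ** N"
      using sym wN by (metis matrix_mul_assoc matrix_transpose_mul)
    then show "transpose w = w"
      by (metis d det_transpose matrix_cancel_left matrix_cancel_right)
    fix v :: "complex^'n" assume v: "v \<noteq> 0"
    define x where "x = matrix_inv N *v v"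
    have Nx: "N *v x = v"
      by (simp add: x_def matrix_vector_mul_assoc matrix_inv_right[OF d])
    then have "x \<noteq> 0" using v by auto
    from pos[OF this] show "Im (herm v (w *v v)) > 0"
      using Nx wN by (metis matrix_vector_mul_assoc)
  qed
qed

text \<open>Multiplying w - conj w by the conjugate transpose of N on the left and by N on the right
  produces the left side of \<open>eq\<close>; comparing determinants gives the transformation law
  of det y.\<close>

lemma det_Im_quotient:
  fixes P N z :: "'n::finite cmat"
  assumes eq: "transpose (cj N) ** P - transpose (cj P) ** N = mat c ** (z - cj z)"
    and d: "det N \<noteq> 0" and mem: "P ** matrix_inv N \<in> siegel"
  shows "complex_of_real (det (Im_matrix (P ** matrix_inv N)) * (cmod (det N))\<^sup>2) =
    c ^ CARD('n) * det (Im_matrix z)"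
proof -
  define w where "w = P ** matrix_inv N"
  have wN: "P = w ** N"
    using d by (simp add: w_def matrix_mul_assoc[symmetric] matrix_inv_left)
  have sw: "transpose w = w" using siegel_sym[OF mem] by (simp add: w_def)
  have Im2: "u - cj u = mat (2 * \<i>) ** cm (Im_matrix u)" for u :: "'n cmat"
    by (simp add: vec_eq_iff mat_mult_entry Im_matrix_def complex_eq_iff)
  have "transpose (cj N) ** (w - cj w) ** N = transpose (cj N) ** P - transpose (cj P) ** N"
    unfolding wN cj_mult matrix_transpose_mul transpose_cj sw
    by (simp add: matrix_ring matrix_mul_assoc)
  also have "\<dots> = mat c ** (z - cj z)" by (rule eq)
  finally have "det (transpose (cj N) ** (w - cj w) ** N) = det (mat c ** (z - cj z))" by simp
  then have "cnj (det N) * ((2 * \<i>) ^ CARD('n) * of_real (det (Im_matrix w))) * det N =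
      c ^ CARD('n) * ((2 * \<i>) ^ CARD('n) * of_real (det (Im_matrix z)))"
    by (simp only: det_mul Im2 det_mat det_cm det_cj det_transpose)
  then have "of_real (det (Im_matrix w)) * (det N * cnj (det N)) = c ^ CARD('n) * of_real (det (Im_matrix z))"
    by (simp add: mult_ac)
  then show ?thesis
    unfolding w_def[symmetric] complex_norm_square[symmetric] by simp
qed

text \<open>The segment from the identity to \<open>y\<close> consists of matrices with positive
  form, hence without kernel. The determinant does not vanish along it and keeps the sign it has at
  the identity.\<close>

lemma pos_def_det_pos:
  fixes y :: "real^'n^'n"
  assumes "pos_def_matrix y"
  shows "det y > 0"
proof -
  define M where "M t = (\<chi> i j. (1 - t) * (mat 1 $ i $ j) + t * y $ i $ j)" for t :: real
  have nz: "det (M t) \<noteq> 0" if "0 \<le> t" "t \<le> 1" for t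
  proof (rule det_nonzero_kernel)
    fix x :: "real^'n" assume x: "x \<noteq> 0"
    have "M t *v x = (1 - t) *\<^sub>R x + t *\<^sub>R (y *v x)"
    proof -
      have "(M t *v x) $ i = (1 - t) * (mat 1 *v x) $ i + t * (y *v x) $ i" for i
        by (simp only: M_def matrix_vector_mult_def vec_lambda_beta sum_distrib_left sum.distrib[symmetric])
           (simp only: distrib_right mult.assoc)
      then show ?thesis by (simp add: vec_eq_iff)
    qed
    then have "x \<bullet> (M t *v x) = (1 - t) * (x \<bullet> x) + t * (x \<bullet> (y *v x))"
      by (simp add: inner_add_right)
    moreover have "x \<bullet> x > 0" "x \<bullet> (y *v x) > 0"
      using x assms by (auto simp: pos_def_matrix_def)
    ultimately have "x \<bullet> (M t *v x) > 0"
    proof (cases "t = 0")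
      case False
      then have "t * (x \<bullet> (y *v x)) > 0" using that \<open>x \<bullet> (y *v x) > 0\<close> by simp
      moreover have "(1 - t) * (x \<bullet> x) \<ge> 0" using that by simp
      ultimately show ?thesis using \<open>x \<bullet> (M t *v x) = _\<close> by linarith
    qed simp
    then show "M t *v x \<noteq> 0" by auto
  qed
  have cont: "continuous_on {0..1} (\<lambda>t. det (M t))"
    unfolding det_def M_def by (auto intro!: continuous_intros)
  have M0: "M 0 = mat 1" and M1: "M 1 = y" by (auto simp: M_def vec_eq_iff)
  show ?thesis
  proof (rule ccontr)
    assume "\<not> det y > 0"
    then have "\<exists>t\<ge>0. t \<le> 1 \<and> det (M t) = 0"
      using IVT2'[of "\<lambda>t. det (M t)" 1 0 0] cont M0 M1 by auto
    then show False using nz by blast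
  qed
qed

lemma siegel_det_Im_pos: "z \<in> siegel \<Longrightarrow> det (Im_matrix z) > 0"
  using pos_def_det_pos siegel_pos by blast

subsection \<open>The action of the symplectic group\<close>

lemma sum_UNIV_sum:
  "(\<Sum>i\<in>(UNIV :: ('a::finite + 'b::finite) set). f i) = (\<Sum>a\<in>UNIV. f (Inl a)) + (\<Sum>b\<in>UNIV. f (Inr b))"
proof -
  have "sum f (range Inl \<union> range Inr) = sum f (range Inl) + sum f (range Inr)"
    by (rule sum.union_disjoint) auto
  then show ?thesis by (simp add: UNIV_sum sum.reindex)
qed

lemma sp_J_mult_entry:
  fixes g :: "'n::finite rmat2"
  shows "(transpose g ** sp_J ** g) $ a $ b =
    (\<Sum>i\<in>UNIV. g $ Inl i $ a * g $ Inr i $ b) - (\<Sum>i\<in>UNIV. g $ Inr i $ a * g $ Inl i $ b)"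
proof -
  have "(sp_J ** g) $ Inl i $ b = g $ Inr i $ b" "(sp_J ** g) $ Inr i $ b = - g $ Inl i $ b" for i
    by (simp_all add: matrix_matrix_mult_def sp_J_def sum_UNIV_sum if_distrib if_distribR cong: if_cong)
  then show ?thesis
    by (simp add: matrix_mul_assoc[symmetric])
       (subst matrix_matrix_mult_def, simp add: transpose_def sum_UNIV_sum sum_negf)
qed

lemma Sp_real_blocks:
  assumes "g \<in> Sp_real"
  shows "transpose (blk_A g) ** blk_C g = transpose (blk_C g) ** blk_A g"
    "transpose (blk_A g) ** blk_D g - transpose (blk_C g) ** blk_B g = mat 1"
    "transpose (blk_D g) ** blk_A g - transpose (blk_B g) ** blk_C g = mat 1"
    "transpose (blk_B g) ** blk_D g = transpose (blk_D g) ** blk_B g"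
proof -
  have *: "(\<Sum>i\<in>UNIV. g $ Inl i $ a * g $ Inr i $ b) - (\<Sum>i\<in>UNIV. g $ Inr i $ a * g $ Inl i $ b) = sp_J $ a $ b" for a b
    using assms sp_J_mult_entry[of g a b] by (simp add: Sp_real_def)
  have c: "(\<Sum>i\<in>UNIV. complex_of_real (g $ Inl i $ a) * of_real (g $ Inr i $ b))
      - (\<Sum>i\<in>UNIV. complex_of_real (g $ Inr i $ a) * of_real (g $ Inl i $ b)) = of_real (sp_J $ a $ b)" for a b
    unfolding *[symmetric] by simp
  note defs = vec_eq_iff matrix_matrix_mult_def transpose_def blk_A_def blk_B_def blk_C_def blk_D_def mat_def
  show "transpose (blk_A g) ** blk_C g = transpose (blk_C g) ** blk_A g"
    using c[of "Inl _" "Inl _"] by (simp add: defs sp_J_def)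
  show "transpose (blk_A g) ** blk_D g - transpose (blk_C g) ** blk_B g = mat 1"
    using c[of "Inl _" "Inr _"] by (simp add: defs sp_J_def)
  show "transpose (blk_B g) ** blk_D g = transpose (blk_D g) ** blk_B g"
    using c[of "Inr _" "Inr _"] by (simp add: defs sp_J_def)
  have "(\<Sum>i\<in>UNIV. complex_of_real (g $ Inr i $ Inr a) * of_real (g $ Inl i $ Inl b))
      - (\<Sum>i\<in>UNIV. complex_of_real (g $ Inl i $ Inr a) * of_real (g $ Inr i $ Inl b)) = (if a = b then 1 else 0)" for a b
    using c[of "Inr a" "Inl b"] by (simp add: sp_J_def algebra_simps)
  then show "transpose (blk_D g) ** blk_A g - transpose (blk_B g) ** blk_C g = mat 1"
    by (simp add: defs)
qed

lemma cj_blk [simp]: "cj (blk_A g) = blk_A g" "cj (blk_B g) = blk_B g"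
    "cj (blk_C g) = blk_C g" "cj (blk_D g) = blk_D g"
  by (simp_all add: vec_eq_iff blk_A_def blk_B_def blk_C_def blk_D_def)

lemma blk_mult:
  "blk_A (g ** h) = blk_A g ** blk_A h + blk_B g ** blk_C h"
  "blk_B (g ** h) = blk_A g ** blk_B h + blk_B g ** blk_D h"
  "blk_C (g ** h) = blk_C g ** blk_A h + blk_D g ** blk_C h"
  "blk_D (g ** h) = blk_C g ** blk_B h + blk_D g ** blk_D h"
  by (simp_all add: vec_eq_iff blk_A_def blk_B_def blk_C_def blk_D_def matrix_matrix_mult_def
      sum_UNIV_sum)

lemma blk_mat: "blk_A (mat c) = mat (of_real c)" "blk_B (mat c) = 0"
    "blk_C (mat c) = 0" "blk_D (mat c) = mat (of_real c)"
  by (simp_all add: vec_eq_iff blk_A_def blk_B_def blk_C_def blk_D_def mat_def)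

lemma blk_eqI:
  assumes "blk_A g = blk_A h" "blk_B g = blk_B h" "blk_C g = blk_C h" "blk_D g = blk_D h"
  shows "g = h"
proof -
  have "g $ i $ j = h $ i $ j" for i j
    using assms by (cases i; cases j) (simp_all add: vec_eq_iff blk_A_def blk_B_def blk_C_def blk_D_def)
  then show ?thesis by (simp add: vec_eq_iff)
qed

abbreviation sp_num :: "'n::finite rmat2 \<Rightarrow> 'n cmat \<Rightarrow> 'n cmat" where
  "sp_num g z \<equiv> blk_A g ** z + blk_B g"

abbreviation sp_den :: "'n::finite rmat2 \<Rightarrow> 'n cmat \<Rightarrow> 'n cmat" where
  "sp_den g z \<equiv> blk_C g ** z + blk_D g"

lemma sp_herm_eq:
  assumes "g \<in> Sp_real" "transpose z = z"
  shows "transpose (sp_den g z) ** sp_num g z = transpose (sp_num g z) ** sp_den g z"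
    "transpose (cj (sp_den g z)) ** sp_num g z - transpose (cj (sp_num g z)) ** sp_den g z = z - cj z"
proof -
  note b = Sp_real_blocks[OF assms(1)]
  \<comment> \<open>Polarized with a second symmetric matrix \<open>u\<close>: taking u = z gives
    the symmetry relation, u = conj z the Hermitian one.\<close>
  have key: "transpose (blk_C g ** u + blk_D g) ** sp_num g z - transpose (blk_A g ** u + blk_B g) ** sp_den g z = z - u"
    if "transpose u = u" for u
  proof -
    have "transpose (blk_C g ** u + blk_D g) ** sp_num g z - transpose (blk_A g ** u + blk_B g) ** sp_den g z
      = u ** (transpose (blk_C g) ** blk_A g - transpose (blk_A g) ** blk_C g) ** z
        - u ** (transpose (blk_A g) ** blk_D g - transpose (blk_C g) ** blk_B g)
        + (transpose (blk_D g) ** blk_A g - transpose (blk_B g) ** blk_C g) ** z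
        + (transpose (blk_D g) ** blk_B g - transpose (blk_B g) ** blk_D g)"
      by (simp add: transpose_add matrix_transpose_mul that matrix_ring matrix_mul_assoc)
    also have "\<dots> = z - u" by (simp only: b) simp
    finally show ?thesis .
  qed
  show "transpose (sp_den g z) ** sp_num g z = transpose (sp_num g z) ** sp_den g z"
    using key[OF assms(2)] by simp
  have "cj (blk_C g ** z + blk_D g) = blk_C g ** cj z + blk_D g"
    "cj (blk_A g ** z + blk_B g) = blk_A g ** cj z + blk_B g"
    by (simp_all only: cj_add cj_mult cj_blk)
  then show "transpose (cj (sp_den g z)) ** sp_num g z - transpose (cj (sp_num g z)) ** sp_den g z = z - cj z"
    using key[of "cj z"] assms(2) by (simp add: transpose_cj)
qed

lemma herm_diff_right: "herm x (y - z) = herm x y - herm x z"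
  by (simp add: herm_def sum_subtractf right_diff_distrib)

lemma herm_commute: "herm y x = cnj (herm x y)"
  by (simp add: herm_def mult.commute)

lemma herm_Im_diff:
  "2 * \<i> * Im (herm (N *v x) (P *v x)) = herm x ((transpose (cj N) ** P - transpose (cj P) ** N) *v x)"
proof -
  have "herm (N *v x) (P *v x) - herm (P *v x) (N *v x) =
     herm x ((transpose (cj N) ** P - transpose (cj P) ** N) *v x)"
    by (simp add: herm_adjoint matrix_vector_mul_assoc matrix_vector_mult_diff_rdistrib herm_diff_right
        del: transpose_matrix_vector)
  moreover have "herm (N *v x) (P *v x) - herm (P *v x) (N *v x) = 2 * \<i> * Im (herm (N *v x) (P *v x))"
    by (subst (2) herm_commute) (simp add: complex_eq_iff)
  ultimately show ?thesis by simp
qed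

lemma siegel_quotient_mem':
  fixes P N z :: "'n::finite cmat"
  assumes z: "z \<in> siegel" and sym: "transpose N ** P = transpose P ** N"
    and eq: "transpose (cj N) ** P - transpose (cj P) ** N = z - cj z"
  shows "det N \<noteq> 0" "P ** matrix_inv N \<in> siegel"
    "det (Im_matrix (P ** matrix_inv N)) * (cmod (det N))\<^sup>2 = det (Im_matrix z)"
proof -
  have pos: "Im (herm (N *v x) (P *v x)) > 0" if "x \<noteq> 0" for x
  proof -
    have "2 * \<i> * Im (herm (N *v x) (P *v x)) = herm x ((z - cj z) *v x)"
      unfolding herm_Im_diff eq ..
    \<comment> \<open>The same identity is read backwards for the pair (z, 1), whose form is that of
      \<open>z\<close> itself.\<close>
    also have "\<dots> = herm x ((transpose (cj (mat 1)) ** z - transpose (cj z) ** mat 1) *v x)"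
      using siegel_sym[OF z] by (simp add: cj_mat transpose_cj)
    also have "\<dots> = 2 * \<i> * Im (herm (mat 1 *v x) (z *v x))"
      unfolding herm_Im_diff ..
    finally have "Im (herm (N *v x) (P *v x)) = Im (herm x (z *v x))" by (simp add: complex_eq_iff)
    then show ?thesis using siegel_herm[OF z that] by simp
  qed
  show d: "det N \<noteq> 0" and m: "P ** matrix_inv N \<in> siegel"
    using siegel_quotient_mem[OF sym pos] by auto
  have "complex_of_real (det (Im_matrix (P ** matrix_inv N)) * (cmod (det N))\<^sup>2) =
    of_real (det (Im_matrix z))"
    using det_Im_quotient[of N P 1 z, OF _ d m] eq by simp
  then show "det (Im_matrix (P ** matrix_inv N)) * (cmod (det N))\<^sup>2 = det (Im_matrix z)"
    by (simp only: of_real_eq_iff)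
qed

lemma sp_act_siegel:
  assumes "g \<in> Sp_real" "z \<in> siegel"
  shows "det (sp_den g z) \<noteq> 0" "sp_act g z \<in> siegel"
    "det (Im_matrix (sp_act g z)) * (cmod (det (sp_den g z)))\<^sup>2 = det (Im_matrix z)"
  using siegel_quotient_mem'[OF assms(2) sp_herm_eq[OF assms(1) siegel_sym[OF assms(2)]]]
  by (simp_all add: sp_act_def)

lemma sp_act_den:
  assumes "g \<in> Sp_real" "z \<in> siegel"
  shows "sp_act g z ** sp_den g z = sp_num g z"
  using sp_act_siegel(1)[OF assms]
  by (simp add: sp_act_def matrix_mul_assoc[symmetric] matrix_inv_left)

lemma sp_den_mult:
  assumes "h \<in> Sp_real" "z \<in> siegel"
  shows "sp_den (g ** h) z = sp_den g (sp_act h z) ** sp_den h z"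
    "sp_num (g ** h) z = sp_num g (sp_act h z) ** sp_den h z"
proof -
  have *: "(X ** sp_act h z + Y) ** sp_den h z = X ** sp_num h z + Y ** sp_den h z" for X Y
    unfolding matrix_add_rdistrib' matrix_mul_assoc[symmetric] sp_act_den[OF assms] ..
  show "sp_den (g ** h) z = sp_den g (sp_act h z) ** sp_den h z"
    "sp_num (g ** h) z = sp_num g (sp_act h z) ** sp_den h z"
    unfolding * by (simp_all add: blk_mult matrix_ring matrix_mul_assoc add_ac)
qed

lemma sp_act_mult:
  assumes "g \<in> Sp_real" "h \<in> Sp_real" "z \<in> siegel"
  shows "sp_act (g ** h) z = sp_act g (sp_act h z)"
proof -
  note d1 = sp_act_siegel(1)[OF assms(2,3)]
  note d2 = sp_act_siegel(1)[OF assms(1) sp_act_siegel(2)[OF assms(2,3)]]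
  have "sp_act (g ** h) z = sp_num g (sp_act h z) ** (sp_den h z ** matrix_inv (sp_den h z)) ** matrix_inv (sp_den g (sp_act h z))"
    unfolding sp_act_def[of "g ** h"] sp_den_mult[OF assms(2,3)] matrix_inv_mul[OF d2 d1]
    by (simp only: matrix_mul_assoc)
  then show ?thesis
    by (simp add: matrix_inv_right[OF d1] sp_act_def[of g])
qed

lemma matrix_inv_mat1: "matrix_inv (mat 1 :: 'a::field^'n^'n) = mat 1"
  by (rule matrix_inv_unique) simp

lemma sp_act_one [simp]: "sp_act (mat 1) z = z"
  by (simp add: sp_act_def blk_mat matrix_inv_mat1)

lemma Sp_real_mult:
  assumes "g \<in> Sp_real" "h \<in> Sp_real"
  shows "g ** h \<in> Sp_real"
proof -
  have "transpose (g ** h) ** sp_J ** (g ** h) = transpose h ** (transpose g ** sp_J ** g) ** h"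
    by (simp add: matrix_transpose_mul matrix_mul_assoc)
  moreover have "invertible (g ** h)"
    using assms by (simp add: Sp_real_def invertible_det_nz det_mul)
  ultimately show ?thesis using assms by (simp add: Sp_real_def)
qed

lemma Sp_real_det: "g \<in> Sp_real \<Longrightarrow> det g \<noteq> 0"
  by (simp add: Sp_real_def invertible_det_nz)

subsection \<open>Substitutions in one complex variable\<close>

lemma borel_measurable_Complex [measurable (raw)]:
  assumes [measurable]: "f \<in> borel_measurable M" "g \<in> borel_measurable M"
  shows "(\<lambda>x. Complex (f x) (g x)) \<in> borel_measurable M"
  unfolding Complex_eq by measurable

text \<open>Lebesgue measure on the complex plane is the image of the planar one, because the two
  agree on boxes.\<close>

lemma nn_integral_complex:
  assumes [measurable]: "F \<in> borel_measurable borel"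
  shows "(\<integral>\<^sup>+z. F z \<partial>(lborel :: complex measure)) = (\<integral>\<^sup>+x. \<integral>\<^sup>+y. F (Complex x y) \<partial>lborel \<partial>lborel)"
proof -
  have m [measurable]: "(\<lambda>(x, y). Complex x y) \<in> borel \<rightarrow>\<^sub>M borel"
    unfolding case_prod_unfold Complex_eq by (intro borel_measurable_continuous_onI continuous_intros)
  have eq: "lborel = distr (lborel :: (real \<times> real) measure) borel (\<lambda>(x, y). Complex x y)"
  proof (rule lborel_eqI)
    fix l u :: complex assume le: "\<And>b. b \<in> Basis \<Longrightarrow> l \<bullet> b \<le> u \<bullet> b"
    have "(\<lambda>(x, y). Complex x y) -` box l u = box (Re l, Im l) (Re u, Im u)"
      by (auto simp: mem_box Basis_prod_def Basis_complex_def)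
    then have "emeasure (distr (lborel :: (real \<times> real) measure) borel (\<lambda>(x, y). Complex x y)) (box l u)
      = emeasure (lborel :: (real \<times> real) measure) (box (Re l, Im l) (Re u, Im u))"
      by (subst emeasure_distr) auto
    also have "\<dots> = (\<Prod>b\<in>Basis. (u - l) \<bullet> b)"
      using le[of 1] le[of \<i>]
      by (subst emeasure_lborel_box)
         (auto simp: Basis_prod_def Basis_complex_def inner_complex_def prod.union_disjoint
            disjoint_iff prod.insert)
    finally show "emeasure (distr (lborel :: (real \<times> real) measure) borel (\<lambda>(x, y). Complex x y)) (box l u) = (\<Prod>b\<in>Basis. (u - l) \<bullet> b)" .
  qed simp
  show ?thesis
    by (subst eq, subst nn_integral_distr, simp, simp, subst lborel_prod[symmetric], subst lborel.nn_integral_fst[symmetric])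
      (use measurable_compose[OF m assms] in \<open>simp_all add: lborel_prod split_beta'\<close>)
qed

lemma nn_integral_translation:
  fixes c :: "'a::euclidean_space"
  assumes [measurable]: "F \<in> borel_measurable borel"
  shows "(\<integral>\<^sup>+z. F (z + c) \<partial>lborel) = (\<integral>\<^sup>+z. F z \<partial>lborel)"
  by (subst (2) lborel_distr_plus[of c, symmetric]) (simp add: nn_integral_distr add.commute)

text \<open>Multiplication by c = a + ib with a nonzero is a product of two triangular maps, that
  is, of an affine substitution in x followed by one in y.\<close>

lemma nn_integral_complex_scale_aux:
  assumes [measurable]: "F \<in> borel_measurable borel" and a: "Re c \<noteq> 0"
  shows "(\<integral>\<^sup>+z. F (c * z) * ennreal ((cmod c)\<^sup>2) \<partial>lborel) = (\<integral>\<^sup>+z. F z \<partial>lborel)"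
proof -
  define a b where "a = Re c" and "b = Im c"
  have a0: "a \<noteq> 0" using a by (simp add: a_def)
  \<comment> \<open>The factor of y left after x has been replaced by (x + b y)/a. Since |1/a| (a^2
    + b^2) = |q|, the weight |c|^2 is exactly used up by the two substitutions.\<close>
  define q where "q = (a\<^sup>2 + b\<^sup>2) / a"
  have pos: "a\<^sup>2 + b\<^sup>2 > 0" using a0 by (simp add: sum_power2_gt_zero_iff)
  then have q0: "q \<noteq> 0" using a0 by (simp add: q_def)
  have c2: "(cmod c)\<^sup>2 = a\<^sup>2 + b\<^sup>2" by (simp add: a_def b_def cmod_power2)
  have mul: "c * Complex x y = Complex (a * x - b * y) (b * x + a * y)" for x y
    by (simp add: complex_eq_iff a_def b_def)
  have "(\<integral>\<^sup>+z. F (c * z) * ennreal ((cmod c)\<^sup>2) \<partial>lborel) =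
     (\<integral>\<^sup>+x. \<integral>\<^sup>+y. F (Complex (a * x - b * y) (b * x + a * y)) * ennreal (a\<^sup>2 + b\<^sup>2) \<partial>lborel \<partial>lborel)"
    by (subst nn_integral_complex) (simp_all add: mul c2)
  also have "\<dots> = (\<integral>\<^sup>+y. \<integral>\<^sup>+x. F (Complex (a * x - b * y) (b * x + a * y)) * ennreal (a\<^sup>2 + b\<^sup>2) \<partial>lborel \<partial>lborel)"
    by (rule lborel_pair.Fubini'[symmetric]) measurable
  also have "\<dots> = (\<integral>\<^sup>+y. ennreal \<bar>1 / a\<bar> * (\<integral>\<^sup>+x. F (Complex x (b / a * x + q * y)) * ennreal (a\<^sup>2 + b\<^sup>2) \<partial>lborel) \<partial>lborel)"
  proof (rule nn_integral_cong, subst nn_integral_real_affine[of _ "1 / a" "b * y / a" for y])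
    fix y
    have "F (Complex (a * (b * y / a + 1 / a * x) - b * y) (b * (b * y / a + 1 / a * x) + a * y)) =
       F (Complex x (b / a * x + q * y))" for x
      using a0 by (intro arg_cong[of _ _ F]) (simp add: complex_eq_iff q_def field_simps power2_eq_square)
    then show "ennreal \<bar>1 / a\<bar> * (\<integral>\<^sup>+ x. F (Complex (a * (b * y / a + 1 / a * x) - b * y) (b * (b * y / a + 1 / a * x) + a * y)) * ennreal (a\<^sup>2 + b\<^sup>2) \<partial>lborel) =
      ennreal \<bar>1 / a\<bar> * (\<integral>\<^sup>+x. F (Complex x (b / a * x + q * y)) * ennreal (a\<^sup>2 + b\<^sup>2) \<partial>lborel)"
      by simp
  qed (use a0 in auto)
  also have "\<dots> = (\<integral>\<^sup>+y. \<integral>\<^sup>+x. F (Complex x (b / a * x + q * y)) * ennreal \<bar>q\<bar> \<partial>lborel \<partial>lborel)"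
  proof -
    have cq: "ennreal \<bar>1 / a\<bar> * ennreal (a\<^sup>2 + b\<^sup>2) = ennreal \<bar>q\<bar>"
      using pos by (subst ennreal_mult[symmetric]) (auto simp: q_def abs_divide)
    show ?thesis
      unfolding cq[symmetric]
      by (subst (1 2) nn_integral_multc) (auto simp only: mult_ac intro!: nn_integral_cong, measurable)
  qed
  also have "\<dots> = (\<integral>\<^sup>+x. \<integral>\<^sup>+y. F (Complex x (b / a * x + q * y)) * ennreal \<bar>q\<bar> \<partial>lborel \<partial>lborel)"
    by (rule lborel_pair.Fubini') measurable
  also have "\<dots> = (\<integral>\<^sup>+x. \<integral>\<^sup>+y. F (Complex x y) \<partial>lborel \<partial>lborel)"
  proof (rule nn_integral_cong)
    fix x :: real
    show "(\<integral>\<^sup>+y. F (Complex x (b / a * x + q * y)) * ennreal \<bar>q\<bar> \<partial>lborel) = (\<integral>\<^sup>+y. F (Complex x y) \<partial>lborel)"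
      by (subst (2) nn_integral_real_affine[OF _ q0, of _ "b / a * x"])
         (simp_all add: nn_integral_cmult mult.commute)
  qed
  also have "\<dots> = (\<integral>\<^sup>+z. F z \<partial>lborel)" by (rule nn_integral_complex[symmetric]) simp
  finally show ?thesis .
qed

lemma nn_integral_complex_scale:
  assumes [measurable]: "F \<in> borel_measurable borel" and c: "c \<noteq> 0"
  shows "(\<integral>\<^sup>+z. F (c * z) * ennreal ((cmod c)\<^sup>2) \<partial>lborel) = (\<integral>\<^sup>+z. F z \<partial>(lborel :: complex measure))"
proof (cases "Re c = 0")
  case True
  \<comment> \<open>A purely imaginary c is written as d (1 + i), where both factors have nonzero
    real part.\<close>
  define d where "d = c / (1 + \<i>)"
  have n: "1 + \<i> \<noteq> 0" by (simp add: complex_eq_iff)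
  then have cd: "c = d * (1 + \<i>)" by (simp add: d_def)
  have "Im c \<noteq> 0" using c True by (auto simp: complex_eq_iff)
  then have d: "Re d \<noteq> 0" using True by (simp add: d_def Re_divide)
  have "(\<integral>\<^sup>+z. F (c * z) * ennreal ((cmod c)\<^sup>2) \<partial>lborel) =
     (\<integral>\<^sup>+z. (F (d * ((1 + \<i>) * z)) * ennreal ((cmod d)\<^sup>2)) * ennreal ((cmod (1 + \<i>))\<^sup>2) \<partial>lborel)"
    unfolding cd by (simp add: norm_mult power_mult_distrib ennreal_mult mult_ac)
  also have "\<dots> = (\<integral>\<^sup>+z. F (d * z) * ennreal ((cmod d)\<^sup>2) \<partial>lborel)"
    by (rule nn_integral_complex_scale_aux[of "\<lambda>z. F (d * z) * ennreal ((cmod d)\<^sup>2)"]) auto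
  also have "\<dots> = (\<integral>\<^sup>+z. F z \<partial>lborel)"
    by (rule nn_integral_complex_scale_aux) (use d in auto)
  finally show ?thesis .
qed (use nn_integral_complex_scale_aux[OF assms(1)] in simp)

text \<open>Substitution y = exp s on the compact intervals [-k, k], followed by monotone
  convergence on both sides.\<close>

lemma nn_integral_exp:
  fixes h :: "real \<Rightarrow> ennreal"
  assumes [measurable]: "h \<in> borel_measurable borel"
  shows "(\<integral>\<^sup>+y. h y * indicator {0<..} y \<partial>lborel) = (\<integral>\<^sup>+s. h (exp s) * ennreal (exp s) \<partial>lborel)"
proof -
  have fin: "(\<integral>\<^sup>+y. h y * indicator {exp (- real (Suc k))..exp (real (Suc k))} y \<partial>lborel) =
      (\<integral>\<^sup>+s. h (exp s) * ennreal (exp s) * indicator {- real (Suc k)..real (Suc k)} s \<partial>lborel)" for k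
    by (rule nn_integral_substitution_aux) (auto intro!: derivative_eq_intros continuous_intros)
  have L: "h y * indicator {0<..} y = (SUP k. h y * indicator {exp (- real (Suc k))..exp (real (Suc k))} y)" for y
  proof (cases "y > 0")
    case True
    obtain k where k: "\<bar>ln y\<bar> \<le> real k" using real_arch_simple by blast
    then have "exp (- real (Suc k)) \<le> exp (ln y)" "exp (ln y) \<le> exp (real (Suc k))"
      unfolding exp_le_cancel_iff by linarith+
    then have "y \<in> {exp (- real (Suc k))..exp (real (Suc k))}"
      using True by simp
    then show ?thesis using True
      by (intro antisym SUP_upper2[of k] SUP_least) (auto split: split_indicator)
  next
    case False
    then have "y \<notin> {exp (- real (Suc k))..exp (real (Suc k))}" for k
      using exp_gt_zero[of "- real (Suc k)"] by (auto simp del: exp_gt_zero)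
    then show ?thesis using False by simp
  qed
  have R: "h (exp s) * ennreal (exp s) = (SUP k. h (exp s) * ennreal (exp s) * indicator {- real (Suc k)..real (Suc k)} s)" for s
  proof -
    obtain k where k: "\<bar>s\<bar> \<le> real k" using real_arch_simple by blast
    then have "s \<in> {- real (Suc k)..real (Suc k)}" by auto
    then show ?thesis
      by (intro antisym SUP_upper2[of k] SUP_least) (auto split: split_indicator)
  qed
  have inc: "incseq (\<lambda>k x. g x * indicator (A k) x :: ennreal)" if "\<And>k. A k \<subseteq> A (Suc k)"
    for g and A :: "nat \<Rightarrow> real set"
    by (intro incseq_SucI le_funI mult_left_mono) (use that in \<open>auto split: split_indicator\<close>)
  have "(\<integral>\<^sup>+y. (SUP k. h y * indicator {exp (- real (Suc k))..exp (real (Suc k))} y) \<partial>lborel) =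
      (SUP k. \<integral>\<^sup>+y. h y * indicator {exp (- real (Suc k))..exp (real (Suc k))} y \<partial>lborel)"
    by (rule nn_integral_monotone_convergence_SUP, rule inc[of "\<lambda>k. {exp (- real (Suc k))..exp (real (Suc k))}"]) auto
  also have "\<dots> = (SUP k. \<integral>\<^sup>+s. h (exp s) * ennreal (exp s) * indicator {- real (Suc k)..real (Suc k)} s \<partial>lborel)"
    by (simp only: fin)
  also have "\<dots> = (\<integral>\<^sup>+s. (SUP k. h (exp s) * ennreal (exp s) * indicator {- real (Suc k)..real (Suc k)} s) \<partial>lborel)"
    by (rule nn_integral_monotone_convergence_SUP[symmetric], rule inc[of "\<lambda>k. {- real (Suc k)..real (Suc k)}"]) auto
  finally show ?thesis unfolding L R[symmetric] .
qed

text \<open>In the logarithmic coordinate y -> c/y becomes the reflection s -> ln c - s.\<close>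

lemma nn_integral_reciprocal:
  fixes h :: "real \<Rightarrow> ennreal"
  assumes [measurable]: "h \<in> borel_measurable borel" and c: "c > 0"
  shows "(\<integral>\<^sup>+y. h (c / y) * ennreal (c / y\<^sup>2) * indicator {0<..} y \<partial>lborel) =
    (\<integral>\<^sup>+y. h y * indicator {0<..} y \<partial>lborel)"
proof -
  have "(\<integral>\<^sup>+y. h (c / y) * ennreal (c / y\<^sup>2) * indicator {0<..} y \<partial>lborel) =
     (\<integral>\<^sup>+s. h (c / exp s) * ennreal (c / (exp s)\<^sup>2) * ennreal (exp s) \<partial>lborel)"
    by (rule nn_integral_exp[of "\<lambda>y. h (c / y) * ennreal (c / y\<^sup>2)"]) measurable
  also have "\<dots> = (\<integral>\<^sup>+s. h (exp (ln c + -1 * s)) * ennreal (exp (ln c + -1 * s)) \<partial>lborel)"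
  proof (rule nn_integral_cong)
    fix s
    have "exp (ln c + -1 * s) = c / exp s" using c by (simp add: exp_diff)
    moreover have "ennreal (c / (exp s)\<^sup>2) * ennreal (exp s) = ennreal (c / exp s)"
      using c by (simp add: ennreal_mult[symmetric] power2_eq_square field_simps)
    ultimately show "h (c / exp s) * ennreal (c / (exp s)\<^sup>2) * ennreal (exp s) =
        h (exp (ln c + -1 * s)) * ennreal (exp (ln c + -1 * s))"
      by (simp add: mult.assoc)
  qed
  also have "\<dots> = (\<integral>\<^sup>+s. h (exp s) * ennreal (exp s) \<partial>lborel)"
    by (subst (2) nn_integral_real_affine[of _ "-1" "ln c"]) auto
  also have "\<dots> = (\<integral>\<^sup>+y. h y * indicator {0<..} y \<partial>lborel)"
    by (rule nn_integral_exp[symmetric]) measurable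
  finally show ?thesis .
qed

text \<open>Coordinates slope t = x/y and height y; the factor y is the Jacobian of x = t y.\<close>

lemma nn_integral_half_plane_slope:
  fixes G :: "complex \<Rightarrow> ennreal"
  assumes [measurable]: "G \<in> borel_measurable borel"
  shows "(\<integral>\<^sup>+z. G z * indicator {z. Im z > 0} z \<partial>lborel) =
    (\<integral>\<^sup>+t. \<integral>\<^sup>+y. ennreal y * G (Complex (t * y) y) * indicator {0<..} y \<partial>lborel \<partial>lborel)"
proof -
  have "(\<integral>\<^sup>+z. G z * indicator {z. Im z > 0} z \<partial>lborel) =
    (\<integral>\<^sup>+x. \<integral>\<^sup>+y. G (Complex x y) * indicator {0<..} y \<partial>lborel \<partial>lborel)"
    by (subst nn_integral_complex) (auto simp: indicator_def)
  also have "\<dots> = (\<integral>\<^sup>+y. \<integral>\<^sup>+x. G (Complex x y) * indicator {0<..} y \<partial>lborel \<partial>lborel)"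
    by (rule lborel_pair.Fubini'[symmetric]) measurable
  also have "\<dots> = (\<integral>\<^sup>+y. \<integral>\<^sup>+t. ennreal y * G (Complex (t * y) y) * indicator {0<..} y \<partial>lborel \<partial>lborel)"
  proof (rule nn_integral_cong)
    fix y :: real
    show "(\<integral>\<^sup>+x. G (Complex x y) * indicator {0<..} y \<partial>lborel) =
      (\<integral>\<^sup>+t. ennreal y * G (Complex (t * y) y) * indicator {0<..} y \<partial>lborel)"
    proof (cases "y > 0")
      case True
      then show ?thesis
        by (subst nn_integral_real_affine[of _ y 0])
           (auto simp: nn_integral_cmult mult_ac)
    qed simp
  qed
  also have "\<dots> = (\<integral>\<^sup>+t. \<integral>\<^sup>+y. ennreal y * G (Complex (t * y) y) * indicator {0<..} y \<partial>lborel \<partial>lborel)"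
    by (rule lborel_pair.Fubini') measurable
  finally show ?thesis .
qed

text \<open>In slope and height the map z -> -1/z reads t -> -t, y -> 1/((1 + t^2) y), so a
  reflection in t and a reciprocal substitution in y suffice.\<close>

lemma nn_integral_inversion:
  fixes F :: "complex \<Rightarrow> ennreal"
  assumes [measurable]: "F \<in> borel_measurable borel"
  shows "(\<integral>\<^sup>+z. F (- 1 / z) * ennreal (1 / cmod z ^ 4) * indicator {z. Im z > 0} z \<partial>lborel) =
    (\<integral>\<^sup>+z. F z * indicator {z. Im z > 0} z \<partial>lborel)"
proof -
  let ?c = "\<lambda>t::real. 1 / (1 + t\<^sup>2)"
  have cp: "?c t > 0" for t by (simp add: add_pos_nonneg)
  have "(\<integral>\<^sup>+z. F z * indicator {z. Im z > 0} z \<partial>lborel) =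
    (\<integral>\<^sup>+t. \<integral>\<^sup>+y. ennreal y * F (Complex (t * y) y) * indicator {0<..} y \<partial>lborel \<partial>lborel)"
    by (rule nn_integral_half_plane_slope) measurable
  also have "\<dots> = (\<integral>\<^sup>+t. \<integral>\<^sup>+y. ennreal y * F (Complex (- t * y) y) * indicator {0<..} y \<partial>lborel \<partial>lborel)"
    by (subst nn_integral_real_affine[of _ "-1" 0]) auto
  also have "\<dots> = (\<integral>\<^sup>+t. \<integral>\<^sup>+y. (ennreal (?c t / y) * F (Complex (- t * (?c t / y)) (?c t / y))) * ennreal (?c t / y\<^sup>2) * indicator {0<..} y \<partial>lborel \<partial>lborel)"
    by (rule nn_integral_cong, rule nn_integral_reciprocal[OF _ cp, symmetric]) measurable
  also have "\<dots> = (\<integral>\<^sup>+t. \<integral>\<^sup>+y. ennreal y * (F (- 1 / Complex (t * y) y) * ennreal (1 / cmod (Complex (t * y) y) ^ 4)) * indicator {0<..} y \<partial>lborel \<partial>lborel)"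
  proof (intro nn_integral_cong)
    fix t y :: real
    show "(ennreal (?c t / y) * F (Complex (- t * (?c t / y)) (?c t / y))) * ennreal (?c t / y\<^sup>2) * indicator {0<..} y =
      ennreal y * (F (- 1 / Complex (t * y) y) * ennreal (1 / cmod (Complex (t * y) y) ^ 4)) * indicator {0<..} y"
    proof (cases "y > 0")
      case True
      have p: "1 + t\<^sup>2 > 0" by (simp add: add_pos_nonneg)
      have nz: "Complex (t * y) y \<noteq> 0" using True by (simp add: complex_eq_iff)
      have arg: "- 1 / Complex (t * y) y = Complex (- t * (?c t / y)) (?c t / y)"
      proof -
        have "Complex (- t * (?c t / y)) (?c t / y) * Complex (t * y) y = - 1"
        proof -
          have c1: "?c t + t * t * ?c t = 1" using p by (simp add: field_simps power2_eq_square)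
          define c where "c = ?c t"
          show ?thesis
            using True c1 unfolding c_def[symmetric] by (simp add: complex_eq_iff mult_ac)
        qed
        then show ?thesis by (metis nonzero_eq_divide_eq nz)
      qed
      have "cmod (Complex (t * y) y) ^ 4 = ((t * y)\<^sup>2 + y\<^sup>2)\<^sup>2"
        by (simp add: cmod_def power4_eq_xxxx power2_eq_square)
      also have "\<dots> = (y\<^sup>2 * (1 + t\<^sup>2))\<^sup>2" by (simp add: power_mult_distrib algebra_simps)
      finally have c4: "cmod (Complex (t * y) y) ^ 4 = (y\<^sup>2 * (1 + t\<^sup>2))\<^sup>2" .
      have "y * (1 / cmod (Complex (t * y) y) ^ 4) = (?c t / y) * (?c t / y\<^sup>2)"
      proof -
        have "y * (1 / (y\<^sup>2 * s)\<^sup>2) = 1 / s / y * (1 / s / y\<^sup>2)" if "s > 0" for s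
          using True that by (simp add: field_simps power2_eq_square)
        from this[OF p] show ?thesis unfolding c4 .
      qed
      then have e: "ennreal y * ennreal (1 / cmod (Complex (t * y) y) ^ 4) = ennreal (?c t / y) * ennreal (?c t / y\<^sup>2)"
        using True cp[of t] by (simp only: ennreal_mult[symmetric] less_imp_le divide_nonneg_nonneg zero_le_power2 zero_le_power norm_ge_zero zero_le_one)
      have "ennreal (?c t / y) * f * ennreal (?c t / y\<^sup>2) = ennreal y * (f * ennreal (1 / cmod (Complex (t * y) y) ^ 4))" for f
      proof -
        have "ennreal (?c t / y) * f * ennreal (?c t / y\<^sup>2) = f * (ennreal (?c t / y) * ennreal (?c t / y\<^sup>2))"
          by (simp only: mult_ac)
        also have "\<dots> = ennreal y * (f * ennreal (1 / cmod (Complex (t * y) y) ^ 4))"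
          unfolding e[symmetric] by (simp only: mult_ac)
        finally show ?thesis .
      qed
      then show ?thesis unfolding arg by simp
    qed simp
  qed
  also have "\<dots> = (\<integral>\<^sup>+z. (F (- 1 / z) * ennreal (1 / cmod z ^ 4)) * indicator {z. Im z > 0} z \<partial>lborel)"
    by (rule nn_integral_half_plane_slope[symmetric]) measurable
  finally show ?thesis by (simp add: mult_ac)
qed

subsection \<open>Changing coordinates in a product measure one at a time\<close>

text \<open>Fubini with coordinate i innermost. The assumptions \<open>dep\<close> say that the
  substitution and the weights may depend on the other coordinates as parameters, but see coordinate
  i only through their last argument.\<close>

lemma nn_integral_PiM_update:
  fixes t :: "('i \<Rightarrow> 'a) \<Rightarrow> 'a \<Rightarrow> 'a" and M :: "'a measure"
  assumes sf: "sigma_finite_measure M" and I: "finite I" "i \<in> I"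
    and F: "F \<in> borel_measurable (PiM I (\<lambda>_. M))"
    and mt: "(\<lambda>a. t a (a i)) \<in> PiM I (\<lambda>_. M) \<rightarrow>\<^sub>M M"
    and mw: "(\<lambda>a. w a (a i)) \<in> borel_measurable (PiM I (\<lambda>_. M))"
    and mv: "(\<lambda>a. v a (a i)) \<in> borel_measurable (PiM I (\<lambda>_. M))"
    and dep: "\<And>a x. t (a(i := x)) = t a" "\<And>a x. w (a(i := x)) = w a" "\<And>a x. v (a(i := x)) = v a"
    and one: "\<And>a G. G \<in> borel_measurable M \<Longrightarrow> (\<integral>\<^sup>+x. G (t a x) * w a x \<partial>M) = (\<integral>\<^sup>+x. G x * v a x \<partial>M)"
  shows "(\<integral>\<^sup>+a. F (a(i := t a (a i))) * w a (a i) \<partial>PiM I (\<lambda>_. M)) = (\<integral>\<^sup>+a. F a * v a (a i) \<partial>PiM I (\<lambda>_. M))"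
proof -
  interpret product_sigma_finite "\<lambda>_. M"
    using sf by (simp add: product_sigma_finite_def)
  define I' where "I' = I - {i}"
  have I': "I = insert i I'" "finite I'" "i \<notin> I'" using I by (auto simp: I'_def)
  have upd: "(\<lambda>a. a(i := t a (a i))) \<in> PiM I (\<lambda>_. M) \<rightarrow>\<^sub>M PiM I (\<lambda>_. M)"
    by (rule measurable_fun_upd[where J=I and f="\<lambda>a. a", OF _ _ mt]) (use I in auto)
  have mF: "(\<lambda>a. F (a(i := t a (a i)))) \<in> borel_measurable (PiM I (\<lambda>_. M))"
    using measurable_compose[OF upd F] by simp
  have "(\<integral>\<^sup>+a. F (a(i := t a (a i))) * w a (a i) \<partial>PiM I (\<lambda>_. M)) =
    (\<integral>\<^sup>+a. \<integral>\<^sup>+x. F (a(i := t a x)) * w a x \<partial>M \<partial>PiM I' (\<lambda>_. M))"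
    unfolding I'(1)
    by (subst product_nn_integral_insert)
       (use I' mF mw in \<open>simp_all add: dep\<close>)
  also have "\<dots> = (\<integral>\<^sup>+a. \<integral>\<^sup>+x. F (a(i := x)) * v a x \<partial>M \<partial>PiM I' (\<lambda>_. M))"
  proof (rule nn_integral_cong, rule one)
    fix a assume a: "a \<in> space (PiM I' (\<lambda>_. M))"
    show "(\<lambda>x. F (a(i := x))) \<in> borel_measurable M"
      using measurable_compose[OF measurable_component_update[OF a I'(3)] F[unfolded I'(1)]] by simp
  qed
  also have "\<dots> = (\<integral>\<^sup>+a. F a * v a (a i) \<partial>PiM I (\<lambda>_. M))"
    unfolding I'(1)
    by (subst product_nn_integral_insert) (use I' F mv in \<open>simp_all add: dep\<close>)
  finally show ?thesis .
qed

text \<open>The coordinates in D are replaced one after another. This equals the simultaneous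
  replacement because the parameters of each substitution do not involve any coordinate in D; every
  coordinate contributes the same weight \<open>w\<close>.\<close>

lemma nn_integral_PiM_update_set:
  fixes t :: "'i \<Rightarrow> ('i \<Rightarrow> 'a) \<Rightarrow> 'a \<Rightarrow> 'a" and M :: "'a measure"
  assumes sf: "sigma_finite_measure M" and I: "finite I" "D \<subseteq> I"
    and F: "F \<in> borel_measurable (PiM I (\<lambda>_. M))"
    and mt: "\<And>i. i \<in> D \<Longrightarrow> (\<lambda>a. t i a (a i)) \<in> PiM I (\<lambda>_. M) \<rightarrow>\<^sub>M M"
    and mw: "w \<in> borel_measurable (PiM I (\<lambda>_. M))"
    and dep: "\<And>i j a x. i \<in> D \<Longrightarrow> j \<in> D \<Longrightarrow> t i (a(j := x)) = t i a" "\<And>j a x. j \<in> D \<Longrightarrow> w (a(j := x)) = w a"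
    and one: "\<And>i a G. i \<in> D \<Longrightarrow> G \<in> borel_measurable M \<Longrightarrow> (\<integral>\<^sup>+x. G (t i a x) * w a \<partial>M) = (\<integral>\<^sup>+x. G x \<partial>M)"
  shows "(\<integral>\<^sup>+a. F (\<lambda>i. if i \<in> D then t i a (a i) else a i) * w a ^ card D \<partial>PiM I (\<lambda>_. M)) = (\<integral>\<^sup>+a. F a \<partial>PiM I (\<lambda>_. M))"
proof -
  have *: "finite E \<Longrightarrow> E \<subseteq> D \<Longrightarrow> (\<integral>\<^sup>+a. F (\<lambda>i. if i \<in> E then t i a (a i) else a i) * w a ^ card E \<partial>PiM I (\<lambda>_. M)) = (\<integral>\<^sup>+a. F a \<partial>PiM I (\<lambda>_. M))" for E
  proof (induction E rule: finite_induct)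
    case empty
    then show ?case by simp
  next
    case (insert j E)
    have jD: "j \<in> D" "j \<in> I" and ED: "E \<subseteq> D" using insert I by auto
    define T where "T = (\<lambda>a i. if i \<in> E then t i a (a i) else a i)"
    have wT: "w (a(j := x)) = w a" for a x using dep(2) jD by auto
    have Tm: "T \<in> PiM I (\<lambda>_. M) \<rightarrow>\<^sub>M PiM I (\<lambda>_. M)"
    proof (rule measurable_PiM_single')
      show "T \<in> space (PiM I (\<lambda>_. M)) \<rightarrow> (\<Pi>\<^sub>E i\<in>I. space M)"
        using measurable_space[OF mt] ED I(2)
        by (auto simp: T_def space_PiM PiE_iff extensional_def subset_iff)
      show "(\<lambda>a. T a i) \<in> PiM I (\<lambda>_. M) \<rightarrow>\<^sub>M M" if "i \<in> I" for i
        using mt[of i] ED that by (cases "i \<in> E") (auto simp: T_def measurable_component_singleton)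
    qed
    define G where "G a = F (T a) * w a ^ card E" for a
    have Gm: "G \<in> borel_measurable (PiM I (\<lambda>_. M))"
      unfolding G_def using measurable_compose[OF Tm F] mw by simp
    have eq: "(\<lambda>i. if i \<in> insert j E then t i a (a i) else a i) = T (a(j := t j a (a j)))" for a
    proof
      fix i
      have "t i (a(j := t j a (a j))) = t i a" if "i \<in> E" using dep(1) that ED jD by blast
      then show "(if i \<in> insert j E then t i a (a i) else a i) = T (a(j := t j a (a j))) i"
        using insert.hyps by (auto simp: T_def)
    qed
    have "(\<integral>\<^sup>+a. F (\<lambda>i. if i \<in> insert j E then t i a (a i) else a i) * w a ^ card (insert j E) \<partial>PiM I (\<lambda>_. M)) =
      (\<integral>\<^sup>+a. G (a(j := t j a (a j))) * w a \<partial>PiM I (\<lambda>_. M))"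
      unfolding eq G_def wT using insert.hyps by (simp add: mult_ac)
    also have "\<dots> = (\<integral>\<^sup>+a. G a * 1 \<partial>PiM I (\<lambda>_. M))"
      by (rule nn_integral_PiM_update[OF sf I(1) jD(2) Gm, of "t j" "\<lambda>a x. w a" "\<lambda>_ _. 1"])
         (use mt mw jD dep one in auto)
    also have "\<dots> = (\<integral>\<^sup>+a. F a \<partial>PiM I (\<lambda>_. M))"
      using insert.IH ED I(2) by (simp add: G_def T_def)
    finally show ?case .
  qed
  show ?thesis using *[of D] I finite_subset by blast
qed

subsection \<open>Measurability of matrix expressions\<close>

lemma borel_measurable_vec_lambda [measurable (raw)]:
  fixes f :: "'n::finite \<Rightarrow> 'a \<Rightarrow> 'b::euclidean_space"
  assumes [measurable]: "\<And>i. f i \<in> borel_measurable M"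
  shows "(\<lambda>x. \<chi> i. f i x) \<in> borel_measurable M"
proof -
  have c: "continuous_on UNIV (\<lambda>v. axis i v :: 'b^'n)" for i
  proof -
    have "continuous_on UNIV (\<lambda>v::'b. if j = i then v else 0)" for j by (cases "j = i") auto
    then show ?thesis unfolding axis_def by (intro continuous_on_vec_lambda)
  qed
  have [measurable]: "(\<lambda>x. axis i (f i x) :: 'b^'n) \<in> borel_measurable M" for i
    using measurable_compose[OF assms borel_measurable_continuous_onI[OF c]] .
  have "(\<lambda>x. \<chi> i. f i x) = (\<lambda>x. \<Sum>i\<in>UNIV. axis i (f i x))"
    by (simp add: vec_eq_iff fun_eq_iff axis_def if_distrib cong: if_cong)
  then show ?thesis by simp
qed

lemma borel_measurable_vec_nth [measurable (raw)]:
  fixes f :: "'a \<Rightarrow> 'b::euclidean_space ^ 'n"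
  assumes "f \<in> borel_measurable M"
  shows "(\<lambda>x. f x $ i) \<in> borel_measurable M"
  using measurable_compose[OF assms borel_measurable_continuous_onI[of "\<lambda>v. v $ i"]]
  by (simp add: continuous_on_component)

lemma borel_measurable_matrix_mult [measurable (raw)]:
  fixes f :: "'a \<Rightarrow> complex^'n::finite^'m::finite" and g :: "'a \<Rightarrow> complex^'k::finite^'n"
  assumes [measurable]: "f \<in> borel_measurable M" "g \<in> borel_measurable M"
  shows "(\<lambda>x. f x ** g x) \<in> borel_measurable M"
  unfolding matrix_matrix_mult_def by measurable

lemma borel_measurable_det_complex [measurable (raw)]:
  fixes f :: "'a \<Rightarrow> complex^'n::finite^'n"
  assumes [measurable]: "f \<in> borel_measurable M"
  shows "(\<lambda>x. det (f x)) \<in> borel_measurable M"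
  unfolding det_def by measurable

lemma borel_measurable_det_real [measurable (raw)]:
  fixes f :: "'a \<Rightarrow> real^'n::finite^'n"
  assumes [measurable]: "f \<in> borel_measurable M"
  shows "(\<lambda>x. det (f x)) \<in> borel_measurable M"
  unfolding det_def by measurable

lemma borel_measurable_Im_matrix [measurable (raw)]:
  assumes [measurable]: "f \<in> borel_measurable M"
  shows "(\<lambda>x. Im_matrix (f x)) \<in> borel_measurable M"
  unfolding Im_matrix_def map_matrix_def by measurable

text \<open>For a singular matrix \<open>matrix_inv\<close> chooses from an empty predicate, hence
  returns one common default value. Measurability of the inverse thus becomes a case distinction on
  the determinant.\<close>

lemma matrix_inv_singular:
  fixes A :: "'a::field^'n^'n"
  assumes "det A = 0"
  shows "matrix_inv A = matrix_inv 0"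
proof -
  have "\<not> (A ** A' = mat 1 \<and> A' ** A = mat 1)" for A' using assms det_right_inverse by blast
  moreover have "\<not> ((0 :: 'a^'n^'n) ** A' = mat 1 \<and> A' ** 0 = mat 1)" for A' :: "'a^'n^'n"
    using det_right_inverse(2)[of "0 :: 'a^'n^'n"] det_0 by (metis mat_0)
  ultimately show ?thesis unfolding matrix_inv_def by (intro arg_cong[of _ _ Eps] ext) blast
qed

lemma matrix_inv_if:
  fixes A :: "'a::field^'n^'n"
  shows "matrix_inv A = (if det A = 0 then matrix_inv 0 else
     (\<chi> i j. det (\<chi> a b. if b = i then (if a = j then 1 else 0) else A $ a $ b) / det A))"
  using matrix_inv_singular[of A] by (simp add: vec_eq_iff matrix_inv_entry)

lemma borel_measurable_matrix_inv [measurable (raw)]: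
  fixes f :: "'a \<Rightarrow> complex^'n::finite^'n"
  assumes [measurable]: "f \<in> borel_measurable M"
  shows "(\<lambda>x. matrix_inv (f x)) \<in> borel_measurable M"
proof -
  have "(\<lambda>x. det (\<chi> a b. if b = i then (if a = j then 1 else 0) else f x $ a $ b)) \<in> borel_measurable M" for i j
    by (intro borel_measurable_det_complex borel_measurable_vec_lambda) measurable
  then show ?thesis
    by (subst matrix_inv_if, intro measurable_If borel_measurable_vec_lambda borel_measurable_divide)
       (auto intro: borel_measurable_det_complex assms)
qed

lemma borel_measurable_sp_act [measurable (raw)]:
  assumes [measurable]: "f \<in> borel_measurable M"
  shows "(\<lambda>x. sp_act g (f x)) \<in> borel_measurable M"
  unfolding sp_act_def by measurable

lemma Im_matrix_quadratic_bound:
  "\<bar>u \<bullet> (Im_matrix z *v u)\<bar> \<le> real CARD('n) ^ 2 * norm (z :: 'n::finite cmat) * norm u ^ 2"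
proof -
  have e: "\<bar>u $ i * (Im (z $ i $ j) * u $ j)\<bar> \<le> norm u * (norm z * norm u)" for i j
  proof -
    have "\<bar>Im (z $ i $ j)\<bar> \<le> norm z"
      using abs_Im_le_cmod[of "z $ i $ j"] Finite_Cartesian_Product.norm_nth_le[of "z $ i" j] Finite_Cartesian_Product.norm_nth_le[of z i] by linarith
    then show ?thesis
      unfolding abs_mult by (intro mult_mono component_le_norm_cart) auto
  qed
  have "u \<bullet> (Im_matrix z *v u) = (\<Sum>i\<in>UNIV. \<Sum>j\<in>UNIV. u $ i * (Im (z $ i $ j) * u $ j))"
    by (simp add: inner_vec_def matrix_vector_mult_def Im_matrix_def sum_distrib_left)
  also have "\<bar>\<dots>\<bar> \<le> (\<Sum>i\<in>(UNIV::'n set). \<Sum>j\<in>(UNIV::'n set). norm u * (norm z * norm u))"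
    by (rule order_trans[OF sum_abs] sum_mono order_trans[OF sum_abs] e)+
  finally show ?thesis by (simp add: power2_eq_square mult_ac)
qed

text \<open>The constant is the minimum of the form on the compact unit sphere, extended by
  homogeneity.\<close>

lemma siegel_uniform:
  assumes "z \<in> siegel"
  obtains c where "c > 0" "\<And>u. u \<bullet> (Im_matrix z *v u) \<ge> c * norm u ^ 2"
proof -
  let ?q = "\<lambda>u. u \<bullet> (Im_matrix z *v u)"
  have "continuous_on (sphere 0 1) ?q"
    by (intro continuous_intros matrix_vector_mult_linear_continuous_on)
  moreover have "axis undefined 1 \<in> sphere (0 :: real^'a) 1" by simp
  ultimately obtain v where v: "v \<in> sphere 0 1" "\<And>u. u \<in> sphere 0 1 \<Longrightarrow> ?q v \<le> ?q u"
    using continuous_attains_inf[of "sphere 0 1" ?q] by (metis compact_sphere empty_iff)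
  have "v \<noteq> 0" using v(1) by auto
  then have pos: "?q v > 0" using siegel_pos[OF assms] by (simp add: pos_def_matrix_def)
  have "?q u \<ge> ?q v * norm u ^ 2" for u
  proof (cases "u = 0")
    case False
    define w where "w = (1 / norm u) *\<^sub>R u"
    have u: "u = norm u *\<^sub>R w" using False by (simp add: w_def)
    have "?q u = norm u ^ 2 * ?q w"
      by (subst (1 2) u) (simp add: matrix_vector_mult_scaleR power2_eq_square)
    moreover have "?q v \<le> ?q w" using v(2)[of w] False by (simp add: w_def)
    ultimately show ?thesis by (metis mult.commute mult_left_mono zero_le_power2)
  qed simp
  then show thesis using that pos by blast
qed

text \<open>The half-space is an F_sigma set: the closed space of symmetric matrices intersected
  with the union of the closed sets on which the form of y is at least |u|^2/(n + 1).\<close>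

lemma siegel_borel [measurable]: "siegel \<in> sets (borel :: 'n::finite cmat measure)"
proof -
  define C where "C n = {z :: 'n cmat. \<forall>u. u \<bullet> (Im_matrix z *v u) \<ge> norm u ^ 2 / real (Suc n)}" for n
  have cC: "closed (C n)" for n
  proof -
    have "continuous_on UNIV (\<lambda>z. u \<bullet> (Im_matrix z *v u))" for u :: "real^'n"
      unfolding inner_vec_def matrix_vector_mult_def Im_matrix_def map_matrix_def
      by (simp, intro continuous_intros)
    then have "closed {z :: 'n cmat. norm u ^ 2 / real (Suc n) \<le> u \<bullet> (Im_matrix z *v u)}" for u
      by (intro closed_Collect_le continuous_on_const)
    then have "closed (\<Inter>u. {z :: 'n cmat. norm u ^ 2 / real (Suc n) \<le> u \<bullet> (Im_matrix z *v u)})" by blast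
    moreover have "C n = (\<Inter>u. {z :: 'n cmat. norm u ^ 2 / real (Suc n) \<le> u \<bullet> (Im_matrix z *v u)})"
      by (auto simp: C_def)
    ultimately show ?thesis by simp
  qed
  have cT: "closed {z :: 'n cmat. transpose z = z}"
    unfolding transpose_def by (intro closed_Collect_eq continuous_intros continuous_on_vec_lambda)
  have eq: "siegel = {z. transpose z = z} \<inter> (\<Union>n. C n)"
  proof (intro equalityI subsetI)
    fix z :: "'n cmat" assume z: "z \<in> siegel"
    obtain c where c: "c > 0" "\<And>u. u \<bullet> (Im_matrix z *v u) \<ge> c * norm u ^ 2"
      using siegel_uniform[OF z] by blast
    obtain n where n: "1 / real (Suc n) < c" using nat_approx_posE[OF c(1)] by blast
    have "norm u ^ 2 / real (Suc n) \<le> c * norm u ^ 2" for u :: "real^'n"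
      using mult_right_mono[of "1 / real (Suc n)" c "norm u ^ 2"] n by simp
    then have "z \<in> C n" unfolding C_def using c(2) order_trans by blast
    then show "z \<in> {z. transpose z = z} \<inter> (\<Union>n. C n)" using siegel_sym[OF z] by blast
  next
    fix z :: "'n cmat" assume "z \<in> {z. transpose z = z} \<inter> (\<Union>n. C n)"
    then obtain n where z: "transpose z = z" "z \<in> C n" by blast
    have "u \<bullet> (Im_matrix z *v u) > 0" if "u \<noteq> 0" for u
    proof -
      have "0 < norm u ^ 2 / real (Suc n)" using that by simp
      also have "\<dots> \<le> u \<bullet> (Im_matrix z *v u)" using z(2) by (simp add: C_def)
      finally show ?thesis .
    qed
    moreover have "transpose (Im_matrix z) = Im_matrix z"
      using z(1) by (simp add: Im_matrix_def transpose_def vec_eq_iff)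
    ultimately show "z \<in> siegel" using z(1) by (simp add: siegel_def pos_def_matrix_def)
  qed
  have "(\<Union>n. C n) \<in> sets borel"
    using borel_closed[OF cC] by (intro sets.countable_UN) auto
  then show ?thesis unfolding eq by (rule sets.Int[OF borel_closed[OF cT]])
qed

subsection \<open>The measure on the half-space\<close>

abbreviation upper_pairs :: "('n::{finite,linorder} \<times> 'n) set" where
  "upper_pairs \<equiv> {(r, s). r \<le> s}"

definition sym_mat :: "('n::{finite,linorder} \<times> 'n \<Rightarrow> 'a) \<Rightarrow> (('a, 'n) vec, 'n) vec" where
  "sym_mat a = (\<chi> r s. a (min r s, max r s))"

lemma sym_mat_nth [simp]: "sym_mat a $ r $ s = a (min r s, max r s)"
  by (simp add: sym_mat_def)

lemma sets_sym_lborel [simp, measurable_cong]: "sets sym_lborel = sets borel"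
  by (simp add: sym_lborel_def)

lemma space_sym_lborel [simp]: "space sym_lborel = UNIV"
  by (simp add: sym_lborel_def)

lemma measurable_sym_mat [measurable]:
  "sym_mat \<in> PiM upper_pairs (\<lambda>_. lborel :: ('b::euclidean_space) measure) \<rightarrow>\<^sub>M borel"
proof -
  have "(\<lambda>a. a (min r s, max r s)) \<in> PiM upper_pairs (\<lambda>_. lborel :: 'b measure) \<rightarrow>\<^sub>M borel" for r s :: 'a
    using measurable_component_singleton[of "(min r s, max r s)" upper_pairs "\<lambda>_. lborel :: 'b measure"]
    by (simp add: min_le_iff_disj)
  then show ?thesis unfolding sym_mat_def[abs_def] by measurable
qed

lemma nn_integral_sym_lborel:
  assumes [measurable]: "F \<in> borel_measurable borel"
  shows "(\<integral>\<^sup>+z. F z \<partial>sym_lborel) = (\<integral>\<^sup>+a. F (sym_mat a) \<partial>PiM upper_pairs (\<lambda>_. lborel))"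
  unfolding sym_lborel_def sym_mat_def[symmetric] by (rule nn_integral_distr) measurable

lemma powi_neg_Suc: "x powi (- int n - 1) = inverse (x ^ (n + 1))" for x :: "'a::field"
proof -
  have "- int n - 1 = - int (n + 1)" by simp
  then show ?thesis by (simp only: power_int_minus power_int_of_nat)
qed

definition siegel_dens :: "'n::finite cmat \<Rightarrow> ennreal" where
  "siegel_dens z = ennreal (det (Im_matrix z) powi (- int CARD('n) - 1))"

lemma borel_measurable_siegel_dens [measurable]: "siegel_dens \<in> borel_measurable borel"
  unfolding siegel_dens_def power_int_def by measurable

lemma sets_siegel_measure [measurable_cong]: "sets siegel_measure = sets (restrict_space borel siegel)"
  unfolding siegel_measure_def by (simp, rule sets_restrict_space_cong) simp

lemma space_siegel_measure [simp]: "space siegel_measure = siegel"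
  by (simp add: siegel_measure_def space_restrict_space)

lemma nn_integral_siegel_measure:
  assumes "F \<in> borel_measurable siegel_measure"
  shows "(\<integral>\<^sup>+z. F z \<partial>siegel_measure) = (\<integral>\<^sup>+z. F z * siegel_dens z * indicator siegel z \<partial>sym_lborel)"
proof -
  have F: "F \<in> borel_measurable (restrict_space sym_lborel siegel)"
    using assms by (simp add: siegel_measure_def)
  have D: "siegel_dens \<in> borel_measurable (restrict_space sym_lborel siegel)"
    by (intro measurable_restrict_space1) measurable
  show ?thesis
    unfolding siegel_measure_def siegel_dens_def[symmetric]
    by (subst nn_integral_density[OF D F], subst nn_integral_restrict_space)
       (simp_all add: mult_ac)
qed

lemma measurable_siegel_extend:
  fixes F :: "'n::{finite,linorder} cmat \<Rightarrow> ennreal"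
  assumes "F \<in> borel_measurable siegel_measure"
  shows "(\<lambda>z. F z * indicator siegel z) \<in> borel_measurable borel"
proof -
  have "F \<in> borel_measurable (restrict_space borel siegel)"
    using assms measurable_cong_sets[OF sets_siegel_measure refl] by blast
  then show ?thesis by (subst (asm) borel_measurable_restrict_space_iff_ennreal) auto
qed

lemma measurable_siegelI:
  assumes "T \<in> borel_measurable borel" "\<And>z. z \<in> siegel \<Longrightarrow> T z \<in> siegel"
  shows "T \<in> siegel_measure \<rightarrow>\<^sub>M siegel_measure"
proof -
  have "T \<in> restrict_space borel siegel \<rightarrow>\<^sub>M restrict_space borel siegel"
    using assms by (intro measurable_restrict_space2 measurable_restrict_space1) (auto simp: space_restrict_space)
  then show ?thesis using measurable_cong_sets[OF sets_siegel_measure sets_siegel_measure] by blast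
qed

lemma measurable_siegelI':
  assumes "f \<in> borel_measurable borel"
  shows "f \<in> borel_measurable siegel_measure"
proof -
  have "f \<in> borel_measurable (restrict_space borel siegel)" by (rule measurable_restrict_space1[OF assms])
  then show ?thesis using measurable_cong_sets[OF sets_siegel_measure refl] by blast
qed

definition siegel_preserving :: "('n::{finite,linorder} cmat \<Rightarrow> 'n cmat) \<Rightarrow> bool" where
  "siegel_preserving T \<longleftrightarrow> T \<in> siegel_measure \<rightarrow>\<^sub>M siegel_measure \<and> distr siegel_measure siegel_measure T = siegel_measure"

lemma siegel_preservingI:
  assumes T: "T \<in> siegel_measure \<rightarrow>\<^sub>M siegel_measure"
    and "\<And>F. F \<in> borel_measurable siegel_measure \<Longrightarrow> (\<integral>\<^sup>+z. F (T z) \<partial>siegel_measure) = (\<integral>\<^sup>+z. F z \<partial>siegel_measure)"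
  shows "siegel_preserving T"
proof -
  have "distr siegel_measure siegel_measure T = siegel_measure"
  proof (rule measure_eqI)
    fix A assume "A \<in> sets (distr siegel_measure siegel_measure T)"
    then have A: "A \<in> sets siegel_measure" by simp
    have "emeasure (distr siegel_measure siegel_measure T) A = (\<integral>\<^sup>+z. indicator A z \<partial>distr siegel_measure siegel_measure T)"
      using A by simp
    also have "\<dots> = (\<integral>\<^sup>+z. indicator A (T z) \<partial>siegel_measure)"
      by (rule nn_integral_distr[OF T]) (use A in simp)
    also have "\<dots> = emeasure siegel_measure A"
      using assms(2)[of "indicator A"] A by simp
    finally show "emeasure (distr siegel_measure siegel_measure T) A = emeasure siegel_measure A" .
  qed simp
  then show ?thesis using T by (simp add: siegel_preserving_def)
qed

lemma siegel_preserving_mem: "siegel_preserving T \<Longrightarrow> z \<in> siegel \<Longrightarrow> T z \<in> siegel"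
  unfolding siegel_preserving_def by (metis measurable_space space_siegel_measure)

lemma siegel_preserving_comp:
  assumes "siegel_preserving S" "siegel_preserving T"
  shows "siegel_preserving (\<lambda>z. S (T z))"
proof -
  have S: "S \<in> siegel_measure \<rightarrow>\<^sub>M siegel_measure" and T: "T \<in> siegel_measure \<rightarrow>\<^sub>M siegel_measure"
    using assms by (auto simp: siegel_preserving_def)
  have "distr siegel_measure siegel_measure (\<lambda>z. S (T z)) = distr (distr siegel_measure siegel_measure T) siegel_measure S"
    using distr_distr[OF S T] by (simp add: o_def)
  then show ?thesis using assms measurable_compose[OF T S] by (simp add: siegel_preserving_def)
qed

lemma siegel_preserving_cong:
  assumes "siegel_preserving S" "\<And>z. z \<in> siegel \<Longrightarrow> S z = T z"
  shows "siegel_preserving T"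
proof -
  have "distr siegel_measure siegel_measure S = distr siegel_measure siegel_measure T"
    by (rule distr_cong) (use assms(2) in auto)
  moreover have "T \<in> siegel_measure \<rightarrow>\<^sub>M siegel_measure"
    using assms measurable_cong[of siegel_measure S T siegel_measure] by (simp add: siegel_preserving_def)
  ultimately show ?thesis using assms(1) by (simp add: siegel_preserving_def)
qed

subsection \<open>Partial inversions\<close>

text \<open>Up to signs, the principal pivot transform of z at k: away from row and column k it is
  the Schur complement of z_kk.\<close>

definition partial_inv :: "'n::finite \<Rightarrow> 'n cmat \<Rightarrow> 'n cmat" where
  "partial_inv k z = (\<chi> i j. if i = k \<and> j = k then - 1 / z $ k $ k
     else if i = k then - z $ k $ j / z $ k $ k
     else if j = k then - z $ i $ k / z $ k $ k
     else z $ i $ j - z $ i $ k * z $ k $ j / z $ k $ k)"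

lemma measurable_partial_inv [measurable]: "partial_inv k \<in> borel_measurable borel"
  unfolding partial_inv_def[abs_def]
  by (intro borel_measurable_vec_lambda measurable_If) measurable

lemma siegel_diag: "z \<in> siegel \<Longrightarrow> Im (z $ k $ k) > 0"
proof -
  assume z: "z \<in> siegel"
  have "axis k 1 \<bullet> (Im_matrix z *v axis k 1) > 0"
    using siegel_pos[OF z] by (simp add: pos_def_matrix_def)
  then show ?thesis
    by (simp add: matrix_vector_mult_basis column_def inner_axis' Im_matrix_def)
qed

text \<open>The map is P N^(-1) for a pair (P, N) that differs from (z, 1) only in row k, where the
  row of z and the unit row are exchanged with a sign. The criterion for quotients applies, and det
  N = -z_kk.\<close>

lemma partial_inv_siegel:
  fixes z :: "'n::finite cmat"
  assumes z: "z \<in> siegel"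
  shows "partial_inv k z \<in> siegel"
    "det (Im_matrix (partial_inv k z)) * (cmod (z $ k $ k))\<^sup>2 = det (Im_matrix z)"
proof -
  have sym: "z $ i $ j = z $ j $ i" for i j
    using arg_cong[OF siegel_sym[OF z], of "\<lambda>A. A $ j $ i"] by (simp add: transpose_def)
  have nz: "z $ k $ k \<noteq> 0" using siegel_diag[OF z, of k] by (metis less_irrefl zero_complex.sel(2))
  define P N :: "'n cmat" where
    "P = (\<chi> i j. if i = k then (if j = k then 1 else 0) else z $ i $ j)" and
    "N = (\<chi> i j. if i = k then - z $ k $ j else (if i = j then 1 else 0))"
  \<comment> \<open>All the products below involve a row or column that is a unit vector except
    possibly at position k.\<close>
  have row: "(\<Sum>l\<in>UNIV. M l * c l) = M k * c k + (if i = k then 0 else c i)"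
    if M: "\<And>l. l \<noteq> k \<Longrightarrow> M l = (if l = i then 1 else 0)" for M c :: "'n \<Rightarrow> complex" and i
  proof -
    have "(\<Sum>l\<in>UNIV. M l * c l) = M k * c k + (\<Sum>l\<in>UNIV - {k}. M l * c l)"
      by (simp add: sum.remove)
    also have "(\<Sum>l\<in>UNIV - {k}. M l * c l) = (\<Sum>l\<in>UNIV - {k}. if l = i then c l else 0)"
      by (intro sum.cong) (auto simp: M)
    finally show ?thesis by simp
  qed
  have "transpose N = (\<chi> i j. if j = k then (mat 1 *v (- z $ k)) $ i else mat 1 $ i $ j)"
    unfolding matrix_vector_mul_lid by (simp add: N_def transpose_def mat_def vec_eq_iff)
  then have "det (transpose N) = (- z $ k) $ k * det (mat 1 :: 'n cmat)"
    by (simp only: cramer_lemma)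
  then have dN: "det N = - z $ k $ k" by simp
  have NP: "(transpose N ** P) $ i $ j = - z $ k $ i * (if j = k then 1 else 0) + (if i = k then 0 else z $ i $ j)" for i j
    using row[of "\<lambda>l. N $ l $ i" i "\<lambda>l. P $ l $ j"]
    by (simp add: matrix_matrix_mult_def transpose_def N_def P_def)
  have NcP: "(transpose (cj N) ** P) $ i $ j = - cnj (z $ k $ i) * (if j = k then 1 else 0) + (if i = k then 0 else z $ i $ j)" for i j
    using row[of "\<lambda>l. cj N $ l $ i" i "\<lambda>l. P $ l $ j"]
    by (simp add: matrix_matrix_mult_def transpose_def N_def P_def)
  have PcN: "(transpose (cj P) ** N) $ i $ j = (if i = k then 1 else 0) * (- z $ k $ j) + (if j = k then 0 else cnj (z $ j $ i))" for i j
    using row[of "\<lambda>l. N $ l $ j" j "\<lambda>l. cj P $ l $ i"]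
    by (simp add: matrix_matrix_mult_def transpose_def N_def P_def mult.commute)
  have PN: "(transpose P ** N) $ i $ j = (if i = k then 1 else 0) * (- z $ k $ j) + (if j = k then 0 else z $ j $ i)" for i j
    using row[of "\<lambda>l. N $ l $ j" j "\<lambda>l. P $ l $ i"]
    by (simp add: matrix_matrix_mult_def transpose_def N_def P_def mult.commute)
  have A1: "transpose N ** P = transpose P ** N"
    unfolding vec_eq_iff NP PN using sym by auto
  have A2: "transpose (cj N) ** P - transpose (cj P) ** N = z - cj z"
    unfolding vec_eq_iff vector_minus_component NcP PcN nth_map_matrix using sym by auto
  have dN0: "det N \<noteq> 0" using dN nz by simp
  have "(partial_inv k z ** N) $ i $ j = P $ i $ j" for i j
    using row[of "\<lambda>l. N $ l $ j" j "\<lambda>l. partial_inv k z $ i $ l"] nz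
    by (auto simp: matrix_matrix_mult_def N_def P_def partial_inv_def mult.commute)
  then have "partial_inv k z ** N = P" by (simp add: vec_eq_iff)
  then have eq: "P ** matrix_inv N = partial_inv k z"
    by (metis dN0 matrix_inv_right matrix_mul_assoc matrix_mul_rid)
  show "partial_inv k z \<in> siegel"
    "det (Im_matrix (partial_inv k z)) * (cmod (z $ k $ k))\<^sup>2 = det (Im_matrix z)"
    using siegel_quotient_mem'(2,3)[OF z A1 A2] by (simp_all add: eq dN)
qed

text \<open>The square only changes the sign of row and column k outside the corner, so the fourth
  power is the identity.\<close>

lemma partial_inv_four: "z $ k $ k \<noteq> 0 \<Longrightarrow> partial_inv k (partial_inv k (partial_inv k (partial_inv k z))) = z"
proof -
  assume nz: "z $ k $ k \<noteq> 0"
  have two: "partial_inv k (partial_inv k w) = (\<chi> i j. if (i = k) \<noteq> (j = k) then - w $ i $ j else w $ i $ j)"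
    if "w $ k $ k \<noteq> 0" for w
    using that by (auto simp: partial_inv_def vec_eq_iff)
  show ?thesis
    by (subst (2) two) (use nz in \<open>auto simp: two vec_eq_iff\<close>)
qed

lemma partial_inv_siegel_iff: "partial_inv k z \<in> siegel \<longleftrightarrow> z \<in> siegel"
proof
  assume a: "partial_inv k z \<in> siegel"
  \<comment> \<open>If z_kk were 0, division by zero would make the corner of the image 0, which is
    impossible in \<open>siegel\<close>. Once it is nonzero, the third iterate serves as
    inverse.\<close>
  have "z $ k $ k \<noteq> 0"
  proof
    assume "z $ k $ k = 0"
    then have "partial_inv k z $ k $ k = 0" by (simp add: partial_inv_def)
    then show False using siegel_diag[OF a, of k] by simp
  qed
  then show "z \<in> siegel"
    using partial_inv_siegel(1)[OF partial_inv_siegel(1)[OF partial_inv_siegel(1)[OF a]]]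
    by (metis partial_inv_four)
qed (rule partial_inv_siegel)

text \<open>The corner is inverted with Jacobian |z_kk|^(-4), the n - 1 other entries of row k (the
  set R) are scaled by -1/z_kk with Jacobian |z_kk|^(-2) each, and the remaining entries (the set Q)
  are translated. The exponents add up to 4 + 2(n - 1) = 2(n + 1).\<close>

lemma nn_integral_partial_inv:
  fixes F :: "'n::{finite,linorder} cmat \<Rightarrow> ennreal"
  assumes [measurable]: "F \<in> borel_measurable borel"
  shows "(\<integral>\<^sup>+z. F (partial_inv k z) * ennreal (1 / cmod (z $ k $ k) ^ (2 * (CARD('n) + 1))) *
      indicator {z. Im (z $ k $ k) > 0} z \<partial>sym_lborel) =
    (\<integral>\<^sup>+z. F z * indicator {z. Im (z $ k $ k) > 0} z \<partial>sym_lborel)"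
proof -
  let ?M = "lborel :: complex measure"
  let ?I = "upper_pairs :: ('n \<times> 'n) set"
  let ?P = "PiM ?I (\<lambda>_. ?M)"
  define \<rho> where "\<rho> s = (min k s, max k s)" for s
  define R where "R = \<rho> ` (UNIV - {k})"
  define Q where "Q = ?I - R - {(k, k)}"
  have finI: "finite ?I" by (rule finite_subset[OF subset_UNIV]) simp
  have kkI: "(k, k) \<in> ?I" by simp
  have \<rho>I: "\<rho> s \<in> ?I" for s by (simp add: \<rho>_def min_le_iff_disj)
  have RI: "R \<subseteq> ?I" unfolding R_def by (rule image_subsetI) (rule \<rho>I)
  have QI: "Q \<subseteq> ?I" by (auto simp: Q_def)
  have inj: "inj_on \<rho> (UNIV - {k})"
    by (auto simp: inj_on_def \<rho>_def min_def max_def split: if_splits)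
  have cardR: "card R = CARD('n) - 1" unfolding R_def by (subst card_image[OF inj]) simp
  have kkR: "(k, k) \<notin> R" by (auto simp: R_def \<rho>_def min_def max_def split: if_splits)
  have Rmem: "\<rho> s \<in> R" if "s \<noteq> k" for s using that by (auto simp: R_def)
  have mI: "(\<lambda>a. a p) \<in> borel_measurable ?P" if "p \<in> ?I" for p
    using measurable_component_singleton[OF that, of "\<lambda>_. ?M"] by simp
  note [measurable] = mI[OF kkI] mI[OF \<rho>I]
  \<comment> \<open>The value -1 at zero is a dummy that makes the scaling factor nonzero for every
    argument; on the half-plane Im z_kk > 0 it never occurs.\<close>
  define c where "c a = (if a (k, k) = 0 then - 1 else a (k, k))" for a :: "'n \<times> 'n \<Rightarrow> complex"
  have c0: "c a \<noteq> 0" for a by (simp add: c_def)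
  have [measurable]: "c \<in> borel_measurable ?P" unfolding c_def[abs_def] by measurable
  define H where "H a = (indicator {x. Im x > 0} (a (k, k)) :: ennreal)" for a :: "'n \<times> 'n \<Rightarrow> complex"
  define F1 where "F1 a = F (sym_mat (a((k, k) := - 1 / a (k, k)))) * (ennreal (1 / cmod (a (k, k)) ^ 4) * H a)" for a
  define T2 where "T2 a p = (if p \<in> R then - 1 / c a * a p else a p)" for a p
  define w where "w a = ennreal ((cmod (- 1 / c a))\<^sup>2)" for a
  define F2 where "F2 a = F1 (T2 a) * w a ^ card R" for a
  \<comment> \<open>The translation is applied to the original coordinates, the scaling after it and
    the corner last, so that each stage sees the row entries and the corner in the form its formula
    needs.\<close>
  define T3 where "T3 a p = (if p \<in> Q then a p + (- a (\<rho> (fst p)) * a (\<rho> (snd p)) / c a) else a p)" for a p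
  have upd: "(\<lambda>a. a((k, k) := - 1 / a (k, k))) \<in> ?P \<rightarrow>\<^sub>M ?P"
    by (rule measurable_fun_upd[where J="?I" and f="\<lambda>a. a"]) (use kkI in auto)
  have F1m [measurable]: "F1 \<in> borel_measurable ?P"
    unfolding F1_def H_def using upd measurable_sym_mat[where 'b=complex] by measurable
  have T2m: "T2 \<in> ?P \<rightarrow>\<^sub>M ?P"
  proof (rule measurable_PiM_single')
    show "T2 \<in> space ?P \<rightarrow> (\<Pi>\<^sub>E i\<in>?I. space ?M)"
    proof
      fix a assume a: "a \<in> space ?P"
      have "T2 a p = undefined" if "p \<notin> ?I" for p
        using that a RI by (auto simp: T2_def space_PiM PiE_iff extensional_def)
      then show "T2 a \<in> (\<Pi>\<^sub>E i\<in>?I. space ?M)" by (simp add: PiE_iff extensional_def)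
    qed
    show "(\<lambda>a. T2 a p) \<in> ?P \<rightarrow>\<^sub>M ?M" if "p \<in> ?I" for p
      using mI[OF that] by (cases "p \<in> R") (auto simp: T2_def)
  qed
  have [measurable]: "w \<in> borel_measurable ?P" unfolding w_def[abs_def] by measurable
  have F2m: "F2 \<in> borel_measurable ?P"
    unfolding F2_def using measurable_compose[OF T2m F1m] by simp
  have s1: "(\<integral>\<^sup>+a. F1 a \<partial>?P) = (\<integral>\<^sup>+a. F (sym_mat a) * H a \<partial>?P)"
    unfolding F1_def H_def
    by (rule nn_integral_PiM_update[OF lborel.sigma_finite_measure_axioms finI kkI, of "\<lambda>a. F (sym_mat a)" "\<lambda>a x. - 1 / x"
        "\<lambda>a x. ennreal (1 / cmod x ^ 4) * indicator {x. Im x > 0} x" "\<lambda>a. indicator {x. Im x > 0}"])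
       (use measurable_sym_mat[where 'b=complex] in \<open>auto simp: nn_integral_inversion[symmetric] mult.assoc\<close>)
  have s2: "(\<integral>\<^sup>+a. F2 a \<partial>?P) = (\<integral>\<^sup>+a. F1 a \<partial>?P)"
    unfolding F2_def T2_def[abs_def]
  proof (rule nn_integral_PiM_update_set[OF lborel.sigma_finite_measure_axioms finI RI F1m, of "\<lambda>p a x. - 1 / c a * x"])
    show "(\<lambda>a. - 1 / c a * a p) \<in> ?P \<rightarrow>\<^sub>M ?M" if "p \<in> R" for p
      using mI[of p] that RI by auto
    show "(\<integral>\<^sup>+x. G (- 1 / c a * x) * w a \<partial>?M) = (\<integral>\<^sup>+x. G x \<partial>?M)" if "G \<in> borel_measurable ?M" for a G
      unfolding w_def using that c0[of a] by (intro nn_integral_complex_scale) auto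
    have "c (a(p := x)) = c a" if "p \<in> R" for a p x using that kkR by (auto simp: c_def)
    then show "(\<lambda>x. - 1 / c (a(j := y)) * x) = (\<lambda>x. - 1 / c a * x)" "w (a(j := y)) = w a" if "j \<in> R" for a j y
      using that by (simp_all add: w_def)
  qed measurable
  have s3: "(\<integral>\<^sup>+a. F2 (T3 a) * 1 ^ card Q \<partial>?P) = (\<integral>\<^sup>+a. F2 a \<partial>?P)"
    unfolding T3_def[abs_def]
  proof (rule nn_integral_PiM_update_set[OF lborel.sigma_finite_measure_axioms finI QI F2m,
        of "\<lambda>p a x. x + (- a (\<rho> (fst p)) * a (\<rho> (snd p)) / c a)" "\<lambda>_. 1"])
    show "(\<lambda>a. a p + (- a (\<rho> (fst p)) * a (\<rho> (snd p)) / c a)) \<in> ?P \<rightarrow>\<^sub>M ?M" if "p \<in> Q" for p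
      using mI[of p] that QI by auto
    show "(\<integral>\<^sup>+x. G (x + (- a (\<rho> (fst p)) * a (\<rho> (snd p)) / c a)) * 1 \<partial>?M) = (\<integral>\<^sup>+x. G x \<partial>?M)"
      if "G \<in> borel_measurable ?M" for p a G
      using that by (subst mult_1_right, intro nn_integral_translation) simp
    have "\<rho> s \<in> insert (k, k) R" for s
    proof (cases "s = k")
      case True
      then show ?thesis by (simp add: \<rho>_def)
    qed (simp add: Rmem)
    moreover have "j \<notin> insert (k, k) R" if "j \<in> Q" for j using that by (simp add: Q_def)
    ultimately have q: "j \<noteq> \<rho> s" "j \<noteq> (k, k)" if "j \<in> Q" for j s using that by blast+
    then have "(a(j := y)) (\<rho> s) = a (\<rho> s)" "c (a(j := y)) = c a" if "j \<in> Q" for j y s a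
      using q(1)[OF that, of s] q(2)[OF that] by (simp_all add: c_def)
    then show "(\<lambda>x. x + (- (a(j := y)) (\<rho> (fst i)) * (a(j := y)) (\<rho> (snd i)) / c (a(j := y)))) =
        (\<lambda>x. x + (- a (\<rho> (fst i)) * a (\<rho> (snd i)) / c a))" if "j \<in> Q" for i j a y
      using that by simp
  qed auto
  have key: "F2 (T3 a) = F (partial_inv k (sym_mat a)) * ennreal (1 / cmod (a (k, k)) ^ (2 * (CARD('n) + 1))) * H a" for a
  proof (cases "Im (a (k, k)) > 0")
    case False
    have "(T2 (T3 a)) (k, k) = a (k, k)" using kkR by (simp add: T2_def T3_def Q_def)
    then show ?thesis using False by (simp add: F2_def F1_def H_def)
  next
    case True
    define \<tau> where "\<tau> = a (k, k)"
    have \<tau>0: "\<tau> \<noteq> 0" using True by (auto simp: \<tau>_def)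
    have T3kk: "T3 a (k, k) = \<tau>" by (simp add: T3_def Q_def \<tau>_def)
    have c3: "c (T3 a) = \<tau>" and ca: "c a = \<tau>" using T3kk \<tau>0 by (simp_all add: c_def \<tau>_def)
    have T2kk: "T2 (T3 a) (k, k) = \<tau>" using kkR T3kk by (simp add: T2_def)
    have mat: "sym_mat ((T2 (T3 a))((k, k) := - 1 / \<tau>)) = partial_inv k (sym_mat a)"
    proof -
      have "((T2 (T3 a))((k, k) := - 1 / \<tau>)) (min i j, max i j) = partial_inv k (sym_mat a) $ i $ j" for i j
      proof -
        consider "i = k" "j = k" | "i = k" "j \<noteq> k" | "i \<noteq> k" "j = k" | "i \<noteq> k" "j \<noteq> k" by blast
        then show ?thesis
        proof cases
          case 1
          then show ?thesis by (simp add: partial_inv_def \<tau>_def)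
        next
          case 2
          then have p: "(min i j, max i j) = \<rho> j" "\<rho> j \<in> R" "\<rho> j \<noteq> (k, k)" "\<rho> j \<notin> Q"
            using Rmem[of j] kkR by (auto simp: \<rho>_def Q_def)
          have "partial_inv k (sym_mat a) $ i $ j = - a (\<rho> j) / \<tau>"
            using 2 by (simp add: partial_inv_def \<rho>_def \<tau>_def)
          then show ?thesis unfolding p(1) using p(2-) by (simp add: T2_def c3) (simp add: T3_def)
        next
          case 3
          then have p: "(min i j, max i j) = \<rho> i" "\<rho> i \<in> R" "\<rho> i \<noteq> (k, k)" "\<rho> i \<notin> Q"
            using Rmem[of i] kkR by (auto simp: \<rho>_def Q_def min.commute max.commute)
          have "partial_inv k (sym_mat a) $ i $ j = - a (\<rho> i) / \<tau>"
            using 3 by (simp add: partial_inv_def \<rho>_def \<tau>_def min.commute max.commute)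
          then show ?thesis unfolding p(1) using p(2-) by (simp add: T2_def c3) (simp add: T3_def)
        next
          case 4
          define p where "p = (min i j, max i j)"
          have fs: "fst p \<noteq> k" "snd p \<noteq> k" using 4 by (auto simp: p_def min_def max_def)
          have "p \<notin> R" "p \<noteq> (k, k)" "p \<in> ?I"
            using fs by (auto simp: R_def \<rho>_def p_def min_def max_def split: if_splits)
          then have "p \<in> Q" by (simp add: Q_def)
          have "a (\<rho> (fst p)) * a (\<rho> (snd p)) = a (\<rho> i) * a (\<rho> j)"
            by (auto simp: p_def min_def max_def)
          then have "T3 a p = a p - a (\<rho> i) * a (\<rho> j) / \<tau>"
            using \<open>p \<in> Q\<close> by (simp add: T3_def ca)
          moreover have "partial_inv k (sym_mat a) $ i $ j = a p - a (\<rho> i) * a (\<rho> j) / \<tau>"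
            using 4 by (simp add: partial_inv_def p_def \<rho>_def \<tau>_def min.commute max.commute)
          ultimately show ?thesis
            unfolding p_def[symmetric] using \<open>p \<notin> R\<close> \<open>p \<noteq> (k, k)\<close> by (simp add: T2_def)
        qed
      qed
      then show ?thesis by (simp add: vec_eq_iff)
    qed
    have W: "ennreal (1 / cmod \<tau> ^ 4) * w (T3 a) ^ card R = ennreal (1 / cmod \<tau> ^ (2 * (CARD('n) + 1)))"
    proof -
      have "w (T3 a) ^ card R = ennreal ((1 / cmod \<tau> ^ 2) ^ (CARD('n) - 1))"
        by (simp add: w_def c3 cardR norm_divide power_divide ennreal_power)
      moreover have "1 / cmod \<tau> ^ 4 * (1 / cmod \<tau> ^ 2) ^ (CARD('n) - 1) = 1 / cmod \<tau> ^ (2 * (CARD('n) + 1))"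
      proof -
        have "CARD('n) \<ge> 1" by (simp add: Suc_leI)
        then have "2 * (CARD('n) + 1) = 4 + 2 * (CARD('n) - 1)" by arith
        then show ?thesis
          by (simp only: power_add power_mult power_divide power_one times_divide_times_eq mult_1)
      qed
      ultimately show ?thesis by (simp add: ennreal_mult[symmetric])
    qed
    have "H (T2 (T3 a)) = 1" "H a = 1" using True T2kk by (simp_all add: H_def \<tau>_def)
    then show ?thesis
      by (simp only: F2_def F1_def T2kk mat mult_1_right \<tau>_def[symmetric] mult.assoc W)
  qed
  have Hs: "indicator {z. Im (z $ k $ k) > 0} (sym_mat a) = H a" for a
    by (simp add: H_def indicator_def)
  have "(\<integral>\<^sup>+z. F (partial_inv k z) * ennreal (1 / cmod (z $ k $ k) ^ (2 * (CARD('n) + 1))) *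
      indicator {z. Im (z $ k $ k) > 0} z \<partial>sym_lborel) = (\<integral>\<^sup>+a. F2 (T3 a) * 1 ^ card Q \<partial>?P)"
    by (subst nn_integral_sym_lborel, measurable)
       (simp only: key Hs sym_mat_nth min.idem max.idem power_one mult_1_right)
  also have "\<dots> = (\<integral>\<^sup>+a. F (sym_mat a) * H a \<partial>?P)" using s1 s2 s3 by simp
  also have "\<dots> = (\<integral>\<^sup>+z. F z * indicator {z. Im (z $ k $ k) > 0} z \<partial>sym_lborel)"
    by (subst nn_integral_sym_lborel, measurable) (simp only: Hs)
  finally show ?thesis .
qed

text \<open>det y is divided by |z_kk|^2, so the density (det y)^(-n-1) gains the factor
  |z_kk|^(2(n+1)), which cancels the Jacobian.\<close>

lemma partial_inv_preserving: "siegel_preserving (partial_inv k :: 'n::{finite,linorder} cmat \<Rightarrow> _)"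
proof (rule siegel_preservingI)
  show T: "partial_inv k \<in> siegel_measure \<rightarrow>\<^sub>M (siegel_measure :: 'n cmat measure)"
    by (rule measurable_siegelI) (auto simp: partial_inv_siegel)
  fix F :: "'n cmat \<Rightarrow> ennreal" assume F: "F \<in> borel_measurable siegel_measure"
  define G where "G z = F z * indicator siegel z * siegel_dens z" for z
  have G [measurable]: "G \<in> borel_measurable borel"
    unfolding G_def using measurable_siegel_extend[OF F] by measurable
  have "(\<integral>\<^sup>+z. F (partial_inv k z) \<partial>siegel_measure) =
      (\<integral>\<^sup>+z. F (partial_inv k z) * siegel_dens z * indicator siegel z \<partial>sym_lborel)"
    by (rule nn_integral_siegel_measure) (rule measurable_compose[OF T F])
  also have "\<dots> = (\<integral>\<^sup>+z. G (partial_inv k z) * ennreal (1 / cmod (z $ k $ k) ^ (2 * (CARD('n) + 1))) *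
      indicator {z. Im (z $ k $ k) > 0} z \<partial>sym_lborel)"
  proof (rule nn_integral_cong)
    fix z :: "'n cmat"
    show "F (partial_inv k z) * siegel_dens z * indicator siegel z =
      G (partial_inv k z) * ennreal (1 / cmod (z $ k $ k) ^ (2 * (CARD('n) + 1))) * indicator {z. Im (z $ k $ k) > 0} z"
    proof (cases "z \<in> siegel")
      case True
      define d t where "d = det (Im_matrix (partial_inv k z))" and "t = cmod (z $ k $ k)"
      have d: "d > 0" using siegel_det_Im_pos[OF partial_inv_siegel(1)[OF True]] by (simp add: d_def)
      have t: "t > 0" using siegel_diag[OF True, of k] by (auto simp: t_def)
      have dz: "det (Im_matrix z) = d * t\<^sup>2" using partial_inv_siegel(2)[OF True, of k] by (simp add: d_def t_def)
      have "(d * t\<^sup>2) powi (- int CARD('n) - 1) = d powi (- int CARD('n) - 1) * (1 / t ^ (2 * (CARD('n) + 1)))"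
      proof -
        have "(t\<^sup>2) powi (- int CARD('n) - 1) = inverse ((t\<^sup>2) ^ (CARD('n) + 1))"
          by (rule powi_neg_Suc)
        moreover have "(t\<^sup>2) ^ (CARD('n) + 1) = t ^ (2 * (CARD('n) + 1))" by (simp only: power_mult)
        ultimately show ?thesis by (simp only: power_int_mult_distrib divide_inverse mult_1_left)
      qed
      then have "siegel_dens z = siegel_dens (partial_inv k z) * ennreal (1 / cmod (z $ k $ k) ^ (2 * (CARD('n) + 1)))"
        unfolding siegel_dens_def dz d_def[symmetric] t_def[symmetric]
        using d t by (subst ennreal_mult[symmetric]) auto
      then show ?thesis
        using True siegel_diag[OF True, of k] by (simp add: G_def partial_inv_siegel_iff mult_ac)
    qed (simp add: G_def partial_inv_siegel_iff)
  qed
  also have "\<dots> = (\<integral>\<^sup>+z. G z * indicator {z. Im (z $ k $ k) > 0} z \<partial>sym_lborel)"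
    by (rule nn_integral_partial_inv[OF G])
  also have "\<dots> = (\<integral>\<^sup>+z. F z * siegel_dens z * indicator siegel z \<partial>sym_lborel)"
    by (rule nn_integral_cong) (auto simp: G_def indicator_def siegel_diag mult_ac)
  also have "\<dots> = (\<integral>\<^sup>+z. F z \<partial>siegel_measure)" by (rule nn_integral_siegel_measure[OF F, symmetric])
  finally show "(\<integral>\<^sup>+z. F (partial_inv k z) \<partial>siegel_measure) = (\<integral>\<^sup>+z. F z \<partial>siegel_measure)" .
qed

subsection \<open>Invariance of the measure under the symplectic group\<close>

definition siegel_inv :: "'n::finite cmat \<Rightarrow> 'n cmat" where
  "siegel_inv z = - matrix_inv z"

lemma transpose_0 [simp]: "transpose 0 = 0"
  by (simp add: transpose_def vec_eq_iff)

lemma matrix_vector_minus_left: "(- A) *v x = - (A *v (x :: 'a::ring_1^'n))"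
  by (simp add: matrix_vector_mult_def vec_eq_iff sum_negf)

lemma matrix_vector_minus_right: "A *v (- x) = - (A *v (x :: 'a::ring_1^'n))"
  by (simp add: matrix_vector_mult_def vec_eq_iff sum_negf)

lemma siegel_det_nonzero: "z \<in> siegel \<Longrightarrow> det z \<noteq> 0"
proof (rule det_nonzero_kernel)
  fix x :: "complex^'a" assume "z \<in> siegel" "x \<noteq> 0"
  from siegel_herm[OF this] show "z *v x \<noteq> 0" by (auto simp: herm_def)
qed

text \<open>
  In terms of the graph \<open>{(x, z x)}\<close>, \<open>partial_inv k\<close> replaces \<open>(x\<^sub>k, (z x)\<^sub>k)\<close> by
  \<open>(- (z x)\<^sub>k, x\<^sub>k)\<close>, so that the composition over all \<open>k\<close> is \<open>z \<mapsto> - z\<inverse>\<close>.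
\<close>

lemma partial_inv_graph:
  fixes z :: "'n::finite cmat"
  assumes nz: "z $ k $ k \<noteq> 0"
  shows "partial_inv k z *v (\<chi> i. if i = k then - (z *v x) $ k else x $ i) =
    (\<chi> i. if i = k then x $ k else (z *v x) $ i)"
proof -
  define p where "p = z *v x"
  have split: "(\<Sum>l\<in>UNIV. f l) = f k + (\<Sum>l\<in>UNIV - {k}. f l)" for f :: "'n \<Rightarrow> complex"
    by (simp add: sum.remove)
  have p: "p $ i = z $ i $ k * x $ k + (\<Sum>l\<in>UNIV - {k}. z $ i $ l * x $ l)" for i
    unfolding p_def matrix_vector_mult_def by (simp only: vec_lambda_beta split)
  define r where "r i = (\<Sum>l\<in>UNIV - {k}. z $ i $ l * x $ l)" for i
  have p': "p $ i = z $ i $ k * x $ k + r i" for i by (simp add: p r_def)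
  have "(partial_inv k z *v (\<chi> i. if i = k then - p $ k else x $ i)) $ i = (if i = k then x $ k else p $ i)" for i
  proof -
    have "(partial_inv k z *v (\<chi> i. if i = k then - p $ k else x $ i)) $ i =
      partial_inv k z $ i $ k * (- p $ k) + (\<Sum>l\<in>UNIV - {k}. partial_inv k z $ i $ l * x $ l)"
      unfolding matrix_vector_mult_def by (simp add: split)
    also have "(\<Sum>l\<in>UNIV - {k}. partial_inv k z $ i $ l * x $ l) =
      (if i = k then - r k / z $ k $ k else r i - z $ i $ k * r k / z $ k $ k)"
    proof (cases "i = k")
      case True
      have "(\<Sum>l\<in>UNIV - {k}. partial_inv k z $ i $ l * x $ l) = (\<Sum>l\<in>UNIV - {k}. - 1 / z $ k $ k * (z $ k $ l * x $ l))"
        by (intro sum.cong) (auto simp: True partial_inv_def)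
      then show ?thesis using True by (simp add: r_def sum_negf sum_divide_distrib)
    next
      case False
      have "(\<Sum>l\<in>UNIV - {k}. partial_inv k z $ i $ l * x $ l) =
          (\<Sum>l\<in>UNIV - {k}. z $ i $ l * x $ l - z $ i $ k / z $ k $ k * (z $ k $ l * x $ l))"
        by (intro sum.cong) (auto simp: False partial_inv_def algebra_simps)
      then show ?thesis using False by (simp add: r_def sum_subtractf sum_distrib_left sum_divide_distrib)
    qed
    also have "partial_inv k z $ i $ k = (if i = k then - 1 / z $ k $ k else - z $ i $ k / z $ k $ k)"
      by (simp add: partial_inv_def)
    finally have e: "(partial_inv k z *v (\<chi> i. if i = k then - p $ k else x $ i)) $ i =
      (if i = k then - 1 / z $ k $ k else - z $ i $ k / z $ k $ k) * - p $ k +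
      (if i = k then - r k / z $ k $ k else r i - z $ i $ k * r k / z $ k $ k)" .
    have "- a / t * - (t * y + b) + (c - a * b / t) = a * y + c" if "t \<noteq> 0" for a b c t y :: complex
      using that by (simp add: field_simps)
    from this[OF nz] show ?thesis unfolding e
      using nz by (cases "i = k") (simp_all add: p' field_simps)
  qed
  then show ?thesis unfolding p_def[symmetric] by (simp add: vec_eq_iff)
qed

text \<open>Induction over the set S of indices already inverted, carrying the graph relation along.
  Each intermediate map stays in the half-space, so the next corner is nonzero. At S = UNIV the
  relation says T z (-(z x)) = x, that is T z = -z^(-1).\<close>

lemma siegel_inv_preserving: "siegel_preserving (siegel_inv :: 'n::{finite,linorder} cmat \<Rightarrow> _)"
proof -
  have "\<exists>T :: 'n cmat \<Rightarrow> 'n cmat. siegel_preserving T \<and>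
      (\<forall>z\<in>siegel. \<forall>x. T z *v (\<chi> i. if i \<in> S then - (z *v x) $ i else x $ i) =
         (\<chi> i. if i \<in> S then x $ i else (z *v x) $ i))" if "finite S" for S
    using that
  proof (induction S rule: finite_induct)
    case empty
    have "siegel_preserving (\<lambda>z :: 'n cmat. z)"
      by (simp add: siegel_preserving_def)
    then show ?case by (intro exI[of _ "\<lambda>z. z"]) simp
  next
    case (insert k S)
    then obtain T where T: "siegel_preserving T"
      and rel: "\<And>z x. z \<in> siegel \<Longrightarrow> T z *v (\<chi> i. if i \<in> S then - (z *v x) $ i else x $ i) =
         (\<chi> i. if i \<in> S then x $ i else (z *v x) $ i)" by blast
    show ?case
    proof (intro exI conjI ballI allI)
      show "siegel_preserving (\<lambda>z. partial_inv k (T z))"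
        by (rule siegel_preserving_comp[OF partial_inv_preserving T])
      fix z x assume z: "z \<in> (siegel :: 'n cmat set)"
      have nz: "T z $ k $ k \<noteq> 0"
        using siegel_diag[OF siegel_preserving_mem[OF T z], of k] by auto
      define x' where "x' = (\<chi> i. if i \<in> S then - (z *v x) $ i else x $ i)"
      have r: "T z *v x' = (\<chi> i. if i \<in> S then x $ i else (z *v x) $ i)"
        using rel[OF z] by (simp add: x'_def)
      have "(\<chi> i. if i = k then - (T z *v x') $ k else x' $ i) = (\<chi> i. if i \<in> insert k S then - (z *v x) $ i else x $ i)"
        unfolding r using insert.hyps(2) by (simp add: vec_eq_iff x'_def)
      moreover have "(\<chi> i. if i = k then x' $ k else (T z *v x') $ i) = (\<chi> i. if i \<in> insert k S then x $ i else (z *v x) $ i)"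
        unfolding r using insert.hyps(2) by (simp add: vec_eq_iff x'_def)
      ultimately show "partial_inv k (T z) *v (\<chi> i. if i \<in> insert k S then - (z *v x) $ i else x $ i) =
          (\<chi> i. if i \<in> insert k S then x $ i else (z *v x) $ i)"
        using partial_inv_graph[OF nz, of x'] by simp
    qed
  qed
  from this[of UNIV] obtain T :: "'n cmat \<Rightarrow> 'n cmat" where T: "siegel_preserving T"
    and rel: "\<And>z x. z \<in> siegel \<Longrightarrow> T z *v (\<chi> i. - (z *v x) $ i) = (\<chi> i. x $ i)" by auto
  have "T z = siegel_inv z" if z: "z \<in> siegel" for z
  proof -
    have "(- T z ** z) *v x = mat 1 *v x" for x
    proof -
      have "(- T z ** z) *v x = T z *v (- (z *v x))"
        by (simp add: matrix_minus_left matrix_vector_minus_left matrix_vector_minus_right matrix_vector_mul_assoc)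
      also have "- (z *v x) = (\<chi> i. - (z *v x) $ i)" by (simp add: vec_eq_iff)
      finally show ?thesis using rel[OF z, of x] by simp
    qed
    then have "- T z ** z = mat 1" unfolding matrix_eq by blast
    then have "z ** - T z = mat 1" using matrix_left_right_inverse by blast
    then show ?thesis using matrix_inv_unique by (fastforce simp: siegel_inv_def)
  qed
  then show ?thesis by (rule siegel_preserving_cong[OF T])
qed

lemma siegel_translate:
  fixes s :: "real^'n::finite^'n"
  assumes s: "transpose s = s" and z: "z \<in> siegel"
  shows "z + cm s \<in> siegel" "Im_matrix (z + cm s) = Im_matrix z"
proof -
  show "Im_matrix (z + cm s) = Im_matrix z" by (simp add: Im_matrix_def vec_eq_iff)
  then show "z + cm s \<in> siegel"
    using z s by (simp add: siegel_def transpose_add transpose_cm)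
qed

lemma nn_integral_sym_translation:
  fixes F :: "'n::{finite,linorder} cmat \<Rightarrow> ennreal"
  assumes [measurable]: "F \<in> borel_measurable borel" and c: "transpose c = c"
  shows "(\<integral>\<^sup>+z. F (z + c) \<partial>sym_lborel) = (\<integral>\<^sup>+z. F z \<partial>sym_lborel)"
proof -
  let ?I = "upper_pairs :: ('n \<times> 'n) set"
  let ?P = "PiM ?I (\<lambda>_. lborel :: complex measure)"
  have finI: "finite ?I" by (rule finite_subset[OF subset_UNIV]) simp
  have sym: "c $ i $ j = c $ j $ i" for i j
    using arg_cong[OF c, of "\<lambda>A. A $ j $ i"] by (simp add: transpose_def)
  have m: "(\<lambda>a. F (sym_mat a)) \<in> borel_measurable ?P"
    using measurable_sym_mat[where 'b=complex] by measurable
  have "(\<integral>\<^sup>+z. F (z + c) \<partial>sym_lborel) = (\<integral>\<^sup>+a. F (sym_mat (\<lambda>p. if p \<in> ?I then a p + c $ fst p $ snd p else a p)) * 1 ^ card ?I \<partial>?P)"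
  proof (subst nn_integral_sym_lborel, measurable, rule nn_integral_cong)
    fix a :: "'n \<times> 'n \<Rightarrow> complex"
    have "sym_mat a + c = sym_mat (\<lambda>p. if p \<in> ?I then a p + c $ fst p $ snd p else a p)"
    proof -
      have "c $ i $ j = c $ min i j $ max i j" for i j using sym[of i j] by (auto simp: min_def max_def)
      moreover have "min i j \<le> max i j" for i j :: 'n by (simp add: min_le_iff_disj)
      ultimately show ?thesis by (simp add: vec_eq_iff)
    qed
    then show "F (sym_mat a + c) = F (sym_mat (\<lambda>p. if p \<in> ?I then a p + c $ fst p $ snd p else a p)) * 1 ^ card ?I"
      by simp
  qed
  also have "\<dots> = (\<integral>\<^sup>+a. F (sym_mat a) \<partial>?P)"
  proof (rule nn_integral_PiM_update_set[OF lborel.sigma_finite_measure_axioms finI order_refl m,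
        of "\<lambda>p a x. x + c $ fst p $ snd p" "\<lambda>_. 1"])
    show "(\<lambda>a. a p + c $ fst p $ snd p) \<in> ?P \<rightarrow>\<^sub>M lborel" if "p \<in> ?I" for p
      using measurable_component_singleton[OF that, of "\<lambda>_. lborel :: complex measure"] by simp
    show "(\<integral>\<^sup>+x. G (x + c $ fst p $ snd p) * 1 \<partial>lborel) = (\<integral>\<^sup>+x. G x \<partial>lborel)"
      if "G \<in> borel_measurable lborel" for p G
      using that by (subst mult_1_right, intro nn_integral_translation) simp
  qed auto
  also have "\<dots> = (\<integral>\<^sup>+z. F z \<partial>sym_lborel)" by (rule nn_integral_sym_lborel[symmetric]) simp
  finally show ?thesis .
qed

lemma translate_preserving:
  fixes s :: "((real, 'n::{finite,linorder}) vec, 'n) vec"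
  assumes s: "transpose s = s"
  shows "siegel_preserving (\<lambda>z. z + cm s)"
proof (rule siegel_preservingI)
  show T: "(\<lambda>z. z + cm s) \<in> siegel_measure \<rightarrow>\<^sub>M siegel_measure"
    by (rule measurable_siegelI) (auto simp: siegel_translate[OF s])
  fix F :: "'n cmat \<Rightarrow> ennreal" assume F: "F \<in> borel_measurable siegel_measure"
  define G where "G z = F z * indicator siegel z * siegel_dens z" for z
  have G [measurable]: "G \<in> borel_measurable borel"
    unfolding G_def using measurable_siegel_extend[OF F] by measurable
  have s': "transpose (- s) = - s" using s by (simp add: transpose_minus)
  have mem: "z + cm s \<in> siegel \<longleftrightarrow> z \<in> siegel" for z
  proof
    assume "z + cm s \<in> siegel"
    from siegel_translate(1)[OF s' this] have "z + cm s + cm (- s) \<in> siegel" .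
    moreover have "z + cm s + cm (- s) = z" by (simp add: vec_eq_iff)
    ultimately show "z \<in> siegel" by simp
  qed (rule siegel_translate[OF s])
  have "(\<integral>\<^sup>+z. F (z + cm s) \<partial>siegel_measure) = (\<integral>\<^sup>+z. F (z + cm s) * siegel_dens z * indicator siegel z \<partial>sym_lborel)"
    by (rule nn_integral_siegel_measure) (rule measurable_compose[OF T F])
  also have "\<dots> = (\<integral>\<^sup>+z. G (z + cm s) \<partial>sym_lborel)"
    by (rule nn_integral_cong)
       (auto simp: G_def indicator_def mem siegel_dens_def siegel_translate(2)[OF s])
  also have "\<dots> = (\<integral>\<^sup>+z. G z \<partial>sym_lborel)"
    by (rule nn_integral_sym_translation[OF G]) (simp add: transpose_cm s)
  also have "\<dots> = (\<integral>\<^sup>+z. F z * siegel_dens z * indicator siegel z \<partial>sym_lborel)"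
    by (rule nn_integral_cong) (auto simp: G_def mult_ac)
  also have "\<dots> = (\<integral>\<^sup>+z. F z \<partial>siegel_measure)" by (rule nn_integral_siegel_measure[OF F, symmetric])
  finally show "(\<integral>\<^sup>+z. F (z + cm s) \<partial>siegel_measure) = (\<integral>\<^sup>+z. F z \<partial>siegel_measure)" .
qed

section \<open>Congruences z -> U z U^T\<close>

lemma cm_inv:
  assumes "det s \<noteq> 0"
  shows "cm s ** cm (matrix_inv s) = mat 1" "cm (matrix_inv s) ** cm s = mat 1"
  using assms by (simp_all add: cm_mult[symmetric] matrix_inv_right matrix_inv_left cm_mat)

text \<open>Hua's identity: \<open>s z s\<close> is a composition of inversions and translations by \<open>s\<close> and \<open>s\<inverse>\<close>.\<close>

lemma symmetric_conj_preserving: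
  fixes s :: "((real, 'n::{finite,linorder}) vec, 'n) vec"
  assumes s: "transpose s = s" and d: "det s \<noteq> 0"
  shows "siegel_preserving (\<lambda>z. cm s ** z ** cm s)"
proof -
  have s': "transpose (matrix_inv s) = matrix_inv s" using s d by (simp add: transpose_matrix_inv)
  define f where "f z = siegel_inv z + cm s" for z :: "'n cmat"
  define g where "g z = siegel_inv z + cm (matrix_inv s)" for z :: "'n cmat"
  have f: "siegel_preserving f" unfolding f_def
    by (rule siegel_preserving_comp[OF translate_preserving[OF s] siegel_inv_preserving])
  have g: "siegel_preserving g" unfolding g_def
    by (rule siegel_preserving_comp[OF translate_preserving[OF s'] siegel_inv_preserving])
  have "siegel_preserving (\<lambda>z. f (g (f z)))"
    by (rule siegel_preserving_comp[OF f siegel_preserving_comp[OF g f]])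
  then show ?thesis
  proof (rule siegel_preserving_cong)
    fix z :: "'n cmat" assume z: "z \<in> siegel"
    define S R where "S = cm s" and "R = cm (matrix_inv s)"
    have SR: "S ** R = mat 1" "R ** S = mat 1" using cm_inv[OF d] by (simp_all add: S_def R_def)
    define w where "w = f z"
    define u where "u = g w"
    have wS: "w \<in> siegel" unfolding w_def by (rule siegel_preserving_mem[OF f z])
    have uS: "u \<in> siegel" unfolding u_def by (rule siegel_preserving_mem[OF g wS])
    have w: "w = S - matrix_inv z" by (simp add: w_def f_def siegel_inv_def S_def)
    \<comment> \<open>With S = s and R = s^(-1), the maps are f z = S - z^(-1) and g w = R - w^(-1).
      The relation w z = S z - 1 is enough to verify that -(w z S) is the inverse of g w.\<close>
    have wz: "w ** z = S ** z - mat 1"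
      unfolding w by (simp add: matrix_ring matrix_inv_left[OF siegel_det_nonzero[OF z]])
    have u: "u = R - matrix_inv w" by (simp add: u_def g_def siegel_inv_def R_def)
    have "u ** (- (w ** z ** S)) = - (R ** (w ** z) ** S) + matrix_inv w ** w ** z ** S"
      unfolding u by (simp add: matrix_ring matrix_mul_assoc)
    also have "\<dots> = - (R ** S ** z ** S) + R ** S + z ** S"
      unfolding wz matrix_inv_left[OF siegel_det_nonzero[OF wS]]
      by (simp add: matrix_ring matrix_mul_assoc)
    also have "\<dots> = mat 1" by (simp add: SR)
    finally have "matrix_inv u = - (w ** z ** S)" by (rule matrix_inv_unique)
    then have "f u = w ** z ** S + S" by (simp add: f_def siegel_inv_def S_def)
    also have "\<dots> = S ** z ** S" unfolding wz by (simp add: matrix_ring)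
    finally show "f (g (f z)) = cm s ** z ** cm s" by (simp add: u_def w_def S_def)
  qed
qed

text \<open>The good matrices are closed under products and contain all invertible symmetric ones.
  Diagonal and transposition matrices are symmetric, and a transvection is a product of two
  symmetric matrices, so induction over elementary matrices applies.\<close>

lemma conj_preserving:
  fixes U :: "((real, 'n::{finite,linorder}) vec, 'n) vec"
  assumes "det U \<noteq> 0"
  shows "siegel_preserving (\<lambda>z. cm U ** z ** transpose (cm U))"
proof -
  define Q where "Q U \<longleftrightarrow> (det U \<noteq> 0 \<longrightarrow> siegel_preserving (\<lambda>z. cm U ** z ** transpose (cm U)))" for U :: "((real, 'n) vec, 'n) vec"
  have symQ: "Q U" if "transpose U = U" for U
    using that symmetric_conj_preserving[OF that] by (simp add: Q_def transpose_cm)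
  have multQ: "Q (A ** B)" if "Q A" "Q B" for A B
    unfolding Q_def
  proof
    assume "det (A ** B) \<noteq> 0"
    then have "det A \<noteq> 0" "det B \<noteq> 0" by (auto simp: det_mul)
    then have "siegel_preserving (\<lambda>z. cm A ** (cm B ** z ** transpose (cm B)) ** transpose (cm A))"
      using that siegel_preserving_comp[of "\<lambda>z. cm A ** z ** transpose (cm A)" "\<lambda>z. cm B ** z ** transpose (cm B)"]
      unfolding Q_def by blast
    then show "siegel_preserving (\<lambda>z. cm (A ** B) ** z ** transpose (cm (A ** B)))"
      by (simp add: cm_mult matrix_transpose_mul matrix_mul_assoc)
  qed
  have "Q U"
  proof (rule induct_matrix_elementary[of Q])
    show "Q A" if "row i A = 0" for A i using that det_zero_row by (auto simp: Q_def)
    show "Q A" if "\<And>i j. i \<noteq> j \<Longrightarrow> A $ i $ j = 0" for A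
      by (rule symQ) (use that in \<open>auto simp: transpose_def vec_eq_iff, metis\<close>)
    define w where "w m n = (\<chi> i j. (mat 1 :: ((real, 'n) vec, 'n) vec) $ i $ Transposition.transpose m n j)" for m n :: 'n
    have wsym: "transpose (w m n) = w m n" for m n
      by (auto simp: w_def transpose_def vec_eq_iff mat_def Transposition.transpose_def)
    show "Q (\<chi> i j. mat 1 $ i $ Transposition.transpose m n j)" if "m \<noteq> n" for m n
      using symQ[OF wsym] by (simp add: w_def)
    show "Q (\<chi> i j. if i = m \<and> j = n then c else of_bool (i = j))" if mn: "m \<noteq> n" for m n c
    proof -
      define E where "E = (\<chi> i j. if i = m \<and> j = n then c else of_bool (i = j))"
      \<comment> \<open>The transvection \<open>E\<close> with its rows m and n exchanged: the entry
        c moves to the diagonal and the result is symmetric.\<close>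
      define B where "B = (\<chi> i j. if i = m then of_bool (j = n) else if i = n then (if j = m then 1 else if j = n then c else 0) else of_bool (i = j))"
      have "(w m n ** B) $ i $ j = E $ i $ j" for i j
      proof -
        have "(w m n ** B) $ i $ j = (\<Sum>k\<in>UNIV. if k = Transposition.transpose m n i then B $ k $ j else 0)"
        proof -
          have "(i = Transposition.transpose m n k) = (k = Transposition.transpose m n i)" for k
            by (auto simp: Transposition.transpose_def split: if_splits)
          then show ?thesis by (simp add: matrix_matrix_mult_def w_def mat_def if_distrib if_distribR cong: if_cong)
        qed
        also have "\<dots> = B $ (Transposition.transpose m n i) $ j" by simp
        also have "\<dots> = E $ i $ j"
          using mn by (auto simp: B_def E_def Transposition.transpose_def)
        finally show ?thesis .
      qed
      then have "E = w m n ** B" by (simp add: vec_eq_iff)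
      moreover have "transpose B = B" using mn by (auto simp: B_def transpose_def vec_eq_iff)
      ultimately have "Q E" using multQ[OF symQ[OF wsym] symQ] by simp
      then show ?thesis by (simp add: E_def)
    qed
  qed (rule multQ)
  then show ?thesis using assms by (simp add: Q_def)
qed

section \<open>Block matrices, the big cell and the full symplectic group\<close>

definition block_matrix :: "real^'n::finite^'n \<Rightarrow> real^'n^'n \<Rightarrow> real^'n^'n \<Rightarrow> real^'n^'n \<Rightarrow> 'n rmat2" where
  "block_matrix A B C D = (\<chi> i j. case (i, j) of
      (Inl a, Inl b) \<Rightarrow> A $ a $ b | (Inl a, Inr b) \<Rightarrow> B $ a $ b
    | (Inr a, Inl b) \<Rightarrow> C $ a $ b | (Inr a, Inr b) \<Rightarrow> D $ a $ b)"

lemma blk_block_matrix [simp]: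
  "blk_A (block_matrix A B C D) = cm A" "blk_B (block_matrix A B C D) = cm B"
  "blk_C (block_matrix A B C D) = cm C" "blk_D (block_matrix A B C D) = cm D"
  by (simp_all add: vec_eq_iff blk_A_def blk_B_def blk_C_def blk_D_def block_matrix_def)

lemma sp_J_square: "sp_J ** sp_J = - (mat 1 :: 'n::finite rmat2)"
proof -
  have "(sp_J ** sp_J) $ i $ j = (- mat 1 :: 'n rmat2) $ i $ j" for i j :: "'n + 'n"
    unfolding matrix_matrix_mult_def
    by (cases i; cases j) (auto simp: sp_J_def mat_def sum_UNIV_sum if_distrib if_distribR sum_negf cong: if_cong)
  then show ?thesis by (simp add: vec_eq_iff)
qed

lemma Sp_realI:
  fixes g :: "'n::finite rmat2"
  assumes "transpose g ** sp_J ** g = sp_J"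
  shows "g \<in> Sp_real"
proof -
  have "sp_J ** (- sp_J) = (mat 1 :: 'n rmat2)" by (simp add: matrix_minus_right sp_J_square)
  from det_right_inverse(2)[OF this] have "det (sp_J :: 'n rmat2) \<noteq> 0" .
  moreover have "det g * det (sp_J :: 'n rmat2) * det g = det (sp_J :: 'n rmat2)"
    using arg_cong[OF assms, of det] by (simp add: det_mul)
  ultimately have "det g \<noteq> 0" by auto
  then show ?thesis using assms by (simp add: Sp_real_def invertible_det_nz)
qed

lemma block_matrix_Sp_real:
  assumes "transpose A ** C = transpose C ** A" "transpose B ** D = transpose D ** B"
    "transpose A ** D - transpose C ** B = mat 1"
  shows "block_matrix A B C D \<in> Sp_real"
proof (rule Sp_realI)
  have e: "(\<Sum>i\<in>UNIV. A $ i $ a * C $ i $ b) = (\<Sum>i\<in>UNIV. C $ i $ a * A $ i $ b)"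
    "(\<Sum>i\<in>UNIV. B $ i $ a * D $ i $ b) = (\<Sum>i\<in>UNIV. D $ i $ a * B $ i $ b)"
    "(\<Sum>i\<in>UNIV. A $ i $ a * D $ i $ b) - (\<Sum>i\<in>UNIV. C $ i $ a * B $ i $ b) = (if a = b then 1 else 0)" for a b
    using assms by (simp_all add: vec_eq_iff matrix_matrix_mult_def transpose_def mat_def)
  have "(transpose (block_matrix A B C D) ** sp_J ** block_matrix A B C D) $ i $ j = sp_J $ i $ j" for i j
  proof -
    have e3: "(\<Sum>i\<in>UNIV. B $ i $ b * C $ i $ a) - (\<Sum>i\<in>UNIV. D $ i $ b * A $ i $ a) = (if b = a then - 1 else 0)" for a b
    proof -
      have "(\<Sum>i\<in>UNIV. B $ i $ b * C $ i $ a) = (\<Sum>i\<in>UNIV. C $ i $ a * B $ i $ b)"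
        "(\<Sum>i\<in>UNIV. D $ i $ b * A $ i $ a) = (\<Sum>i\<in>UNIV. A $ i $ a * D $ i $ b)"
        by (intro sum.cong refl mult.commute)+
      then show ?thesis using e(3)[of a b] by (cases "a = b") auto
    qed
    show ?thesis
      unfolding sp_J_mult_entry
      by (cases i; cases j) (simp_all add: block_matrix_def sp_J_def e e3)
  qed
  then show "transpose (block_matrix A B C D) ** sp_J ** block_matrix A B C D = sp_J"
    by (simp add: vec_eq_iff)
qed

text \<open>The inverse of g is -J g^T J; writing it on the other side of g gives the relation for
  the transpose. It is the source of C D^T = D C^T below.\<close>

lemma Sp_real_transpose:
  assumes "g \<in> Sp_real"
  shows "transpose g \<in> Sp_real"
proof (rule Sp_realI)
  have g: "transpose g ** sp_J ** g = sp_J" using assms by (simp add: Sp_real_def)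
  have "(- (sp_J ** transpose g ** sp_J)) ** g = mat 1"
    using arg_cong[OF g, of "\<lambda>M. - (sp_J ** M)"]
    by (simp add: matrix_minus_left matrix_mul_assoc sp_J_square)
  then have "g ** (- (sp_J ** transpose g ** sp_J)) = mat 1" using matrix_left_right_inverse by blast
  then have "(g ** sp_J ** transpose g) ** (- sp_J) = mat 1"
    by (simp add: matrix_minus_right matrix_mul_assoc)
  then have "(g ** sp_J ** transpose g) ** (- sp_J) ** sp_J = sp_J" by simp
  then have "(g ** sp_J ** transpose g) ** (- (sp_J ** sp_J)) = sp_J"
    by (simp add: matrix_minus_right matrix_minus_left matrix_mul_assoc)
  then show "transpose (transpose g) ** sp_J ** transpose g = sp_J" by (simp add: sp_J_square)
qed

lemma blk_transpose:
  "blk_A (transpose g) = transpose (blk_A g)" "blk_B (transpose g) = transpose (blk_C g)"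
  "blk_C (transpose g) = transpose (blk_B g)" "blk_D (transpose g) = transpose (blk_D g)"
  by (simp_all add: vec_eq_iff blk_A_def blk_B_def blk_C_def blk_D_def transpose_def)

lemma cm_inject: "cm A = cm B \<longleftrightarrow> A = B"
  by (simp add: vec_eq_iff)

text \<open>For invertible C one has g z = A C^(-1) - C^(-T) (z + C^(-1) D)^(-1) C^(-1), with A
  C^(-1) and C^(-1) D symmetric by the block relations: a composition of translation, inversion,
  congruence and translation.\<close>

lemma sp_act_big_cell_preserving:
  fixes g :: "'n::{finite,linorder} rmat2"
  assumes g: "g \<in> Sp_real" and d: "det (blk_C g) \<noteq> 0"
  shows "siegel_preserving (sp_act g)"
proof -
  define A where "A = (\<chi> i j. g $ Inl i $ Inl j)"
  define C where "C = (\<chi> i j. g $ Inr i $ Inl j)"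
  define D where "D = (\<chi> i j. g $ Inr i $ Inr j)"
  have blk: "blk_A g = cm A" "blk_C g = cm C" "blk_D g = cm D"
    by (simp_all add: vec_eq_iff blk_A_def blk_C_def blk_D_def A_def C_def D_def)
  have dC: "det C \<noteq> 0" using d by (simp add: blk det_cm)
  define I where "I = matrix_inv C"
  have IC: "I ** C = mat 1" "C ** I = mat 1" using dC by (simp_all add: I_def matrix_inv_left matrix_inv_right)
  have tIC: "transpose C ** transpose I = mat 1" "transpose I ** transpose C = mat 1"
    using IC by (metis matrix_transpose_mul transpose_mat)+
  note b = Sp_real_blocks[OF g] and b' = Sp_real_blocks(4)[OF Sp_real_transpose[OF g]]
  have AC: "transpose A ** C = transpose C ** A"
    using b(1) by (simp add: blk transpose_cm cm_mult[symmetric] cm_inject)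
  have CD: "C ** transpose D = D ** transpose C"
    using b' by (simp add: blk transpose_cm blk_transpose cm_mult[symmetric] cm_inject)
  define X where "X = A ** I"
  define Y where "Y = I ** D"
  have X': "X = transpose I ** transpose A"
  proof -
    have "X = (transpose I ** transpose C) ** A ** I" by (simp add: tIC X_def)
    also have "\<dots> = transpose I ** (transpose A ** C) ** I" by (simp add: AC matrix_mul_assoc)
    also have "\<dots> = transpose I ** transpose A ** (C ** I)" by (simp add: matrix_mul_assoc)
    finally show ?thesis by (simp add: IC)
  qed
  then have X: "transpose X = X" by (simp add: X_def matrix_transpose_mul)
  have Y: "transpose Y = Y"
  proof -
    have "transpose Y = (I ** C) ** transpose D ** transpose I" by (simp add: Y_def matrix_transpose_mul IC)
    also have "\<dots> = I ** (D ** transpose C) ** transpose I" by (simp add: CD[symmetric] matrix_mul_assoc)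
    also have "\<dots> = I ** D ** (transpose C ** transpose I)" by (simp add: matrix_mul_assoc)
    finally show ?thesis by (simp add: tIC Y_def)
  qed
  have dI: "det (transpose I) \<noteq> 0" using det_right_inverse(2)[OF IC(1)] by simp
  define T where "T z = (cm (transpose I) ** siegel_inv (z + cm Y) ** transpose (cm (transpose I))) + cm X" for z
  have T: "siegel_preserving T"
    unfolding T_def
    by (rule siegel_preserving_comp[OF translate_preserving[OF X] siegel_preserving_comp[OF conj_preserving[OF dI]
         siegel_preserving_comp[OF siegel_inv_preserving translate_preserving[OF Y]]]])
  show ?thesis
  proof (rule siegel_preserving_cong[OF T])
    fix z :: "'n cmat" assume z: "z \<in> siegel"
    define S where "S = z + cm Y"
    have dS: "det S \<noteq> 0" unfolding S_def by (rule siegel_det_nonzero[OF siegel_translate(1)[OF Y z]])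
    have IS: "matrix_inv S ** S = mat 1" by (rule matrix_inv_left[OF dS])
    have CI: "cm C ** cm I = mat 1" "cm I ** cm C = mat 1" using IC by (simp_all add: cm_mult[symmetric] cm_mat)
    have den: "sp_den g z = cm C ** S"
    proof -
      have "cm C ** S = cm C ** z + (cm C ** cm I) ** cm D"
        by (simp add: S_def Y_def cm_mult matrix_add_ldistrib matrix_mul_assoc)
      then show ?thesis by (simp add: CI blk)
    qed
    \<comment> \<open>B is recovered from A^T D - C^T B = 1 by multiplying with C^(-T).\<close>
    have B: "blk_B g = cm X ** cm D - cm (transpose I)"
    proof -
      have "cm (transpose I) ** (transpose (cm A) ** cm D - transpose (cm C) ** blk_B g) = cm (transpose I)"
        using b(2) by (simp add: blk)
      then have "cm (transpose I) ** transpose (cm A) ** cm D - cm (transpose I) ** transpose (cm C) ** blk_B g = cm (transpose I)"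
        by (simp add: matrix_ring matrix_mul_assoc)
      moreover have "cm (transpose I) ** transpose (cm C) = mat 1"
        using tIC by (simp add: transpose_cm cm_mult[symmetric] cm_mat)
      moreover have "cm (transpose I) ** transpose (cm A) = cm X"
        using X' by (simp add: transpose_cm cm_mult[symmetric])
      ultimately show ?thesis by (simp add: algebra_simps)
    qed
    have "T z ** sp_den g z = - (cm (transpose I) ** matrix_inv S ** (cm I ** cm C) ** S) + cm X ** cm C ** S"
      unfolding den T_def siegel_inv_def S_def[symmetric]
      by (simp add: transpose_cm matrix_ring matrix_mul_assoc)
    also have "\<dots> = - (cm (transpose I) ** (matrix_inv S ** S)) + cm X ** sp_den g z"
      by (simp add: CI den matrix_mul_assoc)
    also have "\<dots> = - cm (transpose I) + (cm A ** (cm I ** cm C)) ** z + cm X ** cm D"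
      by (simp add: IS blk X_def cm_mult matrix_ring matrix_mul_assoc)
    also have "\<dots> = sp_num g z" by (simp add: CI B blk)
    finally have "T z ** sp_den g z = sp_act g z ** sp_den g z" by (simp only: sp_act_den[OF g z])
    then show "T z = sp_act g z" using matrix_cancel_right[OF sp_act_siegel(1)[OF g z]] by blast
  qed
qed

text \<open>det(x C + D) is a polynomial in x. It is nonzero at one complex point, so it has
  finitely many roots and some real number is not among them.\<close>

lemma det_shift_nonzero:
  fixes C D :: "complex^'n^'n"
  assumes "det (mat c ** C + D) \<noteq> 0"
  obtains t :: real where "det (mat (complex_of_real t) ** C + D) \<noteq> 0"
proof -
  define p where "p = det (\<chi> i j. [:D $ i $ j, C $ i $ j:])"
  have "poly p x = det (mat x ** C + D)" for x
    by (simp add: p_def det_def poly_sum poly_prod mat_mult_entry algebra_simps)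
  then have "p \<noteq> 0" using assms by (metis poly_0)
  then have "finite {x. poly p x = 0}" by (rule poly_roots_finite)
  moreover have "infinite (range complex_of_real)"
    using finite_imageD[of complex_of_real UNIV] infinite_UNIV_char_0 by (auto simp: inj_on_def)
  ultimately have "\<not> range complex_of_real \<subseteq> {x. poly p x = 0}" using finite_subset by blast
  then obtain t where "poly p (complex_of_real t) \<noteq> 0" by auto
  then show thesis using that \<open>\<And>x. poly p x = det (mat x ** C + D)\<close> by metis
qed

lemma mat_i_siegel: "(mat \<i> :: 'n::finite cmat) \<in> siegel"
proof -
  have "Im_matrix (mat \<i> :: 'n cmat) = mat 1" by (simp add: Im_matrix_def mat_def vec_eq_iff)
  then show ?thesis unfolding siegel_def pos_def_matrix_def by simp
qed

text \<open>Every g is a product of two elements of the big cell: g = (g u) v with v = u^(-1). The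
  lower left block of g u is -(t C + D), invertible for a suitable real t because C i + D is
  invertible; that of v is the identity.\<close>

lemma sp_act_preserving:
  fixes g :: "'n::{finite,linorder} rmat2"
  assumes g: "g \<in> Sp_real"
  shows "siegel_preserving (sp_act g)"
proof -
  have "det (mat \<i> ** blk_C g + blk_D g) \<noteq> 0"
    using sp_act_siegel(1)[OF g mat_i_siegel] by (simp add: mat_commute)
  then obtain t :: real where t: "det (mat (complex_of_real t) ** blk_C g + blk_D g) \<noteq> 0"
    by (rule det_shift_nonzero)
  define u :: "'n rmat2" where "u = block_matrix (- mat t) (mat 1) (- mat 1) 0"
  define v :: "'n rmat2" where "v = block_matrix 0 (- mat 1) (mat 1) (- mat t)"
  have u: "u \<in> Sp_real" unfolding u_def
    by (rule block_matrix_Sp_real) (simp_all add: transpose_minus matrix_ring transpose_0)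
  have v: "v \<in> Sp_real" unfolding v_def
    by (rule block_matrix_Sp_real) (simp_all add: transpose_minus matrix_ring transpose_0)
  have cmm: "cm (- M) = - cm M" for M :: "((real, 'n) vec, 'n) vec" by (simp add: vec_eq_iff)
  have cm0: "cm (0 :: ((real, 'n) vec, 'n) vec) = 0" by (simp add: vec_eq_iff)
  have uv: "u ** v = mat 1"
    by (rule blk_eqI) (simp_all add: blk_mult u_def v_def cmm cm0 cm_mat blk_mat matrix_ring)
  have "blk_C (g ** u) = - (mat (complex_of_real t) ** blk_C g + blk_D g)"
    by (simp add: blk_mult u_def cmm cm_mat matrix_ring mat_commute)
  also have "\<dots> = mat (- 1) ** (mat (complex_of_real t) ** blk_C g + blk_D g)"
    by (simp only: vec_eq_iff mat_mult_entry) simp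
  finally have "det (blk_C (g ** u)) \<noteq> 0" using t by (simp add: det_mul det_mat)
  then have 1: "siegel_preserving (sp_act (g ** u))"
    by (rule sp_act_big_cell_preserving[OF Sp_real_mult[OF g u]])
  have 2: "siegel_preserving (sp_act v)"
    by (rule sp_act_big_cell_preserving[OF v]) (simp add: v_def cm_mat)
  show ?thesis
  proof (rule siegel_preserving_cong[OF siegel_preserving_comp[OF 1 2]])
    fix z :: "'n cmat" assume z: "z \<in> siegel"
    have "g ** u ** v = g" by (simp add: uv matrix_mul_assoc[symmetric])
    then show "sp_act (g ** u) (sp_act v z) = sp_act g z"
      using sp_act_mult[OF Sp_real_mult[OF g u] v z] by simp
  qed
qed

subsection \<open>Discreteness of the integral symplectic group\<close>

lemma Sp_int_real: "g \<in> Sp_int \<Longrightarrow> g \<in> Sp_real"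
  by (simp add: Sp_int_def)

lemma countable_Sp_int: "countable (Sp_int :: 'n::finite rmat2 set)"
proof (rule countable_subset)
  let ?f = "\<lambda>h :: int ^ ('n + 'n) ^ ('n + 'n). map_matrix real_of_int h"
  show "Sp_int \<subseteq> range ?f"
  proof
    fix g :: "'n rmat2" assume "g \<in> Sp_int"
    then have "g $ i $ j = real_of_int \<lfloor>g $ i $ j\<rfloor>" for i j
      by (auto simp: Sp_int_def elim!: Ints_cases)
    then have "g = ?f (\<chi> i j. \<lfloor>g $ i $ j\<rfloor>)" by (simp add: vec_eq_iff)
    then show "g \<in> range ?f" by blast
  qed
qed simp

lemma finite_bounded_integral_matrices:
  "finite {g :: real^'m::finite^'k::finite. (\<forall>i j. g $ i $ j \<in> \<int>) \<and> (\<forall>i j. \<bar>g $ i $ j\<bar> \<le> B)}"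
proof (rule finite_subset)
  let ?P = "(UNIV :: 'k set) \<times> (UNIV :: 'm set) \<rightarrow>\<^sub>E {x :: real. x \<in> \<int> \<and> \<bar>x\<bar> \<le> B}"
  have "{x :: real. x \<in> \<int> \<and> \<bar>x\<bar> \<le> B} \<subseteq> real_of_int ` {- \<lceil>B\<rceil>..\<lceil>B\<rceil>}"
    by (auto elim!: Ints_cases) (auto simp: image_iff le_ceiling_iff abs_le_iff, linarith+)
  then have "finite {x :: real. x \<in> \<int> \<and> \<bar>x\<bar> \<le> B}" by (rule finite_subset) simp
  then show "finite ((\<lambda>f. \<chi> i j. f (i, j)) ` ?P)" by (intro finite_imageI finite_PiE) auto
  show "{g :: real^'m^'k. (\<forall>i j. g $ i $ j \<in> \<int>) \<and> (\<forall>i j. \<bar>g $ i $ j\<bar> \<le> B)} \<subseteq> (\<lambda>f. \<chi> i j. f (i, j)) ` ?P"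
  proof
    fix g :: "real^'m^'k" assume g: "g \<in> {g. (\<forall>i j. g $ i $ j \<in> \<int>) \<and> (\<forall>i j. \<bar>g $ i $ j\<bar> \<le> B)}"
    have "g = (\<chi> i j. (\<lambda>(i, j). g $ i $ j) (i, j))" by (simp add: vec_eq_iff)
    then show "g \<in> (\<lambda>f. \<chi> i j. f (i, j)) ` ?P"
      using g by (intro image_eqI[of _ _ "\<lambda>p\<in>UNIV \<times> UNIV. g $ fst p $ snd p"]) (auto simp: vec_eq_iff)
  qed
qed

lemma matrix_mult_bounded:
  assumes "\<And>i j. cmod ((A :: complex^'n^'m) $ i $ j) \<le> a" "\<And>i j. cmod ((B :: complex^'k^'n) $ i $ j) \<le> b"
  shows "cmod ((A ** B) $ i $ j) \<le> real CARD('n) * (a * b)"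
proof -
  have "cmod ((A ** B) $ i $ j) \<le> (\<Sum>l\<in>(UNIV::'n set). cmod (A $ i $ l * B $ l $ j))"
    unfolding matrix_matrix_mult_def by (simp add: norm_sum)
  also have "\<dots> \<le> (\<Sum>l\<in>(UNIV::'n set). a * b)"
  proof (rule sum_mono)
    fix l
    have "0 \<le> a" using order_trans[OF norm_ge_zero assms(1)] .
    then show "cmod (A $ i $ l * B $ l $ j) \<le> a * b"
      unfolding norm_mult by (intro mult_mono assms) auto
  qed
  finally show ?thesis by simp
qed

lemma entry_bound: "\<exists>b. \<forall>i j. cmod ((A :: complex^'n::finite^'m::finite) $ i $ j) \<le> b"
proof -
  have "cmod (A $ i $ j) \<le> norm A" for i j
    using Finite_Cartesian_Product.norm_nth_le[of "A $ i" j] Finite_Cartesian_Product.norm_nth_le[of A i] by linarith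
  then show ?thesis by blast
qed

lemma herm_diag_real:
  assumes "z \<in> siegel" "c \<ge> 0" "\<And>u. u \<bullet> (Im_matrix z *v u) \<ge> c * norm u ^ 2"
  shows "Im (herm v (z *v v)) \<ge> c * (\<Sum>i\<in>UNIV. (cmod (v $ i))\<^sup>2)"
proof -
  have "c * (\<Sum>i\<in>UNIV. (cmod (v $ i))\<^sup>2) = c * norm (\<chi> i. Re (v $ i)) ^ 2 + c * norm (\<chi> i. Im (v $ i)) ^ 2"
    by (simp add: norm_vec_def L2_set_def sum_nonneg cmod_power2 sum.distrib distrib_left)
  also have "\<dots> \<le> Im (herm v (z *v v))"
    unfolding herm_Im_symmetric[OF siegel_sym[OF assms(1)]] by (intro add_mono assms)
  finally show ?thesis .
qed

text \<open>The value of the imaginary form is carried along by x -> (C z + D) x. A lower bound for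
  the form of Im(g z) therefore bounds C z + D from above.\<close>

lemma herm_transform:
  assumes "g \<in> Sp_real" "z \<in> siegel"
  shows "Im (herm (sp_den g z *v x) (sp_act g z *v (sp_den g z *v x))) = Im (herm x (z *v x))"
proof -
  have sym: "transpose z = z" by (rule siegel_sym[OF assms(2)])
  have "sp_act g z *v (sp_den g z *v x) = sp_num g z *v x"
    by (simp add: matrix_vector_mul_assoc sp_act_den[OF assms])
  moreover have "2 * \<i> * Im (herm (sp_den g z *v x) (sp_num g z *v x)) = herm x ((z - cj z) *v x)"
    unfolding herm_Im_diff sp_herm_eq(2)[OF assms(1) sym] ..
  moreover have "2 * \<i> * Im (herm (mat 1 *v x) (z *v x)) = herm x ((z - cj z) *v x)"
    unfolding herm_Im_diff using sym by (simp add: cj_mat transpose_cj)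
  ultimately show ?thesis by (simp add: complex_eq_iff)
qed

text \<open>If g z is near z, its form is bounded below, so \<open>herm_transform\<close> bounds the
  entries of C z + D. As C and D are real and y is invertible, this bounds C and D; then A z + B =
  (g z)(C z + D) bounds A and B. Only finitely many integral matrices remain.\<close>

lemma Sp_int_locally_finite:
  fixes z :: "'n::finite cmat"
  assumes z: "z \<in> siegel"
  obtains U where "open U" "z \<in> U" "finite {g \<in> Sp_int. sp_act g z \<in> U}"
proof -
  obtain c where c: "c > 0" "\<And>u. u \<bullet> (Im_matrix z *v u) \<ge> c * norm u ^ 2"
    using siegel_uniform[OF z] by blast
  define K where "K = real CARD('n) ^ 2"
  have K: "K > 0" by (simp add: K_def)
  \<comment> \<open>Chosen so that moving within distance r changes the form by at most c/2 |u|^2,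
    which leaves half of the lower bound.\<close>
  define r where "r = c / (2 * K)"
  have r: "r > 0" using c K by (simp add: r_def)
  have low: "u \<bullet> (Im_matrix w *v u) \<ge> c / 2 * norm u ^ 2" if "w \<in> ball z r" for u w
  proof -
    have "Im_matrix w = Im_matrix z + Im_matrix (w - z)" by (simp add: Im_matrix_def vec_eq_iff)
    then have "u \<bullet> (Im_matrix w *v u) = u \<bullet> (Im_matrix z *v u) + u \<bullet> (Im_matrix (w - z) *v u)"
      by (simp add: matrix_vector_mult_add_rdistrib inner_add_right)
    moreover have "\<bar>u \<bullet> (Im_matrix (w - z) *v u)\<bar> \<le> K * norm (w - z) * norm u ^ 2"
      unfolding K_def by (rule Im_matrix_quadratic_bound)
    moreover have "K * norm (w - z) * norm u ^ 2 \<le> K * r * norm u ^ 2"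
      using that K by (intro mult_right_mono mult_left_mono) (auto simp: dist_norm norm_minus_commute)
    moreover have "K * r = c / 2" using K by (simp add: r_def)
    ultimately show ?thesis using c(2)[of u] by (simp add: algebra_simps)
  qed
  define Y where "Y = cm (Im_matrix z)"
  define X where "X = map_matrix (\<lambda>x. complex_of_real (Re x)) z"
  have zXY: "z = X + mat \<i> ** Y" by (simp add: vec_eq_iff mat_mult_entry X_def Y_def Im_matrix_def complex_eq_iff)
  have dY: "det Y \<noteq> 0" using siegel_det_Im_pos[OF z] by (simp add: Y_def det_cm)
  define Yi where "Yi = matrix_inv (Im_matrix z)"
  have YYi: "Y ** cm Yi = mat 1"
    using siegel_det_Im_pos[OF z] by (simp add: Y_def Yi_def cm_mult[symmetric] matrix_inv_right cm_mat)
  obtain bX where bX: "\<And>i j. cmod (X $ i $ j) \<le> bX" using entry_bound by blast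
  obtain bY where bY: "\<And>i j. cmod (cm Yi $ i $ j) \<le> bY" using entry_bound by blast
  obtain bz where bz: "\<And>i j. cmod (z $ i $ j) \<le> bz" using entry_bound by blast
  define k where "k = real CARD('n)"
  \<comment> \<open>From c/2 |N_ij|^2 <= Im z_jj <= \<open>bz\<close> for N = C z + D, tested on the
    j-th unit vector; \<open>w0\<close> below bounds the entries of g z.\<close>
  define m where "m = sqrt (2 / c * bz)"
  define w0 where "w0 = norm z + r"
  define B where "B b = k * (b * bY) + (b + k * (k * (b * bY) * bX))" for b
  text \<open>For real \<open>C\<close> and \<open>D\<close>, a bound on the entries of \<open>C z + D\<close> bounds those of \<open>C\<close> and \<open>D\<close>.\<close>
  have bound: "cmod (C $ i $ j) \<le> k * (b * bY) \<and> cmod (D $ i $ j) \<le> b + k * (k * (b * bY) * bX)"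
    if CD: "cj C = C" "cj D = D" and b: "\<And>i j. cmod ((C ** z + D) $ i $ j) \<le> b" for C D :: "'n cmat" and b i j
  proof -
    define N where "N = C ** z + D"
    have Nb: "cmod (N $ i $ j) \<le> b" for i j using b[of i j] by (simp add: N_def)
    have real: "Im (C $ i $ j) = 0" "Im (D $ i $ j) = 0" for i j
      using CD by (metis complex_cnj_cancel_iff nth_map_matrix complex_In_mult_cnj_zero complex_cnj_complex_of_real Reals_cnj_iff complex_is_Real_iff)+
    have ImN: "map_matrix (\<lambda>x. complex_of_real (Im x)) N = C ** Y"
    proof -
      have "Im ((C ** z) $ i $ j) = (\<Sum>l\<in>UNIV. Re (C $ i $ l) * Im (z $ l $ j))" for i j
        by (simp add: matrix_matrix_mult_def real)
      moreover have "(C ** Y) $ i $ j = complex_of_real (\<Sum>l\<in>UNIV. Re (C $ i $ l) * Im (z $ l $ j))" for i j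
      proof -
        have "C $ i $ l = complex_of_real (Re (C $ i $ l))" for l using real by (simp add: complex_eq_iff)
        then show ?thesis
          by (simp add: matrix_matrix_mult_def Y_def Im_matrix_def)
      qed
      ultimately show ?thesis by (simp add: vec_eq_iff N_def real)
    qed
    have C: "C = map_matrix (\<lambda>x. complex_of_real (Im x)) N ** cm Yi"
      unfolding ImN by (simp add: matrix_mul_assoc[symmetric] YYi)
    have Cb: "cmod (C $ i $ j) \<le> k * (b * bY)" for i j
      unfolding k_def
    proof (subst C, rule matrix_mult_bounded)
      show "cmod (map_matrix (\<lambda>x. complex_of_real (Im x)) N $ i $ j) \<le> b" for i j
        using Nb[of i j] abs_Im_le_cmod[of "N $ i $ j"] by simp
    qed (rule bY)
    have ReN: "D = map_matrix (\<lambda>x. complex_of_real (Re x)) N - C ** X"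
    proof -
      have "(C ** X) $ i $ j = complex_of_real (Re ((C ** z) $ i $ j))" for i j
      proof -
        have "C $ i $ l = complex_of_real (Re (C $ i $ l))" for l using real by (simp add: complex_eq_iff)
        then have "C $ i $ l * X $ l $ j = complex_of_real (Re (C $ i $ l * z $ l $ j))" for l
          using real by (simp add: X_def complex_eq_iff)
        then show ?thesis by (simp add: matrix_matrix_mult_def)
      qed
      then show ?thesis using real by (simp add: vec_eq_iff N_def complex_eq_iff)
    qed
    have "cmod (D $ i $ j) \<le> cmod (map_matrix (\<lambda>x. complex_of_real (Re x)) N $ i $ j) + cmod ((C ** X) $ i $ j)"
      by (subst ReN) (use norm_triangle_ineq4[of "map_matrix (\<lambda>x. complex_of_real (Re x)) N $ i $ j" "(C ** X) $ i $ j"] in simp)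
    moreover have "cmod (map_matrix (\<lambda>x. complex_of_real (Re x)) N $ i $ j) \<le> b"
      using Nb[of i j] abs_Re_le_cmod[of "N $ i $ j"] by simp
    moreover have "cmod ((C ** X) $ i $ j) \<le> k * (k * (b * bY) * bX)"
      unfolding k_def by (rule matrix_mult_bounded) (use Cb bX in \<open>auto simp: k_def\<close>)
    ultimately show ?thesis using Cb[of i j] by linarith
  qed
  have "{g \<in> Sp_int. sp_act g z \<in> ball z r} \<subseteq> {g. (\<forall>i j. g $ i $ j \<in> \<int>) \<and> (\<forall>i j. \<bar>g $ i $ j\<bar> \<le> max (max (k * (m * bY)) (m + k * (k * (m * bY) * bX)))
      (max (k * ((k * (w0 * m)) * bY)) (k * (w0 * m) + k * (k * (k * (w0 * m) * bY) * bX))))}"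
  proof
    fix g :: "'n rmat2" assume g: "g \<in> {g \<in> Sp_int. sp_act g z \<in> ball z r}"
    then have gI: "g \<in> Sp_int" and gR: "g \<in> Sp_real" and w: "sp_act g z \<in> ball z r" by (auto simp: Sp_int_def)
    define N where "N = sp_den g z"
    have wS: "sp_act g z \<in> siegel" by (rule sp_act_siegel[OF gR z])
    have Nb: "cmod (N $ i $ j) \<le> m" for i j
    proof -
      define e where "e = (axis j 1 :: complex^'n)"
      have Ne: "(N *v e) $ l = N $ l $ j" for l
        by (simp add: e_def matrix_vector_mult_def axis_def if_distrib cong: if_cong)
      have "Im (herm e (z *v e)) = Im (z $ j $ j)"
        by (simp add: herm_def e_def matrix_vector_mult_def axis_def if_distrib if_distribR cong: if_cong)
      also have "\<dots> \<le> bz" using bz[of j j] abs_Im_le_cmod[of "z $ j $ j"] by linarith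
      finally have "Im (herm (N *v e) (sp_act g z *v (N *v e))) \<le> bz"
        unfolding N_def herm_transform[OF gR z] .
      moreover have "Im (herm (N *v e) (sp_act g z *v (N *v e))) \<ge> c / 2 * (\<Sum>l\<in>UNIV. (cmod ((N *v e) $ l))\<^sup>2)"
        by (rule herm_diag_real[OF wS]) (use c low[OF w] in auto)
      moreover have "(\<Sum>l\<in>UNIV. (cmod ((N *v e) $ l))\<^sup>2) \<ge> (cmod (N $ i $ j))\<^sup>2"
        unfolding Ne by (rule member_le_sum) auto
      ultimately have "c / 2 * (cmod (N $ i $ j))\<^sup>2 \<le> bz"
        using c(1) by (meson mult_left_mono order_trans less_imp_le half_gt_zero)
      then have "(cmod (N $ i $ j))\<^sup>2 \<le> 2 / c * bz" using c(1) by (simp add: field_simps)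
      then show ?thesis unfolding m_def by (rule real_le_rsqrt)
    qed
    have Wb: "cmod (sp_act g z $ i $ j) \<le> w0" for i j
    proof -
      have "norm (sp_act g z) \<le> norm z + r"
        using w norm_triangle_ineq[of z "sp_act g z - z"] by (simp add: dist_norm norm_minus_commute)
      moreover have "cmod (sp_act g z $ i $ j) \<le> norm (sp_act g z)"
        using Finite_Cartesian_Product.norm_nth_le[of "sp_act g z $ i" j] Finite_Cartesian_Product.norm_nth_le[of "sp_act g z" i] by linarith
      ultimately show ?thesis by (simp add: w0_def)
    qed
    have Pb: "cmod (sp_num g z $ i $ j) \<le> k * (w0 * m)" for i j
      unfolding sp_act_den[OF gR z, symmetric] k_def by (rule matrix_mult_bounded[OF Wb]) (use Nb N_def in auto)
    note b1 = bound[of "blk_C g" "blk_D g" m] and b2 = bound[of "blk_A g" "blk_B g" "k * (w0 * m)"]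
    have "\<bar>g $ Inr i $ Inl j\<bar> \<le> k * (m * bY)" "\<bar>g $ Inr i $ Inr j\<bar> \<le> m + k * (k * (m * bY) * bX)"
      "\<bar>g $ Inl i $ Inl j\<bar> \<le> k * ((k * (w0 * m)) * bY)"
      "\<bar>g $ Inl i $ Inr j\<bar> \<le> k * (w0 * m) + k * (k * (k * (w0 * m) * bY) * bX)" for i j
      using b1[of i j] b2[of i j] Nb Pb
      by (simp_all add: N_def) (simp_all add: blk_A_def blk_B_def blk_C_def blk_D_def)
    then have "\<bar>g $ i $ j\<bar> \<le> max (max (k * (m * bY)) (m + k * (k * (m * bY) * bX)))
      (max (k * ((k * (w0 * m)) * bY)) (k * (w0 * m) + k * (k * (k * (w0 * m) * bY) * bX)))" for i j
      by (cases i; cases j) (simp_all add: le_max_iff_disj)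
    moreover have "\<forall>i j. g $ i $ j \<in> \<int>" using gI by (simp add: Sp_int_def)
    ultimately show "g \<in> {g. (\<forall>i j. g $ i $ j \<in> \<int>) \<and> (\<forall>i j. \<bar>g $ i $ j\<bar> \<le> max (max (k * (m * bY)) (m + k * (k * (m * bY) * bX)))
      (max (k * ((k * (w0 * m)) * bY)) (k * (w0 * m) + k * (k * (k * (w0 * m) * bY) * bX))))}" by blast
  qed
  then have "finite {g \<in> Sp_int. sp_act g z \<in> ball z r}"
    by (rule finite_subset[OF _ finite_bounded_integral_matrices])
  then show thesis using that[of "ball z r"] r by simp
qed

subsection \<open>Fixed points\<close>

text \<open>Commuting with E_ii kills the off-diagonal entries, and commuting with E_ij + E_ji
  identifies the diagonal ones.\<close>

lemma commutes_symmetric_scalar: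
  fixes M :: "'a::field^'n^'n"
  assumes "\<And>s. transpose s = s \<Longrightarrow> M ** s = s ** M"
  shows "\<exists>c. M = mat c"
proof -
  define E :: "'n \<Rightarrow> 'n \<Rightarrow> 'a^'n^'n" where "E i j = (\<chi> a b. if a = i \<and> b = j \<or> a = j \<and> b = i then 1 else 0)" for i j
  have sym: "transpose (E i j) = E i j" for i j by (auto simp: E_def transpose_def vec_eq_iff)
  have ME: "(M ** E i i) $ a $ b = (if b = i then M $ a $ i else 0)" for i a b
  proof -
    have "M $ a $ l * E i i $ l $ b = (if l = i then (if b = i then M $ a $ i else 0) else 0)" for l
      by (simp add: E_def)
    then show ?thesis by (simp add: matrix_matrix_mult_def)
  qed
  have EM: "(E i i ** M) $ a $ b = (if a = i then M $ i $ b else 0)" for i a b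
  proof -
    have "E i i $ a $ l * M $ l $ b = (if l = i then (if a = i then M $ i $ b else 0) else 0)" for l
      by (simp add: E_def)
    then show ?thesis by (simp add: matrix_matrix_mult_def)
  qed
  have off: "M $ a $ i = 0" if "a \<noteq> i" for a i
    using arg_cong[OF assms[OF sym[of i i]], of "\<lambda>M. M $ a $ i"] that by (simp add: ME EM)
  have diag: "M $ i $ i = M $ j $ j" if "i \<noteq> j" for i j
  proof -
    have "(M ** E i j) $ i $ j = M $ i $ i"
    proof -
      have "M $ i $ l * E i j $ l $ j = (if l = i then M $ i $ i else 0)" for l
        using that by (auto simp: E_def)
      then show ?thesis by (simp add: matrix_matrix_mult_def)
    qed
    moreover have "(E i j ** M) $ i $ j = M $ j $ j"
    proof -
      have "E i j $ i $ l * M $ l $ j = (if l = j then M $ j $ j else 0)" for l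
        using that by (auto simp: E_def)
      then show ?thesis by (simp add: matrix_matrix_mult_def)
    qed
    ultimately show ?thesis using assms[OF sym[of i j]] by simp
  qed
  have "M = mat (M $ undefined $ undefined)"
    unfolding vec_eq_iff mat_def using off diag by auto (metis diag)
  then show ?thesis by blast
qed

text \<open>The equation g z = z cleared of its denominator. It is quadratic in z, so along a line
  it is a polynomial of degree at most two.\<close>

definition sp_defect :: "'n::finite rmat2 \<Rightarrow> 'n cmat \<Rightarrow> 'n cmat" where
  "sp_defect g z = sp_num g z - z ** sp_den g z"

lemma sp_fixed_defect:
  assumes "g \<in> Sp_real" "z \<in> siegel" "sp_act g z = z"
  shows "sp_defect g z = 0"
  using sp_act_den[OF assms(1,2)] assms(3) by (simp add: sp_defect_def)

lemma sp_defect_line: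
  fixes g :: "'n::finite rmat2"
  shows "sp_defect g (z + mat t ** s) =
    sp_defect g z + mat t ** (blk_A g ** s - s ** blk_D g - z ** blk_C g ** s - s ** blk_C g ** z) - mat (t\<^sup>2) ** (s ** blk_C g ** s)"
proof -
  have m2: "mat t ** (mat t ** M) = mat (t\<^sup>2) ** M" for M :: "'n cmat"
    by (simp add: vec_eq_iff mat_mult_entry power2_eq_square)
  have c: "M ** (mat t ** K) = mat t ** (M ** K)" for M K :: "'n cmat"
    by (metis mat_commute matrix_mul_assoc)
  define T where "T = mat t ** s"
  have e: "blk_A g ** T = mat t ** (blk_A g ** s)" "T ** blk_D g = mat t ** (s ** blk_D g)"
    "z ** blk_C g ** T = mat t ** (z ** blk_C g ** s)" "T ** blk_C g ** z = mat t ** (s ** blk_C g ** z)"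
    "T ** blk_C g ** T = mat (t\<^sup>2) ** (s ** blk_C g ** s)"
  proof -
    show "blk_A g ** T = mat t ** (blk_A g ** s)" "z ** blk_C g ** T = mat t ** (z ** blk_C g ** s)"
      unfolding T_def by (rule c)+
    show "T ** blk_D g = mat t ** (s ** blk_D g)" "T ** blk_C g ** z = mat t ** (s ** blk_C g ** z)"
      unfolding T_def by (simp_all only: matrix_mul_assoc)
    have "T ** blk_C g ** T = mat t ** (T ** blk_C g ** s)" unfolding T_def by (rule c)
    also have "T ** blk_C g ** s = mat t ** (s ** blk_C g ** s)" unfolding T_def by (simp only: matrix_mul_assoc)
    finally show "T ** blk_C g ** T = mat (t\<^sup>2) ** (s ** blk_C g ** s)" by (simp only: m2)
  qed
  have "sp_defect g (z + T) = sp_defect g z + (blk_A g ** T - T ** blk_D g - z ** blk_C g ** T - T ** blk_C g ** z) - T ** blk_C g ** T"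
    unfolding sp_defect_def by (simp add: matrix_ring matrix_mul_assoc)
  then show ?thesis unfolding e by (simp only: matrix_ring T_def)
qed

text \<open>The hypothesis makes a coefficient of the quadratic polynomial in t nonzero: that of t^2
  is -s C s, and for C = 0 that of t is A s - s D.\<close>

lemma sp_defect_line_finite:
  fixes z :: "'n::finite cmat"
  assumes ne: "s ** blk_C g ** s \<noteq> 0 \<or> blk_C g = 0 \<and> blk_A g ** s \<noteq> s ** blk_D g"
  shows "finite {t :: real. sp_defect g (z + mat (complex_of_real t) ** s) = 0}"
proof -
  define a b c where "a = sp_defect g z" and "b = blk_A g ** s - s ** blk_D g - z ** blk_C g ** s - s ** blk_C g ** z"
    and "c = s ** blk_C g ** s"
  have nz: "c \<noteq> 0 \<or> b \<noteq> 0" using ne by (auto simp: b_def c_def)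
  then obtain i j where ij: "c $ i $ j \<noteq> 0 \<or> b $ i $ j \<noteq> 0"
    by (auto simp: vec_eq_iff)
  define p where "p = [:a $ i $ j, b $ i $ j, - c $ i $ j:]"
  have "p \<noteq> 0" using ij by (auto simp: p_def)
  then have "finite {x. poly p x = 0}" by (rule poly_roots_finite)
  then have "finite (complex_of_real -` {x. poly p x = 0})"
    by (rule finite_vimageI) (auto simp: inj_on_def)
  moreover have "{t. sp_defect g (z + mat (complex_of_real t) ** s) = 0} \<subseteq> complex_of_real -` {x. poly p x = 0}"
  proof
    fix t assume "t \<in> {t. sp_defect g (z + mat (complex_of_real t) ** s) = 0}"
    then have "(a + mat (of_real t) ** b - mat ((of_real t)\<^sup>2) ** c) $ i $ j = 0"
      by (simp add: sp_defect_line a_def b_def c_def)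
    then have "a $ i $ j + of_real t * b $ i $ j - (of_real t)\<^sup>2 * c $ i $ j = 0"
      by (simp add: mat_mult_entry)
    then show "t \<in> complex_of_real -` {x. poly p x = 0}"
      by (simp add: p_def algebra_simps power2_eq_square)
  qed
  ultimately show ?thesis using finite_subset by blast
qed

section \<open>Null sets and sigma-finiteness\<close>

lemma sigma_finite_sym_lborel: "sigma_finite_measure (sym_lborel :: 'n::{finite,linorder} cmat measure)"
proof -
  let ?I = "upper_pairs :: ('n \<times> 'n) set"
  let ?P = "PiM ?I (\<lambda>_. lborel :: complex measure)"
  have finI: "finite ?I" by (rule finite_subset[OF subset_UNIV]) simp
  interpret product_sigma_finite "\<lambda>_. lborel :: complex measure"
    by (simp add: product_sigma_finite_def lborel.sigma_finite_measure_axioms)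
  define A where "A k = {z :: 'n cmat. \<forall>i j. cmod (z $ i $ j) \<le> real k}" for k
  have Am: "A k \<in> sets borel" for k
  proof -
    have "closed {z :: 'n cmat. cmod (z $ i $ j) \<le> real k}" for i j
      by (intro closed_Collect_le continuous_intros)
    then have "closed (\<Inter>i. \<Inter>j. {z :: 'n cmat. cmod (z $ i $ j) \<le> real k})" by blast
    moreover have "A k = (\<Inter>i. \<Inter>j. {z :: 'n cmat. cmod (z $ i $ j) \<le> real k})" by (auto simp: A_def)
    ultimately show ?thesis by simp
  qed
  have "emeasure sym_lborel (A k) < \<infinity>" for k
  proof -
    have "emeasure sym_lborel (A k) = emeasure ?P (sym_mat -` A k \<inter> space ?P)"
      unfolding sym_lborel_def sym_mat_def[symmetric] by (rule emeasure_distr) (use Am in auto)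
    also have "\<dots> \<le> emeasure ?P (\<Pi>\<^sub>E p\<in>?I. cball 0 (real k))"
    proof (rule emeasure_mono)
      show "sym_mat -` A k \<inter> space ?P \<subseteq> (\<Pi>\<^sub>E p\<in>?I. cball 0 (real k))"
      proof
        fix a assume a: "a \<in> sym_mat -` A k \<inter> space ?P"
        have "cmod (a (r, s)) \<le> real k" if "r \<le> s" for r s
        proof -
          have "sym_mat a \<in> A k" using a by simp
          then have "cmod (sym_mat a $ r $ s) \<le> real k" unfolding A_def by blast
          then show ?thesis using that by (simp add: min_absorb1 max_absorb2)
        qed
        then show "a \<in> (\<Pi>\<^sub>E p\<in>?I. cball 0 (real k))"
          using a by (auto simp: space_PiM PiE_iff)
      qed
      show "(\<Pi>\<^sub>E p\<in>?I. cball 0 (real k)) \<in> sets ?P" by (rule sets_PiM_I_finite[OF finI]) auto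
    qed
    also have "\<dots> = (\<Prod>p\<in>?I. emeasure lborel (cball (0::complex) (real k)))"
      by (rule emeasure_PiM[OF finI]) auto
    also have "\<dots> < \<infinity>"
      using emeasure_lborel_cball_finite[of "0::complex" "real k"]
      by (simp add: ennreal_prod_eq_top less_top[symmetric] power_eq_top_ennreal)
    finally show ?thesis .
  qed
  moreover have "(\<Union>k. A k) = UNIV"
  proof -
    have "z \<in> (\<Union>k. A k)" for z
    proof -
      obtain b where "\<And>i j. cmod (z $ i $ j) \<le> b" using entry_bound by blast
      moreover obtain k where "b \<le> real k" using real_arch_simple by blast
      ultimately have "z \<in> A k" unfolding A_def using order_trans by blast
      then show ?thesis by blast
    qed
    then show ?thesis by blast
  qed
  ultimately show ?thesis
    using Am by (intro sigma_finite_measure.intro exI[of _ "range A"]) (auto simp: less_top[symmetric])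
qed

text \<open>
  A Borel set meeting every line in a fixed direction in finitely many points is null, by
  translation invariance and Fubini.
\<close>

lemma null_of_finite_lines:
  fixes E :: "'n::{finite,linorder} cmat set"
  assumes E: "E \<in> sets borel" and s: "transpose s = s"
    and fin: "\<And>z. finite {t :: real. z + mat (complex_of_real t) ** s \<in> E}"
  shows "emeasure sym_lborel E = 0"
proof -
  interpret S: sigma_finite_measure "sym_lborel :: 'n cmat measure" by (rule sigma_finite_sym_lborel)
  interpret P: pair_sigma_finite "lborel :: real measure" "sym_lborel :: 'n cmat measure"
    by (simp add: pair_sigma_finite_def lborel.sigma_finite_measure_axioms S.sigma_finite_measure_axioms)
  have m: "(\<lambda>p. snd p + mat (complex_of_real (fst p)) ** s) \<in> lborel \<Otimes>\<^sub>M sym_lborel \<rightarrow>\<^sub>M borel"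
    unfolding mat_def by measurable
  have m2: "(\<lambda>p. indicator E (snd p + mat (complex_of_real (fst p)) ** s) * indicator {0..1} (fst p) :: ennreal) \<in> borel_measurable (lborel \<Otimes>\<^sub>M (sym_lborel :: 'n cmat measure))"
    by (rule borel_measurable_times_ennreal[OF measurable_compose[OF m borel_measurable_indicator[OF E]]]) measurable
  have inv: "(\<integral>\<^sup>+z. indicator E (z + mat (complex_of_real t) ** s) \<partial>sym_lborel) = emeasure sym_lborel E" for t
  proof -
    have "transpose (mat (complex_of_real t) ** s) = mat (complex_of_real t) ** s"
      by (simp add: matrix_transpose_mul s mat_commute)
    then show ?thesis
      using E by (subst nn_integral_sym_translation[of "indicator E"]) auto
  qed
  \<comment> \<open>The measure of E is averaged over its translates by t s with t in [0, 1]; after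
    exchanging the integrals, the inner one is over a finite set of t.\<close>
  have "emeasure sym_lborel E = (\<integral>\<^sup>+t. emeasure (sym_lborel :: 'n cmat measure) E * indicator {0..1::real} t \<partial>lborel)"
    by (simp add: nn_integral_cmult_indicator)
  also have "\<dots> = (\<integral>\<^sup>+t. \<integral>\<^sup>+z. indicator E (z + mat (complex_of_real t) ** s) * indicator {0..1} t \<partial>sym_lborel \<partial>lborel)"
  proof (rule nn_integral_cong)
    fix t :: real
    show "emeasure (sym_lborel :: 'n cmat measure) E * indicator {0..1} t = (\<integral>\<^sup>+z. indicator E (z + mat (complex_of_real t) ** s) * indicator {0..1} t \<partial>sym_lborel)"
      using inv[of t] by (cases "t \<in> {0..1}") auto
  qed
  also have "\<dots> = (\<integral>\<^sup>+z. \<integral>\<^sup>+t. indicator E (z + mat (complex_of_real t) ** s) * indicator {0..1} t \<partial>lborel \<partial>sym_lborel)"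
    by (rule P.Fubini'[symmetric]) (use m2 in \<open>simp only: split_beta'\<close>)
  also have "\<dots> = (\<integral>\<^sup>+z. 0 \<partial>(sym_lborel :: 'n cmat measure))"
  proof (rule nn_integral_cong)
    fix z :: "'n cmat"
    have "AE t in lborel. t \<notin> {t :: real. z + mat (complex_of_real t) ** s \<in> E}"
      by (rule AE_not_in) (use finite_imp_null_set_lborel[OF fin] in blast)
    then have "AE t in lborel. (indicator E (z + mat (complex_of_real t) ** s) * indicator {0..1} t :: ennreal) = 0"
      by (rule AE_mp) (auto intro!: AE_I2)
    then show "(\<integral>\<^sup>+t. indicator E (z + mat (complex_of_real t) ** s) * indicator {0..1} t \<partial>lborel) = 0"
      by (subst nn_integral_cong_AE) auto
  qed
  finally show ?thesis by simp
qed

lemma siegel_null_sets: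
  fixes E :: "'n::{finite,linorder} cmat set"
  assumes "E \<in> sets borel" "emeasure sym_lborel E = 0"
  shows "AE z in siegel_measure. z \<notin> E"
proof -
  have m: "(\<lambda>z. indicator E z :: ennreal) \<in> borel_measurable siegel_measure"
    by (rule measurable_siegelI') (use assms in simp)
  have nE: "AE z in sym_lborel. z \<notin> E"
    by (rule AE_not_in) (use assms in \<open>auto simp: null_sets_def\<close>)
  have "(\<integral>\<^sup>+z. indicator E z \<partial>siegel_measure) = (\<integral>\<^sup>+z. indicator E z * siegel_dens z * indicator siegel z \<partial>sym_lborel)"
    by (rule nn_integral_siegel_measure[OF m])
  also have "\<dots> = (\<integral>\<^sup>+z. 0 \<partial>(sym_lborel :: 'n cmat measure))"
  proof (rule nn_integral_cong_AE)
    from nE show "AE z in sym_lborel. indicator E z * siegel_dens z * indicator siegel z = 0"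
      by eventually_elim simp
  qed
  finally have "(\<integral>\<^sup>+z. indicator E z \<partial>siegel_measure) = 0" by simp
  then have "AE z in siegel_measure. (indicator E z :: ennreal) = 0"
    using nn_integral_0_iff_AE[OF m] by simp
  then show ?thesis by (rule AE_mp) (auto intro!: AE_I2 simp: indicator_def split: if_splits)
qed

text \<open>If C is nonzero, lines in the direction of the identity meet the fixed locus in finitely
  many points. If C = 0 and no direction works, then A = D is a scalar of square 1, and a single
  fixed point forces B = 0, so g is plus or minus the identity.\<close>

lemma sp_fixed_null:
  fixes g :: "'n::{finite,linorder} rmat2"
  assumes g: "g \<in> Sp_int" and ne: "g \<noteq> mat 1" "g \<noteq> - mat 1"
  shows "AE z in siegel_measure. sp_act g z \<noteq> z"
proof -
  have gR: "g \<in> Sp_real" using g by (rule Sp_int_real)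
  define E where "E = {z :: 'n cmat. sp_defect g z = 0}"
  have Em: "E \<in> sets borel"
  proof -
    have "(\<lambda>z. sp_defect g z) \<in> borel_measurable borel" unfolding sp_defect_def by measurable
    from measurable_sets[OF this, of "{0}"] show ?thesis by (simp add: E_def vimage_def)
  qed
  \<comment> \<open>The second alternative is needed for translations (A = D = 1 or -1, C = 0, B
    nonzero), which move every point.\<close>
  have "\<exists>s. transpose s = s \<and> (s ** blk_C g ** s \<noteq> 0 \<or> blk_C g = 0 \<and> blk_A g ** s \<noteq> s ** blk_D g) \<or> E \<inter> siegel = {}"
  proof (cases "blk_C g = 0")
    case False
    then show ?thesis by (intro exI[of _ "mat 1"]) simp
  next
    case C: True
    show ?thesis
    proof (rule ccontr)
      assume "\<nexists>s. transpose s = s \<and> (s ** blk_C g ** s \<noteq> 0 \<or> blk_C g = 0 \<and> blk_A g ** s \<noteq> s ** blk_D g) \<or> E \<inter> siegel = {}"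
      then have comm: "\<And>s. transpose s = s \<Longrightarrow> blk_A g ** s = s ** blk_D g" and "E \<inter> siegel \<noteq> {}" using C by auto
      then obtain z where z: "z \<in> siegel" "sp_defect g z = 0" by (auto simp: E_def)
      have AD: "blk_A g = blk_D g" using comm[of "mat 1"] by simp
      then obtain c where c: "blk_A g = mat c" using commutes_symmetric_scalar[of "blk_A g"] comm by metis
      have B: "blk_B g = 0"
        using z(2) comm[OF siegel_sym[OF z(1)]] by (simp add: sp_defect_def C matrix_ring)
      have h: "mat c ** mat c = (mat 1 :: 'n cmat)"
        using Sp_real_blocks(2)[OF gR] by (simp add: C AD[symmetric] c)
      have "c * c = 1"
        using arg_cong[OF h, of "\<lambda>M. M $ undefined $ undefined"] unfolding mat_mult_entry by (simp add: mat_def)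
      then have "c = 1 \<or> c = - 1" using square_eq_1_iff by blast
      then show False
      proof
        assume "c = 1"
        then have "g = mat 1" by (intro blk_eqI) (simp_all add: blk_mat C B c AD[symmetric])
        then show False using ne by simp
      next
        assume "c = - 1"
        moreover have "- mat 1 = (mat (- 1) :: 'n rmat2)" by (simp add: vec_eq_iff mat_def)
        ultimately have "g = - mat 1" by (simp, intro blk_eqI) (simp_all add: blk_mat C B c AD[symmetric])
        then show False using ne by simp
      qed
    qed
  qed
  then obtain s where s: "transpose s = s \<and> (s ** blk_C g ** s \<noteq> 0 \<or> blk_C g = 0 \<and> blk_A g ** s \<noteq> s ** blk_D g) \<or> E \<inter> siegel = {}"
    by blast
  have "AE z in siegel_measure. z \<notin> E"
  proof (cases "E \<inter> siegel = {}")
    case True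
    then show ?thesis by (intro AE_I2) auto
  next
    case False
    then have s': "transpose s = s" "s ** blk_C g ** s \<noteq> 0 \<or> blk_C g = 0 \<and> blk_A g ** s \<noteq> s ** blk_D g" using s by auto
    have "emeasure sym_lborel E = 0"
      by (rule null_of_finite_lines[OF Em s'(1)]) (use sp_defect_line_finite[OF s'(2)] in \<open>simp add: E_def\<close>)
    then show ?thesis by (rule siegel_null_sets[OF Em])
  qed
  then show ?thesis
    by (rule AE_mp) (auto intro!: AE_I2 simp: E_def dest: sp_fixed_defect[OF gR])
qed

subsection \<open>Fundamental domains and the measure on the quotient\<close>

lemma sigma_finite_siegel_measure: "sigma_finite_measure (siegel_measure :: 'n::{finite,linorder} cmat measure)"
proof -
  interpret S: sigma_finite_measure "sym_lborel :: 'n cmat measure" by (rule sigma_finite_sym_lborel)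
  interpret R: sigma_finite_measure "restrict_space (sym_lborel :: 'n cmat measure) siegel"
    by (rule sigma_finite_measure_restrict_space[OF S.sigma_finite_measure_axioms]) simp
  have "siegel_dens \<in> borel_measurable (restrict_space (sym_lborel :: 'n cmat measure) siegel)"
    by (intro measurable_restrict_space1) measurable
  then show ?thesis
    unfolding siegel_measure_def siegel_dens_def[symmetric]
    by (subst R.sigma_finite_iff_density_finite) (auto simp: siegel_dens_def)
qed

lemma sp_act_minus_one: "sp_act (- mat 1) z = (z :: 'n::finite cmat)"
proof -
  have m: "- mat 1 = (mat (- 1) :: 'n rmat2)" by (simp add: vec_eq_iff mat_def)
  have m': "mat (- 1) = (- mat 1 :: 'n cmat)" by (simp add: vec_eq_iff mat_def)
  have "matrix_inv (- mat 1 :: 'n cmat) = - mat 1" by (rule matrix_inv_unique) (simp add: matrix_ring)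
  then show ?thesis unfolding m by (simp add: sp_act_def blk_mat m' matrix_ring)
qed

locale arith_group =
  fixes \<Gamma> :: "'n::{finite,linorder} rmat2 set"
  assumes sub: "\<Gamma> \<subseteq> Sp_int" and one: "mat 1 \<in> \<Gamma>"
    and mult: "\<And>g h. g \<in> \<Gamma> \<Longrightarrow> h \<in> \<Gamma> \<Longrightarrow> g ** h \<in> \<Gamma>" and inv: "\<And>g. g \<in> \<Gamma> \<Longrightarrow> matrix_inv g \<in> \<Gamma>"
begin

lemma real: "g \<in> \<Gamma> \<Longrightarrow> g \<in> Sp_real"
  using sub Sp_int_real by blast

lemma countable: "countable \<Gamma>"
  using countable_subset[OF sub countable_Sp_int] .

lemma inv_mult: "g \<in> \<Gamma> \<Longrightarrow> matrix_inv g ** g = mat 1" "g \<in> \<Gamma> \<Longrightarrow> g ** matrix_inv g = mat 1"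
  using matrix_inv_left matrix_inv_right Sp_real_det real by blast+

lemma act_mem: "g \<in> \<Gamma> \<Longrightarrow> z \<in> siegel \<Longrightarrow> sp_act g z \<in> siegel"
  using sp_act_siegel(2) real by blast

lemma act_mult: "g \<in> \<Gamma> \<Longrightarrow> h \<in> \<Gamma> \<Longrightarrow> z \<in> siegel \<Longrightarrow> sp_act (g ** h) z = sp_act g (sp_act h z)"
  using sp_act_mult real by blast

lemma act_inv: "g \<in> \<Gamma> \<Longrightarrow> z \<in> siegel \<Longrightarrow> sp_act (matrix_inv g) (sp_act g z) = z"
  "g \<in> \<Gamma> \<Longrightarrow> z \<in> siegel \<Longrightarrow> sp_act g (sp_act (matrix_inv g) z) = z"
  using act_mult[of "matrix_inv g" g z] act_mult[of g "matrix_inv g" z] inv inv_mult by auto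

lemma act_measurable: "g \<in> \<Gamma> \<Longrightarrow> sp_act g \<in> siegel_measure \<rightarrow>\<^sub>M siegel_measure"
  using sp_act_preserving[OF real] by (simp add: siegel_preserving_def)

abbreviation orbit :: "'n cmat \<Rightarrow> 'n cmat set" where
  "orbit \<equiv> siegel_orbit \<Gamma>"

lemma orbit_mem: "w \<in> orbit z \<longleftrightarrow> (\<exists>g\<in>\<Gamma>. w = sp_act g z)"
  by (auto simp: siegel_orbit_def)

lemma orbit_self: "z \<in> orbit z"
  unfolding orbit_mem using one by (intro bexI[of _ "mat 1"]) auto

lemma orbit_siegel: "z \<in> siegel \<Longrightarrow> orbit z \<subseteq> siegel"
  by (auto simp: orbit_mem act_mem)

lemma orbit_act:
  assumes g: "g \<in> \<Gamma>" and z: "z \<in> siegel"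
  shows "orbit (sp_act g z) = orbit z"
proof (intro equalityI subsetI)
  fix w assume "w \<in> orbit (sp_act g z)"
  then obtain h where "h \<in> \<Gamma>" "w = sp_act h (sp_act g z)" unfolding orbit_mem by blast
  then show "w \<in> orbit z" unfolding orbit_mem using act_mult[OF _ g z] mult g by metis
next
  fix w assume "w \<in> orbit z"
  then obtain h where h: "h \<in> \<Gamma>" "w = sp_act h z" unfolding orbit_mem by blast
  have "w = sp_act (h ** matrix_inv g) (sp_act g z)"
    using act_mult[OF h(1) inv[OF g] act_mem[OF g z]] act_inv(1)[OF g z] h(2) by simp
  then show "w \<in> orbit (sp_act g z)" unfolding orbit_mem using mult h(1) inv g by blast
qed

lemma orbit_eq: "w \<in> orbit z \<Longrightarrow> z \<in> siegel \<Longrightarrow> orbit w = orbit z"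
  using orbit_act by (auto simp: orbit_mem)

text \<open>By local finiteness only finitely many orbit points lie in a neighbourhood of z; the
  others are removed from it.\<close>

lemma orbit_isolated:
  assumes z: "z \<in> siegel"
  obtains V where "open V" "orbit z \<inter> V = {z}"
proof -
  obtain U where U: "open U" "z \<in> U" "finite {g \<in> Sp_int. sp_act g z \<in> U}"
    using Sp_int_locally_finite[OF z] .
  have "orbit z \<inter> U \<subseteq> (\<lambda>g. sp_act g z) ` {g \<in> Sp_int. sp_act g z \<in> U}"
    using sub unfolding siegel_orbit_def by blast
  then have fin: "finite (orbit z \<inter> U)" using U(3) finite_subset by blast
  define V where "V = U - (orbit z \<inter> U - {z})"
  have "open V" unfolding V_def using fin by (intro open_Diff U finite_imp_closed) auto
  moreover have "orbit z \<inter> V = {z}" using U(2) orbit_self by (auto simp: V_def)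
  ultimately show thesis using that by blast
qed

text \<open>From each orbit take the point that is isolated by the first basis set U n meeting the
  orbit exactly once. Whether U n does so depends only on the orbit, so the least n is common to all
  its points and the choice is unique.\<close>

lemma fundamental_domain:
  obtains F where "F \<in> sets siegel_measure" "\<And>z. z \<in> siegel \<Longrightarrow> \<exists>!w. w \<in> F \<and> w \<in> orbit z"
proof -
  obtain B :: "'n cmat set set" where B: "countable B" "topological_basis B"
    using ex_countable_basis by blast
  have ne: "B \<noteq> {}" using B(2) by (metis UNIV_I empty_iff open_UNIV topological_basisE)
  define U where "U = from_nat_into B"
  have Uopen: "open (U n)" for n
    using from_nat_into[OF ne] B(2) topological_basis_open by (auto simp: U_def)
  have ex: "\<exists>n. orbit z \<inter> U n = {z}" if z: "z \<in> siegel" for z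
  proof -
    obtain V where V: "open V" "orbit z \<inter> V = {z}" using orbit_isolated[OF z] .
    then obtain b where "b \<in> B" "z \<in> b" "b \<subseteq> V" using topological_basisE[OF B(2) V(1)] by blast
    then have "orbit z \<inter> b = {z}" using V(2) orbit_self by blast
    then show ?thesis using from_nat_into_surj[OF B(1) \<open>b \<in> B\<close>] by (auto simp: U_def)
  qed
  define S where "S n z \<longleftrightarrow> (\<exists>w. orbit z \<inter> U n = {w})" for n z
  define F where "F = {z \<in> siegel. \<exists>n. orbit z \<inter> U n = {z} \<and> (\<forall>m. m < n \<longrightarrow> \<not> S m z)}"
  have Sorb: "S n w \<longleftrightarrow> S n z" if "w \<in> orbit z" "z \<in> siegel" for n w z
    using orbit_eq[OF that] by (simp add: S_def)
  have uniq: "\<exists>!w. w \<in> F \<and> w \<in> orbit z" if z: "z \<in> siegel" for z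
  proof -
    have "\<exists>n. S n z" using ex[OF z] by (auto simp: S_def)
    define n where "n = (LEAST n. S n z)"
    have Sn: "S n z" unfolding n_def using \<open>\<exists>n. S n z\<close> by (rule LeastI_ex)
    have Sm: "\<not> S m z" if "m < n" for m using not_less_Least that unfolding n_def by blast
    from Sn obtain w where w: "orbit z \<inter> U n = {w}" by (auto simp: S_def)
    then have wo: "w \<in> orbit z" by blast
    have "w \<in> F"
      using wo w Sm orbit_siegel[OF z] orbit_eq[OF wo z] Sorb[OF wo z] by (auto simp: F_def)
    moreover have "v = w" if v: "v \<in> F" "v \<in> orbit z" for v
    proof -
      from v(1) obtain k where k: "orbit v \<inter> U k = {v}" "\<And>m. m < k \<Longrightarrow> \<not> S m v" by (auto simp: F_def)
      have "S k z" using k(1) orbit_eq[OF v(2) z] by (auto simp: S_def)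
      then have "n \<le> k" using Sm by (meson not_less)
      moreover have "k \<le> n" using k(2)[of n] Sn Sorb[OF v(2) z] by (meson not_less)
      ultimately have "k = n" by simp
      then show ?thesis using k(1) w orbit_eq[OF v(2) z] by auto
    qed
    ultimately show ?thesis using wo by blast
  qed
  let ?M = "siegel_measure :: 'n cmat measure"
  have mU: "{z \<in> space ?M. sp_act g z \<in> U n} \<in> sets ?M" for g n
  proof -
    have "sp_act g \<in> borel_measurable ?M" by (rule measurable_siegelI') measurable
    from measurable_sets[OF this borel_open[OF Uopen[of n]]] show ?thesis by (simp add: vimage_def Int_def conj_commute)
  qed
  have mE: "{z \<in> space ?M. sp_act g z = sp_act h z} \<in> sets ?M" for g h
  proof -
    have "(\<lambda>z. sp_act g z - sp_act h z) \<in> borel_measurable ?M" by (rule measurable_siegelI') measurable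
    from measurable_sets[OF this, of "{0}"] show ?thesis by (simp add: vimage_def Int_def conj_commute)
  qed
  \<comment> \<open>Rewritten with quantifiers over the countable group, the conditions defining
    \<open>F\<close> become countable combinations of measurable sets.\<close>
  have single: "orbit z \<inter> U n = {sp_act g z} \<longleftrightarrow> sp_act g z \<in> U n \<and> (\<forall>h\<in>\<Gamma>. sp_act h z \<in> U n \<longrightarrow> sp_act h z = sp_act g z)"
    if "g \<in> \<Gamma>" for g z n
    using that unfolding siegel_orbit_def by auto
  have mS1: "{z \<in> space ?M. orbit z \<inter> U n = {sp_act g z}} \<in> sets ?M" if "g \<in> \<Gamma>" for g n
    unfolding single[OF that]
    by (intro sets.sets_Collect_conj sets.sets_Collect_countable_All' sets.sets_Collect_imp mU mE countable)
  have S: "S n z \<longleftrightarrow> (\<exists>g\<in>\<Gamma>. orbit z \<inter> U n = {sp_act g z})" for n z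
    unfolding S_def by (metis Int_iff insertI1 orbit_mem)
  have mS: "{z \<in> space ?M. S n z} \<in> sets ?M" for n
    unfolding S by (intro sets.sets_Collect_countable_Ex' mS1 countable)
  have "F = {z \<in> space ?M. \<exists>n. orbit z \<inter> U n = {sp_act (mat 1) z} \<and> (\<forall>m\<in>{..<n}. \<not> S m z)}"
    by (auto simp: F_def)
  also have "\<dots> \<in> sets ?M"
    by (intro sets.sets_Collect_countable_Ex sets.sets_Collect_conj mS1 one sets.sets_Collect_countable_Ball sets.sets_Collect_neg mS)
  finally show thesis using that uniq by blast
qed

section \<open>Generic stabilizers and unfolding of nonnegative integrals\<close>

definition stab_order :: nat where
  "stab_order = card (\<Gamma> \<inter> {mat 1, - mat 1})"

lemma stab_order_pos: "stab_order > 0"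
  unfolding stab_order_def using one by (subst card_gt_0_iff) auto

definition generic :: "'n cmat \<Rightarrow> bool" where
  "generic z \<longleftrightarrow> (\<forall>g\<in>\<Gamma>. sp_act g z = z \<longrightarrow> g = mat 1 \<or> g = - mat 1)"

lemma AE_generic: "AE z in siegel_measure. generic z"
proof -
  have "AE z in siegel_measure. \<forall>g\<in>\<Gamma> - {mat 1, - mat 1}. sp_act g z \<noteq> z"
    by (rule AE_ball_countable[THEN iffD2]) (use countable sp_fixed_null sub in auto)
  then show ?thesis by eventually_elim (auto simp: generic_def)
qed

text \<open>The elements carrying z to the same point as g form the coset of g modulo the
  stabilizer, which for generic z is \<Gamma> intersected with {1, -1}.\<close>

lemma stabilizer_coset:
  assumes z: "z \<in> siegel" "generic z" and g: "g \<in> \<Gamma>"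
  shows "finite {h \<in> \<Gamma>. sp_act h z = sp_act g z}" "card {h \<in> \<Gamma>. sp_act h z = sp_act g z} = stab_order"
proof -
  let ?E = "\<Gamma> \<inter> {mat 1, - mat 1}"
  have eq: "{h \<in> \<Gamma>. sp_act h z = sp_act g z} = (\<lambda>e. g ** e) ` ?E"
  proof (intro equalityI subsetI)
    fix h assume "h \<in> {h \<in> \<Gamma>. sp_act h z = sp_act g z}"
    then have h: "h \<in> \<Gamma>" "sp_act h z = sp_act g z" by auto
    have "sp_act (matrix_inv g ** h) z = z"
      using act_mult[OF inv[OF g] h(1) z(1)] h(2) act_inv(1)[OF g z(1)] by simp
    then have "matrix_inv g ** h \<in> ?E"
      using z(2) mult[OF inv[OF g] h(1)] by (auto simp: generic_def)
    moreover have "h = g ** (matrix_inv g ** h)" by (simp add: matrix_mul_assoc inv_mult[OF g])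
    ultimately show "h \<in> (\<lambda>e. g ** e) ` ?E" by blast
  next
    fix h assume "h \<in> (\<lambda>e. g ** e) ` ?E"
    then obtain e where e: "e \<in> ?E" "h = g ** e" by blast
    have "sp_act e z = z" using e(1) by (auto simp: sp_act_minus_one)
    then show "h \<in> {h \<in> \<Gamma>. sp_act h z = sp_act g z}"
      using e act_mult[OF g _ z(1)] mult[OF g] by auto
  qed
  have "inj_on (\<lambda>e. g ** e) ?E"
    by (rule inj_onI) (use matrix_cancel_left[OF Sp_real_det[OF real[OF g]]] in blast)
  then show "finite {h \<in> \<Gamma>. sp_act h z = sp_act g z}" "card {h \<in> \<Gamma>. sp_act h z = sp_act g z} = stab_order"
    unfolding eq stab_order_def by (auto simp: card_image)
qed

lemma nn_integral_count_indicator: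
  assumes "finite {g \<in> \<Gamma>. P g}"
  shows "(\<integral>\<^sup>+g. of_bool (P g) \<partial>count_space \<Gamma>) = of_nat (card {g \<in> \<Gamma>. P g})"
proof -
  have "(\<integral>\<^sup>+g. of_bool (P g) \<partial>count_space \<Gamma>) = (\<integral>\<^sup>+g. indicator {g \<in> \<Gamma>. P g} g \<partial>count_space \<Gamma>)"
    by (rule nn_integral_cong) (auto simp: indicator_def)
  also have "\<dots> = emeasure (count_space \<Gamma>) {g \<in> \<Gamma>. P g}" by (rule nn_integral_indicator) auto
  also have "\<dots> = of_nat (card {g \<in> \<Gamma>. P g})" using assms by (intro emeasure_count_space_finite) auto
  finally show ?thesis .
qed

context
  fixes F assumes F: "F \<in> sets siegel_measure" and Funiq: "\<And>z. z \<in> siegel \<Longrightarrow> \<exists>!w. w \<in> F \<and> w \<in> orbit z"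
begin

lemma F_siegel: "F \<subseteq> siegel"
  using sets.sets_into_space[OF F] by simp

text \<open>Only one orbit point w lies in \<open>F\<close>. Inversion maps the g with g^(-1) z = w
  bijectively to the elements carrying z to w, a coset of the generic stabilizer.\<close>

lemma count_F:
  assumes z: "z \<in> siegel" "generic z"
  shows "(\<integral>\<^sup>+g. indicator F (sp_act (matrix_inv g) z) \<partial>count_space \<Gamma>) = of_nat stab_order"
proof -
  obtain w where w: "w \<in> F" "w \<in> orbit z" "\<And>v. v \<in> F \<Longrightarrow> v \<in> orbit z \<Longrightarrow> v = w" using Funiq[OF z(1)] by blast
  obtain s where s: "s \<in> \<Gamma>" "w = sp_act s z" using w(2) by (auto simp: orbit_mem)
  have mem: "sp_act (matrix_inv g) z \<in> F \<longleftrightarrow> sp_act (matrix_inv g) z = sp_act s z" if "g \<in> \<Gamma>" for g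
    using w(1) w(3)[of "sp_act (matrix_inv g) z"] inv[OF that] s by (auto simp: orbit_mem)
  have invinv: "matrix_inv (matrix_inv g) = g" if "g \<in> \<Gamma>" for g
    by (rule matrix_inv_unique) (rule inv_mult(1)[OF that])
  let ?A = "{g \<in> \<Gamma>. sp_act (matrix_inv g) z \<in> F}" and ?B = "{h \<in> \<Gamma>. sp_act h z = sp_act s z}"
  have bij: "bij_betw matrix_inv ?A ?B"
    by (rule bij_betw_byWitness[of _ matrix_inv]) (use mem invinv inv w(1) s(2) in auto)
  have fin: "finite ?A" using bij_betw_finite[OF bij] stabilizer_coset(1)[OF z s(1)] by simp
  have "(\<integral>\<^sup>+g. indicator F (sp_act (matrix_inv g) z) \<partial>count_space \<Gamma>) = (\<integral>\<^sup>+g. of_bool (sp_act (matrix_inv g) z \<in> F) \<partial>count_space \<Gamma>)"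
    by (rule nn_integral_cong) (auto simp: indicator_def)
  also have "\<dots> = of_nat (card ?A)" by (rule nn_integral_count_indicator[OF fin])
  also have "card ?A = stab_order" using bij_betw_same_card[OF bij] stabilizer_coset(2)[OF z s(1)] by simp
  finally show ?thesis .
qed

text \<open>By invariance, the integral over \<open>F\<close> of the translate by h equals the
  integral over h F. The sets h F cover almost every point exactly \<open>stab_order\<close> times,
  counted over h in \<Gamma>.\<close>

lemma nn_integral_unfold:
  assumes g: "g \<in> borel_measurable siegel_measure"
  shows "(\<integral>\<^sup>+z. (\<integral>\<^sup>+h. g (sp_act h z) \<partial>count_space \<Gamma>) * indicator F z \<partial>siegel_measure) =
    of_nat stab_order * (\<integral>\<^sup>+z. g z \<partial>siegel_measure)"
proof -
  have Fi: "(indicator F :: _ \<Rightarrow> ennreal) \<in> borel_measurable siegel_measure" using F by simp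
  have gm: "(\<lambda>z. g (sp_act h z)) \<in> borel_measurable siegel_measure" if "h \<in> \<Gamma>" for h
    using measurable_compose[OF act_measurable[OF that] g] .
  have Fm: "(\<lambda>z. indicator F (sp_act (matrix_inv h) z) :: ennreal) \<in> borel_measurable siegel_measure" if "h \<in> \<Gamma>" for h
    using measurable_compose[OF act_measurable[OF inv[OF that]] Fi] .
  have "(\<integral>\<^sup>+z. (\<integral>\<^sup>+h. g (sp_act h z) \<partial>count_space \<Gamma>) * indicator F z \<partial>siegel_measure) =
    (\<integral>\<^sup>+z. \<integral>\<^sup>+h. g (sp_act h z) * indicator F z \<partial>count_space \<Gamma> \<partial>siegel_measure)"
    by (intro nn_integral_cong nn_integral_multc[symmetric]) simp
  also have "\<dots> = (\<integral>\<^sup>+h. \<integral>\<^sup>+z. g (sp_act h z) * indicator F z \<partial>siegel_measure \<partial>count_space \<Gamma>)"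
    by (rule nn_integral_count_space_nn_integral[OF countable]) (intro borel_measurable_times_ennreal gm Fi)
  also have "\<dots> = (\<integral>\<^sup>+h. \<integral>\<^sup>+z. g z * indicator F (sp_act (matrix_inv h) z) \<partial>siegel_measure \<partial>count_space \<Gamma>)"
  proof (rule nn_integral_cong)
    fix h assume "h \<in> space (count_space \<Gamma>)"
    then have h: "h \<in> \<Gamma>" by simp
    have "(\<integral>\<^sup>+z. g (sp_act h z) * indicator F z \<partial>siegel_measure) =
      (\<integral>\<^sup>+z. g (sp_act h z) * indicator F (sp_act (matrix_inv h) (sp_act h z)) \<partial>siegel_measure)"
      by (rule nn_integral_cong) (simp add: act_inv[OF h])
    also have "\<dots> = (\<integral>\<^sup>+z. g z * indicator F (sp_act (matrix_inv h) z) \<partial>distr siegel_measure siegel_measure (sp_act h))"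
      by (rule nn_integral_distr[symmetric, OF act_measurable[OF h]]) (use g Fm[OF h] in simp)
    also have "distr siegel_measure siegel_measure (sp_act h) = siegel_measure"
      using sp_act_preserving[OF real[OF h]] by (simp add: siegel_preserving_def)
    finally show "(\<integral>\<^sup>+z. g (sp_act h z) * indicator F z \<partial>siegel_measure) = (\<integral>\<^sup>+z. g z * indicator F (sp_act (matrix_inv h) z) \<partial>siegel_measure)" .
  qed
  also have "\<dots> = (\<integral>\<^sup>+z. \<integral>\<^sup>+h. g z * indicator F (sp_act (matrix_inv h) z) \<partial>count_space \<Gamma> \<partial>siegel_measure)"
    by (rule nn_integral_count_space_nn_integral[OF countable, symmetric]) (use g Fm in auto)
  also have "\<dots> = (\<integral>\<^sup>+z. of_nat stab_order * g z \<partial>siegel_measure)"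
  proof (rule nn_integral_cong_AE)
    show "AE z in siegel_measure. (\<integral>\<^sup>+h. g z * indicator F (sp_act (matrix_inv h) z) \<partial>count_space \<Gamma>) = of_nat stab_order * g z"
      using AE_generic AE_space
    proof eventually_elim
      case (elim z)
      then show ?case using count_F[of z] by (simp add: nn_integral_cmult mult.commute)
    qed
  qed
  also have "\<dots> = of_nat stab_order * (\<integral>\<^sup>+z. g z \<partial>siegel_measure)"
    by (rule nn_integral_cmult[OF g])
  finally show ?thesis .
qed

section \<open>The measure on the orbit space\<close>

abbreviation quot_sets :: "'n cmat set set set" where
  "quot_sets \<equiv> {E. E \<subseteq> siegel_quotient \<Gamma> \<and> \<Union>E \<in> sets siegel_measure}"

abbreviation quot_fun :: "'n cmat set set \<Rightarrow> ennreal" where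
  "quot_fun \<equiv> \<lambda>E. SUP A \<in> {A \<in> sets siegel_measure. A \<subseteq> \<Union>E \<and> inj_on orbit A}. emeasure siegel_measure A"

lemma quot_mem: "E \<subseteq> siegel_quotient \<Gamma> \<Longrightarrow> z \<in> siegel \<Longrightarrow> z \<in> \<Union>E \<longleftrightarrow> orbit z \<in> E"
proof
  assume E: "E \<subseteq> siegel_quotient \<Gamma>" and z: "z \<in> siegel" and "z \<in> \<Union>E"
  then obtain y where "y \<in> siegel" "orbit y \<in> E" "z \<in> orbit y" by (auto simp: siegel_quotient_def)
  then show "orbit z \<in> E" using orbit_eq by metis
qed (use orbit_self in auto)

lemma quot_Union: "E \<subseteq> siegel_quotient \<Gamma> \<Longrightarrow> \<Union>E \<subseteq> siegel"
  using orbit_siegel by (fastforce simp: siegel_quotient_def)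

text \<open>The supremum defining the quotient measure is attained at the part of \<open>F\<close>
  over E. To bound a competing set A, its measure is unfolded to an integral over
  \<open>F\<close>.\<close>

lemma quot_fun_eq:
  assumes E: "E \<in> quot_sets"
  shows "quot_fun E = emeasure siegel_measure (F \<inter> \<Union>E)"
proof (rule antisym)
  have EQ: "E \<subseteq> siegel_quotient \<Gamma>" and Em: "\<Union>E \<in> sets siegel_measure" using E by auto
  have "inj_on orbit (F \<inter> \<Union>E)"
  proof (rule inj_onI)
    fix z w assume "z \<in> F \<inter> \<Union>E" "w \<in> F \<inter> \<Union>E" "orbit z = orbit w"
    then show "z = w" using Funiq[of z] F_siegel orbit_self[of z] orbit_self[of w] by auto
  qed
  then show "emeasure siegel_measure (F \<inter> \<Union>E) \<le> quot_fun E"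
    using F Em by (intro SUP_upper) auto
  show "quot_fun E \<le> emeasure siegel_measure (F \<inter> \<Union>E)"
  proof (rule SUP_least)
    fix A assume "A \<in> {A \<in> sets siegel_measure. A \<subseteq> \<Union>E \<and> inj_on orbit A}"
    then have A: "A \<in> sets siegel_measure" "A \<subseteq> \<Union>E" "inj_on orbit A" by auto
    have "of_nat stab_order * emeasure siegel_measure A = of_nat stab_order * (\<integral>\<^sup>+z. indicator A z \<partial>siegel_measure)"
      using A(1) by simp
    also have "\<dots> = (\<integral>\<^sup>+z. (\<integral>\<^sup>+h. indicator A (sp_act h z) \<partial>count_space \<Gamma>) * indicator F z \<partial>siegel_measure)"
      by (rule nn_integral_unfold[symmetric]) (use A in simp)
    also have "\<dots> \<le> (\<integral>\<^sup>+z. of_nat stab_order * indicator (F \<inter> \<Union>E) z \<partial>siegel_measure)"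
    proof (rule nn_integral_mono_AE)
      show "AE z in siegel_measure. (\<integral>\<^sup>+h. indicator A (sp_act h z) \<partial>count_space \<Gamma>) * indicator F z \<le> of_nat stab_order * indicator (F \<inter> \<Union>E) z"
        using AE_generic AE_space
      proof eventually_elim
        case (elim z)
        then have z: "z \<in> siegel" "generic z" by auto
        \<comment> \<open>A contains at most one point of the orbit of z, so the h with h z in A
          fill at most one coset of the generic stabilizer.\<close>
        have "(\<integral>\<^sup>+h. indicator A (sp_act h z) \<partial>count_space \<Gamma>) \<le> of_nat stab_order * indicator (\<Union>E) z"
        proof (cases "\<exists>h\<in>\<Gamma>. sp_act h z \<in> A")
          case False
          then have "(\<integral>\<^sup>+h. indicator A (sp_act h z) \<partial>count_space \<Gamma>) = (\<integral>\<^sup>+h. 0 \<partial>count_space \<Gamma>)"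
            by (intro nn_integral_cong) auto
          then show ?thesis by simp
        next
          case True
          then obtain s where s: "s \<in> \<Gamma>" "sp_act s z \<in> A" by blast
          have "sp_act s z \<in> \<Union>E" using s A(2) by blast
          then have zE: "z \<in> \<Union>E"
            using quot_mem[OF EQ] z(1) act_mem[OF s(1) z(1)] orbit_act[OF s(1) z(1)] by metis
          have "sp_act h z = sp_act s z" if "h \<in> \<Gamma>" "sp_act h z \<in> A" for h
            using inj_onD[OF A(3) _ that(2) s(2)] orbit_act[OF that(1) z(1)] orbit_act[OF s(1) z(1)] by simp
          then have "(\<integral>\<^sup>+h. indicator A (sp_act h z) \<partial>count_space \<Gamma>) \<le> (\<integral>\<^sup>+h. of_bool (sp_act h z = sp_act s z) \<partial>count_space \<Gamma>)"
            by (intro nn_integral_mono) (auto simp: indicator_def)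
          also have "\<dots> = of_nat stab_order"
            using nn_integral_count_indicator[OF stabilizer_coset(1)[OF z s(1)]] stabilizer_coset(2)[OF z s(1)] by simp
          finally show ?thesis using zE by simp
        qed
        then show ?case by (cases "z \<in> F"; cases "z \<in> \<Union>E") (simp_all add: indicator_def)
      qed
    qed
    also have "\<dots> = of_nat stab_order * emeasure siegel_measure (F \<inter> \<Union>E)"
      using F Em by (simp add: nn_integral_cmult)
    finally show "emeasure siegel_measure A \<le> emeasure siegel_measure (F \<inter> \<Union>E)"
      using stab_order_pos by (subst (asm) ennreal_mult_le_mult_iff) (auto simp: of_nat_eq_0_iff)
  qed
qed

lemma quot_sigma_algebra: "sigma_algebra (siegel_quotient \<Gamma>) quot_sets"
proof (rule sigma_algebra_iff2[THEN iffD2], intro conjI ballI allI impI)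
  show "quot_sets \<subseteq> Pow (siegel_quotient \<Gamma>)" by auto
  show "{} \<in> quot_sets" by simp
next
  fix E assume E: "E \<in> quot_sets"
  then have EQ: "E \<subseteq> siegel_quotient \<Gamma>" by simp
  have "\<Union>(siegel_quotient \<Gamma> - E) = siegel - \<Union>E"
  proof (intro equalityI subsetI)
    fix z assume z: "z \<in> \<Union>(siegel_quotient \<Gamma> - E)"
    then have zs: "z \<in> siegel" using quot_Union[of "siegel_quotient \<Gamma> - E"] by blast
    then have "orbit z \<in> siegel_quotient \<Gamma> - E" using quot_mem[of "siegel_quotient \<Gamma> - E" z] z by blast
    then show "z \<in> siegel - \<Union>E" using quot_mem[OF EQ zs] zs by blast
  next
    fix z assume z: "z \<in> siegel - \<Union>E"
    then have "orbit z \<in> siegel_quotient \<Gamma> - E" using quot_mem[OF EQ, of z] by (auto simp: siegel_quotient_def)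
    then show "z \<in> \<Union>(siegel_quotient \<Gamma> - E)" using orbit_self by blast
  qed
  moreover have "siegel - \<Union>E \<in> sets siegel_measure" using E sets.compl_sets[of "\<Union>E" siegel_measure] by simp
  ultimately show "siegel_quotient \<Gamma> - E \<in> quot_sets" by simp
next
  fix A :: "nat \<Rightarrow> _" assume A: "range A \<subseteq> quot_sets"
  have "\<Union>(\<Union>i. A i) = (\<Union>i. \<Union>(A i))" by blast
  moreover have "(\<Union>i. \<Union>(A i)) \<in> sets siegel_measure" using A by (intro sets.countable_UN) auto
  ultimately show "(\<Union>i. A i) \<in> quot_sets" using A by auto
qed

lemma sets_quotient: "sets (siegel_quotient_measure \<Gamma>) = quot_sets"
  unfolding siegel_quotient_measure_def by (rule sigma_algebra.sets_measure_of_eq[OF quot_sigma_algebra])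

lemma space_quotient: "space (siegel_quotient_measure \<Gamma>) = siegel_quotient \<Gamma>"
  unfolding siegel_quotient_measure_def by (rule sigma_algebra.space_measure_of_eq[OF quot_sigma_algebra])

lemma emeasure_quotient:
  assumes E: "E \<in> quot_sets"
  shows "emeasure (siegel_quotient_measure \<Gamma>) E = emeasure siegel_measure (F \<inter> \<Union>E)"
proof -
  have "emeasure (siegel_quotient_measure \<Gamma>) E = quot_fun E"
    unfolding siegel_quotient_measure_def
  proof (rule emeasure_measure_of_sigma[OF quot_sigma_algebra _ _ E])
    show "positive quot_sets quot_fun"
      unfolding positive_def using quot_fun_eq[of "{}"] by simp
    show "countably_additive quot_sets quot_fun"
    proof (rule countably_additiveI)
      fix A :: "nat \<Rightarrow> _" assume A: "range A \<subseteq> quot_sets" "disjoint_family A" "(\<Union>i. A i) \<in> quot_sets"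
      have Ai: "A i \<in> quot_sets" for i using A(1) by blast
      have disj: "disjoint_family (\<lambda>i. F \<inter> \<Union>(A i))"
        unfolding disjoint_family_on_def
      proof (intro ballI impI)
        fix i j :: nat assume "i \<noteq> j"
        then have "A i \<inter> A j = {}" using A(2) by (auto simp: disjoint_family_on_def)
        then show "F \<inter> \<Union>(A i) \<inter> (F \<inter> \<Union>(A j)) = {}"
          using quot_mem[of "A i"] quot_mem[of "A j"] Ai F_siegel by blast
      qed
      have "(\<Sum>i. quot_fun (A i)) = (\<Sum>i. emeasure siegel_measure (F \<inter> \<Union>(A i)))"
        using quot_fun_eq[OF Ai] by simp
      also have "\<dots> = emeasure siegel_measure (\<Union>i. F \<inter> \<Union>(A i))"
        by (rule suminf_emeasure[OF _ disj]) (use Ai F in auto)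
      also have "(\<Union>i. F \<inter> \<Union>(A i)) = F \<inter> \<Union>(\<Union>i. A i)" by blast
      finally show "(\<Sum>i. quot_fun (A i)) = quot_fun (\<Union>i. A i)" using quot_fun_eq[OF A(3)] by simp
    qed
  qed
  then show ?thesis using quot_fun_eq[OF E] by simp
qed

text \<open>The quotient measure is the image of the measure on \<open>F\<close>, so that Bochner
  integrals over the orbit space can be computed on \<open>F\<close>.\<close>

lemma orbit_measurable: "orbit \<in> restrict_space siegel_measure F \<rightarrow>\<^sub>M siegel_quotient_measure \<Gamma>"
  and quotient_distr: "distr (restrict_space siegel_measure F) (siegel_quotient_measure \<Gamma>) orbit = siegel_quotient_measure \<Gamma>"
proof -
  have sp: "space (restrict_space siegel_measure F) = F"
    using F_siegel by (auto simp: space_restrict_space)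
  have pre: "orbit -` E \<inter> F = F \<inter> \<Union>E" if "E \<in> quot_sets" for E
  proof (rule set_eqI)
    fix z show "z \<in> orbit -` E \<inter> F \<longleftrightarrow> z \<in> F \<inter> \<Union>E"
      using quot_mem[of E z] that F_siegel by auto
  qed
  have m: "F \<inter> \<Union>E \<in> sets (restrict_space siegel_measure F)" if "E \<in> quot_sets" for E
    using that F F_siegel by (auto simp: sets_restrict_space_iff Int_absorb2)
  show o: "orbit \<in> restrict_space siegel_measure F \<rightarrow>\<^sub>M siegel_quotient_measure \<Gamma>"
  proof (rule measurableI)
    fix z assume "z \<in> space (restrict_space siegel_measure F)"
    then show "orbit z \<in> space (siegel_quotient_measure \<Gamma>)"
      using F_siegel by (auto simp: sp space_quotient siegel_quotient_def)
  next
    fix E assume "E \<in> sets (siegel_quotient_measure \<Gamma>)"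
    then have "E \<in> quot_sets" unfolding sets_quotient .
    then show "orbit -` E \<inter> space (restrict_space siegel_measure F) \<in> sets (restrict_space siegel_measure F)"
      unfolding sp using pre m by simp
  qed
  show "distr (restrict_space siegel_measure F) (siegel_quotient_measure \<Gamma>) orbit = siegel_quotient_measure \<Gamma>"
  proof (rule measure_eqI)
    fix E assume "E \<in> sets (distr (restrict_space siegel_measure F) (siegel_quotient_measure \<Gamma>) orbit)"
    then have E: "E \<in> sets (siegel_quotient_measure \<Gamma>)" and E': "E \<in> quot_sets" using sets_quotient by auto
    show "emeasure (distr (restrict_space siegel_measure F) (siegel_quotient_measure \<Gamma>) orbit) E = emeasure (siegel_quotient_measure \<Gamma>) E"
      unfolding emeasure_distr[OF o E] sp pre[OF E'] emeasure_quotient[OF E']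
      by (rule emeasure_restrict_space) (use F F_siegel in \<open>auto simp: Int_absorb2\<close>)
  qed simp
qed

lemma integral_quotient:
  fixes \<psi> :: "'n cmat \<Rightarrow> complex"
  assumes m: "\<psi> \<in> borel_measurable siegel_measure"
    and inva: "\<And>g z. g \<in> \<Gamma> \<Longrightarrow> z \<in> siegel \<Longrightarrow> \<psi> (sp_act g z) = \<psi> z"
  shows "(\<integral>orb. \<psi> (SOME z. z \<in> orb) \<partial>siegel_quotient_measure \<Gamma>) = (\<integral>z. \<psi> z \<partial>restrict_space siegel_measure F)"
proof -
  define \<Psi> where "\<Psi> orb = \<psi> (SOME z. z \<in> orb)" for orb
  \<comment> \<open>The chosen representative lies in the orbit, and by invariance of \<psi> the
    choice does not matter.\<close>
  have val: "\<Psi> (orbit z) = \<psi> z" if z: "z \<in> siegel" for z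
  proof -
    have "(SOME w. w \<in> orbit z) \<in> orbit z" by (rule someI[of _ z]) (rule orbit_self)
    then show ?thesis using inva z by (auto simp: \<Psi>_def orbit_mem)
  qed
  have "\<Psi> \<in> borel_measurable (siegel_quotient_measure \<Gamma>)"
  proof (rule measurableI)
    fix B :: "complex set" assume B: "B \<in> sets borel"
    define E where "E = \<Psi> -` B \<inter> siegel_quotient \<Gamma>"
    have EQ: "E \<subseteq> siegel_quotient \<Gamma>" by (simp add: E_def)
    have "\<Union>E = \<psi> -` B \<inter> siegel"
    proof (rule set_eqI)
      fix z show "z \<in> \<Union>E \<longleftrightarrow> z \<in> \<psi> -` B \<inter> siegel"
        using quot_mem[OF EQ, of z] quot_Union[OF EQ] val[of z] by (auto simp: E_def siegel_quotient_def)
    qed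
    then have "E \<in> quot_sets" using EQ measurable_sets[OF m B] by simp
    then show "\<Psi> -` B \<inter> space (siegel_quotient_measure \<Gamma>) \<in> sets (siegel_quotient_measure \<Gamma>)"
      by (simp add: space_quotient sets_quotient E_def)
  qed simp
  then have "(\<integral>orb. \<Psi> orb \<partial>distr (restrict_space siegel_measure F) (siegel_quotient_measure \<Gamma>) orbit) = (\<integral>z. \<Psi> (orbit z) \<partial>restrict_space siegel_measure F)"
    by (rule integral_distr[OF orbit_measurable])
  also have "\<dots> = (\<integral>z. \<psi> z \<partial>restrict_space siegel_measure F)"
    by (rule Bochner_Integration.integral_cong) (use val in \<open>auto simp: space_restrict_space\<close>)
  finally show ?thesis unfolding quotient_distr by (simp add: \<Psi>_def)
qed

text \<open>The map (g, z) -> g z sends the product of counting measure on \<Gamma> and the measure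
  on \<open>F\<close> to \<open>stab_order\<close> times \<open>siegel_measure\<close>. This one
  identity, proved by the nonnegative unfolding, gives integrability on the product and, with
  Fubini, the signed version.\<close>

lemma integral_unfold:
  fixes k :: "'n cmat \<Rightarrow> complex"
  assumes k: "integrable siegel_measure k"
  shows "(\<integral>z. (\<integral>g. k (sp_act g z) \<partial>count_space \<Gamma>) \<partial>restrict_space siegel_measure F) =
    of_nat stab_order * (\<integral>z. k z \<partial>siegel_measure)"
proof -
  let ?R = "restrict_space siegel_measure F"
  let ?C = "count_space \<Gamma>"
  interpret C: sigma_finite_measure ?C by (rule sigma_finite_measure_count_space_countable[OF countable])
  interpret R: sigma_finite_measure ?R
    by (rule sigma_finite_measure_restrict_space[OF sigma_finite_siegel_measure F])
  interpret P: pair_sigma_finite ?C ?R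
    by (simp add: pair_sigma_finite_def C.sigma_finite_measure_axioms R.sigma_finite_measure_axioms)
  define \<phi> where "\<phi> p = sp_act (fst p) (snd p)" for p :: "'n rmat2 \<times> 'n cmat"
  have \<phi>m: "\<phi> \<in> ?C \<Otimes>\<^sub>M ?R \<rightarrow>\<^sub>M siegel_measure"
    by (rule measurable_pair_measure_countable1[OF countable])
       (simp add: \<phi>_def, intro measurable_restrict_space1 act_measurable)
  have eq: "distr (?C \<Otimes>\<^sub>M ?R) siegel_measure \<phi> = density siegel_measure (\<lambda>_. ennreal (real stab_order))"
  proof (rule measure_eqI)
    fix A assume "A \<in> sets (distr (?C \<Otimes>\<^sub>M ?R) siegel_measure \<phi>)"
    then have A: "A \<in> sets siegel_measure" by simp
    have Ai: "(indicator A :: _ \<Rightarrow> ennreal) \<in> borel_measurable siegel_measure" using A by simp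
    have m: "(\<lambda>p. indicator A (\<phi> p) :: ennreal) \<in> borel_measurable (?C \<Otimes>\<^sub>M ?R)"
      using measurable_compose[OF \<phi>m Ai] .
    have "emeasure (distr (?C \<Otimes>\<^sub>M ?R) siegel_measure \<phi>) A = (\<integral>\<^sup>+z. indicator A z \<partial>distr (?C \<Otimes>\<^sub>M ?R) siegel_measure \<phi>)"
      using A by simp
    also have "\<dots> = (\<integral>\<^sup>+p. indicator A (\<phi> p) \<partial>(?C \<Otimes>\<^sub>M ?R))" by (rule nn_integral_distr[OF \<phi>m]) (use Ai in simp)
    also have "\<dots> = (\<integral>\<^sup>+z. \<integral>\<^sup>+g. indicator A (\<phi> (g, z)) \<partial>?C \<partial>?R)" by (rule P.nn_integral_snd[OF m, symmetric])
    also have "\<dots> = (\<integral>\<^sup>+z. (\<integral>\<^sup>+g. indicator A (sp_act g z) \<partial>?C) * indicator F z \<partial>siegel_measure)"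
      by (subst nn_integral_restrict_space) (use F F_siegel in \<open>auto simp: \<phi>_def Int_absorb2\<close>)
    also have "\<dots> = of_nat stab_order * emeasure siegel_measure A"
      using nn_integral_unfold[OF Ai] A by simp
    also have "\<dots> = emeasure (density siegel_measure (\<lambda>_. ennreal (real stab_order))) A"
      using A by (simp add: emeasure_density_const ennreal_of_nat_eq_real_of_nat)
    finally show "emeasure (distr (?C \<Otimes>\<^sub>M ?R) siegel_measure \<phi>) A = emeasure (density siegel_measure (\<lambda>_. ennreal (real stab_order))) A" .
  qed simp
  have km: "k \<in> borel_measurable siegel_measure" using k by simp
  have kd: "integrable (density siegel_measure (\<lambda>_. ennreal (real stab_order))) k"
    using k by (subst integrable_density) auto
  have "integrable (?C \<Otimes>\<^sub>M ?R) (\<lambda>p. k (\<phi> p))"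
    by (rule integrable_distr[OF \<phi>m]) (simp only: eq kd)
  then have "(\<integral>z. (\<integral>g. k (\<phi> (g, z)) \<partial>?C) \<partial>?R) = (\<integral>p. k (\<phi> p) \<partial>(?C \<Otimes>\<^sub>M ?R))"
    using P.integral_snd[of "\<lambda>g z. k (\<phi> (g, z))"] by (simp add: split_beta')
  also have "\<dots> = (\<integral>z. k z \<partial>distr (?C \<Otimes>\<^sub>M ?R) siegel_measure \<phi>)"
    by (rule integral_distr[OF \<phi>m km, symmetric])
  also have "\<dots> = (\<integral>z. real stab_order *\<^sub>R k z \<partial>siegel_measure)"
    unfolding eq by (rule integral_density) (use km in auto)
  also have "\<dots> = of_nat stab_order * (\<integral>z. k z \<partial>siegel_measure)"
    by (simp add: scaleR_conv_of_real)
  finally show ?thesis by (simp add: \<phi>_def)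
qed

end

end

subsection \<open>The orbit of the compact torus\<close>

text \<open>In the coordinate (z - i)(z + i)^(-1) of the bounded model, the quotient of these two
  matrices is the point whose coordinate is multiplied by q: q on the unit circle rotates about i,
  and q = 0 gives i.\<close>

abbreviation cayley_num :: "'n::finite cmat \<Rightarrow> complex \<Rightarrow> 'n cmat" where
  "cayley_num z q \<equiv> (z + mat \<i>) + mat q ** (z - mat \<i>)"

abbreviation cayley_den :: "'n::finite cmat \<Rightarrow> complex \<Rightarrow> 'n cmat" where
  "cayley_den z q \<equiv> mat (- \<i>) ** ((z + mat \<i>) - mat q ** (z - mat \<i>))"

definition cayley_disc :: "'n::finite cmat \<Rightarrow> complex \<Rightarrow> 'n cmat" where
  "cayley_disc z q = cayley_num z q ** matrix_inv (cayley_den z q)"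

lemma mat_vec: "mat c *v x = (\<chi> i. (c::'a::comm_ring_1) * x $ i)"
  by (simp add: matrix_vector_mult_def mat_def vec_eq_iff if_distrib if_distribR cong: if_cong)

lemma matrix_commute_sum_diff:
  fixes A C :: "'a::comm_ring_1^'n^'n"
  assumes "A ** C = C ** A"
  shows "(A - C) ** (A + C) = (A + C) ** (A - C)"
proof -
  have D: "(A - C) ** C = C ** (A - C)"
    by (simp only: matrix_diff_ldistrib' matrix_diff_rdistrib' assms)
  have "A + C = (A - C) + (C + C)" by (simp add: vec_eq_iff)
  then show ?thesis by (simp only: matrix_add_ldistrib matrix_add_rdistrib' D)
qed

text \<open>For u = (z + i) x and v = (z - i) x the imaginary form of the pair is |u|^2 - |q|^2
  |v|^2. It is smallest at |q| = 1, where it equals four times the form of z at x.\<close>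

lemma cayley_disc_siegel:
  assumes z: "z \<in> siegel" and q: "cmod q \<le> 1"
  shows "det (cayley_den z q) \<noteq> 0" "cayley_disc z q \<in> siegel"
proof -
  let ?A = "z + mat \<i>" and ?B = "z - mat \<i>"
  have comm: "?A ** ?B = ?B ** ?A" using matrix_commute_sum_diff[OF mat_commute[of \<i> z, symmetric]] by simp
  have tm: "transpose (mat a ** Y) = mat a ** transpose Y" for a and Y :: "'a cmat"
    by (simp only: matrix_transpose_mul transpose_mat mat_commute[of a "transpose Y"])
  have t: "transpose (cayley_den z q) = cayley_den z q" "transpose (cayley_num z q) = cayley_num z q"
    using siegel_sym[OF z]
    by (simp_all only: tm transpose_add transpose_diff transpose_mat)
  have c: "X ** (mat a ** Y) = mat a ** (X ** Y)" for X Y :: "'a cmat" and a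
    by (simp only: matrix_mul_assoc mat_commute[of a X])
  have "?A ** (mat q ** ?B) = (mat q ** ?B) ** ?A"
    unfolding c comm by (simp only: matrix_mul_assoc)
  note E = matrix_commute_sum_diff[OF this]
  have sym: "transpose (cayley_den z q) ** cayley_num z q = transpose (cayley_num z q) ** cayley_den z q"
    unfolding t c[of "cayley_num z q"] matrix_mul_assoc[symmetric, of "mat (- \<i>)"] E ..
  have pos: "Im (herm (cayley_den z q *v x) (cayley_num z q *v x)) > 0" if x: "x \<noteq> 0" for x
  proof -
    define u where "u = ?A *v x"
    define v where "v = ?B *v x"
    have N: "(cayley_den z q *v x) $ i = - \<i> * (u $ i - q * v $ i)" for i
      by (simp add: u_def v_def mat_vec matrix_vector_mul_assoc[symmetric] matrix_vector_mult_diff_rdistrib del: matrix_vector_mul_assoc)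
    have P: "(cayley_num z q *v x) $ i = u $ i + q * v $ i" for i
      by (simp add: u_def v_def mat_vec matrix_vector_mul_assoc[symmetric] matrix_vector_mult_add_rdistrib del: matrix_vector_mul_assoc)
    have e: "Im (cnj (- \<i> * (a - b)) * (a + b)) = (cmod a)\<^sup>2 - (cmod b)\<^sup>2" for a b
      unfolding cmod_power2 by (simp add: algebra_simps power2_eq_square)
    have "Im (herm (cayley_den z q *v x) (cayley_num z q *v x)) = (\<Sum>i\<in>UNIV. (cmod (u $ i))\<^sup>2 - (cmod (q * v $ i))\<^sup>2)"
      unfolding herm_def N P Im_sum e ..
    also have "\<dots> \<ge> (\<Sum>i\<in>UNIV. (cmod (u $ i))\<^sup>2 - (cmod (v $ i))\<^sup>2)"
    proof (rule sum_mono)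
      fix i
      have "cmod (q * v $ i) \<le> cmod (v $ i)" using mult_right_mono[OF q, of "cmod (v $ i)"] by (simp add: norm_mult)
      then have "(cmod (q * v $ i))\<^sup>2 \<le> (cmod (v $ i))\<^sup>2" by (intro power_mono) auto
      then show "(cmod (u $ i))\<^sup>2 - (cmod (v $ i))\<^sup>2 \<le> (cmod (u $ i))\<^sup>2 - (cmod (q * v $ i))\<^sup>2" by simp
    qed
    also have "(\<Sum>i\<in>UNIV. (cmod (u $ i))\<^sup>2 - (cmod (v $ i))\<^sup>2) = 4 * Im (herm x (z *v x))"
    proof -
      have "u $ i = (z *v x) $ i + \<i> * x $ i" "v $ i = (z *v x) $ i - \<i> * x $ i" for i
        by (simp_all add: u_def v_def mat_vec matrix_vector_mult_add_rdistrib matrix_vector_mult_diff_rdistrib)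
      moreover have "(cmod (a + \<i> * b))\<^sup>2 - (cmod (a - \<i> * b))\<^sup>2 = 4 * Im (cnj b * a)" for a b
        unfolding cmod_power2 by (simp add: algebra_simps power2_eq_square)
      ultimately show ?thesis by (simp add: herm_def sum_distrib_left)
    qed
    finally show ?thesis using siegel_herm[OF z x] by simp
  qed
  show "det (cayley_den z q) \<noteq> 0" "cayley_disc z q \<in> siegel"
    unfolding cayley_disc_def using siegel_quotient_mem[OF sym pos] by simp_all
qed

lemma cayley_disc_unique:
  assumes "w ** cayley_den z q = cayley_num z q" "det (cayley_den z q) \<noteq> 0"
  shows "w = cayley_disc z q"
  unfolding cayley_disc_def assms(1)[symmetric] matrix_mul_assoc[of w "cayley_den z q", symmetric] matrix_inv_right[OF assms(2)]
  by simp

lemma has_derivative_vecI: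
  fixes f :: "'a::real_normed_vector \<Rightarrow> 'b::euclidean_space ^ 'n"
  assumes "\<And>i. ((\<lambda>x. f x $ i) has_derivative (\<lambda>h. f' h $ i)) (at a within S)"
  shows "(f has_derivative f') (at a within S)"
proof -
  have "((\<lambda>x. f x \<bullet> b) has_derivative (\<lambda>h. f' h \<bullet> b)) (at a within S)" if b: "b \<in> Basis" for b
  proof -
    obtain i u where "b = axis i u" using b unfolding Basis_vec_def by blast
    then show ?thesis using has_derivative_inner_left[OF assms[of i], of u] by (simp add: inner_axis)
  qed
  then show ?thesis by (subst has_derivative_componentwise_within) blast
qed

lemma det_holomorphic:
  assumes "\<And>i j. (\<lambda>q. M q $ i $ j) holomorphic_on S"
  shows "(\<lambda>q. det (M q)) holomorphic_on S"
  unfolding det_def by (intro holomorphic_intros assms)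

lemma cayley_disc_entry_holomorphic:
  assumes "\<And>q. q \<in> S \<Longrightarrow> det (cayley_den z q) \<noteq> 0"
  shows "(\<lambda>q. cayley_disc z q $ i $ j) holomorphic_on S"
    and "(\<lambda>q. det (cayley_den z q)) holomorphic_on S"
proof -
  have P: "(\<lambda>q. cayley_num z q $ i $ j) holomorphic_on S" for i j
    by (simp add: mat_mult_entry) (intro holomorphic_intros)
  have N: "(\<lambda>q. cayley_den z q $ i $ j) holomorphic_on S" for i j
    by (simp add: mat_mult_entry) (intro holomorphic_intros)
  show d: "(\<lambda>q. det (cayley_den z q)) holomorphic_on S" by (rule det_holomorphic[OF N])
  have M: "(\<lambda>q. (\<chi> a b. if b = i then (if a = j then 1 else 0) else cayley_den z q $ a $ b) $ k $ l) holomorphic_on S" for i j k l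
    using N[of k l] by (cases "l = i"; cases "k = j") (auto intro: holomorphic_intros)
  have "(\<lambda>q. det (\<chi> a b. if b = i then (if a = j then 1 else 0) else cayley_den z q $ a $ b) / det (cayley_den z q)) holomorphic_on S" for i j
    by (intro holomorphic_on_divide det_holomorphic M d assms)
  then have I: "(\<lambda>q. matrix_inv (cayley_den z q) $ i $ j) holomorphic_on S" for i j
    by (rule holomorphic_transform) (simp only: matrix_inv_entry[OF assms])
  show "(\<lambda>q. cayley_disc z q $ i $ j) holomorphic_on S"
    unfolding cayley_disc_def matrix_matrix_mult_def[of "cayley_num z _" "matrix_inv (cayley_den z _)"] vec_lambda_beta
    by (intro holomorphic_intros P I)
qed

lemma siegel_holomorphic_continuous: "siegel_holomorphic f \<Longrightarrow> continuous_on siegel f"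
  unfolding siegel_holomorphic_def continuous_on_eq_continuous_within
  using has_derivative_continuous by blast

text \<open>The disc lies inside \<open>siegel\<close>, so the chain rule holds for derivatives
  within \<open>siegel\<close>. Tangent vectors of the disc are complex multiples h Z', and
  homogeneity of D turns D(h Z') into h D(Z').\<close>

lemma siegel_holomorphic_disc:
  assumes f: "siegel_holomorphic f" and z: "z \<in> siegel"
  shows "continuous_on (cball 0 1) (\<lambda>q. f (cayley_disc z q))" "(\<lambda>q. f (cayley_disc z q)) holomorphic_on ball 0 1"
proof -
  have mem: "cayley_disc z q \<in> siegel" if "q \<in> cball 0 1" for q
    using cayley_disc_siegel[OF z] that by simp
  have dz: "\<And>q. q \<in> cball 0 1 \<Longrightarrow> det (cayley_den z q) \<noteq> 0"
    using cayley_disc_siegel[OF z] by simp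
  have H: "(\<lambda>q. cayley_disc z q $ i $ j) holomorphic_on cball 0 1" for i j
    by (rule cayley_disc_entry_holomorphic[OF dz])
  have "continuous_on (cball 0 1) (\<lambda>q. \<chi> i j. cayley_disc z q $ i $ j)"
    by (intro continuous_intros holomorphic_on_imp_continuous_on H)
  then have c: "continuous_on (cball 0 1) (cayley_disc z)" by simp
  show "continuous_on (cball 0 1) (\<lambda>q. f (cayley_disc z q))"
    by (rule continuous_on_compose2[OF siegel_holomorphic_continuous[OF f] c]) (use mem in auto)
  show "(\<lambda>q. f (cayley_disc z q)) holomorphic_on ball 0 1"
  proof (rule holomorphic_onI)
    fix q :: complex assume q: "q \<in> ball 0 1"
    define Z' where "Z' = (\<chi> i j. deriv (\<lambda>q. cayley_disc z q $ i $ j) q)"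
    have D': "((\<lambda>q. cayley_disc z q $ i $ j) has_field_derivative Z' $ i $ j) (at q within ball 0 1)" for i j
      using holomorphic_derivI[OF holomorphic_on_subset[OF H] open_ball q] by (simp add: Z'_def has_field_derivative_at_within)
    have "((\<lambda>q. cayley_disc z q $ i $ j) has_derivative (\<lambda>h. map_matrix ((*) h) Z' $ i $ j)) (at q within ball 0 1)" for i j
      using D'[of i j] unfolding has_field_derivative_def
      by (rule has_derivative_eq_rhs) (simp add: fun_eq_iff mult.commute)
    then have Z: "(cayley_disc z has_derivative (\<lambda>h. map_matrix ((*) h) Z')) (at q within ball 0 1)"
      by (intro has_derivative_vecI)
    obtain D where D: "(f has_derivative D) (at (cayley_disc z q) within siegel)" "\<And>c w. D (map_matrix ((*) c) w) = c * D w"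
      using f mem[of q] q unfolding siegel_holomorphic_def by force
    have "(f has_derivative D) (at (cayley_disc z q) within cayley_disc z ` ball 0 1)"
      by (rule has_derivative_subset[OF D(1)]) (use mem in auto)
    from diff_chain_within[OF Z this]
    have "((\<lambda>q. f (cayley_disc z q)) has_derivative (\<lambda>h. h * D Z')) (at q within ball 0 1)"
      by (simp add: o_def D(2))
    then have "((\<lambda>q. f (cayley_disc z q)) has_field_derivative D Z') (at q within ball 0 1)"
      unfolding has_field_derivative_def by (rule has_derivative_eq_rhs) (simp add: fun_eq_iff mult.commute)
    then show "(\<lambda>q. f (cayley_disc z q)) field_differentiable (at q within ball 0 1)"
      unfolding field_differentiable_def by blast
  qed
qed

text \<open>Cauchy's formula at the centre of the unit circle, with the parameter t in
  [0, 1].\<close>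

lemma mean_value_circle:
  assumes c: "continuous_on (cball 0 1) G" and h: "G holomorphic_on ball 0 1"
  shows "(\<integral>t. G (exp (2 * of_real pi * \<i> * of_real t)) \<partial>restrict_space lborel {0..1}) = G 0"
proof -
  let ?e = "\<lambda>t::real. exp (2 * of_real pi * \<i> * of_real t)"
  have cancel: "inverse (2 * of_real pi * \<i>) * ((2 * of_real pi * \<i>) * x) = x" for x :: complex
    by (simp add: field_simps)
  have "((\<lambda>u. G u / (u - 0)) has_contour_integral (2 * of_real pi * \<i> * G 0)) (circlepath 0 1)"
    by (rule Cauchy_integral_circlepath[OF c h]) simp
  then have "((\<lambda>t. G (?e t) / ?e t * (2 * of_real pi * \<i> * ?e t)) has_integral (2 * of_real pi * \<i> * G 0)) {0..1}"
    unfolding has_contour_integral vector_derivative_circlepath by (simp add: circlepath)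
  then have "((\<lambda>t. (2 * of_real pi * \<i>) * G (?e t)) has_integral (2 * of_real pi * \<i> * G 0)) {0..1}"
    by (simp add: mult_ac)
  from has_integral_mult_right[OF this, of "inverse (2 * of_real pi * \<i>)"]
  have I: "((\<lambda>t. G (?e t)) has_integral G 0) {0..1}" by (simp only: cancel)
  have "continuous_on {0..1} (\<lambda>t. G (?e t))"
    by (rule continuous_on_compose2[OF c]) (auto intro!: continuous_intros simp: norm_exp_eq_Re)
  then have S: "set_integrable lborel {0..1} (\<lambda>t. G (?e t))" by (rule borel_integrable_atLeastAtMost')
  have "(\<integral>t. G (?e t) \<partial>restrict_space lborel {0..1}) = (LINT t:{0..1}|lborel. G (?e t))"
    unfolding set_lebesgue_integral_def by (rule integral_restrict_space) simp
  also have "\<dots> = G 0" using set_borel_integral_eq_integral(2)[OF S] integral_unique[OF I] by simp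
  finally show ?thesis .
qed

section \<open>Averaging the kernel over rotations\<close>

definition rotation :: "real \<Rightarrow> 'n::finite rmat2" where
  "rotation t = block_matrix (mat (cos (pi * t))) (mat (sin (pi * t))) (mat (- sin (pi * t))) (mat (cos (pi * t)))"

lemma rotation_Sp_real: "rotation t \<in> Sp_real"
  unfolding rotation_def
proof (rule block_matrix_Sp_real)
  have m: "mat a ** mat b = (mat (a * b) :: real^'n^'n)" for a b
    by (simp add: vec_eq_iff mat_mult_entry) (simp add: mat_def)
  have d: "mat a - mat b = (mat (a - b) :: real^'n^'n)" for a b
    by (simp add: vec_eq_iff mat_def)
  show "transpose (mat (cos (pi * t))) ** mat (- sin (pi * t)) = transpose (mat (- sin (pi * t))) ** (mat (cos (pi * t)) :: real^'n^'n)"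
    "transpose (mat (sin (pi * t))) ** mat (cos (pi * t)) = transpose (mat (cos (pi * t))) ** (mat (sin (pi * t)) :: real^'n^'n)"
    by (simp_all only: transpose_mat m mult.commute)
  have "cos (pi * t) * cos (pi * t) - - sin (pi * t) * sin (pi * t) = 1"
    using sin_cos_squared_add3[of "pi * t"] by (simp add: power2_eq_square)
  then show "transpose (mat (cos (pi * t))) ** mat (cos (pi * t)) - transpose (mat (- sin (pi * t))) ** mat (sin (pi * t)) = (mat 1 :: real^'n^'n)"
    by (simp only: transpose_mat m d)
qed

lemma blk_rotation: "blk_A (rotation t) = mat (of_real (cos (pi * t)))" "blk_B (rotation t) = mat (of_real (sin (pi * t)))"
    "blk_C (rotation t) = mat (- of_real (sin (pi * t)))" "blk_D (rotation t) = mat (of_real (cos (pi * t)))"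
  by (simp_all add: rotation_def cm_mat)

text \<open>By Euler, 2 \<zeta> cos = 1 + \<zeta>^2 and 2 \<zeta> sin = -i (\<zeta>^2 - 1). So up to
  the scalar 2 \<zeta> the rotation by pi t is the point q = \<zeta>^2 of the Cayley disc, and q
  runs once round the circle as t runs through [0, 1].\<close>

lemma rotation_cayley:
  fixes z :: "'n::finite cmat" and t :: real
  defines "\<zeta> \<equiv> exp (\<i> * of_real (pi * t))"
  shows "mat (2 * \<zeta>) ** sp_den (rotation t) z = cayley_den z (\<zeta>\<^sup>2)"
    "mat (2 * \<zeta>) ** sp_num (rotation t) z = cayley_num z (\<zeta>\<^sup>2)"
proof -
  have c: "2 * \<zeta> * of_real (cos (pi * t)) = 1 + \<zeta>\<^sup>2" and s: "2 * \<zeta> * of_real (sin (pi * t)) = - \<i> * (\<zeta>\<^sup>2 - 1)"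
  proof -
    have e: "\<zeta> = of_real (cos (pi * t)) + \<i> * of_real (sin (pi * t))" by (simp add: \<zeta>_def exp_Euler cos_of_real sin_of_real del: of_real_mult)
    have p: "(of_real (cos (pi * t)))\<^sup>2 + (of_real (sin (pi * t)))\<^sup>2 = (1::complex)"
      by (simp flip: of_real_power of_real_add)
    show "2 * \<zeta> * of_real (cos (pi * t)) = 1 + \<zeta>\<^sup>2" unfolding e p[symmetric] by (simp add: algebra_simps power2_eq_square)
    show "2 * \<zeta> * of_real (sin (pi * t)) = - \<i> * (\<zeta>\<^sup>2 - 1)" unfolding e p[symmetric] by (simp add: algebra_simps power2_eq_square)
  qed
  have aux: "2 * \<zeta> * (a * of_real (cos (pi * t)) + b * of_real (sin (pi * t))) = a * (1 + \<zeta>\<^sup>2) + b * (- \<i> * (\<zeta>\<^sup>2 - 1))" for a b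
    unfolding c[symmetric] s[symmetric] by (simp add: algebra_simps)
  have "(mat (2 * \<zeta>) ** sp_den (rotation t) z) $ i $ j = cayley_den z (\<zeta>\<^sup>2) $ i $ j
      \<and> (mat (2 * \<zeta>) ** sp_num (rotation t) z) $ i $ j = cayley_num z (\<zeta>\<^sup>2) $ i $ j" for i j
  proof -
    define \<delta> :: complex where "\<delta> = (if i = j then 1 else 0)"
    have m: "mat x $ i $ j = x * \<delta>" for x by (simp add: mat_def \<delta>_def)
    have "(mat (2 * \<zeta>) ** sp_den (rotation t) z) $ i $ j = 2 * \<zeta> * (\<delta> * of_real (cos (pi * t)) + (- z $ i $ j) * of_real (sin (pi * t)))"
      by (simp add: mat_mult_entry blk_rotation m algebra_simps)
    moreover have "(mat (2 * \<zeta>) ** sp_num (rotation t) z) $ i $ j = 2 * \<zeta> * (z $ i $ j * of_real (cos (pi * t)) + \<delta> * of_real (sin (pi * t)))"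
      by (simp add: mat_mult_entry blk_rotation m algebra_simps)
    ultimately show ?thesis unfolding aux by (simp add: mat_mult_entry m algebra_simps)
  qed
  then show "mat (2 * \<zeta>) ** sp_den (rotation t) z = cayley_den z (\<zeta>\<^sup>2)"
    "mat (2 * \<zeta>) ** sp_num (rotation t) z = cayley_num z (\<zeta>\<^sup>2)"
    by (simp_all only: vec_eq_iff) blast+
qed

lemma borel_measurable_mat [measurable (raw)]:
  assumes [measurable]: "c \<in> borel_measurable M"
  shows "(\<lambda>x. mat (c x) :: 'n::finite cmat) \<in> borel_measurable M"
  unfolding mat_def by measurable

lemma siegel_shift_det: "z \<in> siegel \<Longrightarrow> det (z + mat \<i>) \<noteq> 0"
  using cayley_disc_siegel(1)[of z 0] by (auto simp: det_mul)

definition cusp_kernel :: "nat \<Rightarrow> ('n::finite cmat \<Rightarrow> complex) \<Rightarrow> 'n cmat \<Rightarrow> complex" where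
  "cusp_kernel m f z = f z * cnj (f_one m z) * of_real (det (Im_matrix z) ^ m)"

text \<open>With d = det(C z + D) and e = \<zeta>^n, conj det(w + i)^(-1) contributes conj(d e) and
  det Im w contributes 1/(d conj d). Since |e| = 1 the conjugates cancel, and the remaining 1/(d e)
  = 2^n / det(\<open>cayley_den z q\<close>) is holomorphic in q.\<close>

lemma cusp_kernel_rotation:
  fixes z :: "'n::finite cmat" and t :: real
  assumes z: "z \<in> siegel"
  defines "q \<equiv> exp (2 * of_real pi * \<i> * of_real t)"
  shows "cusp_kernel m f (sp_act (rotation t) z) =
    2 ^ (m * CARD('n)) * cnj (f_one m z) * of_real (det (Im_matrix z) ^ m) *
      (f (cayley_disc z q) * inverse (det (cayley_den z q) ^ m))"
proof -
  define \<zeta> where "\<zeta> = exp (\<i> * of_real (pi * t))"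
  define w where "w = sp_act (rotation t) z"
  define d where "d = det (sp_den (rotation t) z)"
  define e where "e = \<zeta> ^ CARD('n)"
  define N where "N = det (cayley_den z q)"
  define b where "b = det (w + mat \<i>)"
  define a where "a = det (z + mat \<i>)"
  have q: "\<zeta>\<^sup>2 = q" by (simp add: \<zeta>_def q_def exp_double[symmetric] mult_ac)
  have "cmod \<zeta> = 1" by (simp add: \<zeta>_def)
  then have "\<zeta> * cnj \<zeta> = 1" by (simp add: complex_mult_cnj cmod_power2[symmetric])
  then have e: "e * cnj e = 1" by (simp add: e_def power_mult_distrib[symmetric])
  have g: "rotation t \<in> Sp_real" by (rule rotation_Sp_real)
  note s = sp_act_siegel[OF g z, folded w_def d_def]
  have nz: "\<zeta> \<noteq> 0" by (simp add: \<zeta>_def)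
  then have nz2: "det (mat (2 * \<zeta>) :: 'n cmat) \<noteq> 0" by (simp add: det_mat)
  have rc: "mat (2 * \<zeta>) ** sp_den (rotation t) z = cayley_den z q" "mat (2 * \<zeta>) ** sp_num (rotation t) z = cayley_num z q"
    using rotation_cayley[of t z] unfolding \<zeta>_def[symmetric] q by simp_all
  have N: "N = 2 ^ CARD('n) * e * d"
    unfolding N_def rc(1)[symmetric] det_mul det_mat d_def e_def by (simp add: power_mult_distrib)
  have "w ** cayley_den z q = cayley_num z q"
    unfolding rc[symmetric] matrix_mul_assoc mat_commute[of "2 * \<zeta>" w, symmetric]
    unfolding matrix_mul_assoc[symmetric] w_def sp_act_den[OF g z] ..
  then have wZ: "w = cayley_disc z q"
    by (intro cayley_disc_unique cayley_disc_siegel(1)[OF z]) (simp_all add: q_def norm_exp_eq_Re)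
  have "mat \<i> ** cayley_den z q = (z + mat \<i>) - mat q ** (z - mat \<i>)"
    by (simp add: vec_eq_iff mat_mult_entry)
  then have "(w + mat \<i>) ** cayley_den z q = cayley_num z q + ((z + mat \<i>) - mat q ** (z - mat \<i>))"
    using \<open>w ** cayley_den z q = cayley_num z q\<close> by (simp add: matrix_add_rdistrib')
  also have "\<dots> = mat 2 ** (z + mat \<i>)" by (simp add: vec_eq_iff mat_mult_entry)
  finally have "b * N = 2 ^ CARD('n) * a"
    unfolding b_def N_def a_def by (metis det_mul det_mat)
  then have a: "a = b * d * e" unfolding N by (simp add: ac_simps eq_commute[of a])
  have anz: "a \<noteq> 0" unfolding a_def by (rule siegel_shift_det[OF z])
  have Y: "of_real (det (Im_matrix z)) = of_real (det (Im_matrix w)) * (d * cnj d)"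
    unfolding s(3)[symmetric] by (simp add: complex_norm_square[symmetric] del: of_real_power)
  have "inverse (cnj b) * of_real (det (Im_matrix w)) =
      2 ^ CARD('n) * inverse N * inverse (cnj a) * of_real (det (Im_matrix z))"
  proof -
    have "2 ^ CARD('n) * inverse N * inverse (cnj a) * (of_real (det (Im_matrix w)) * (d * cnj d)) =
       inverse (cnj b) * of_real (det (Im_matrix w)) * inverse (e * cnj e)"
      using anz unfolding a N by (simp add: field_simps)
    then show ?thesis unfolding Y e inverse_1 mult_1_right by (rule sym)
  qed
  from arg_cong[OF this, of "\<lambda>x. x ^ m"]
  have key: "inverse (cnj b ^ m) * of_real (det (Im_matrix w)) ^ m =
      2 ^ (m * CARD('n)) * inverse (N ^ m) * inverse (cnj a ^ m) * of_real (det (Im_matrix z)) ^ m"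
    by (simp add: power_mult_distrib power_inverse power_mult[symmetric] mult.commute[of m])
  have f1: "cnj (f_one m w) = cnj ((2 * \<i>) ^ (m * CARD('n))) * inverse (cnj b ^ m)"
    "cnj (f_one m z) = cnj ((2 * \<i>) ^ (m * CARD('n))) * inverse (cnj a ^ m)"
    by (simp_all add: f_one_def power_int_minus a_def b_def)
  have "cusp_kernel m f w = f w * cnj ((2 * \<i>) ^ (m * CARD('n))) * (inverse (cnj b ^ m) * of_real (det (Im_matrix w)) ^ m)"
    unfolding cusp_kernel_def f1 by (simp only: of_real_power mult_ac)
  also have "\<dots> = 2 ^ (m * CARD('n)) * (cnj ((2 * \<i>) ^ (m * CARD('n))) * inverse (cnj a ^ m)) * of_real (det (Im_matrix z) ^ m) *
      (f w * inverse (N ^ m))"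
    unfolding key by (simp only: of_real_power mult_ac)
  finally show ?thesis unfolding f1(2)[symmetric] wZ[symmetric] unfolding w_def N_def .
qed

lemma cusp_kernel_mean_value:
  fixes z :: "'n::finite cmat"
  assumes f: "siegel_holomorphic f" and z: "z \<in> siegel"
  shows "(\<integral>t. cusp_kernel m f (sp_act (rotation t) z) \<partial>restrict_space lborel {0..1}) =
    f (mat \<i>) * of_real ((cmod (f_one m z))\<^sup>2 * det (Im_matrix z) ^ m)"
proof -
  define c where "c = 2 ^ (m * CARD('n)) * cnj (f_one m z) * of_real (det (Im_matrix z) ^ m)"
  define G where "G q = f (cayley_disc z q) * inverse (det (cayley_den z q) ^ m)" for q
  have nz: "\<And>q. q \<in> cball 0 1 \<Longrightarrow> det (cayley_den z q) \<noteq> 0"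
    using cayley_disc_siegel(1)[OF z] by simp
  note N = cayley_disc_entry_holomorphic(2)[of "cball 0 1" z, OF nz]
  have "continuous_on (cball 0 1) G"
    unfolding G_def using nz
    by (intro continuous_intros siegel_holomorphic_disc[OF f z] holomorphic_on_imp_continuous_on[OF N]) auto
  moreover have "G holomorphic_on ball 0 1"
    unfolding G_def using nz
    by (intro holomorphic_intros siegel_holomorphic_disc[OF f z] holomorphic_on_subset[OF N]) auto
  ultimately have "(\<integral>t. G (exp (2 * of_real pi * \<i> * of_real t)) \<partial>restrict_space lborel {0..1}) = G 0"
    by (rule mean_value_circle)
  moreover have "cusp_kernel m f (sp_act (rotation t) z) = c * G (exp (2 * of_real pi * \<i> * of_real t))" for t
    unfolding cusp_kernel_rotation[OF z] c_def G_def ..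
  \<comment> \<open>At q = 0 the disc passes through i and the denominator has determinant (-i)^n
    det(z + i). Together with 2^(mn) its power restores exactly the factor (2i)^(mn) in
    \<open>f_one\<close>.\<close>
  moreover have "c * G 0 = f (mat \<i>) * of_real ((cmod (f_one m z))\<^sup>2 * det (Im_matrix z) ^ m)"
  proof -
    have m0: "mat 0 = (0 :: 'n cmat)" by (simp add: mat_def vec_eq_iff)
    have d0: "cayley_den z 0 = mat (- \<i>) ** (z + mat \<i>)" and n0: "cayley_num z 0 = z + mat \<i>" by (simp_all add: m0)
    have "mat \<i> ** cayley_den z 0 = cayley_num z 0"
      unfolding d0 n0 by (simp add: vec_eq_iff mat_mult_entry)
    then have Z0: "cayley_disc z 0 = mat \<i>"
      by (intro cayley_disc_unique[symmetric] nz) simp_all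
    have D0: "det (cayley_den z 0) = (- \<i>) ^ CARD('n) * det (z + mat \<i>)"
      unfolding d0 det_mul det_mat ..
    have F0: "2 ^ (m * CARD('n)) * inverse (((- \<i>) ^ CARD('n) * det (z + mat \<i>)) ^ m) = f_one m z"
    proof -
      have i: "inverse ((- \<i>) ^ k) = \<i> ^ k" for k
        by (simp add: power_inverse[symmetric])
      show ?thesis
        by (simp add: f_one_def power_int_minus power_mult_distrib i power_mult[symmetric] mult.commute[of m])
    qed
    have "c * G 0 = f (mat \<i>) * ((2 ^ (m * CARD('n)) * inverse (((- \<i>) ^ CARD('n) * det (z + mat \<i>)) ^ m)) *
        cnj (f_one m z) * of_real (det (Im_matrix z) ^ m))"
      unfolding c_def G_def Z0 D0 by (simp only: mult_ac)
    then show ?thesis unfolding F0 of_real_mult complex_norm_square .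
  qed
  ultimately show ?thesis by simp
qed

text \<open>The map (t, z) -> rotation t z sends the product of the uniform measure on [0, 1] and
  \<open>siegel_measure\<close> to \<open>siegel_measure\<close>, since every fixed t preserves the
  latter. Integrability on the product follows, and Fubini puts the average over t inside.\<close>

lemma integral_rotation_average:
  fixes k :: "'n::{finite,linorder} cmat \<Rightarrow> complex"
  assumes k: "integrable siegel_measure k"
  shows "(\<integral>z. k z \<partial>siegel_measure) =
    (\<integral>z. (\<integral>t. k (sp_act (rotation t) z) \<partial>restrict_space lborel {0..1}) \<partial>siegel_measure)"
proof -
  let ?M = "siegel_measure :: 'n cmat measure"
  let ?T = "restrict_space lborel {0..1::real}"
  interpret T: prob_space ?T
    by (rule prob_spaceI) (simp add: space_restrict_space emeasure_restrict_space)
  interpret M: sigma_finite_measure ?M by (rule sigma_finite_siegel_measure)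
  interpret P: pair_sigma_finite ?T ?M
    by (simp add: pair_sigma_finite_def T.sigma_finite_measure_axioms M.sigma_finite_measure_axioms)
  define \<phi> where "\<phi> p = sp_act (rotation (fst p)) (snd p)" for p :: "real \<times> 'n cmat"
  have \<phi>m: "\<phi> \<in> ?T \<Otimes>\<^sub>M ?M \<rightarrow>\<^sub>M ?M"
  proof -
    have [measurable]: "(\<lambda>z. z) \<in> borel_measurable ?M" by (rule measurable_siegelI') simp
    have [measurable]: "(\<lambda>t. t) \<in> borel_measurable ?T" by (rule measurable_restrict_space1) simp
    have [measurable]: "snd \<in> borel_measurable (?T \<Otimes>\<^sub>M ?M)"
      using measurable_compose[OF measurable_snd, of "\<lambda>z. z" ?M borel ?T] by simp
    have [measurable]: "fst \<in> borel_measurable (?T \<Otimes>\<^sub>M ?M)"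
      using measurable_compose[OF measurable_fst, of "\<lambda>z. z" ?T borel ?M] by simp
    have "\<phi> \<in> borel_measurable (?T \<Otimes>\<^sub>M ?M)"
      unfolding \<phi>_def sp_act_def blk_rotation by measurable
    then have "\<phi> \<in> ?T \<Otimes>\<^sub>M ?M \<rightarrow>\<^sub>M restrict_space borel siegel"
      by (rule measurable_restrict_space2[rotated]) (auto simp: space_pair_measure \<phi>_def intro: sp_act_siegel(2)[OF rotation_Sp_real])
    then show ?thesis using measurable_cong_sets[OF refl sets_siegel_measure] by blast
  qed
  have eq: "distr (?T \<Otimes>\<^sub>M ?M) ?M \<phi> = ?M"
  proof (rule measure_eqI)
    fix A assume "A \<in> sets (distr (?T \<Otimes>\<^sub>M ?M) ?M \<phi>)"
    then have A: "A \<in> sets ?M" by simp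
    have Ai: "(indicator A :: _ \<Rightarrow> ennreal) \<in> borel_measurable ?M" using A by simp
    have m: "(\<lambda>p. indicator A (\<phi> p) :: ennreal) \<in> borel_measurable (?T \<Otimes>\<^sub>M ?M)"
      using measurable_compose[OF \<phi>m Ai] .
    have "emeasure (distr (?T \<Otimes>\<^sub>M ?M) ?M \<phi>) A = (\<integral>\<^sup>+z. indicator A z \<partial>distr (?T \<Otimes>\<^sub>M ?M) ?M \<phi>)"
      using A by simp
    also have "\<dots> = (\<integral>\<^sup>+p. indicator A (\<phi> p) \<partial>(?T \<Otimes>\<^sub>M ?M))" by (rule nn_integral_distr[OF \<phi>m]) (use Ai in simp)
    also have "\<dots> = (\<integral>\<^sup>+t. \<integral>\<^sup>+z. indicator A (\<phi> (t, z)) \<partial>?M \<partial>?T)" by (rule M.nn_integral_fst[OF m, symmetric])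
    also have "\<dots> = (\<integral>\<^sup>+t. emeasure ?M A \<partial>?T)"
    proof (rule nn_integral_cong)
      fix t
      have r: "rotation t \<in> Sp_real" by (rule rotation_Sp_real)
      have g: "sp_act (rotation t) \<in> ?M \<rightarrow>\<^sub>M ?M" "distr ?M ?M (sp_act (rotation t)) = ?M"
        using sp_act_preserving[OF r] by (auto simp: siegel_preserving_def)
      have "(\<integral>\<^sup>+z. indicator A (\<phi> (t, z)) \<partial>?M) = (\<integral>\<^sup>+z. indicator A z \<partial>distr ?M ?M (sp_act (rotation t)))"
        unfolding \<phi>_def fst_conv snd_conv by (rule nn_integral_distr[OF g(1), symmetric]) (use Ai in simp)
      then show "(\<integral>\<^sup>+z. indicator A (\<phi> (t, z)) \<partial>?M) = emeasure ?M A" unfolding g(2) using A by simp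
    qed
    also have "\<dots> = emeasure ?M A" using T.emeasure_space_1 by simp
    finally show "emeasure (distr (?T \<Otimes>\<^sub>M ?M) ?M \<phi>) A = emeasure ?M A" .
  qed simp
  have km: "k \<in> borel_measurable ?M" using k by simp
  have "(\<integral>z. k z \<partial>?M) = (\<integral>z. k z \<partial>distr (?T \<Otimes>\<^sub>M ?M) ?M \<phi>)" unfolding eq ..
  also have "\<dots> = (\<integral>p. k (\<phi> p) \<partial>(?T \<Otimes>\<^sub>M ?M))" by (rule integral_distr[OF \<phi>m km])
  also have "\<dots> = (\<integral>z. (\<integral>t. k (\<phi> (t, z)) \<partial>?T) \<partial>?M)"
  proof -
    have "integrable (?T \<Otimes>\<^sub>M ?M) (\<lambda>p. k (\<phi> p))"
      by (rule integrable_distr[OF \<phi>m]) (simp only: eq k)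
    then show ?thesis using P.integral_snd[of "\<lambda>t z. k (\<phi> (t, z))"] by (simp add: split_beta')
  qed
  finally show ?thesis by (simp add: \<phi>_def)
qed

lemma integral_cusp_kernel:
  fixes f :: "'n::{finite,linorder} cmat \<Rightarrow> complex"
  assumes f: "siegel_holomorphic f" and k: "integrable siegel_measure (cusp_kernel m f)"
  shows "(\<integral>z. cusp_kernel m f z \<partial>siegel_measure) =
    f (mat \<i>) * of_real (\<integral>z. (cmod (f_one m z))\<^sup>2 * det (Im_matrix z) ^ m \<partial>(siegel_measure :: 'n cmat measure))"
proof -
  have "(\<integral>z. cusp_kernel m f z \<partial>siegel_measure) =
      (\<integral>z. f (mat \<i>) * of_real ((cmod (f_one m z))\<^sup>2 * det (Im_matrix z) ^ m) \<partial>(siegel_measure :: 'n cmat measure))"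
    unfolding integral_rotation_average[OF k]
    by (rule Bochner_Integration.integral_cong) (simp_all add: cusp_kernel_mean_value[OF f])
  then show ?thesis by (simp only: integral_mult_right_zero integral_complex_of_real)
qed

subsection \<open>Unfolding\<close>

text \<open>Without absolute summability both sides are 0 by convention. Hence the Poincare series
  may be treated as an integral at every point without discussing its convergence there.\<close>

lemma infsum_eq_integral_count_space:
  fixes h :: "'a \<Rightarrow> complex"
  shows "infsum h A = (\<integral>x. h x \<partial>count_space A)"
proof (cases "Infinite_Set_Sum.abs_summable_on h A")
  case True
  then show ?thesis using infsetsum_infsum[OF True] by (simp add: infsetsum_def)
next
  case False
  then have "\<not> h summable_on A"
    using abs_summable_equivalent[of h A] summable_on_iff_abs_summable_on_complex[of h A] by blast
  then show ?thesis
    using False by (simp add: infsum_not_exists abs_summable_on_def not_integrable_integral_eq)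
qed

lemma siegel_holomorphic_measurable:
  assumes "siegel_holomorphic f"
  shows "f \<in> borel_measurable siegel_measure"
  using borel_measurable_continuous_on_restrict[OF siegel_holomorphic_continuous[OF assms]]
    measurable_cong_sets[OF sets_siegel_measure refl] by blast

lemma cusp_kernel_measurable:
  fixes f :: "'n::{finite,linorder} cmat \<Rightarrow> complex"
  assumes "siegel_holomorphic f"
  shows "cusp_kernel m f \<in> borel_measurable siegel_measure"
proof -
  have [measurable]: "f \<in> borel_measurable siegel_measure" by (rule siegel_holomorphic_measurable[OF assms])
  have "(\<lambda>z :: 'n cmat. f_one m z) \<in> borel_measurable borel"
    unfolding f_one_def power_int_minus power_int_of_nat by measurable
  then have "(\<lambda>z :: 'n cmat. cnj (f_one m z)) \<in> borel_measurable borel"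
    by (rule measurable_compose) (intro borel_measurable_continuous_onI continuous_intros)
  moreover have "(\<lambda>z :: 'n cmat. complex_of_real (det (Im_matrix z) ^ m)) \<in> borel_measurable borel"
    by (rule measurable_compose[OF _ borel_measurable_of_real]) measurable
  ultimately have [measurable]: "(\<lambda>z. cnj (f_one m z) * of_real (det (Im_matrix z) ^ m)) \<in> borel_measurable (siegel_measure :: 'n cmat measure)"
    by (intro measurable_siegelI' borel_measurable_times)
  show ?thesis unfolding cusp_kernel_def mult.assoc by measurable
qed

lemma norm_f_one:
  fixes z :: "'n::finite cmat"
  assumes "z \<in> siegel"
  shows "cmod (f_one m z) = 2 ^ (m * CARD('n)) * cmod (det (z + mat \<i>)) powr (- real m)"
  using siegel_shift_det[OF assms]
  by (simp add: f_one_def norm_mult norm_power norm_power_int power_int_minus powr_minus powr_realpow norm_inverse)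

text \<open>Half of the power (det y)^m is spent on the growth bound of the cusp form. The other
  half, with the modulus of \<open>f_one\<close>, is the integrand assumed integrable in
  \<open>int\<close>.\<close>

lemma cusp_kernel_integrable:
  fixes f :: "'n::{finite,linorder} cmat \<Rightarrow> complex"
  assumes f: "siegel_holomorphic f"
    and bdd: "bdd_above ((\<lambda>z. norm (f z) * det (Im_matrix z) powr (real m / 2)) ` siegel)"
    and int: "integrable siegel_measure (\<lambda>z :: 'n cmat. cmod (det (z + mat \<i>)) powr (- real m) * det (Im_matrix z) powr (real m / 2))"
  shows "integrable siegel_measure (cusp_kernel m f)"
proof -
  let ?h = "\<lambda>z :: 'n cmat. cmod (det (z + mat \<i>)) powr (- real m) * det (Im_matrix z) powr (real m / 2)"
  obtain K where K: "\<And>z. z \<in> siegel \<Longrightarrow> norm (f z) * det (Im_matrix z) powr (real m / 2) \<le> K"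
    using bdd by (auto simp: bdd_above_def)
  have "norm (cusp_kernel m f z) \<le> norm (K * 2 ^ (m * CARD('n)) * ?h z)" if z: "z \<in> siegel" for z
  proof -
    have "det (Im_matrix z) ^ m = det (Im_matrix z) powr (real m / 2) * det (Im_matrix z) powr (real m / 2)"
      using siegel_det_Im_pos[OF z] by (simp add: powr_realpow[symmetric] powr_add[symmetric])
    then have "norm (cusp_kernel m f z) = (norm (f z) * det (Im_matrix z) powr (real m / 2)) * (2 ^ (m * CARD('n)) * ?h z)"
      unfolding cusp_kernel_def norm_mult complex_mod_cnj norm_f_one[OF z] norm_of_real by simp
    also have "\<dots> \<le> K * (2 ^ (m * CARD('n)) * ?h z)"
      by (rule mult_right_mono[OF K[OF z]]) simp
    finally show ?thesis by (simp add: mult.assoc)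
  qed
  then show ?thesis
    by (intro Bochner_Integration.integrable_bound[OF integrable_mult_right[OF int, of "K * 2 ^ (m * CARD('n))"]
          cusp_kernel_measurable[OF f]] AE_I2) simp
qed

text \<open>Of the factor j^m conj(j)^m produced by (det y)^m, the part j^m is absorbed by the
  invariance of f and the part conj(j)^m by the slash action on \<open>f_one\<close>.\<close>

lemma cusp_kernel_act:
  assumes g: "g \<in> Sp_real" and z: "z \<in> siegel" and f: "slash m f g z = f z"
  shows "cusp_kernel m f (sp_act g z) = f z * cnj (slash m (f_one m) g z) * of_real (det (Im_matrix z) ^ m)"
proof -
  define j where "j = det (sp_den g z)"
  define w where "w = sp_act g z"
  note s = sp_act_siegel[OF g z, folded j_def w_def]
  have sl: "slash m u g z = inverse (j ^ m) * u w" for u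
    by (simp add: slash_def j_def w_def power_int_minus)
  have "of_real (det (Im_matrix z)) = of_real (det (Im_matrix w)) * (j * cnj j)"
    unfolding s(3)[symmetric] by (simp add: complex_norm_square[symmetric] del: of_real_power)
  then have Y: "of_real (det (Im_matrix z) ^ m) = of_real (det (Im_matrix w) ^ m) * (j ^ m * cnj j ^ m)"
    by (simp add: power_mult_distrib)
  show ?thesis
    unfolding w_def[symmetric] sl cusp_kernel_def Y f[symmetric, unfolded sl] using s(1) by (simp add: field_simps)
qed

context arith_group
begin

text \<open>Right multiplication by h permutes \<Gamma>.\<close>

lemma integral_orbit_invariant:
  fixes k :: "'n cmat \<Rightarrow> complex"
  assumes h: "h \<in> \<Gamma>" and z: "z \<in> siegel"
  shows "(\<integral>g. k (sp_act g (sp_act h z)) \<partial>count_space \<Gamma>) = (\<integral>g. k (sp_act g z) \<partial>count_space \<Gamma>)"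
proof -
  have bij: "bij_betw (\<lambda>g. g ** h) \<Gamma> \<Gamma>"
    by (rule bij_betw_byWitness[of _ "\<lambda>g. g ** matrix_inv h"])
       (auto simp: matrix_mul_assoc[symmetric] inv_mult[OF h] mult h inv)
  have "(\<integral>g. k (sp_act g (sp_act h z)) \<partial>count_space \<Gamma>) = (\<integral>g. k (sp_act (g ** h) z) \<partial>count_space \<Gamma>)"
    by (rule Bochner_Integration.integral_cong) (simp_all add: act_mult[OF _ h z])
  also have "\<dots> = (\<integral>g. k (sp_act g z) \<partial>count_space \<Gamma>)"
    using infsetsum_reindex_bij_betw[OF bij, of "\<lambda>g. k (sp_act g z)"] by (simp add: infsetsum_def)
  finally show ?thesis .
qed

lemma integral_orbit_measurable:
  fixes k :: "'n cmat \<Rightarrow> complex"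
  assumes k: "k \<in> borel_measurable siegel_measure"
  shows "(\<lambda>z. \<integral>g. k (sp_act g z) \<partial>count_space \<Gamma>) \<in> borel_measurable siegel_measure"
proof -
  interpret C: sigma_finite_measure "count_space \<Gamma>" by (rule sigma_finite_measure_count_space_countable[OF countable])
  have "(\<lambda>p. k (sp_act (fst p) (snd p))) \<in> borel_measurable (count_space \<Gamma> \<Otimes>\<^sub>M siegel_measure)"
    by (rule measurable_pair_measure_countable1[OF countable])
       (simp, rule measurable_compose[OF act_measurable k])
  from measurable_pair_swap[OF this]
  have "(\<lambda>(z, g). k (sp_act g z)) \<in> borel_measurable (siegel_measure \<Otimes>\<^sub>M count_space \<Gamma>)"
    by simp
  then show ?thesis by (rule C.borel_measurable_lebesgue_integral)
qed

lemma petersson_unfold: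
  assumes f: "f \<in> cusp_forms m \<Gamma>" and k: "integrable siegel_measure (cusp_kernel m f)"
  shows "petersson m \<Gamma> f (poincare_series m \<Gamma> (f_one m)) = (\<integral>z. cusp_kernel m f z \<partial>siegel_measure)"
proof -
  obtain F where F: "F \<in> sets siegel_measure" "\<And>z. z \<in> siegel \<Longrightarrow> \<exists>!w. w \<in> F \<and> w \<in> orbit z"
    by (rule fundamental_domain) (rule that)
  define \<psi> where "\<psi> z = f z * cnj (poincare_series m \<Gamma> (f_one m) z) * of_real (det (Im_matrix z) ^ m)" for z
  have eq: "\<psi> z = (\<integral>g. cusp_kernel m f (sp_act g z) \<partial>count_space \<Gamma>)" if z: "z \<in> siegel" for z
  proof -
    have "(\<integral>g. cusp_kernel m f (sp_act g z) \<partial>count_space \<Gamma>) =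
        (\<integral>g. f z * cnj (slash m (f_one m) g z) * of_real (det (Im_matrix z) ^ m) \<partial>count_space \<Gamma>)"
      by (rule Bochner_Integration.integral_cong)
         (use cusp_kernel_act[OF real z] f z in \<open>simp_all add: cusp_forms_def\<close>)
    then show ?thesis
      by (simp only: \<psi>_def poincare_series_def infsum_eq_integral_count_space integral_mult_left_zero
          integral_mult_right_zero Bochner_Integration.integral_cnj)
  qed
  have meas: "\<psi> \<in> borel_measurable siegel_measure"
    using integral_orbit_measurable[of "cusp_kernel m f"] k
    by (subst measurable_cong[where g = "\<lambda>z. \<integral>g. cusp_kernel m f (sp_act g z) \<partial>count_space \<Gamma>"]) (auto simp: eq)
  have inva: "\<psi> (sp_act g z) = \<psi> z" if "g \<in> \<Gamma>" "z \<in> siegel" for g z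
    using that integral_orbit_invariant[OF that] by (simp add: eq act_mem)
  have "(\<integral>orb. \<psi> (SOME z. z \<in> orb) \<partial>siegel_quotient_measure \<Gamma>) = (\<integral>z. \<psi> z \<partial>restrict_space siegel_measure F)"
    by (rule integral_quotient[OF F meas inva])
  also have "\<dots> = (\<integral>z. (\<integral>g. cusp_kernel m f (sp_act g z) \<partial>count_space \<Gamma>) \<partial>restrict_space siegel_measure F)"
    by (rule Bochner_Integration.integral_cong) (auto simp: space_restrict_space eq)
  also have "\<dots> = of_nat stab_order * (\<integral>z. cusp_kernel m f z \<partial>siegel_measure)"
    by (rule integral_unfold[OF F k])
  finally show ?thesis
    using stab_order_pos by (simp add: petersson_def Let_def stab_order_def[symmetric] \<psi>_def)
qed

end

lemma congruence_subgroup_arith: "congruence_subgroup \<Gamma> \<Longrightarrow> arith_group \<Gamma>"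
  unfolding congruence_subgroup_def arith_group_def by blast

subsection \<open>Gamma integrals\<close>

lemma nn_integral_Gamma:
  assumes x: "x > 0" and s: "s > 0"
  shows "(\<integral>\<^sup>+t. ennreal (t powr (x - 1) * exp (- s * t)) * indicator {0<..} t \<partial>lborel) =
    ennreal (Gamma x * s powr (- x))"
proof -
  have G: "(\<integral>\<^sup>+t. ennreal (t powr (x - 1) / exp t) * indicator {0..} t \<partial>lborel) = ennreal (Gamma x)"
    by (rule nn_integral_has_integral_lebesgue'[OF _ Gamma_integral_real[OF x]]) auto
  have "(\<integral>\<^sup>+t. ennreal (t powr (x - 1) / exp t) * indicator {0..} t \<partial>lborel) =
    ennreal \<bar>s\<bar> * (\<integral>\<^sup>+t. ennreal ((0 + s * t) powr (x - 1) / exp (0 + s * t)) * indicator {0..} (0 + s * t) \<partial>lborel)"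
    by (rule nn_integral_real_affine) (use s in auto)
  also have "\<dots> = ennreal s * (\<integral>\<^sup>+t. ennreal (s powr (x - 1)) * (ennreal (t powr (x - 1) * exp (- s * t)) * indicator {0<..} t) \<partial>lborel)"
  proof -
    have "ennreal ((0 + s * t) powr (x - 1) / exp (0 + s * t)) * indicator {0..} (0 + s * t) =
      ennreal (s powr (x - 1)) * (ennreal (t powr (x - 1) * exp (- s * t)) * indicator {0<..} t)" for t
    proof (cases "t > 0")
      case True
      then show ?thesis using s
        by (simp add: powr_mult exp_minus divide_inverse ennreal_mult[symmetric] mult_ac)
    next
      case False
      then show ?thesis using s by (cases "t = 0") (auto simp: zero_le_mult_iff)
    qed
    then show ?thesis using s by simp
  qed
  also have "\<dots> = ennreal (s powr x) * (\<integral>\<^sup>+t. ennreal (t powr (x - 1) * exp (- s * t)) * indicator {0<..} t \<partial>lborel)"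
  proof -
    have "s * s powr (x - 1) = s powr x" using s by (simp add: powr_mult_base)
    then show ?thesis
      using s by (subst nn_integral_cmult) (auto simp: mult.assoc[symmetric] ennreal_mult[symmetric])
  qed
  finally have e: "ennreal (Gamma x) = ennreal (s powr x) * (\<integral>\<^sup>+t. ennreal (t powr (x - 1) * exp (- s * t)) * indicator {0<..} t \<partial>lborel)"
    using G by simp
  have "ennreal (Gamma x * s powr (- x)) = ennreal (s powr (- x)) * ennreal (Gamma x)"
    using x by (subst ennreal_mult[symmetric]) (auto simp: mult.commute)
  also have "\<dots> = ennreal (s powr (- x) * s powr x) * (\<integral>\<^sup>+t. ennreal (t powr (x - 1) * exp (- s * t)) * indicator {0<..} t \<partial>lborel)"
    unfolding e by (simp add: ennreal_mult mult.assoc)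
  also have "s powr (- x) * s powr x = 1" using s by (simp add: powr_add[symmetric])
  finally show ?thesis by simp
qed

text \<open>A power as a Laplace transform. Inserting it and exchanging integrals reduces the Beta
  and quadratic integrals below to Gamma and Gauss integrals.\<close>

lemma powr_as_Gamma_integral:
  assumes x: "x > 0" and s: "s > 0"
  shows "ennreal (s powr (- x)) =
    ennreal (1 / Gamma x) * (\<integral>\<^sup>+t. ennreal (t powr (x - 1) * exp (- s * t)) * indicator {0<..} t \<partial>lborel)"
proof -
  have "Gamma x \<noteq> 0" using Gamma_real_pos[OF x] by linarith
  then show ?thesis
    unfolding nn_integral_Gamma[OF assms] using x
    by (subst ennreal_mult[symmetric]) (auto intro!: less_imp_le Gamma_real_pos)
qed

lemma nn_integral_Beta_half_line:
  assumes a: "a > - 1" and ab: "b - a - 1 > 0" and c: "c > 0"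
  shows "(\<integral>\<^sup>+s. ennreal (s powr a * (s + c) powr (- b)) * indicator {0<..} s \<partial>lborel) =
    ennreal (Gamma (a + 1) * Gamma (b - a - 1) / Gamma b * c powr (a + 1 - b))"
proof -
  have b: "b > 0" using a ab by linarith
  let ?g = "\<lambda>s t. ennreal (1 / Gamma b) * (ennreal (s powr a) * ennreal (t powr (b - 1) * exp (- (s + c) * t))) * indicator {0<..} t * indicator {0<..} s"
  have "(\<integral>\<^sup>+s. ennreal (s powr a * (s + c) powr (- b)) * indicator {0<..} s \<partial>lborel) =
    (\<integral>\<^sup>+s. \<integral>\<^sup>+t. ?g s t \<partial>lborel \<partial>lborel)"
  proof (rule nn_integral_cong)
    fix s :: real
    show "ennreal (s powr a * (s + c) powr (- b)) * indicator {0<..} s = (\<integral>\<^sup>+t. ?g s t \<partial>lborel)"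
    proof (cases "s > 0")
      case True
      have "ennreal (s powr a * (s + c) powr (- b)) = ennreal (s powr a) * ennreal ((s + c) powr (- b))"
        by (simp add: ennreal_mult)
      also have "ennreal ((s + c) powr (- b)) = ennreal (1 / Gamma b) * (\<integral>\<^sup>+t. ennreal (t powr (b - 1) * exp (- (s + c) * t)) * indicator {0<..} t \<partial>lborel)"
        by (rule powr_as_Gamma_integral[OF b]) (use True c in simp)
      also have "ennreal (s powr a) * (ennreal (1 / Gamma b) * (\<integral>\<^sup>+t. ennreal (t powr (b - 1) * exp (- (s + c) * t)) * indicator {0<..} t \<partial>lborel)) =
         (\<integral>\<^sup>+t. ennreal (s powr a) * (ennreal (1 / Gamma b) * (ennreal (t powr (b - 1) * exp (- (s + c) * t)) * indicator {0<..} t)) \<partial>lborel)"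
        by (simp add: nn_integral_cmult)
      finally show ?thesis using True by (simp add: mult_ac)
    qed simp
  qed
  also have "\<dots> = (\<integral>\<^sup>+t. \<integral>\<^sup>+s. ?g s t \<partial>lborel \<partial>lborel)"
    by (rule lborel_pair.Fubini') measurable
  also have "\<dots> = (\<integral>\<^sup>+t. ennreal (1 / Gamma b * Gamma (a + 1)) * (ennreal (t powr ((b - a - 1) - 1) * exp (- c * t)) * indicator {0<..} t) \<partial>lborel)"
  proof (rule nn_integral_cong)
    fix t :: real
    show "(\<integral>\<^sup>+s. ?g s t \<partial>lborel) = ennreal (1 / Gamma b * Gamma (a + 1)) * (ennreal (t powr ((b - a - 1) - 1) * exp (- c * t)) * indicator {0<..} t)"
    proof (cases "t > 0")
      case True
      have G: "(\<integral>\<^sup>+s. ennreal (s powr (a + 1 - 1) * exp (- t * s)) * indicator {0<..} s \<partial>lborel) = ennreal (Gamma (a + 1) * t powr (- (a + 1)))"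
        by (rule nn_integral_Gamma) (use a True in auto)
      have "(\<integral>\<^sup>+s. ?g s t \<partial>lborel) = (\<integral>\<^sup>+s. ennreal (1 / Gamma b * (t powr (b - 1) * exp (- c * t))) * (ennreal (s powr (a + 1 - 1) * exp (- t * s)) * indicator {0<..} s) \<partial>lborel)"
      proof (rule nn_integral_cong)
        fix s :: real
        have E: "exp (- (s + c) * t) = exp (- c * t) * exp (- t * s)"
          unfolding exp_add[symmetric] by (simp add: algebra_simps)
        have G0: "0 \<le> 1 / Gamma b" using Gamma_real_pos[OF b] by simp
        show "?g s t = ennreal (1 / Gamma b * (t powr (b - 1) * exp (- c * t))) * (ennreal (s powr (a + 1 - 1) * exp (- t * s)) * indicator {0<..} s)"
          unfolding E using True G0
          by (simp only: ennreal_mult mult_nonneg_nonneg powr_ge_zero exp_ge_zero)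
             (simp add: mult_ac)
      qed
      also have "\<dots> = ennreal (1 / Gamma b * (t powr (b - 1) * exp (- c * t))) * ennreal (Gamma (a + 1) * t powr (- (a + 1)))"
        by (subst nn_integral_cmult, measurable) (simp only: G)
      also have "\<dots> = ennreal (1 / Gamma b * Gamma (a + 1) * (t powr (b - 1) * t powr (- (a + 1)) * exp (- c * t)))"
        using Gamma_real_pos[OF b] Gamma_real_pos[of "a + 1"] a by (subst ennreal_mult[symmetric]) (auto simp: mult_ac)
      also have "t powr (b - 1) * t powr (- (a + 1)) = t powr ((b - a - 1) - 1)"
        by (simp add: powr_add[symmetric] algebra_simps)
      finally show ?thesis using True Gamma_real_pos[OF b] Gamma_real_pos[of "a + 1"] a
        by (simp add: ennreal_mult[symmetric])
    qed simp
  qed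
  also have "\<dots> = ennreal (1 / Gamma b * Gamma (a + 1)) * ennreal (Gamma (b - a - 1) * c powr (- (b - a - 1)))"
    by (subst nn_integral_cmult, measurable) (simp only: nn_integral_Gamma[OF ab c])
  also have "\<dots> = ennreal (Gamma (a + 1) * Gamma (b - a - 1) / Gamma b * c powr (a + 1 - b))"
    using Gamma_real_pos[OF b] Gamma_real_pos[of "a + 1"] a Gamma_real_pos[OF ab]
    by (subst ennreal_mult[symmetric]) (auto simp: mult_ac algebra_simps)
  finally show ?thesis .
qed

lemma nn_integral_gaussian:
  assumes x: "x > 0"
  shows "(\<integral>\<^sup>+t. ennreal (exp (- x * t\<^sup>2)) \<partial>lborel) = ennreal (sqrt (pi / x))"
proof -
  \<comment> \<open>The variance 1/(2x) makes the centred normal density proportional to exp(-x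
    t^2), so its total mass 1 gives the value.\<close>
  define \<sigma> where "\<sigma> = 1 / sqrt (2 * x)"
  have s: "\<sigma> > 0" "\<sigma>\<^sup>2 = 1 / (2 * x)" using x by (simp_all add: \<sigma>_def power_divide)
  have d: "normal_density 0 \<sigma> t = 1 / sqrt (pi / x) * exp (- x * t\<^sup>2)" for t
    unfolding normal_density_def s(2) using x by (simp add: field_simps)
  interpret prob_space "density lborel (normal_density 0 \<sigma>)" by (rule prob_space_normal_density[OF s(1)])
  have "1 = (\<integral>\<^sup>+t. ennreal (normal_density 0 \<sigma> t) \<partial>lborel)"
    using emeasure_space_1 by (subst (asm) emeasure_density) auto
  also have "\<dots> = ennreal (1 / sqrt (pi / x)) * (\<integral>\<^sup>+t. ennreal (exp (- x * t\<^sup>2)) \<partial>lborel)"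
  proof -
    have "ennreal (normal_density 0 \<sigma> t) = ennreal (1 / sqrt (pi / x)) * ennreal (exp (- x * t\<^sup>2))" for t
      unfolding d using x by (intro ennreal_mult) auto
    then show ?thesis by (simp add: nn_integral_cmult)
  qed
  finally have "ennreal (sqrt (pi / x)) * 1 = ennreal (sqrt (pi / x)) * (ennreal (1 / sqrt (pi / x)) * (\<integral>\<^sup>+t. ennreal (exp (- x * t\<^sup>2)) \<partial>lborel))"
    by simp
  also have "\<dots> = (\<integral>\<^sup>+t. ennreal (exp (- x * t\<^sup>2)) \<partial>lborel)"
    using x by (simp add: mult.assoc[symmetric] ennreal_mult[symmetric])
  finally show ?thesis by simp
qed

text \<open>The integral of (1 + t^2)^(-p) over the real line, for p > 1/2.\<close>

definition quad_const :: "real \<Rightarrow> real" where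
  "quad_const p = sqrt pi * Gamma (p - 1 / 2) / Gamma p"

lemma nn_integral_quadratic_powr:
  assumes p: "p > 1 / 2" and q: "q > 0" and v: "v > 0"
  shows "(\<integral>\<^sup>+t. ennreal ((q * t\<^sup>2 + v) powr (- p)) \<partial>lborel) = ennreal (quad_const p * q powr (- 1 / 2) * v powr (1 / 2 - p))"
proof -
  have p0: "p > 0" using p by simp
  let ?g = "\<lambda>t x. ennreal (1 / Gamma p) * (ennreal (x powr (p - 1) * exp (- (q * t\<^sup>2 + v) * x)) * indicator {0<..} x)"
  have pos: "q * t\<^sup>2 + v > 0" for t using q v by (simp add: add_nonneg_pos)
  have "(\<integral>\<^sup>+t. ennreal ((q * t\<^sup>2 + v) powr (- p)) \<partial>lborel) = (\<integral>\<^sup>+t. \<integral>\<^sup>+x. ?g t x \<partial>lborel \<partial>lborel)"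
    by (rule nn_integral_cong, subst powr_as_Gamma_integral[OF p0 pos]) (subst nn_integral_cmult, auto)
  also have "\<dots> = (\<integral>\<^sup>+x. \<integral>\<^sup>+t. ?g t x \<partial>lborel \<partial>lborel)"
    by (rule lborel_pair.Fubini') measurable
  also have "\<dots> = (\<integral>\<^sup>+x. ennreal (1 / Gamma p * sqrt (pi / q)) * (ennreal (x powr ((p - 1 / 2) - 1) * exp (- v * x)) * indicator {0<..} x) \<partial>lborel)"
  proof (rule nn_integral_cong)
    fix x :: real
    show "(\<integral>\<^sup>+t. ?g t x \<partial>lborel) = ennreal (1 / Gamma p * sqrt (pi / q)) * (ennreal (x powr ((p - 1 / 2) - 1) * exp (- v * x)) * indicator {0<..} x)"
    proof (cases "x > 0")
      case True
      have "(\<integral>\<^sup>+t. ?g t x \<partial>lborel) = (\<integral>\<^sup>+t. ennreal (1 / Gamma p * x powr (p - 1) * exp (- v * x)) * ennreal (exp (- (q * x) * t\<^sup>2)) \<partial>lborel)"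
      proof (rule nn_integral_cong)
        fix t :: real
        have E: "exp (- (q * t\<^sup>2 + v) * x) = exp (- v * x) * exp (- (q * x) * t\<^sup>2)"
          unfolding exp_add[symmetric] by (simp add: algebra_simps)
        have G0: "0 \<le> 1 / Gamma p" using Gamma_real_pos[OF p0] by simp
        show "?g t x = ennreal (1 / Gamma p * x powr (p - 1) * exp (- v * x)) * ennreal (exp (- (q * x) * t\<^sup>2))"
          unfolding E using True G0
          by (simp only: ennreal_mult mult_nonneg_nonneg powr_ge_zero exp_ge_zero)
             (simp add: mult_ac)
      qed
      also have "\<dots> = ennreal (1 / Gamma p * x powr (p - 1) * exp (- v * x)) * ennreal (sqrt (pi / (q * x)))"
        by (subst nn_integral_cmult, measurable, subst nn_integral_gaussian) (use q True in auto)
      also have "\<dots> = ennreal (1 / Gamma p * sqrt (pi / q) * (x powr (p - 1) * x powr (- 1 / 2) * exp (- v * x)))"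
      proof -
        have "sqrt (pi / (q * x)) = sqrt (pi / q) * x powr (- 1 / 2)"
          using True q by (simp add: real_sqrt_divide real_sqrt_mult powr_minus powr_half_sqrt field_simps)
        then show ?thesis
          using Gamma_real_pos[OF p0] by (subst ennreal_mult[symmetric]) (auto simp: mult_ac q less_imp_le)
      qed
      also have "x powr (p - 1) * x powr (- 1 / 2) = x powr ((p - 1 / 2) - 1)"
        by (simp add: powr_add[symmetric] algebra_simps)
      finally show ?thesis using True Gamma_real_pos[OF p0] q by (simp add: ennreal_mult[symmetric])
    qed simp
  qed
  also have "\<dots> = ennreal (1 / Gamma p * sqrt (pi / q)) * ennreal (Gamma (p - 1 / 2) * v powr (- (p - 1 / 2)))"
    by (subst nn_integral_cmult, measurable, subst nn_integral_Gamma) (use p v in auto)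
  also have "\<dots> = ennreal (quad_const p * q powr (- 1 / 2) * v powr (1 / 2 - p))"
  proof -
    have "sqrt (pi / q) = sqrt pi * q powr (- 1 / 2)"
      using q by (simp add: real_sqrt_divide powr_minus powr_half_sqrt field_simps)
    then show ?thesis
      using Gamma_real_pos[OF p0] Gamma_real_pos[of "p - 1 / 2"] p q
      by (subst ennreal_mult[symmetric]) (auto simp: quad_const_def mult_ac)
  qed
  finally show ?thesis .
qed

subsection \<open>Bordered matrices\<close>

text \<open>Row and column k of Z are overwritten instead of a new index being added, so the matrix
  type stays fixed through the inductions. In use, row k of Z is a placeholder, a multiple of the
  unit vector.\<close>

definition bordered :: "'n::finite \<Rightarrow> 'a^'n^'n \<Rightarrow> 'a^'n \<Rightarrow> 'a \<Rightarrow> 'a^'n^'n" where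
  "bordered k Z u t = (\<chi> i j. if i = k then (if j = k then t else u $ j) else if j = k then u $ i else Z $ i $ j)"

text \<open>Bilinear also over the complex numbers: Schur complements of symmetric complex matrices
  involve no conjugation.\<close>

definition dot :: "'a::comm_ring_1^'n \<Rightarrow> 'a^'n \<Rightarrow> 'a" where
  "dot u v = (\<Sum>i\<in>UNIV. u $ i * v $ i)"

lemma dot_real: "dot u v = u \<bullet> (v :: real^'n)"
  by (simp add: dot_def inner_vec_def)

lemma sum_split_index:
  fixes f :: "'n::finite \<Rightarrow> 'a::comm_monoid_add"
  shows "sum f UNIV = f k + sum f (UNIV - {k})"
  by (simp add: sum.remove)

lemma transpose_nth: "transpose A = A \<Longrightarrow> A $ i $ j = A $ j $ i"
  by (drule arg_cong[of _ _ "\<lambda>M. M $ j $ i"]) (simp add: transpose_def)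

lemma inv_vec_row:
  fixes Z :: "'a::field^'n^'n"
  assumes d: "det Z \<noteq> 0" and row: "\<And>j. Z $ i $ j = (if i = j then c else 0)" and c: "c \<noteq> 0"
  shows "(matrix_inv Z *v u) $ i = u $ i / c"
proof -
  have "Z *v (matrix_inv Z *v u) = u" by (simp add: matrix_vector_mul_assoc matrix_inv_right[OF d])
  then have "(\<Sum>j\<in>UNIV. Z $ i $ j * (matrix_inv Z *v u) $ j) = u $ i"
    by (metis (no_types, lifting) matrix_vector_mult_def sum.cong vec_lambda_beta)
  then have "c * (matrix_inv Z *v u) $ i = u $ i" by (simp add: row mult_delta_left)
  then show ?thesis using c by (simp add: field_simps)
qed

text \<open>Schur complement. The bordered matrix is L P L^T, where L is the identity plus \<eta> =
  Z^(-1) u in row k and P is Z with its corner c replaced by t - u \<eta>. The determinant of L is 1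
  because \<eta>_k = 0.\<close>

lemma det_bordered:
  fixes Z :: "'a::field^'n^'n"
  assumes sym: "transpose Z = Z" and d: "det Z \<noteq> 0"
    and row: "\<And>j. Z $ k $ j = (if k = j then c else 0)" and c: "c \<noteq> 0" and u: "u $ k = 0"
  shows "det (bordered k Z u t) * c = det Z * (t - dot u (matrix_inv Z *v u))"
proof -
  define \<eta> where "\<eta> = matrix_inv Z *v u"
  have Z\<eta>: "Z *v \<eta> = u" by (simp add: \<eta>_def matrix_vector_mul_assoc matrix_inv_right[OF d])
  have \<eta>k: "\<eta> $ k = 0" unfolding \<eta>_def using inv_vec_row[OF d row c] u by simp
  have col: "Z $ i $ k = (if i = k then c else 0)" for i
    using row[of i] transpose_nth[OF sym, of k i] by auto
  define \<sigma> where "\<sigma> = t - dot u \<eta>"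
  define L where "L = (\<chi> i j. (if i = j then 1 else 0) + (if i = k then \<eta> $ j else 0))"
  define D where "D = (\<chi> i j. if i = j then (if i = k then \<sigma> / c else 1) else 0)"
  define P where "P = (\<chi> i j. if i = k \<and> j = k then \<sigma> else Z $ i $ j)"
  have "transpose L = (\<chi> i j. if j = k then (mat 1 *v (\<chi> a. (if a = k then 1 else 0) + \<eta> $ a)) $ i else mat 1 $ i $ j)"
    unfolding matrix_vector_mul_lid by (auto simp: L_def transpose_def mat_def vec_eq_iff)
  then have "det (transpose L) = (\<chi> a. (if a = k then 1 else 0) + \<eta> $ a) $ k * det (mat 1 :: 'a^'n^'n)"
    by (simp only: cramer_lemma)
  then have dL: "det L = 1" by (simp add: \<eta>k)
  have "P = Z ** D"
  proof -
    have "(Z ** D) $ i $ j = Z $ i $ j * (if j = k then \<sigma> / c else 1)" for i j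
    proof -
      have "Z $ i $ a * D $ a $ j = (if a = j then Z $ i $ j * (if j = k then \<sigma> / c else 1) else 0)" for a
        by (simp add: D_def)
      then show ?thesis by (simp add: matrix_matrix_mult_def)
    qed
    then show ?thesis using c by (simp add: vec_eq_iff P_def col)
  qed
  moreover have "det D = \<sigma> / c"
    by (subst det_diagonal) (auto simp: D_def)
  ultimately have dP: "det P = det Z * (\<sigma> / c)" by (simp add: det_mul)
  have P\<eta>: "(\<Sum>b\<in>UNIV. P $ a $ b * \<eta> $ b) = u $ a" for a
  proof -
    have "(\<Sum>b\<in>UNIV. P $ a $ b * \<eta> $ b) = (\<Sum>b\<in>UNIV. Z $ a $ b * \<eta> $ b)"
      by (intro sum.cong) (auto simp: P_def \<eta>k)
    then show ?thesis using Z\<eta> by (simp add: matrix_vector_mult_def vec_eq_iff)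
  qed
  have Psym: "P $ i $ j = P $ j $ i" for i j using transpose_nth[OF sym, of i j] by (auto simp: P_def)
  have R: "(P ** transpose L) $ a $ j = P $ a $ j + (if j = k then u $ a else 0)" for a j
  proof -
    have "(P ** transpose L) $ a $ j = (\<Sum>b\<in>UNIV. (if j = b then P $ a $ b else 0) + (if j = k then P $ a $ b * \<eta> $ b else 0))"
      unfolding matrix_matrix_mult_def transpose_def L_def by (auto intro!: sum.cong simp: distrib_left)
    then show ?thesis using P\<eta>[of a] by (simp add: sum.distrib)
  qed
  have "(L ** (P ** transpose L)) $ i $ j = bordered k Z u t $ i $ j" for i j
  proof -
    have "(L ** (P ** transpose L)) $ i $ j = (\<Sum>a\<in>UNIV. L $ i $ a * (P $ a $ j + (if j = k then u $ a else 0)))"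
      by (subst matrix_matrix_mult_def) (simp add: R)
    also have "\<dots> = (\<Sum>a\<in>UNIV. (if i = a then P $ a $ j + (if j = k then u $ a else 0) else 0) +
         (if i = k then P $ j $ a * \<eta> $ a + (if j = k then u $ a * \<eta> $ a else 0) else 0))"
      by (rule sum.cong[OF refl]) (auto simp: L_def algebra_simps Psym[of _ j])
    also have "\<dots> = P $ i $ j + (if j = k then u $ i else 0) + (if i = k then u $ j + (if j = k then dot u \<eta> else 0) else 0)"
      by (simp add: sum.distrib P\<eta> dot_def)
    also have "\<dots> = bordered k Z u t $ i $ j"
      using row col by (auto simp: bordered_def P_def \<sigma>_def u)
    finally show ?thesis .
  qed
  then have "bordered k Z u t = L ** (P ** transpose L)" by (simp add: vec_eq_iff)
  then have "det (bordered k Z u t) = det Z * (\<sigma> / c)" by (simp add: det_mul dL dP)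
  then show ?thesis using c by (simp add: \<sigma>_def \<eta>_def)
qed

text \<open>Completing the square in the direction of \<eta> = Y^(-1) u; the coefficient of s^2 that
  remains is the Schur complement.\<close>

lemma bordered_quadratic:
  fixes Y :: "real^'n^'n"
  assumes sym: "transpose Y = Y" and Y\<eta>: "Y *v \<eta> = u" and u: "u $ k = 0" and \<eta>: "\<eta> $ k = 0" and w: "w $ k = 0"
    and row: "\<And>j. Y $ k $ j = (if k = j then 1 else 0)"
  shows "(w + axis k s) \<bullet> (bordered k Y u t *v (w + axis k s)) =
    (w + s *\<^sub>R \<eta>) \<bullet> (Y *v (w + s *\<^sub>R \<eta>)) + (t - u \<bullet> \<eta>) * s\<^sup>2"
proof -
  have b: "bordered k Y u t *v (w + axis k s) = Y *v w + s *\<^sub>R u + axis k (u \<bullet> w + s * t)"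
  proof -
    have "(bordered k Y u t *v (w + axis k s)) $ i = (Y *v w + s *\<^sub>R u + axis k (u \<bullet> w + s * t)) $ i" for i
    proof (cases "i = k")
      case True
      have Yw: "(Y *v w) $ k = 0" using w by (simp add: matrix_vector_mult_def row mult_delta_left)
      have "(bordered k Y u t *v (w + axis k s)) $ k = t * s + (\<Sum>j\<in>UNIV - {k}. u $ j * w $ j)"
        unfolding matrix_vector_mult_def
        by (simp add: sum_split_index[of _ k] bordered_def axis_def w)
      also have "(\<Sum>j\<in>UNIV - {k}. u $ j * w $ j) = u \<bullet> w"
        by (simp add: inner_vec_def sum_split_index[of _ k] w)
      finally show ?thesis using True Yw u by simp
    next
      case False
      have "(bordered k Y u t *v (w + axis k s)) $ i = u $ i * s + (\<Sum>j\<in>UNIV - {k}. Y $ i $ j * w $ j)"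
        unfolding matrix_vector_mult_def using False
        by (simp add: sum_split_index[of _ k] bordered_def axis_def w)
      also have "(\<Sum>j\<in>UNIV - {k}. Y $ i $ j * w $ j) = (Y *v w) $ i"
        by (simp add: matrix_vector_mult_def sum_split_index[of _ k] w)
      finally show ?thesis using False by (simp add: axis_def)
    qed
    then show ?thesis by (simp add: vec_eq_iff)
  qed
  have Yw: "(Y *v w) $ k = 0" using w by (simp add: matrix_vector_mult_def row mult_delta_left)
  have \<eta>Yw: "\<eta> \<bullet> (Y *v w) = u \<bullet> w"
    using sym Y\<eta> by (metis dot_lmul_matrix inner_commute transpose_matrix_vector vector_transpose_matrix)
  show ?thesis
    unfolding b
    unfolding matrix_vector_right_distrib matrix_vector_mult_scaleR Y\<eta>
    using \<eta>Yw w u Yw \<eta>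
    by (simp add: inner_add_left inner_add_right inner_axis inner_axis' algebra_simps power2_eq_square inner_commute)
qed

text \<open>Encodes a matrix of size S as a full-size one. Determinant and inverse then agree with
  those of the S-block, up to the units outside.\<close>

definition unit_outside :: "'n set \<Rightarrow> real^'n^'n \<Rightarrow> bool" where
  "unit_outside S Y \<longleftrightarrow> (\<forall>i j. i \<notin> S \<or> j \<notin> S \<longrightarrow> Y $ i $ j = (if i = j then 1 else 0))"

lemma pos_def_sym: "pos_def_matrix Y \<Longrightarrow> transpose Y = Y"
  by (simp add: pos_def_matrix_def)

lemma pos_defD: "pos_def_matrix Y \<Longrightarrow> v \<noteq> 0 \<Longrightarrow> v \<bullet> (Y *v v) > 0"
  by (simp add: pos_def_matrix_def)

lemma pos_def_nonneg: "pos_def_matrix Y \<Longrightarrow> v \<bullet> (Y *v v) \<ge> 0"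
  using pos_defD[of Y v] by (cases "v = 0") auto

lemma pos_def_inverse:
  assumes "pos_def_matrix Y"
  shows "pos_def_matrix (matrix_inv Y)"
proof -
  have d: "det Y \<noteq> 0" using pos_def_det_pos[OF assms] by simp
  have "v \<bullet> (matrix_inv Y *v v) > 0" if "v \<noteq> 0" for v
  proof -
    define x where "x = matrix_inv Y *v v"
    have v: "Y *v x = v" by (simp add: x_def matrix_vector_mul_assoc matrix_inv_right[OF d])
    then have "x \<noteq> 0" using that by auto
    from pos_defD[OF assms this] show ?thesis using v by (simp add: x_def inner_commute)
  qed
  then show ?thesis
    using assms d by (simp add: pos_def_matrix_def transpose_matrix_inv)
qed

lemma vec_split:
  fixes x :: "real^'n"
  shows "\<exists>w. w $ k = 0 \<and> x = w + axis k (x $ k)"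
  by (intro exI[of _ "\<chi> i. if i = k then 0 else x $ i"]) (auto simp: vec_eq_iff axis_def)

text \<open>Schur's criterion. After completing the square, the form is a sum of the form of Y and
  the Schur complement times the square of the k-th coordinate.\<close>

lemma bordered_pos_def_iff:
  fixes Y :: "real^'n^'n"
  assumes sym: "transpose Y = Y" and u: "u $ k = 0" and row: "\<And>j. Y $ k $ j = (if k = j then 1 else 0)"
  shows "pos_def_matrix (bordered k Y u t) \<longleftrightarrow> pos_def_matrix Y \<and> t - u \<bullet> (matrix_inv Y *v u) > 0"
proof
  assume b: "pos_def_matrix (bordered k Y u t)"
  have Yw: "w \<bullet> (Y *v w) = w \<bullet> (bordered k Y u t *v w)" if "w $ k = 0" for w
  proof -
    have "w $ i * (Y *v w) $ i = w $ i * (bordered k Y u t *v w) $ i" for i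
    proof (cases "i = k")
      case False
      then have "(Y *v w) $ i = (bordered k Y u t *v w) $ i"
        unfolding matrix_vector_mult_def using that by (auto intro!: sum.cong simp: bordered_def)
      then show ?thesis by simp
    qed (use that in simp)
    then show ?thesis by (simp only: inner_vec_def inner_real_def)
  qed
  have pY: "pos_def_matrix Y"
    unfolding pos_def_matrix_def
  proof (intro conjI allI impI sym)
    fix x :: "real^'n" assume x: "x \<noteq> 0"
    obtain w where w: "w $ k = 0" "x = w + axis k (x $ k)" using vec_split by blast
    have Yax: "Y *v axis k s = axis k s" for s
    proof -
      have "(Y *v axis k s) $ i = axis k s $ i" for i
        using transpose_nth[OF sym, of i k]
        by (simp add: matrix_vector_mult_def axis_def row if_distrib cong: if_cong)
      then show ?thesis by (simp add: vec_eq_iff)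
    qed
    have Ywk: "(Y *v w) $ k = 0" using w(1) by (simp add: matrix_vector_mult_def row mult_delta_left)
    have "x \<bullet> (Y *v x) = w \<bullet> (Y *v w) + (x $ k)\<^sup>2"
      by (subst (1 2) w(2))
         (simp add: matrix_vector_right_distrib Yax inner_add_left inner_add_right inner_axis inner_axis' w(1) Ywk power2_eq_square)
    moreover have "w \<bullet> (Y *v w) \<ge> 0" using Yw[OF w(1)] pos_def_nonneg[OF b] by simp
    moreover have "w \<bullet> (Y *v w) > 0" if "x $ k = 0"
    proof -
      have "w \<noteq> 0" using that w(2) x by auto
      then show ?thesis using Yw[OF w(1)] pos_defD[OF b] by simp
    qed
    ultimately show "x \<bullet> (Y *v x) > 0"
      by (cases "x $ k = 0") (auto intro: add_nonneg_pos)
  qed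
  have d: "det Y \<noteq> 0" using pos_def_det_pos[OF pY] by simp
  define \<eta> where "\<eta> = matrix_inv Y *v u"
  have Y\<eta>: "Y *v \<eta> = u" by (simp add: \<eta>_def matrix_vector_mul_assoc matrix_inv_right[OF d])
  have \<eta>k: "\<eta> $ k = 0" using inv_vec_row[OF d row, of u] u by (simp add: \<eta>_def)
  \<comment> \<open>This vector makes the completed square vanish, so the form takes the Schur
    complement as its value.\<close>
  have "(- \<eta> + axis k 1) \<bullet> (bordered k Y u t *v (- \<eta> + axis k 1)) = t - u \<bullet> \<eta>"
    by (subst bordered_quadratic[OF sym Y\<eta> u \<eta>k _ row]) (auto simp: \<eta>k)
  moreover have "- \<eta> + axis k 1 \<noteq> 0" using \<eta>k by (metis axis_nth add_0 neg_0_equal_iff_equal vector_add_component vector_uminus_component zero_index zero_neq_one)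
  ultimately show "pos_def_matrix Y \<and> t - u \<bullet> (matrix_inv Y *v u) > 0"
    using pY pos_defD[OF b] \<eta>_def by metis
next
  assume a: "pos_def_matrix Y \<and> t - u \<bullet> (matrix_inv Y *v u) > 0"
  then have pY: "pos_def_matrix Y" by simp
  have d: "det Y \<noteq> 0" using pos_def_det_pos[OF pY] by simp
  define \<eta> where "\<eta> = matrix_inv Y *v u"
  have Y\<eta>: "Y *v \<eta> = u" by (simp add: \<eta>_def matrix_vector_mul_assoc matrix_inv_right[OF d])
  have \<eta>k: "\<eta> $ k = 0" using inv_vec_row[OF d row, of u] u by (simp add: \<eta>_def)
  have \<sigma>: "t - u \<bullet> \<eta> > 0" using a by (simp add: \<eta>_def)
  have bs: "transpose (bordered k Y u t) = bordered k Y u t"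
    using transpose_nth[OF sym] by (auto simp: bordered_def transpose_def vec_eq_iff)
  show "pos_def_matrix (bordered k Y u t)"
    unfolding pos_def_matrix_def
  proof (intro conjI allI impI bs)
    fix x :: "real^'n" assume x: "x \<noteq> 0"
    obtain w where w: "w $ k = 0" "x = w + axis k (x $ k)" using vec_split by blast
    have "x \<bullet> (bordered k Y u t *v x) = (w + x $ k *\<^sub>R \<eta>) \<bullet> (Y *v (w + x $ k *\<^sub>R \<eta>)) + (t - u \<bullet> \<eta>) * (x $ k)\<^sup>2"
      by (subst (1 2) w(2)) (rule bordered_quadratic[OF sym Y\<eta> u \<eta>k w(1) row])
    moreover have "(w + x $ k *\<^sub>R \<eta>) \<bullet> (Y *v (w + x $ k *\<^sub>R \<eta>)) \<ge> 0" by (rule pos_def_nonneg[OF pY])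
    moreover have "(w + x $ k *\<^sub>R \<eta>) \<bullet> (Y *v (w + x $ k *\<^sub>R \<eta>)) > 0" if "x $ k = 0"
    proof -
      have "w \<noteq> 0" using that w(2) x by auto
      then show ?thesis using that pos_defD[OF pY] by simp
    qed
    ultimately show "x \<bullet> (bordered k Y u t *v x) > 0"
      using \<sigma> by (cases "x $ k = 0") (auto intro: add_nonneg_pos)
  qed
qed

subsection \<open>Integrating powers of quadratic forms\<close>

lemma nn_integral_PiM_translation:
  fixes F :: "('i \<Rightarrow> real) \<Rightarrow> ennreal"
  assumes I: "finite I" and F: "F \<in> borel_measurable (PiM I (\<lambda>_. lborel))"
  shows "(\<integral>\<^sup>+a. F (\<lambda>i. if i \<in> I then a i + h i else a i) \<partial>PiM I (\<lambda>_. lborel)) = (\<integral>\<^sup>+a. F a \<partial>PiM I (\<lambda>_. lborel))"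
proof -
  have "(\<integral>\<^sup>+a. F (\<lambda>i. if i \<in> I then a i + h i else a i) * 1 ^ card I \<partial>PiM I (\<lambda>_. lborel)) = (\<integral>\<^sup>+a. F a \<partial>PiM I (\<lambda>_. lborel))"
  proof (rule nn_integral_PiM_update_set[OF lborel.sigma_finite_measure_axioms I order_refl F, of "\<lambda>i a x. x + h i" "\<lambda>_. 1"])
    show "(\<lambda>a. a i + h i) \<in> PiM I (\<lambda>_. lborel) \<rightarrow>\<^sub>M lborel" if "i \<in> I" for i
      using measurable_component_singleton[OF that, of "\<lambda>_. lborel :: real measure"] by simp
    show "(\<integral>\<^sup>+x. G (x + h i) * 1 \<partial>lborel) = (\<integral>\<^sup>+x. G x \<partial>lborel)" if "G \<in> borel_measurable lborel" for i G
      using that by (subst mult_1_right, intro nn_integral_translation) simp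
  qed auto
  then show ?thesis by simp
qed

text \<open>The map \<rho> names the coordinate of the product measure that holds entry i. Later it
  is \<open>sorted_pair k\<close>, which places a border vector among the coordinates of a symmetric
  matrix.\<close>

definition vec_of :: "'n::finite set \<Rightarrow> ('n \<Rightarrow> 'i) \<Rightarrow> ('i \<Rightarrow> real) \<Rightarrow> real^'n" where
  "vec_of S \<rho> b = (\<chi> i. if i \<in> S then b (\<rho> i) else 0)"

text \<open>The integral of (1 + |x|^2)^(-q) over n-dimensional space, for q > n/2.\<close>

definition vec_const :: "nat \<Rightarrow> real \<Rightarrow> real" where
  "vec_const n q = pi powr (real n / 2) * Gamma (q - real n / 2) / Gamma q"

lemma measurable_vec_of [measurable]:
  "vec_of S \<rho> \<in> borel_measurable (PiM (\<rho> ` S) (\<lambda>_. lborel :: real measure))"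
proof -
  have "(\<lambda>b. if i \<in> S then b (\<rho> i) else 0) \<in> borel_measurable (PiM (\<rho> ` S) (\<lambda>_. lborel :: real measure))" for i
    using measurable_component_singleton[of "\<rho> i" "\<rho> ` S" "\<lambda>_. lborel :: real measure"] by (cases "i \<in> S") auto
  then show ?thesis unfolding vec_of_def[abs_def] by measurable
qed

lemma borel_measurable_matrix_vector [measurable (raw)]:
  fixes f :: "'a \<Rightarrow> real^'n::finite" and A :: "real^'n^'m::finite"
  assumes [measurable]: "f \<in> borel_measurable M"
  shows "(\<lambda>x. A *v f x) \<in> borel_measurable M"
  unfolding matrix_vector_mult_def by measurable

lemma vec_of_translate:
  assumes "inj_on \<rho> S" "\<And>i. i \<notin> S \<Longrightarrow> v $ i = 0"
  shows "vec_of S \<rho> (\<lambda>j. if j \<in> \<rho> ` S then b j + v $ inv_into S \<rho> j else b j) = vec_of S \<rho> b + v"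
  using assms by (auto simp: vec_of_def vec_eq_iff)

text \<open>The inductive step shared by the following integrals: index k is split off as a border
  and replaced by a unit row and column.\<close>

lemma unit_outside_decomp:
  fixes Y :: "real^'n^'n"
  assumes Y: "pos_def_matrix Y" and out: "unit_outside (insert k S) Y" and k: "k \<notin> S"
  obtains Y' u t where "Y = bordered k Y' u t" "pos_def_matrix Y'" "unit_outside S Y'" "u $ k = 0"
    "\<And>i. i \<notin> S \<Longrightarrow> u $ i = 0" "\<And>j. Y' $ k $ j = (if k = j then 1 else 0)"
    "t - u \<bullet> (matrix_inv Y' *v u) > 0" "det Y = det Y' * (t - u \<bullet> (matrix_inv Y' *v u))"
proof -
  define Y' where "Y' = (\<chi> i j. if i = k \<or> j = k then (if i = j then 1 else 0) else Y $ i $ j)"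
  define u where "u = (\<chi> i. if i = k then 0 else Y $ i $ k)"
  define t where "t = Y $ k $ k"
  note sym = transpose_nth[OF pos_def_sym[OF Y]]
  have eq: "Y = bordered k Y' u t"
  proof -
    have "Y $ i $ j = bordered k Y' u t $ i $ j" for i j
      using sym[of i j] by (auto simp: bordered_def Y'_def u_def t_def)
    then show ?thesis by (simp add: vec_eq_iff)
  qed
  have uk: "u $ k = 0" by (simp add: u_def)
  have row: "Y' $ k $ j = (if k = j then 1 else 0)" for j by (simp add: Y'_def)
  have sym': "transpose Y' = Y'"
  proof -
    have "Y' $ j $ i = Y' $ i $ j" for i j using sym[of i j] by (auto simp: Y'_def)
    then show ?thesis unfolding vec_eq_iff by (auto simp: transpose_def)
  qed
  have pd: "pos_def_matrix Y'" "t - u \<bullet> (matrix_inv Y' *v u) > 0"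
    using Y bordered_pos_def_iff[OF sym' uk row] unfolding eq by auto
  have d: "det Y' \<noteq> 0" using pos_def_det_pos[OF pd(1)] by simp
  have "det Y * 1 = det Y' * (t - u \<bullet> (matrix_inv Y' *v u))"
    unfolding eq dot_real[symmetric] by (rule det_bordered[OF sym' d row _ uk]) simp
  moreover have "unit_outside S Y'" using out by (auto simp: unit_outside_def Y'_def)
  moreover have "u $ i = 0" if "i \<notin> S" for i
    using out that by (auto simp: u_def unit_outside_def)
  ultimately show thesis using that[OF eq pd(1) _ uk _ row pd(2)] by simp
qed

lemma quad_const_pos: "p > 1 / 2 \<Longrightarrow> quad_const p > 0"
  by (simp add: quad_const_def Gamma_real_pos)

lemma vec_const_pos: "q > real n / 2 \<Longrightarrow> vec_const n q > 0"
  using Gamma_real_pos[of q] Gamma_real_pos[of "q - real n / 2"]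
  by (simp add: vec_const_def)

lemma vec_const_Suc:
  assumes "q > real (Suc n) / 2"
  shows "vec_const n q * quad_const (q - real n / 2) = vec_const (Suc n) q"
proof -
  have "Gamma (q - real n / 2) > 0" using assms by (intro Gamma_real_pos) simp
  moreover have "pi powr (real (Suc n) / 2) = pi powr (real n / 2) * sqrt pi"
    by (simp add: powr_half_sqrt[symmetric] powr_add[symmetric] add_divide_distrib add.commute)
  moreover have e: "q - real n / 2 - 1 / 2 = q - real (Suc n) / 2" by (simp add: field_simps)
  ultimately show ?thesis unfolding vec_const_def quad_const_def e by (simp del: of_nat_Suc)
qed

text \<open>Induction on S with the new coordinate y as outer variable. Completing the square shifts
  the inner vector by y \<eta>, which translation invariance removes; the induction hypothesis then
  leaves a power of \<sigma> y^2 + s in one variable, and the constants telescope.\<close>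

lemma nn_integral_vec_quadratic:
  fixes Q :: "real^'n^'n"
  assumes "finite S" "inj_on \<rho> S" "pos_def_matrix Q" "unit_outside S Q" "s > 0" "q > real (card S) / 2"
  shows "(\<integral>\<^sup>+b. ennreal ((s + vec_of S \<rho> b \<bullet> (Q *v vec_of S \<rho> b)) powr (- q)) \<partial>PiM (\<rho> ` S) (\<lambda>_. lborel)) =
    ennreal (vec_const (card S) q * det Q powr (- 1 / 2) * s powr (real (card S) / 2 - q))"
  using assms
proof (induction S arbitrary: Q s rule: finite_induct)
  case empty
  have "Q = mat 1" using empty by (simp add: unit_outside_def vec_eq_iff mat_def)
  moreover have "vec_of {} \<rho> b = 0" for b by (simp add: vec_of_def vec_eq_iff)
  moreover have "Gamma q > 0" using empty by (intro Gamma_real_pos) simp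
  ultimately show ?case by (simp add: PiM_empty nn_integral_count_space_finite vec_const_def)
next
  case (insert k S)
  define n where "n = card S"
  have q: "q > real (Suc n) / 2" using insert by (simp add: n_def)
  obtain Q' u t where Q: "Q = bordered k Q' u t" and Q': "pos_def_matrix Q'" "unit_outside S Q'" and u: "u $ k = 0"
    "\<And>i. i \<notin> S \<Longrightarrow> u $ i = 0" and row: "\<And>j. Q' $ k $ j = (if k = j then 1 else 0)"
    and \<sigma>: "t - u \<bullet> (matrix_inv Q' *v u) > 0" and det: "det Q = det Q' * (t - u \<bullet> (matrix_inv Q' *v u))"
    using unit_outside_decomp[OF insert.prems(2,3) insert.hyps(2)] by blast
  define \<eta> where "\<eta> = matrix_inv Q' *v u"
  define \<sigma> where "\<sigma> = t - u \<bullet> \<eta>"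
  have \<sigma>0: "\<sigma> > 0" using \<sigma> by (simp add: \<sigma>_def \<eta>_def)
  have d0: "det Q' > 0" by (rule pos_def_det_pos[OF Q'(1)])
  have Q\<eta>: "Q' *v \<eta> = u" using d0 by (simp add: \<eta>_def matrix_vector_mul_assoc matrix_inv_right)
  have \<eta>0: "\<eta> $ i = 0" if "i \<notin> S" for i
  proof -
    have "Q' $ i $ j = (if i = j then 1 else 0)" for j using Q'(2) that by (simp add: unit_outside_def)
    from inv_vec_row[OF _ this, of u] show ?thesis using d0 u(2)[OF that] by (simp add: \<eta>_def)
  qed
  have inj: "inj_on \<rho> S" and \<rho>k: "\<rho> k \<notin> \<rho> ` S" using insert by auto
  have fin: "finite (\<rho> ` S)" using insert by simp
  interpret product_sigma_finite "\<lambda>_. lborel :: real measure"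
    by (simp add: product_sigma_finite_def lborel.sigma_finite_measure_axioms)
  let ?M = "PiM (\<rho> ` S) (\<lambda>_. lborel :: real measure)"
  let ?w = "vec_of S \<rho>"
  have v: "vec_of (insert k S) \<rho> (x(\<rho> k := y)) = ?w x + axis k y" for x y
  proof -
    have "\<rho> i \<noteq> \<rho> k" if "i \<in> S" for i using \<rho>k that by (metis imageI)
    then show ?thesis using insert.hyps(2) by (auto simp: vec_of_def vec_eq_iff axis_def)
  qed
  have wk: "?w x $ k = 0" for x using insert.hyps(2) by (simp add: vec_of_def)
  have quad: "(?w x + axis k y) \<bullet> (Q *v (?w x + axis k y)) = (?w x + y *\<^sub>R \<eta>) \<bullet> (Q' *v (?w x + y *\<^sub>R \<eta>)) + \<sigma> * y\<^sup>2" for x y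
    unfolding Q \<sigma>_def by (rule bordered_quadratic[OF pos_def_sym[OF Q'(1)] Q\<eta> u(1) \<eta>0[OF insert.hyps(2)] wk row])
  have quad': "s + (?w x + axis k y) \<bullet> (Q *v (?w x + axis k y)) = (s + \<sigma> * y\<^sup>2) + (?w x + y *\<^sub>R \<eta>) \<bullet> (Q' *v (?w x + y *\<^sub>R \<eta>))" for x y
    unfolding quad by simp
  have "(\<integral>\<^sup>+b. ennreal ((s + vec_of (insert k S) \<rho> b \<bullet> (Q *v vec_of (insert k S) \<rho> b)) powr (- q)) \<partial>PiM (\<rho> ` insert k S) (\<lambda>_. lborel)) =
    (\<integral>\<^sup>+y. \<integral>\<^sup>+x. ennreal (((s + \<sigma> * y\<^sup>2) + (?w x + y *\<^sub>R \<eta>) \<bullet> (Q' *v (?w x + y *\<^sub>R \<eta>))) powr (- q)) \<partial>?M \<partial>lborel)"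
    unfolding image_insert
  proof (subst product_nn_integral_insert_rev[OF fin \<rho>k])
    show "(\<lambda>b. ennreal ((s + vec_of (insert k S) \<rho> b \<bullet> (Q *v vec_of (insert k S) \<rho> b)) powr (- q)))
        \<in> borel_measurable (PiM (insert (\<rho> k) (\<rho> ` S)) (\<lambda>_. lborel))"
      using measurable_vec_of[of "insert k S" \<rho>] unfolding image_insert by measurable
  qed (simp only: v quad')
  also have "\<dots> = (\<integral>\<^sup>+y. ennreal (vec_const n q * det Q' powr (- 1 / 2)) * ennreal ((\<sigma> * y\<^sup>2 + s) powr (- (q - real n / 2))) \<partial>lborel)"
  proof (rule nn_integral_cong)
    fix y :: real
    have pos: "s + \<sigma> * y\<^sup>2 > 0" using insert.prems \<sigma>0 by (simp add: add_pos_nonneg)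
    let ?F = "\<lambda>x. ennreal (((s + \<sigma> * y\<^sup>2) + ?w x \<bullet> (Q' *v ?w x)) powr (- q))"
    have "(\<integral>\<^sup>+x. ennreal (((s + \<sigma> * y\<^sup>2) + (?w x + y *\<^sub>R \<eta>) \<bullet> (Q' *v (?w x + y *\<^sub>R \<eta>))) powr (- q)) \<partial>?M) =
       (\<integral>\<^sup>+x. ?F (\<lambda>j. if j \<in> \<rho> ` S then x j + (y *\<^sub>R \<eta>) $ inv_into S \<rho> j else x j) \<partial>?M)"
    proof -
      have "?w (\<lambda>j. if j \<in> \<rho> ` S then x j + (y *\<^sub>R \<eta>) $ inv_into S \<rho> j else x j) = ?w x + y *\<^sub>R \<eta>" for x
        by (rule vec_of_translate[OF inj]) (use \<eta>0 in simp)
      then show ?thesis by (simp only:)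
    qed
    also have "\<dots> = (\<integral>\<^sup>+x. ?F x \<partial>?M)"
      by (rule nn_integral_PiM_translation[OF fin]) measurable
    also have "\<dots> = ennreal (vec_const n q * det Q' powr (- 1 / 2) * (s + \<sigma> * y\<^sup>2) powr (real n / 2 - q))"
      using insert.IH[OF inj Q' pos] q by (simp add: n_def)
    also have "\<dots> = ennreal (vec_const n q * det Q' powr (- 1 / 2)) * ennreal ((\<sigma> * y\<^sup>2 + s) powr (- (q - real n / 2)))"
      using q vec_const_pos[of n q] by (subst ennreal_mult[symmetric]) (auto simp: add.commute)
    finally show "(\<integral>\<^sup>+x. ennreal (((s + \<sigma> * y\<^sup>2) + (?w x + y *\<^sub>R \<eta>) \<bullet> (Q' *v (?w x + y *\<^sub>R \<eta>))) powr (- q)) \<partial>?M) =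
      ennreal (vec_const n q * det Q' powr (- 1 / 2)) * ennreal ((\<sigma> * y\<^sup>2 + s) powr (- (q - real n / 2)))" .
  qed
  also have "\<dots> = ennreal (vec_const n q * det Q' powr (- 1 / 2)) *
      ennreal (quad_const (q - real n / 2) * \<sigma> powr (- 1 / 2) * s powr (1 / 2 - (q - real n / 2)))"
    by (subst nn_integral_cmult, measurable, subst nn_integral_quadratic_powr) (use q \<sigma>0 insert.prems in auto)
  also have "\<dots> = ennreal ((vec_const n q * quad_const (q - real n / 2)) * (det Q' powr (- 1 / 2) * \<sigma> powr (- 1 / 2)) * s powr (1 / 2 - (q - real n / 2)))"
    using q vec_const_pos[of n q] quad_const_pos[of "q - real n / 2"] by (subst ennreal_mult[symmetric]) (auto simp: mult_ac)
  also have "det Q' powr (- 1 / 2) * \<sigma> powr (- 1 / 2) = det Q powr (- 1 / 2)"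
    using d0 \<sigma>0 by (simp add: det powr_mult \<sigma>_def \<eta>_def)
  also have "1 / 2 - (q - real n / 2) = real (card (insert k S)) / 2 - q"
    using insert.hyps by (simp add: n_def add_divide_distrib)
  finally show ?case using vec_const_Suc[OF q] insert.hyps by (simp add: n_def)
qed

subsection \<open>Integrating over symmetric matrices\<close>

definition pairs_on :: "'n::linorder set \<Rightarrow> ('n \<times> 'n) set" where
  "pairs_on S = {(r, s). r \<le> s \<and> r \<in> S \<and> s \<in> S}"

definition sorted_pair :: "'n::linorder \<Rightarrow> 'n \<Rightarrow> 'n \<times> 'n" where
  "sorted_pair k s = (min k s, max k s)"

text \<open>Zero outside S, as suits a real part x. A matrix y with units outside S is obtained by
  adding \<open>diag_on (- S)\<close>.\<close>

definition sym_on :: "'n::{finite,linorder} set \<Rightarrow> ('n \<times> 'n \<Rightarrow> real) \<Rightarrow> ((real, 'n) vec, 'n) vec" where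
  "sym_on S a = (\<chi> i j. if i \<in> S \<and> j \<in> S then a (sorted_pair i j) else 0)"

lemma finite_pairs_on [simp]: "finite (pairs_on (S :: 'n::{finite,linorder} set))"
  by (rule finite_subset[OF subset_UNIV]) simp

lemma sorted_pair_commute: "sorted_pair i j = sorted_pair j i"
  by (simp add: sorted_pair_def min.commute max.commute)

lemma sorted_pair_mem: "i \<in> S \<Longrightarrow> j \<in> S \<Longrightarrow> sorted_pair i j \<in> pairs_on S"
  by (auto simp: sorted_pair_def pairs_on_def min_def max_def)

lemma inj_sorted_pair: "inj_on (sorted_pair k) S"
  by (auto simp: inj_on_def sorted_pair_def min_def max_def split: if_splits)

lemma pairs_on_insert:
  assumes "k \<notin> S"
  shows "pairs_on (insert k S) = insert (k, k) (pairs_on S \<union> sorted_pair k ` S)"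
    "pairs_on S \<inter> sorted_pair k ` S = {}" "(k, k) \<notin> pairs_on S \<union> sorted_pair k ` S"
proof -
  have "p \<in> sorted_pair k ` S \<longleftrightarrow> (\<exists>s\<in>S. p = (k, s) \<and> k \<le> s \<or> p = (s, k) \<and> s \<le> k)" for p
    by (auto simp: sorted_pair_def min_def max_def image_iff split: if_splits) (metis order.antisym)+
  then have J: "sorted_pair k ` S = {p. \<exists>s\<in>S. p = (k, s) \<and> k \<le> s \<or> p = (s, k) \<and> s \<le> k}" by blast
  show "pairs_on (insert k S) = insert (k, k) (pairs_on S \<union> sorted_pair k ` S)"
    "pairs_on S \<inter> sorted_pair k ` S = {}" "(k, k) \<notin> pairs_on S \<union> sorted_pair k ` S"
    unfolding J using assms by (auto simp: pairs_on_def)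
qed

lemma measurable_sym_on [measurable]:
  "sym_on S \<in> borel_measurable (PiM (pairs_on S) (\<lambda>_. lborel :: real measure))"
proof -
  have "(\<lambda>a. if i \<in> S \<and> j \<in> S then a (sorted_pair i j) else 0) \<in> borel_measurable (PiM (pairs_on S) (\<lambda>_. lborel :: real measure))" for i j
    using measurable_component_singleton[of "sorted_pair i j" "pairs_on S" "\<lambda>_. lborel :: real measure"] sorted_pair_mem[of i S j]
    by (cases "i \<in> S \<and> j \<in> S") auto
  then show ?thesis unfolding sym_on_def[abs_def] by measurable
qed

text \<open>The coordinates of a symmetric matrix on S and k split into those on S, the border row
  and the corner, with the corner innermost: the order in which Schur complements are
  integrated.\<close>

lemma nn_integral_pairs_insert:
  fixes F :: "((real, 'n::{finite,linorder}) vec, 'n) vec \<Rightarrow> ennreal"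
  assumes k: "k \<notin> S" and [measurable]: "F \<in> borel_measurable borel"
  shows "(\<integral>\<^sup>+a. F (sym_on (insert k S) a) \<partial>PiM (pairs_on (insert k S)) (\<lambda>_. lborel)) =
    (\<integral>\<^sup>+a. \<integral>\<^sup>+b. \<integral>\<^sup>+t. F (bordered k (sym_on S a) (vec_of S (sorted_pair k) b) t) \<partial>lborel
       \<partial>PiM (sorted_pair k ` S) (\<lambda>_. lborel) \<partial>PiM (pairs_on S) (\<lambda>_. lborel))"
proof -
  interpret product_sigma_finite "\<lambda>_. lborel :: real measure"
    by (simp add: product_sigma_finite_def lborel.sigma_finite_measure_axioms)
  note split = pairs_on_insert[OF k]
  let ?I = "pairs_on S" and ?J = "sorted_pair k ` S"
  have finJ: "finite ?J" by simp
  have finIJ: "finite (?I \<union> ?J)" by simp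
  have Fm: "(\<lambda>a. F (sym_on (insert k S) a)) \<in> borel_measurable (PiM (insert (k, k) (?I \<union> ?J)) (\<lambda>_. lborel))"
    unfolding split(1)[symmetric] by measurable
  have up: "(\<lambda>p. (fst p)((k, k) := snd p)) \<in> PiM (?I \<union> ?J) (\<lambda>_. lborel :: real measure) \<Otimes>\<^sub>M lborel \<rightarrow>\<^sub>M PiM (insert (k, k) (?I \<union> ?J)) (\<lambda>_. lborel)"
    by (rule measurable_fun_upd[where J="?I \<union> ?J"]) auto
  have m2: "(\<lambda>x. \<integral>\<^sup>+t. F (sym_on (insert k S) (x((k, k) := t))) \<partial>lborel) \<in> borel_measurable (PiM (?I \<union> ?J) (\<lambda>_. lborel))"
    using measurable_compose[OF up Fm] by (intro lborel.borel_measurable_nn_integral) (simp add: split_beta')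
  have E: "(\<integral>\<^sup>+a. F (sym_on (insert k S) a) \<partial>PiM (pairs_on (insert k S)) (\<lambda>_. lborel)) =
    (\<integral>\<^sup>+a. \<integral>\<^sup>+b. \<integral>\<^sup>+t. F (sym_on (insert k S) ((merge ?I ?J (a, b))((k, k) := t))) \<partial>lborel \<partial>PiM ?J (\<lambda>_. lborel) \<partial>PiM ?I (\<lambda>_. lborel))"
    unfolding split(1)
    by (subst product_nn_integral_insert[OF finIJ split(3) Fm], subst product_nn_integral_fold[OF split(2) _ finJ m2]) auto
  have key: "sym_on (insert k S) ((merge ?I ?J (a, b))((k, k) := t)) = bordered k (sym_on S a) (vec_of S (sorted_pair k) b) t" for a b t
  proof -
    have 1: "sorted_pair k j \<in> ?J" "sorted_pair k j \<notin> ?I" "sorted_pair k j \<noteq> (k, k)" if "j \<in> S" for j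
    proof -
      show J: "sorted_pair k j \<in> ?J" using that by (rule imageI)
      show "sorted_pair k j \<notin> ?I" using J split(2) by (metis IntI empty_iff)
      show "sorted_pair k j \<noteq> (k, k)" using J split(3) by (metis UnI2)
    qed
    have 2: "sorted_pair i j \<in> ?I" "sorted_pair i j \<noteq> (k, k)" if "i \<in> S" "j \<in> S" for i j
      using sorted_pair_mem[OF that] split(3) by (blast, metis UnI1)
    have 3: "sorted_pair k k = (k, k)" by (simp add: sorted_pair_def)
    define m where "m = (merge ?I ?J (a, b))((k, k) := t)"
    have mk: "m (k, k) = t" by (simp add: m_def)
    have mb: "m (sorted_pair k j) = b (sorted_pair k j)" if "j \<in> S" for j
      using 1[OF that] by (simp add: m_def merge_def)
    have ma: "m (sorted_pair i j) = a (sorted_pair i j)" if "i \<in> S" "j \<in> S" for i j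
      using 2[OF that] by (simp add: m_def merge_def)
    have "sym_on (insert k S) m $ i $ j = bordered k (sym_on S a) (vec_of S (sorted_pair k) b) t $ i $ j" for i j
    proof -
      consider "i = k" "j = k" | "i = k" "j \<noteq> k" | "i \<noteq> k" "j = k" | "i \<noteq> k" "j \<noteq> k" by blast
      then show ?thesis
      proof cases
        case 3
        then show ?thesis
          by (cases "i \<in> S") (simp_all add: sym_on_def bordered_def vec_of_def sorted_pair_commute[of i k] mb)
      qed (use k in \<open>simp_all add: sym_on_def bordered_def vec_of_def 3 mk mb ma\<close>)
    qed
    then show ?thesis by (simp add: vec_eq_iff m_def)
  qed
  show ?thesis unfolding E key ..
qed

section \<open>The integral over the real part x\<close>

definition cvec :: "real^'n \<Rightarrow> complex^'n" where
  "cvec v = (\<chi> i. complex_of_real (v $ i))"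

lemma cvec_nth [simp]: "cvec v $ i = complex_of_real (v $ i)"
  by (simp add: cvec_def)

lemma dot_add_left: "dot (u + v) w = dot u w + dot v w"
  by (simp add: dot_def distrib_right sum.distrib)

lemma dot_add_right: "dot w (u + v) = dot w u + dot w v"
  by (simp add: dot_def distrib_left sum.distrib)

lemma dot_commute: "dot u v = dot v u"
  by (simp add: dot_def mult.commute)

lemma dot_symmetric_matrix:
  assumes "transpose Z = Z"
  shows "dot (Z *v x) y = dot x (Z *v y)"
proof -
  have "dot (Z *v x) y = (\<Sum>i\<in>UNIV. \<Sum>j\<in>UNIV. Z $ i $ j * x $ j * y $ i)"
    by (simp add: dot_def matrix_vector_mult_def sum_distrib_right)
  also have "\<dots> = (\<Sum>j\<in>UNIV. \<Sum>i\<in>UNIV. Z $ i $ j * x $ j * y $ i)" by (rule sum.swap)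
  also have "\<dots> = (\<Sum>j\<in>UNIV. \<Sum>i\<in>UNIV. x $ j * (Z $ j $ i * y $ i))"
  proof (intro sum.cong refl)
    fix i j show "Z $ i $ j * x $ j * y $ i = x $ j * (Z $ j $ i * y $ i)"
      using transpose_nth[OF assms, of i j] by simp
  qed
  also have "\<dots> = dot x (Z *v y)"
    by (simp add: dot_def matrix_vector_mult_def sum_distrib_left)
  finally show ?thesis .
qed

lemma Im_dot_cvec: "Im (dot (cvec x) (M *v cvec y)) = x \<bullet> (Im_matrix M *v y)"
  by (simp add: dot_def inner_vec_def matrix_vector_mult_def Im_matrix_def sum_distrib_left)

lemma neg_inverse_siegel:
  fixes Z :: "'n::finite cmat"
  assumes Z: "Z \<in> siegel"
  shows "det Z \<noteq> 0" "- matrix_inv Z \<in> siegel"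
    "det (Im_matrix (- matrix_inv Z)) * (cmod (det Z))\<^sup>2 = det (Im_matrix Z)"
proof -
  have t: "transpose Z = Z" by (rule siegel_sym[OF Z])
  have m1: "cj (- mat 1) = (- mat 1 :: 'n cmat)" by (simp add: vec_eq_iff mat_def)
  have "det Z \<noteq> 0 \<and> (- mat 1) ** matrix_inv Z \<in> siegel \<and>
    det (Im_matrix ((- mat 1) ** matrix_inv Z)) * (cmod (det Z))\<^sup>2 = det (Im_matrix Z)"
    by (intro conjI siegel_quotient_mem'[OF Z, of Z "- mat 1"])
       (simp_all add: m1 transpose_minus matrix_ring t transpose_cj)
  then show "det Z \<noteq> 0" "- matrix_inv Z \<in> siegel"
    "det (Im_matrix (- matrix_inv Z)) * (cmod (det Z))\<^sup>2 = det (Im_matrix Z)"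
    by (simp_all add: matrix_ring)
qed

definition xiy :: "((real, 'n::finite) vec, 'n) vec \<Rightarrow> ((real, 'n) vec, 'n) vec \<Rightarrow> 'n cmat" where
  "xiy X Y = (\<chi> i j. Complex (X $ i $ j) (Y $ i $ j))"

lemma Im_xiy [simp]: "Im_matrix (xiy X Y) = Y"
  by (simp add: xiy_def Im_matrix_def vec_eq_iff)

lemma xiy_siegel:
  assumes "transpose X = X" "pos_def_matrix Y"
  shows "xiy X Y \<in> siegel"
proof -
  have "transpose (xiy X Y) = xiy X Y"
    using transpose_nth[OF assms(1)] transpose_nth[OF pos_def_sym[OF assms(2)]]
    by (auto simp: vec_eq_iff transpose_def xiy_def)
  then show ?thesis using assms(2) by (simp add: siegel_def)
qed

text \<open>
  After the shift \<open>d = \<beta> - X \<eta>\<close> with \<open>\<eta> = Y\<inverse> u\<close>, the imaginary part of the Schur complement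
  of \<open>x + i y\<close> is the Schur complement of \<open>y\<close> plus a positive definite form in \<open>d\<close>.
\<close>

lemma det_bordered_xiy:
  fixes X Y :: "((real, 'n::finite) vec, 'n) vec"
  assumes X: "transpose X = X" and Y: "pos_def_matrix Y"
    and Xrow: "\<And>j. X $ k $ j = 0" and Yrow: "\<And>j. Y $ k $ j = (if k = j then 1 else 0)"
    and u: "u $ k = 0" and b: "\<beta> $ k = 0"
  defines "Z \<equiv> xiy X Y" and "\<eta> \<equiv> matrix_inv Y *v u"
  defines "d \<equiv> \<beta> - X *v \<eta>"
  shows "\<exists>r. \<forall>t. cmod (det (xiy (bordered k X \<beta> t) (bordered k Y u s))) =
    cmod (det Z) * cmod (Complex (t - r) ((s - u \<bullet> \<eta>) + d \<bullet> (Im_matrix (- matrix_inv Z) *v d)))"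
proof -
  have ZS: "Z \<in> siegel" unfolding Z_def by (rule xiy_siegel[OF X Y])
  note Zsym = siegel_sym[OF ZS] and dZ = neg_inverse_siegel(1)[OF ZS]
  have dY: "det Y \<noteq> 0" using pos_def_det_pos[OF Y] by simp
  have Y\<eta>: "Y *v \<eta> = u" by (simp add: \<eta>_def matrix_vector_mul_assoc matrix_inv_right[OF dY])
  have row: "Z $ k $ j = (if k = j then \<i> else 0)" for j
    by (simp add: Z_def xiy_def Xrow Yrow complex_eq_iff)
  define w where "w = (\<chi> i. Complex (\<beta> $ i) (u $ i))"
  have wk: "w $ k = 0" using u b by (simp add: w_def complex_eq_iff)
  have M: "xiy (bordered k X \<beta> t) (bordered k Y u s) = bordered k Z w (Complex t s)" for t
    by (simp add: vec_eq_iff xiy_def bordered_def Z_def w_def)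
  have Z\<eta>: "w = cvec d + Z *v cvec \<eta>"
  proof -
    have "(Z *v cvec \<eta>) $ i = Complex ((X *v \<eta>) $ i) ((Y *v \<eta>) $ i)" for i
      by (simp add: complex_eq_iff matrix_vector_mult_def Z_def xiy_def)
    then show ?thesis by (simp add: vec_eq_iff w_def d_def Y\<eta> complex_eq_iff)
  qed
  have inv: "matrix_inv Z *v (Z *v cvec \<eta>) = cvec \<eta>"
    by (simp add: matrix_vector_mul_assoc matrix_inv_left[OF dZ])
  \<comment> \<open>With w = d + Z \<eta> the mixed term is twice the real number d \<eta>, and the
    last term has imaginary part u \<eta>. Only the form in d is left to be expressed by
    Im(-Z^(-1)).\<close>
  have "dot w (matrix_inv Z *v w) = dot (cvec d) (matrix_inv Z *v cvec d) + 2 * dot (cvec d) (cvec \<eta>) + dot (cvec \<eta>) (Z *v cvec \<eta>)"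
  proof -
    have "dot (Z *v cvec \<eta>) (matrix_inv Z *v cvec d) = dot (cvec \<eta>) (cvec d)"
      by (simp add: dot_symmetric_matrix[OF Zsym] matrix_vector_mul_assoc matrix_inv_right[OF dZ])
    then show ?thesis
      unfolding Z\<eta> matrix_vector_right_distrib inv
      by (simp add: dot_add_left dot_add_right dot_commute[of "cvec \<eta>" "cvec d"] dot_commute[of "Z *v cvec \<eta>"])
  qed
  moreover have "Im (dot (cvec d) (cvec \<eta>)) = 0" by (simp add: dot_def)
  moreover have "Im (dot (cvec \<eta>) (Z *v cvec \<eta>)) = u \<bullet> \<eta>"
    unfolding Im_dot_cvec using Y\<eta> by (simp add: Z_def inner_commute)
  moreover have "Im (dot (cvec d) (matrix_inv Z *v cvec d)) = - (d \<bullet> (Im_matrix (- matrix_inv Z) *v d))"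
  proof -
    have "Im_matrix (- matrix_inv Z) = - Im_matrix (matrix_inv Z)" by (simp add: Im_matrix_def vec_eq_iff)
    then show ?thesis unfolding Im_dot_cvec
      by (simp add: matrix_vector_mult_def inner_vec_def sum_negf)
  qed
  ultimately have Imw: "Im (dot w (matrix_inv Z *v w)) = u \<bullet> \<eta> - d \<bullet> (Im_matrix (- matrix_inv Z) *v d)"
    by simp
  have "cmod (det (xiy (bordered k X \<beta> t) (bordered k Y u s))) =
    cmod (det Z) * cmod (Complex (t - Re (dot w (matrix_inv Z *v w))) ((s - u \<bullet> \<eta>) + d \<bullet> (Im_matrix (- matrix_inv Z) *v d)))" for t
  proof -
    \<comment> \<open>The placeholder in the corner of Z is i, of modulus 1, so it disappears under
      \<open>cmod\<close>.\<close>
    have "det (bordered k Z w (Complex t s)) * \<i> = det Z * (Complex t s - dot w (matrix_inv Z *v w))"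
      by (rule det_bordered[OF Zsym dZ row _ wk]) simp
    from arg_cong[OF this, of cmod]
    have "cmod (det (bordered k Z w (Complex t s))) = cmod (det Z) * cmod (Complex t s - dot w (matrix_inv Z *v w))"
      by (simp add: norm_mult)
    moreover have "Complex t s - dot w (matrix_inv Z *v w) = Complex (t - Re (dot w (matrix_inv Z *v w))) ((s - u \<bullet> \<eta>) + d \<bullet> (Im_matrix (- matrix_inv Z) *v d))"
      using Imw by (simp add: complex_eq_iff)
    ultimately show ?thesis unfolding M by simp
  qed
  then show ?thesis by blast
qed

text \<open>Outside S the matrix Z is i times the identity, and so is -Z^(-1). Thus the form in the
  shifted border is again admissible for the vector integral over S.\<close>

lemma unit_outside_neg_inverse:
  fixes X Y :: "((real, 'n::finite) vec, 'n) vec"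
  assumes X: "transpose X = X" and Y: "pos_def_matrix Y" and out: "unit_outside S Y"
    and Xout: "\<And>i j. i \<notin> S \<Longrightarrow> X $ i $ j = 0"
  shows "unit_outside S (Im_matrix (- matrix_inv (xiy X Y)))"
proof -
  define Z where "Z = xiy X Y"
  have ZS: "Z \<in> siegel" unfolding Z_def by (rule xiy_siegel[OF X Y])
  note dZ = neg_inverse_siegel(1)[OF ZS]
  have row: "matrix_inv Z $ i $ j = (if i = j then 1 / \<i> else 0)" if i: "i \<notin> S" for i j
  proof -
    have r: "Z $ i $ j = (if i = j then \<i> else 0)" for j
      using Xout[OF i] out i by (simp add: Z_def xiy_def unit_outside_def complex_eq_iff)
    have "(matrix_inv Z *v axis j 1) $ i = (axis j 1 :: complex^'n) $ i / \<i>"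
      by (rule inv_vec_row[OF dZ r]) simp
    moreover have "(matrix_inv Z *v axis j 1) $ i = matrix_inv Z $ i $ j"
      by (simp add: matrix_vector_mult_def axis_def if_distrib cong: if_cong)
    ultimately show ?thesis by (simp add: axis_def split: if_splits)
  qed
  have sym: "Im_matrix (- matrix_inv Z) $ i $ j = Im_matrix (- matrix_inv Z) $ j $ i" for i j
    by (rule transpose_nth[OF pos_def_sym[OF siegel_pos[OF neg_inverse_siegel(2)[OF ZS]]]])
  have "Im_matrix (- matrix_inv Z) $ i $ j = (if i = j then 1 else 0)" if "i \<notin> S" for i j
    using row[OF that, of j] by (simp add: Im_matrix_def)
  then show ?thesis unfolding unit_outside_def Z_def[symmetric] using sym by metis
qed

lemma borel_measurable_xiy [measurable (raw)]:
  assumes [measurable]: "f \<in> borel_measurable M" "g \<in> borel_measurable M"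
  shows "(\<lambda>x. xiy (f x) (g x)) \<in> borel_measurable M"
  unfolding xiy_def by measurable

text \<open>\<open>quad_const\<close> comes from the corner and \<open>vec_const\<close> from the
  border. The remaining exponent p falls by 1/2 because the border integral returns one factor |det
  Z|.\<close>

primrec x_const :: "nat \<Rightarrow> real \<Rightarrow> real" where
  "x_const 0 p = 1"
| "x_const (Suc n) p = quad_const p * vec_const n (2 * p - 1) * x_const n (p - 1 / 2)"

lemma x_const_pos: "p > real n / 2 \<Longrightarrow> x_const n p > 0"
proof (induction n arbitrary: p)
  case (Suc n)
  then have "quad_const p > 0" "vec_const n (2 * p - 1) > 0" "x_const n (p - 1 / 2) > 0"
    by (auto intro!: quad_const_pos vec_const_pos Suc.IH simp: field_simps)
  then show ?case by simp
qed simp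

lemma nn_integral_cmod_powr:
  assumes p: "p > 1 / 2" and V: "V > 0" and c: "c \<ge> 0"
  shows "(\<integral>\<^sup>+t. ennreal ((c * cmod (Complex (t - r) V)) powr (- 2 * p)) \<partial>lborel) =
    ennreal (c powr (- 2 * p) * quad_const p * V powr (- (2 * p - 1)))"
proof -
  have "(\<integral>\<^sup>+t. ennreal ((c * cmod (Complex (t - r) V)) powr (- 2 * p)) \<partial>lborel) =
     (\<integral>\<^sup>+t. ennreal (c powr (- 2 * p)) * ennreal ((1 * (t + (- r))\<^sup>2 + V\<^sup>2) powr (- p)) \<partial>lborel)"
  proof (rule nn_integral_cong)
    fix t
    have pos: "(t - r)\<^sup>2 + V\<^sup>2 > 0" using V by (simp add: add_nonneg_pos)
    have "cmod (Complex (t - r) V) powr (- 2 * p) = (((t - r)\<^sup>2 + V\<^sup>2) powr (1 / 2)) powr (- 2 * p)"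
      using pos by (simp add: cmod_def powr_half_sqrt)
    also have "\<dots> = ((t - r)\<^sup>2 + V\<^sup>2) powr (- p)" by (simp add: powr_powr)
    finally show "ennreal ((c * cmod (Complex (t - r) V)) powr (- 2 * p)) =
       ennreal (c powr (- 2 * p)) * ennreal ((1 * (t + (- r))\<^sup>2 + V\<^sup>2) powr (- p))"
      using c by (subst powr_mult) (auto simp: ennreal_mult)
  qed
  also have "\<dots> = ennreal (c powr (- 2 * p)) * (\<integral>\<^sup>+t. ennreal ((1 * t\<^sup>2 + V\<^sup>2) powr (- p)) \<partial>lborel)"
    by (subst nn_integral_cmult, measurable, subst nn_integral_translation[of "\<lambda>t. ennreal ((1 * t\<^sup>2 + V\<^sup>2) powr (- p))"]) auto
  also have "\<dots> = ennreal (c powr (- 2 * p)) * ennreal (quad_const p * 1 powr (- 1 / 2) * (V\<^sup>2) powr (1 / 2 - p))"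
    by (subst nn_integral_quadratic_powr) (use p V in auto)
  also have "(V\<^sup>2) powr (1 / 2 - p) = V powr (- (2 * p - 1))"
  proof -
    have "(V\<^sup>2) powr (1 / 2 - p) = (V powr 2) powr (1 / 2 - p)" using V by simp
    also have "\<dots> = V powr (- (2 * p - 1))" by (simp add: powr_powr algebra_simps)
    finally show ?thesis .
  qed
  finally show ?thesis using quad_const_pos[OF p] by (simp add: ennreal_mult[symmetric] mult.assoc)
qed

lemma sym_on_props:
  "transpose (sym_on S a) = sym_on S a" "i \<notin> S \<Longrightarrow> sym_on S a $ i $ j = 0"
  by (auto simp: sym_on_def transpose_def vec_eq_iff sorted_pair_commute)

text \<open>Induction by Schur complements. The corner t is integrated over the line, independently
  of its real shift r; then the border is integrated after a translation; the rest is the same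
  integral for Y' with p - 1/2.\<close>

lemma nn_integral_x:
  fixes Y :: "((real, 'n::{finite,linorder}) vec, 'n) vec"
  assumes "finite S" "pos_def_matrix Y" "unit_outside S Y" "p > real (card S) / 2"
  shows "(\<integral>\<^sup>+a. ennreal (cmod (det (xiy (sym_on S a) Y)) powr (- 2 * p)) \<partial>PiM (pairs_on S) (\<lambda>_. lborel)) =
    ennreal (x_const (card S) p * det Y powr ((real (card S) + 1) / 2 - 2 * p))"
  using assms
proof (induction S arbitrary: Y p rule: finite_induct)
  case empty
  have Y: "Y = mat 1" using empty by (simp add: unit_outside_def vec_eq_iff mat_def)
  have "xiy (sym_on {} a) Y = mat \<i>" for a
    by (simp add: Y vec_eq_iff xiy_def sym_on_def mat_def complex_eq_iff)
  then show ?case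
    by (simp add: Y det_mat norm_power pairs_on_def PiM_empty nn_integral_count_space_finite)
next
  case (insert k S)
  define n where "n = card S"
  have cS: "card (insert k S) = Suc n" using insert.hyps by (simp add: n_def)
  have p: "p > real (Suc n) / 2" using insert.prems(3) by (simp only: cS)
  have p2: "p > 1 / 2" and q2: "2 * p - 1 > real n / 2" and p3: "p - 1 / 2 > real n / 2"
    using p by (simp_all add: field_simps)
  obtain Y' u s where Y: "Y = bordered k Y' u s" and Y': "pos_def_matrix Y'" "unit_outside S Y'" and u: "u $ k = 0"
    "\<And>i. i \<notin> S \<Longrightarrow> u $ i = 0" and row: "\<And>j. Y' $ k $ j = (if k = j then 1 else 0)"
    and \<sigma>: "s - u \<bullet> (matrix_inv Y' *v u) > 0" and det: "det Y = det Y' * (s - u \<bullet> (matrix_inv Y' *v u))"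
    using unit_outside_decomp[OF insert.prems(1,2) insert.hyps(2)] by blast
  define \<eta> where "\<eta> = matrix_inv Y' *v u"
  define \<sigma> where "\<sigma> = s - u \<bullet> \<eta>"
  have \<sigma>0: "\<sigma> > 0" using \<sigma> by (simp add: \<sigma>_def \<eta>_def)
  have d0: "det Y' > 0" by (rule pos_def_det_pos[OF Y'(1)])
  define v where "v = vec_of S (sorted_pair k)"
  define C where "C = quad_const p * vec_const n (2 * p - 1) * (det Y' powr (- 1 / 2) * \<sigma> powr (real n / 2 - (2 * p - 1)))"
  have C0: "C \<ge> 0" using quad_const_pos[OF p2] vec_const_pos[OF q2] by (simp add: C_def)
  have "(\<integral>\<^sup>+a. ennreal (cmod (det (xiy (sym_on (insert k S) a) Y)) powr (- 2 * p)) \<partial>PiM (pairs_on (insert k S)) (\<lambda>_. lborel)) =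
    (\<integral>\<^sup>+a. \<integral>\<^sup>+b. \<integral>\<^sup>+t. ennreal (cmod (det (xiy (bordered k (sym_on S a) (v b) t) Y)) powr (- 2 * p)) \<partial>lborel
       \<partial>PiM (sorted_pair k ` S) (\<lambda>_. lborel) \<partial>PiM (pairs_on S) (\<lambda>_. lborel))"
    unfolding v_def
    by (rule nn_integral_pairs_insert[OF insert.hyps(2), of "\<lambda>X. ennreal (cmod (det (xiy X Y)) powr (- 2 * p))"]) measurable
  also have "\<dots> = (\<integral>\<^sup>+a. ennreal C * ennreal (cmod (det (xiy (sym_on S a) Y')) powr (- 2 * (p - 1 / 2))) \<partial>PiM (pairs_on S) (\<lambda>_. lborel))"
  proof (rule nn_integral_cong)
    fix a :: "'n \<times> 'n \<Rightarrow> real"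
    define X where "X = sym_on S a"
    have X: "transpose X = X" and Xout: "\<And>i j. i \<notin> S \<Longrightarrow> X $ i $ j = 0"
      using sym_on_props by (auto simp: X_def)
    define Z where "Z = xiy X Y'"
    have ZS: "Z \<in> siegel" unfolding Z_def by (rule xiy_siegel[OF X Y'(1)])
    note Z = neg_inverse_siegel[OF ZS]
    define Q where "Q = Im_matrix (- matrix_inv Z)"
    have Q: "pos_def_matrix Q" "unit_outside S Q"
      using siegel_pos[OF Z(2)] unit_outside_neg_inverse[OF X Y' Xout] by (simp_all add: Q_def Z_def)
    define g where "g = (X *v \<eta>)"
    \<comment> \<open>The shift g = X \<eta> is supported on S, so it translates only coordinates
      that are actually integrated.\<close>
    have g0: "g $ i = 0" if "i \<notin> S" for i using Xout[OF that] by (simp add: g_def matrix_vector_mult_def)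
    have inner: "(\<integral>\<^sup>+t. ennreal (cmod (det (xiy (bordered k X (v b) t) Y)) powr (- 2 * p)) \<partial>lborel) =
      ennreal (cmod (det Z) powr (- 2 * p) * quad_const p) * ennreal ((\<sigma> + (v b + - g) \<bullet> (Q *v (v b + - g))) powr (- (2 * p - 1)))" for b
    proof -
      have vk: "v b $ k = 0" using insert.hyps(2) by (simp add: v_def vec_of_def)
      obtain r where r: "\<And>t. cmod (det (xiy (bordered k X (v b) t) Y)) =
          cmod (det Z) * cmod (Complex (t - r) (\<sigma> + (v b + - g) \<bullet> (Q *v (v b + - g))))"
        using det_bordered_xiy[OF X Y'(1) Xout[OF insert.hyps(2)] row u(1) vk, of s]
        unfolding Z_def Q_def \<sigma>_def \<eta>_def g_def Y by auto
      have "\<sigma> + (v b + - g) \<bullet> (Q *v (v b + - g)) > 0" using \<sigma>0 pos_def_nonneg[OF Q(1)] by (simp add: add_pos_nonneg)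
      then show ?thesis
        unfolding r using quad_const_pos[OF p2]
        by (subst nn_integral_cmod_powr[OF p2]) (auto simp: ennreal_mult[symmetric])
    qed
    let ?F = "\<lambda>b. ennreal ((\<sigma> + v b \<bullet> (Q *v v b)) powr (- (2 * p - 1)))"
    have vm [measurable]: "v \<in> borel_measurable (PiM (sorted_pair k ` S) (\<lambda>_. lborel :: real measure))"
      unfolding v_def by measurable
    have "(\<integral>\<^sup>+b. \<integral>\<^sup>+t. ennreal (cmod (det (xiy (bordered k X (v b) t) Y)) powr (- 2 * p)) \<partial>lborel \<partial>PiM (sorted_pair k ` S) (\<lambda>_. lborel)) =
      ennreal (cmod (det Z) powr (- 2 * p) * quad_const p) * (\<integral>\<^sup>+b. ennreal ((\<sigma> + (v b + - g) \<bullet> (Q *v (v b + - g))) powr (- (2 * p - 1))) \<partial>PiM (sorted_pair k ` S) (\<lambda>_. lborel))"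
      unfolding inner by (rule nn_integral_cmult) measurable
    also have "(\<integral>\<^sup>+b. ennreal ((\<sigma> + (v b + - g) \<bullet> (Q *v (v b + - g))) powr (- (2 * p - 1))) \<partial>PiM (sorted_pair k ` S) (\<lambda>_. lborel)) =
      (\<integral>\<^sup>+b. ?F (\<lambda>j. if j \<in> sorted_pair k ` S then b j + (- g) $ inv_into S (sorted_pair k) j else b j) \<partial>PiM (sorted_pair k ` S) (\<lambda>_. lborel))"
    proof -
      have "v (\<lambda>j. if j \<in> sorted_pair k ` S then b j + (- g) $ inv_into S (sorted_pair k) j else b j) = v b + - g" for b
        unfolding v_def by (rule vec_of_translate[OF inj_sorted_pair]) (use g0 in simp)
      then show ?thesis by (simp only:)
    qed
    also have "\<dots> = (\<integral>\<^sup>+b. ?F b \<partial>PiM (sorted_pair k ` S) (\<lambda>_. lborel))"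
      by (rule nn_integral_PiM_translation) (use insert.hyps(1) in auto)
    also have "\<dots> = ennreal (vec_const n (2 * p - 1) * det Q powr (- 1 / 2) * \<sigma> powr (real n / 2 - (2 * p - 1)))"
      unfolding v_def n_def
      by (rule nn_integral_vec_quadratic[OF insert.hyps(1) inj_sorted_pair Q \<sigma>0]) (use q2 n_def in simp)
    \<comment> \<open>det Im(-Z^(-1)) = det Y' / |det Z|^2; its power -1/2 is the source of the
      factor |det Z|.\<close>
    also have "det Q powr (- 1 / 2) = det Y' powr (- 1 / 2) * cmod (det Z)"
    proof -
      have "det Q = det Y' / (cmod (det Z))\<^sup>2" using Z(1,3) by (simp add: Q_def Z_def field_simps)
      then have "det Q powr (- 1 / 2) = det Y' powr (- 1 / 2) / ((cmod (det Z))\<^sup>2) powr (- 1 / 2)"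
        by (simp add: powr_divide)
      also have "((cmod (det Z))\<^sup>2) powr (- 1 / 2) = 1 / cmod (det Z)"
        using Z(1) by (simp add: powr_minus powr_half_sqrt field_simps)
      finally show ?thesis by simp
    qed
    also have "ennreal (cmod (det Z) powr (- 2 * p) * quad_const p) *
        ennreal (vec_const n (2 * p - 1) * (det Y' powr (- 1 / 2) * cmod (det Z)) * \<sigma> powr (real n / 2 - (2 * p - 1))) =
      ennreal (C * (cmod (det Z) powr (- 2 * p) * cmod (det Z)))"
      using quad_const_pos[OF p2] vec_const_pos[OF q2] by (subst ennreal_mult[symmetric]) (auto simp: C_def mult_ac)
    also have "cmod (det Z) powr (- 2 * p) * cmod (det Z) = cmod (det Z) powr (- 2 * (p - 1 / 2))"
    proof -
      have "cmod (det Z) powr (- 2 * p) * cmod (det Z) powr 1 = cmod (det Z) powr (- 2 * p + 1)"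
        by (simp only: powr_add)
      moreover have "- 2 * p + 1 = - 2 * (p - 1 / 2)" by simp
      ultimately show ?thesis using Z(1) by simp
    qed
    finally show "(\<integral>\<^sup>+b. \<integral>\<^sup>+t. ennreal (cmod (det (xiy (bordered k (sym_on S a) (v b) t) Y)) powr (- 2 * p)) \<partial>lborel
       \<partial>PiM (sorted_pair k ` S) (\<lambda>_. lborel)) = ennreal C * ennreal (cmod (det (xiy (sym_on S a) Y')) powr (- 2 * (p - 1 / 2)))"
      using C0 by (simp only: X_def[symmetric] Z_def[symmetric] ennreal_mult powr_ge_zero)
  qed
  also have "\<dots> = ennreal C * ennreal (x_const n (p - 1 / 2) * det Y' powr ((real n + 1) / 2 - 2 * (p - 1 / 2)))"
    using insert.IH[OF Y', of "p - 1 / 2"] p3 by (subst nn_integral_cmult) (auto simp: n_def)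
  also have "\<dots> = ennreal (x_const (Suc n) p * ((det Y' powr (- 1 / 2) * det Y' powr ((real n + 1) / 2 - 2 * (p - 1 / 2))) * \<sigma> powr (real n / 2 - (2 * p - 1))))"
    using C0 x_const_pos[OF p3] by (subst ennreal_mult[symmetric]) (auto simp: C_def mult_ac)
  also have "det Y' powr (- 1 / 2) * det Y' powr ((real n + 1) / 2 - 2 * (p - 1 / 2)) = det Y' powr ((real (Suc n) + 1) / 2 - 2 * p)"
    unfolding powr_add[symmetric] by (rule arg_cong[of _ _ "\<lambda>e. det Y' powr e"]) (simp add: field_simps)
  also have "\<sigma> powr (real n / 2 - (2 * p - 1)) = \<sigma> powr ((real (Suc n) + 1) / 2 - 2 * p)"
    by (rule arg_cong[of _ _ "\<lambda>e. \<sigma> powr e"]) (simp add: field_simps)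
  also have "det Y' powr ((real (Suc n) + 1) / 2 - 2 * p) * \<sigma> powr ((real (Suc n) + 1) / 2 - 2 * p) = det Y powr ((real (Suc n) + 1) / 2 - 2 * p)"
    using d0 \<sigma>0 by (simp add: det powr_mult \<sigma>_def \<eta>_def)
  finally show ?case by (simp only: cS)
qed

section \<open>The integral over the imaginary part y\<close>

definition diag_on :: "'n::finite set \<Rightarrow> real^'n^'n" where
  "diag_on S = (\<chi> i j. if i = j \<and> i \<in> S then 1 else 0)"

lemma inverse_row_unit:
  fixes Y :: "real^'n^'n"
  assumes "det Y \<noteq> 0" "\<And>j. Y $ i $ j = (if i = j then 1 else 0)"
  shows "matrix_inv Y $ i $ j = (if i = j then 1 else 0)"
proof -
  have "(matrix_inv Y *v axis j 1) $ i = (axis j 1 :: real^'n) $ i / 1"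
    by (rule inv_vec_row[OF assms]) simp
  moreover have "(matrix_inv Y *v axis j 1) $ i = matrix_inv Y $ i $ j"
    by (simp add: matrix_vector_mult_def axis_def if_distrib cong: if_cong)
  ultimately show ?thesis by (simp add: axis_def split: if_splits)
qed

text \<open>On the S-block W = Y + 1, so Y^(-1) - W^(-1) = Y^(-1) (W - Y) W^(-1) = Q. Outside S both
  inverses and Q are the identity, which accounts for the correction D in the proof. Q is positive
  definite as the inverse of W Y = Y^2 + Y - D.\<close>

lemma inverse_difference:
  fixes Y :: "real^'n^'n"
  assumes Y: "pos_def_matrix Y" and out: "unit_outside S Y"
  defines "W \<equiv> Y + diag_on S" and "Q \<equiv> matrix_inv Y ** matrix_inv (Y + diag_on S)"
  shows "det W > 0" "transpose W = W" "pos_def_matrix Q" "unit_outside S Q" "det Q * (det Y * det W) = 1"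
    "(\<And>i. i \<notin> S \<Longrightarrow> b $ i = 0) \<Longrightarrow> b \<bullet> (matrix_inv Y *v b) - b \<bullet> (matrix_inv W *v b) = b \<bullet> (Q *v b)"
proof -
  note Ysym = pos_def_sym[OF Y]
  have dY: "det Y > 0" by (rule pos_def_det_pos[OF Y])
  define E where "E = (diag_on S :: real^'n^'n)"
  define D where "D = (diag_on (- S) :: real^'n^'n)"
  have ED: "E + D = mat 1" by (simp add: E_def D_def diag_on_def vec_eq_iff mat_def)
  have Esym: "transpose E = E" by (auto simp: E_def diag_on_def transpose_def vec_eq_iff)
  have Ex: "(diag_on T *v x) $ i = (if i \<in> T then x $ i else 0)" for x :: "real^'n" and i T
    by (simp add: diag_on_def matrix_vector_mult_def mult_delta_left if_conn(1)[symmetric] cong: if_cong)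
  have W: "W = Y + E" by (simp add: W_def E_def)
  show Wsym: "transpose W = W" by (simp add: W transpose_add Ysym Esym)
  have "pos_def_matrix W"
    unfolding pos_def_matrix_def
  proof (intro conjI allI impI Wsym)
    fix v :: "real^'n" assume "v \<noteq> 0"
    have "v \<bullet> (E *v v) = (\<Sum>i\<in>UNIV. if i \<in> S then (v $ i)\<^sup>2 else 0)"
      by (auto simp: inner_vec_def E_def Ex power2_eq_square intro!: sum.cong)
    then have "v \<bullet> (E *v v) \<ge> 0" by (simp add: sum_nonneg)
    then show "v \<bullet> (W *v v) > 0"
      using pos_defD[OF Y \<open>v \<noteq> 0\<close>] by (simp add: W matrix_vector_mult_add_rdistrib inner_add_right)
  qed
  then show dW: "det W > 0" by (rule pos_def_det_pos)
  have Yout: "Y $ i $ j = (if i = j then 1 else 0)" if "i \<notin> S \<or> j \<notin> S" for i j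
    using out that unfolding unit_outside_def by blast
  have rowD: "(D ** M) $ i $ j = (if i \<in> S then 0 else M $ i $ j)" for M :: "real^'n^'n" and i j
  proof -
    have "D $ i $ a * M $ a $ j = (if a = i then (if i \<in> S then 0 else M $ i $ j) else 0)" for a
      by (auto simp: D_def diag_on_def)
    then show ?thesis by (simp add: matrix_matrix_mult_def)
  qed
  have colD: "(M ** D) $ i $ j = (if j \<in> S then 0 else M $ i $ j)" for M :: "real^'n^'n" and i j
  proof -
    have "M $ i $ a * D $ a $ j = (if a = j then (if j \<in> S then 0 else M $ i $ j) else 0)" for a
      by (auto simp: D_def diag_on_def)
    then show ?thesis by (simp add: matrix_matrix_mult_def)
  qed
  have DW: "D ** W = D" and YD: "Y ** D = D" and DY: "D ** Y = D"
    unfolding vec_eq_iff rowD colD using Yout by (auto simp: W E_def D_def diag_on_def)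
  have EY: "E ** Y = Y - D" and YE: "Y ** E = Y - D"
  proof -
    have E: "E = mat 1 - D" using ED by (simp add: algebra_simps)
    show "E ** Y = Y - D" "Y ** E = Y - D" unfolding E by (simp_all add: matrix_ring DY YD)
  qed
  have Winv: "W ** matrix_inv W = mat 1" "matrix_inv W ** W = mat 1" using dW by (simp_all add: matrix_inv_right matrix_inv_left)
  have Yinv: "Y ** matrix_inv Y = mat 1" "matrix_inv Y ** Y = mat 1" using dY by (simp_all add: matrix_inv_right matrix_inv_left)
  have diff: "matrix_inv Y - matrix_inv W + D = Q"
  proof (rule matrix_cancel_right)
    show "det W \<noteq> 0" using dW by simp
    show "(matrix_inv Y - matrix_inv W + D) ** W = Q ** W"
    proof (rule matrix_cancel_left)
      show "det Y \<noteq> 0" using dY by simp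
      have "Y ** ((matrix_inv Y - matrix_inv W + D) ** W) = (Y ** matrix_inv Y) ** W - Y ** (matrix_inv W ** W) + Y ** (D ** W)"
        by (simp add: matrix_ring matrix_mul_assoc)
      also have "\<dots> = mat 1" by (simp add: Yinv Winv DW YD) (use ED in \<open>simp add: W algebra_simps\<close>)
      also have "\<dots> = (Y ** matrix_inv Y) ** (matrix_inv W ** W)" by (simp add: Yinv Winv)
      also have "\<dots> = Y ** (Q ** W)" by (simp add: Q_def W_def matrix_mul_assoc)
      finally show "Y ** ((matrix_inv Y - matrix_inv W + D) ** W) = Y ** (Q ** W)" .
    qed
  qed
  have WY: "W ** Y = Y ** Y + Y - D" by (simp add: W matrix_ring EY)
  have YW: "Y ** W = Y ** Y + Y - D" by (simp add: W matrix_ring YE)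
  have pWY: "pos_def_matrix (W ** Y)"
    unfolding pos_def_matrix_def
  proof (intro conjI allI impI)
    have "transpose (W ** Y) = Y ** W" by (simp only: matrix_transpose_mul Ysym Wsym)
    then show "transpose (W ** Y) = W ** Y" by (simp only: WY YW)
    fix v :: "real^'n" assume v: "v \<noteq> 0"
    have "v \<bullet> ((Y ** Y) *v v) = (Y *v v) \<bullet> (Y *v v)"
      by (metis Ysym dot_lmul_matrix matrix_vector_mul_assoc transpose_matrix_vector)
    moreover have "v \<bullet> (D *v v) \<le> (Y *v v) \<bullet> (Y *v v)"
    proof -
      have "v $ i * (D *v v) $ i \<le> (Y *v v) $ i * (Y *v v) $ i" for i
      proof (cases "i \<in> S")
        case False
        then have "(Y *v v) $ i = v $ i" by (simp add: matrix_vector_mult_def Yout mult_delta_left)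
        then show ?thesis by (simp add: D_def Ex)
      qed (simp add: D_def Ex)
      then show ?thesis by (simp add: inner_vec_def sum_mono)
    qed
    ultimately show "v \<bullet> ((W ** Y) *v v) > 0"
      using pos_defD[OF Y v]
      by (simp add: WY matrix_vector_mult_add_rdistrib matrix_vector_mult_diff_rdistrib inner_add_right inner_diff_right)
  qed
  have "matrix_inv (W ** Y) = Q"
    unfolding Q_def W_def[symmetric] using dW dY by (intro matrix_inv_mul) auto
  then show "pos_def_matrix Q" using pos_def_inverse[OF pWY] by simp
  show "det Q * (det Y * det W) = 1"
  proof -
    have "det (matrix_inv Y) * det Y = 1" "det (matrix_inv W) * det W = 1"
      using Yinv(2) Winv(2) by (metis det_mul det_I)+
    moreover have "det Q = det (matrix_inv Y) * det (matrix_inv W)" by (simp add: Q_def W_def det_mul)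
    ultimately show ?thesis by (metis mult.assoc mult.left_commute mult.right_neutral)
  qed
  have "Q $ i $ j = (if i = j then 1 else 0)" if i: "i \<notin> S" for i j
  proof -
    have "W $ i $ j = (if i = j then 1 else 0)" for j using Yout i by (simp add: W E_def diag_on_def)
    then have "matrix_inv W $ i $ j = (if i = j then 1 else 0)" using dW by (intro inverse_row_unit) auto
    moreover have "matrix_inv Y $ i $ j = (if i = j then 1 else 0)" using dY Yout i by (intro inverse_row_unit) auto
    moreover have "D $ i $ j = (if i = j then 1 else 0)" using i by (simp add: D_def diag_on_def)
    ultimately show ?thesis unfolding diff[symmetric] by simp
  qed
  then show "unit_outside S Q"
    unfolding unit_outside_def using transpose_nth[OF pos_def_sym[OF \<open>pos_def_matrix Q\<close>]] by metis
  assume b: "\<And>i. i \<notin> S \<Longrightarrow> b $ i = 0"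
  have "D *v b = 0" using b by (simp add: vec_eq_iff D_def Ex)
  then show "b \<bullet> (matrix_inv Y *v b) - b \<bullet> (matrix_inv W *v b) = b \<bullet> (Q *v b)"
    unfolding diff[symmetric]
    by (simp add: matrix_vector_mult_add_rdistrib matrix_vector_mult_diff_rdistrib inner_diff_right)
qed

lemma pos_def_borel [measurable]:
  "{Y :: ((real, 'n::finite) vec, 'n) vec. pos_def_matrix Y} \<in> sets borel"
proof -
  have "pos_def_matrix Y \<longleftrightarrow> xiy 0 Y \<in> siegel" for Y :: "((real, 'n) vec, 'n) vec"
  proof -
    have "transpose (0 :: ((real, 'n) vec, 'n) vec) = 0" by (simp add: transpose_def vec_eq_iff)
    then show ?thesis using xiy_siegel[of 0 Y] siegel_pos[of "xiy 0 Y"] by auto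
  qed
  then have "{Y :: ((real, 'n) vec, 'n) vec. pos_def_matrix Y} = (\<lambda>Y. xiy 0 Y) -` siegel \<inter> space borel" by auto
  moreover have "(\<lambda>Y. xiy 0 Y) -` siegel \<inter> space borel \<in> sets (borel :: ((real, 'n) vec, 'n) vec measure)"
    by (rule measurable_sets[OF _ siegel_borel]) measurable
  ultimately show ?thesis by simp
qed

text \<open>A Beta integral from the corner and a vector integral from the border; the latter yields
  det Q^(-1/2) = (det Y det W)^(1/2), which raises a and lowers b by 1/2.\<close>

primrec y_const :: "nat \<Rightarrow> real \<Rightarrow> real \<Rightarrow> real" where
  "y_const 0 a b = 1"
| "y_const (Suc n) a b = Gamma (a + 1) * Gamma (b - a - 1) / Gamma b * vec_const n (b - a - 1) * y_const n (a + 1 / 2) (b - 1 / 2)"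

lemma y_const_nonneg: "a > - 1 \<Longrightarrow> b - a - 1 > real n - 1 \<Longrightarrow> y_const n a b \<ge> 0"
proof (induction n arbitrary: a b)
  case (Suc n)
  have "y_const n (a + 1 / 2) (b - 1 / 2) \<ge> 0" using Suc.prems by (intro Suc.IH) auto
  moreover have "Gamma (a + 1) > 0" "Gamma (b - a - 1) > 0" "Gamma b > 0"
    using Suc.prems by (auto intro!: Gamma_real_pos)
  moreover have "vec_const n (b - a - 1) > 0" using Suc.prems by (intro vec_const_pos) auto
  ultimately show ?case by simp
qed simp

text \<open>A Beta integral over positive definite matrices, Y against Y + 1. For a fixed border,
  positivity confines the corner to a half-line starting at r, where the integrand is s^a (s + 1 +
  \<kappa>)^(-b) in s = t - r, up to constants. The result is a power of 1 + \<kappa>, with \<kappa>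
  a quadratic form in the border.\<close>

lemma nn_integral_y:
  fixes S :: "'n::{finite,linorder} set"
  assumes "finite S" "a > - 1" "b - a - 1 > real (card S) - 1"
  shows "(\<integral>\<^sup>+c. ennreal (det (sym_on S c + diag_on (- S)) powr a * det (sym_on S c + diag_on (- S) + diag_on S) powr (- b)) *
      indicator {Y. pos_def_matrix Y} (sym_on S c + diag_on (- S)) \<partial>PiM (pairs_on S) (\<lambda>_. lborel)) =
    ennreal (y_const (card S) a b)"
  using assms
proof (induction S arbitrary: a b rule: finite_induct)
  case empty
  have [simp]: "sym_on {} c = 0" "diag_on UNIV = mat 1" "diag_on {} = 0" for c :: "'n \<times> 'n \<Rightarrow> real"
    by (simp_all add: sym_on_def diag_on_def vec_eq_iff mat_def)
  have "pos_def_matrix (mat 1 :: ((real, 'n) vec, 'n) vec)" by (simp add: pos_def_matrix_def)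
  then show ?case
    by (simp add: pairs_on_def PiM_empty nn_integral_count_space_finite)
next
  case (insert k S)
  define n where "n = card S"
  have cS: "card (insert k S) = Suc n" using insert.hyps by (simp add: n_def)
  define \<delta> where "\<delta> = b - a - 1"
  have a: "a > - 1" and \<delta>: "\<delta> > real n" using insert.prems by (simp_all add: cS \<delta>_def)
  have \<delta>0: "\<delta> > 0" and \<delta>2: "\<delta> > real n / 2" using \<delta> by (auto intro: le_less_trans)
  have b0: "b > 0" using a \<delta>0 by (simp add: \<delta>_def)
  have Gp: "Gamma (a + 1) > 0" "Gamma \<delta> > 0" "Gamma b > 0" using a \<delta>0 b0 by (auto intro!: Gamma_real_pos)
  define C where "C = Gamma (a + 1) * Gamma \<delta> / Gamma b"
  have C0: "C > 0" using Gp by (simp add: C_def)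
  define v where "v = vec_of S (sorted_pair k)"
  have vm [measurable]: "v \<in> borel_measurable (PiM (sorted_pair k ` S) (\<lambda>_. lborel :: real measure))"
    unfolding v_def by measurable
  define f where "f Y T a b = ennreal (det Y powr a * det (Y + diag_on T) powr (- b)) * indicator {Y. pos_def_matrix Y} Y"
    for Y :: "((real, 'n) vec, 'n) vec" and T a b
  have bm1: "bordered k X \<beta> t + diag_on (- insert k S) = bordered k (X + diag_on (- S)) \<beta> t"
    if "\<And>i j. i \<notin> S \<Longrightarrow> X $ i $ j = 0" "\<And>i. i \<notin> S \<Longrightarrow> \<beta> $ i = 0" for X :: "((real, 'n) vec, 'n) vec" and \<beta> t
    using insert.hyps(2) that by (auto simp: vec_eq_iff bordered_def diag_on_def)
  have bm2: "bordered k Y \<beta> t + diag_on (insert k S) = bordered k (Y + diag_on S) \<beta> (t + 1)"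
    if "\<beta> $ k = 0" for Y :: "((real, 'n) vec, 'n) vec" and \<beta> t
    using insert.hyps(2) that by (auto simp: vec_eq_iff bordered_def diag_on_def)
  have "(\<integral>\<^sup>+c. f (sym_on (insert k S) c + diag_on (- insert k S)) (insert k S) a b \<partial>PiM (pairs_on (insert k S)) (\<lambda>_. lborel)) =
    (\<integral>\<^sup>+c. \<integral>\<^sup>+x. \<integral>\<^sup>+t. f (bordered k (sym_on S c) (v x) t + diag_on (- insert k S)) (insert k S) a b \<partial>lborel
       \<partial>PiM (sorted_pair k ` S) (\<lambda>_. lborel) \<partial>PiM (pairs_on S) (\<lambda>_. lborel))"
    unfolding v_def f_def
    by (rule nn_integral_pairs_insert[OF insert.hyps(2), of "\<lambda>X. ennreal (det (X + diag_on (- insert k S)) powr a *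
       det (X + diag_on (- insert k S) + diag_on (insert k S)) powr (- b)) * indicator {Y. pos_def_matrix Y} (X + diag_on (- insert k S))"]) measurable
  also have "\<dots> = (\<integral>\<^sup>+c. ennreal (C * vec_const n \<delta>) * f (sym_on S c + diag_on (- S)) S (a + 1 / 2) (b - 1 / 2) \<partial>PiM (pairs_on S) (\<lambda>_. lborel))"
  proof (rule nn_integral_cong)
    fix c :: "'n \<times> 'n \<Rightarrow> real"
    define Y where "Y = sym_on S c + diag_on (- S)"
    have out: "unit_outside S Y" by (auto simp: unit_outside_def Y_def diag_on_def sym_on_def)
    have row: "Y $ k $ j = (if k = j then 1 else 0)" for j using out insert.hyps(2) by (simp add: unit_outside_def)
    have Ysym: "transpose Y = Y"
      using sym_on_props(1)[of S c] by (auto simp: Y_def transpose_add diag_on_def transpose_def vec_eq_iff)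
    have v0: "v x $ i = 0" if "i \<notin> S" for x i using that by (simp add: v_def vec_of_def)
    have vk: "v x $ k = 0" for x using v0 insert.hyps(2) by simp
    have bY: "bordered k (sym_on S c) (v x) t + diag_on (- insert k S) = bordered k Y (v x) t" for x t
      unfolding Y_def by (rule bm1) (use sym_on_props(2) v0 in auto)
    show "(\<integral>\<^sup>+x. \<integral>\<^sup>+t. f (bordered k (sym_on S c) (v x) t + diag_on (- insert k S)) (insert k S) a b \<partial>lborel
       \<partial>PiM (sorted_pair k ` S) (\<lambda>_. lborel)) = ennreal (C * vec_const n \<delta>) * f (sym_on S c + diag_on (- S)) S (a + 1 / 2) (b - 1 / 2)"
      unfolding bY Y_def[symmetric]
    \<comment> \<open>If the inner block is not positive definite, no bordered matrix over it is,
      and both sides vanish.\<close>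
    proof (cases "pos_def_matrix Y")
      case False
      then have "\<not> pos_def_matrix (bordered k Y (v x) t)" for x t
        using bordered_pos_def_iff[OF Ysym vk row] by blast
      then show "(\<integral>\<^sup>+x. \<integral>\<^sup>+t. f (bordered k Y (v x) t) (insert k S) a b \<partial>lborel
       \<partial>PiM (sorted_pair k ` S) (\<lambda>_. lborel)) = ennreal (C * vec_const n \<delta>) * f Y S (a + 1 / 2) (b - 1 / 2)"
        using False by (simp add: f_def)
    next
      case True
      define W where "W = Y + diag_on S"
      define Q where "Q = matrix_inv Y ** matrix_inv W"
      note inv = inverse_difference[OF True out, folded W_def, folded Q_def]
      have dY: "det Y > 0" by (rule pos_def_det_pos[OF True])
      have rowW: "W $ k $ j = (if k = j then 1 else 0)" for j
        using row insert.hyps(2) by (simp add: W_def diag_on_def)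
      define A where "A = det Y powr a * det W powr (- b)"
      have A0: "A \<ge> 0" by (simp add: A_def)
      have inner: "(\<integral>\<^sup>+t. f (bordered k Y (v x) t) (insert k S) a b \<partial>lborel) =
        ennreal (A * C) * ennreal ((1 + v x \<bullet> (Q *v v x)) powr (- \<delta>))" for x
      proof -
        define r where "r = v x \<bullet> (matrix_inv Y *v v x)"
        define \<rho> where "\<rho> = v x \<bullet> (matrix_inv W *v v x)"
        define \<kappa> where "\<kappa> = v x \<bullet> (Q *v v x)"
        \<comment> \<open>The two Schur complements, of Y and of Y + 1, start at different points of
          the line. Their distance is governed by the form of Y^(-1) - W^(-1) on vectors supported
          on S.\<close>
        have k: "r - \<rho> = \<kappa>" unfolding r_def \<rho>_def \<kappa>_def 
          using inverse_difference(6)[OF True out, of "v x"] v0 by (simp add: W_def Q_def)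
        have k0: "1 + \<kappa> > 0" using pos_def_nonneg[OF inv(3), of "v x"] by (simp add: \<kappa>_def)
        have d1: "det (bordered k Y (v x) t) = det Y * (t - r)" for t
          using det_bordered[OF Ysym _ row _ vk[of x], where t=t] dY by (simp add: r_def dot_real)
        have d2: "det (bordered k W (v x) t) = det W * (t - \<rho>)" for t
          using det_bordered[OF inv(2) _ rowW _ vk[of x], where t=t] inv(1) by (simp add: \<rho>_def dot_real)
        have ft: "f (bordered k Y (v x) t) (insert k S) a b =
          ennreal A * (ennreal ((t + (- r)) powr a * ((t + (- r)) + (1 + \<kappa>)) powr (- b)) * indicator {0<..} (t + (- r)))" for t
        proof (cases "t - r > 0")
          case pos: True
          have pb: "pos_def_matrix (bordered k Y (v x) t)"
            using bordered_pos_def_iff[OF Ysym vk row] True pos by (simp add: r_def)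
          have "t + 1 - \<rho> = (t + (- r)) + (1 + \<kappa>)" using k by simp
          then have e2: "(det W * (t + 1 - \<rho>)) powr (- b) = det W powr (- b) * ((t + (- r)) + (1 + \<kappa>)) powr (- b)"
            using inv(1) pos k0 by (simp only:) (subst powr_mult, auto)
          have e1: "(det Y * (t - r)) powr a = det Y powr a * (t + (- r)) powr a"
            using dY pos by (simp add: powr_mult)
          have "f (bordered k Y (v x) t) (insert k S) a b = ennreal ((det Y * (t - r)) powr a * (det W * (t + 1 - \<rho>)) powr (- b))"
            using pb by (simp add: f_def bm2[OF vk] W_def[symmetric] d1 d2)
          also have "\<dots> = ennreal (A * ((t + (- r)) powr a * ((t + (- r)) + (1 + \<kappa>)) powr (- b)))"
            unfolding e1 e2 A_def by (simp only: mult_ac)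
          also have "\<dots> = ennreal A * ennreal ((t + (- r)) powr a * ((t + (- r)) + (1 + \<kappa>)) powr (- b))"
            by (rule ennreal_mult) (simp_all add: A_def)
          finally show ?thesis using pos by simp
        next
          case neg: False
          have "\<not> pos_def_matrix (bordered k Y (v x) t)"
            using bordered_pos_def_iff[OF Ysym vk row] neg by (simp add: r_def)
          then show ?thesis using neg by (simp add: f_def)
        qed
        have "(\<integral>\<^sup>+t. f (bordered k Y (v x) t) (insert k S) a b \<partial>lborel) =
          ennreal A * (\<integral>\<^sup>+t. ennreal (t powr a * (t + (1 + \<kappa>)) powr (- b)) * indicator {0<..} t \<partial>lborel)"
          unfolding ft
          by (subst nn_integral_cmult, measurable,
              subst nn_integral_translation[of "\<lambda>t. ennreal (t powr a * (t + (1 + \<kappa>)) powr (- b)) * indicator {0<..} t"]) auto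
        also have "\<dots> = ennreal A * ennreal (C * (1 + \<kappa>) powr (- \<delta>))"
        proof -
          have "a + 1 - b = - \<delta>" by (simp add: \<delta>_def)
          then show ?thesis
            unfolding nn_integral_Beta_half_line[OF a \<delta>0[unfolded \<delta>_def] k0] by (simp only: C_def \<delta>_def)
        qed
        finally show ?thesis using A0 C0 by (simp add: \<kappa>_def ennreal_mult mult.assoc)
      qed
      have "(\<integral>\<^sup>+x. \<integral>\<^sup>+t. f (bordered k Y (v x) t) (insert k S) a b \<partial>lborel \<partial>PiM (sorted_pair k ` S) (\<lambda>_. lborel)) =
        ennreal (A * C) * (\<integral>\<^sup>+x. ennreal ((1 + v x \<bullet> (Q *v v x)) powr (- \<delta>)) \<partial>PiM (sorted_pair k ` S) (\<lambda>_. lborel))"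
        unfolding inner by (rule nn_integral_cmult) measurable
      also have "(\<integral>\<^sup>+x. ennreal ((1 + v x \<bullet> (Q *v v x)) powr (- \<delta>)) \<partial>PiM (sorted_pair k ` S) (\<lambda>_. lborel)) =
        ennreal (vec_const n \<delta> * det Q powr (- 1 / 2) * 1 powr (real n / 2 - \<delta>))"
        unfolding v_def n_def
        by (rule nn_integral_vec_quadratic[OF insert.hyps(1) inj_sorted_pair inv(3,4)]) (use \<delta>2 n_def in auto)
      also have "det Q powr (- 1 / 2) = det Y powr (1 / 2) * det W powr (1 / 2)"
      proof -
        have "det Q = inverse (det Y * det W)" using inv(5) dY inv(1) by (simp add: field_simps)
        then have "det Q powr (- 1 / 2) = (det Y * det W) powr (1 / 2)"
          using dY inv(1) by (simp add: powr_minus inverse_powr powr_mult)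
        then show ?thesis using dY inv(1) by (simp add: powr_mult)
      qed
      also have "ennreal (A * C) * ennreal (vec_const n \<delta> * (det Y powr (1 / 2) * det W powr (1 / 2)) * 1 powr (real n / 2 - \<delta>)) =
         ennreal (C * vec_const n \<delta>) * ennreal ((det Y powr a * det Y powr (1 / 2)) * (det W powr (- b) * det W powr (1 / 2)))"
        using A0 C0 vec_const_pos[OF \<delta>2] by (subst (1 2) ennreal_mult[symmetric]) (auto simp: A_def mult_ac)
      also have "det W powr (- b) * det W powr (1 / 2) = det W powr (- (b - 1 / 2))"
        by (simp add: powr_add[symmetric])
      also have "det Y powr a * det Y powr (1 / 2) = det Y powr (a + 1 / 2)"
        by (simp add: powr_add)
      finally show "(\<integral>\<^sup>+x. \<integral>\<^sup>+t. f (bordered k Y (v x) t) (insert k S) a b \<partial>lborel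
       \<partial>PiM (sorted_pair k ` S) (\<lambda>_. lborel)) = ennreal (C * vec_const n \<delta>) * f Y S (a + 1 / 2) (b - 1 / 2)"
        using True by (simp add: f_def W_def)
    qed
  qed
  also have "\<dots> = ennreal (C * vec_const n \<delta>) * ennreal (y_const n (a + 1 / 2) (b - 1 / 2))"
    using insert.IH[of "a + 1 / 2" "b - 1 / 2"] a \<delta>
    by (subst nn_integral_cmult) (auto simp: f_def n_def \<delta>_def)
  also have "\<dots> = ennreal (y_const (Suc n) a b)"
    using C0 vec_const_pos[OF \<delta>2] y_const_nonneg[of "a + 1 / 2" n "b - 1 / 2"] a \<delta>
    by (subst ennreal_mult[symmetric]) (auto simp: C_def \<delta>_def)
  finally show ?case by (simp only: cS f_def)
qed

subsection \<open>The integral over the half-space\<close>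

lemma measurable_PiM_Complex:
  assumes "f \<in> N \<rightarrow>\<^sub>M PiM J (\<lambda>_. lborel :: real measure)" "g \<in> N \<rightarrow>\<^sub>M PiM J (\<lambda>_. lborel :: real measure)"
  shows "(\<lambda>p. \<lambda>i\<in>J. Complex (f p i) (g p i)) \<in> N \<rightarrow>\<^sub>M PiM J (\<lambda>_. lborel)"
proof (rule measurable_restrict)
  fix i assume i: "i \<in> J"
  have "(\<lambda>p. f p i) \<in> borel_measurable N" "(\<lambda>p. g p i) \<in> borel_measurable N"
    using measurable_compose[OF assms(1) measurable_component_singleton[OF i]]
      measurable_compose[OF assms(2) measurable_component_singleton[OF i]] by simp_all
  then show "(\<lambda>p. Complex (f p i) (g p i)) \<in> N \<rightarrow>\<^sub>M lborel" by simp
qed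

lemma measurable_PiM_fun_upd_compose:
  assumes "F \<in> borel_measurable (PiM (insert i I) (\<lambda>_. lborel :: complex measure))"
    "f \<in> N \<rightarrow>\<^sub>M PiM I (\<lambda>_. lborel)" "g \<in> borel_measurable N"
  shows "(\<lambda>p. F ((f p)(i := g p))) \<in> borel_measurable N"
proof -
  have "(\<lambda>p. (f p)(i := g p)) \<in> N \<rightarrow>\<^sub>M PiM (insert i I) (\<lambda>_. lborel)"
    by (rule measurable_fun_upd[where J=I]) (use assms in auto)
  from measurable_compose[OF this assms(1)] show ?thesis .
qed

text \<open>Induction on I: a complex coordinate is split into two real ones, and Fubini moves its
  real part past the imaginary parts already collected.\<close>

lemma nn_integral_PiM_complex:
  fixes F :: "('i \<Rightarrow> complex) \<Rightarrow> ennreal"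
  assumes "finite I" "F \<in> borel_measurable (PiM I (\<lambda>_. lborel))"
  shows "(\<integral>\<^sup>+c. F c \<partial>PiM I (\<lambda>_. lborel)) =
    (\<integral>\<^sup>+x. \<integral>\<^sup>+y. F (\<lambda>i\<in>I. Complex (x i) (y i)) \<partial>PiM I (\<lambda>_. lborel) \<partial>PiM I (\<lambda>_. lborel))"
  using assms
proof (induction I arbitrary: F rule: finite_induct)
  case empty
  then show ?case by (simp add: PiM_empty nn_integral_count_space_finite)
next
  case (insert i I)
  interpret C: product_sigma_finite "\<lambda>_. lborel :: complex measure"
    by (simp add: product_sigma_finite_def lborel.sigma_finite_measure_axioms)
  interpret R: product_sigma_finite "\<lambda>_. lborel :: real measure"
    by (simp add: product_sigma_finite_def lborel.sigma_finite_measure_axioms)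
  interpret RI: sigma_finite_measure "PiM I (\<lambda>_. lborel :: real measure)"
    by (rule R.sigma_finite[OF insert.hyps(1)])
  interpret P: pair_sigma_finite "lborel :: real measure" "PiM I (\<lambda>_. lborel :: real measure)"
    by (simp add: pair_sigma_finite_def lborel.sigma_finite_measure_axioms RI.sigma_finite_measure_axioms)
  note Fm = insert.prems
  note comp = measurable_PiM_fun_upd_compose[OF Fm] and cm = measurable_PiM_Complex
  let ?R = "\<lambda>I. PiM I (\<lambda>_. lborel :: real measure)"
  let ?C = "\<lambda>I. PiM I (\<lambda>_. lborel :: complex measure)"
  define G where "G c = (\<integral>\<^sup>+s. \<integral>\<^sup>+t. F (c(i := Complex s t)) \<partial>lborel \<partial>lborel)" for c
  have "(\<lambda>p. F ((fst (fst p))(i := Complex (snd (fst p)) (snd p)))) \<in> borel_measurable ((?C I \<Otimes>\<^sub>M lborel) \<Otimes>\<^sub>M lborel)"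
    by (rule comp) measurable
  then have Gm: "G \<in> borel_measurable (?C I)"
    unfolding G_def by (intro lborel.borel_measurable_nn_integral) (simp add: split_beta')
  have "(\<integral>\<^sup>+c. F c \<partial>?C (insert i I)) = (\<integral>\<^sup>+c. \<integral>\<^sup>+z. F (c(i := z)) \<partial>lborel \<partial>?C I)"
    by (rule C.product_nn_integral_insert[OF insert.hyps Fm])
  also have "\<dots> = (\<integral>\<^sup>+c. G c \<partial>?C I)"
  proof (rule nn_integral_cong)
    fix c assume "c \<in> space (?C I)"
    then have "(\<lambda>z. F (c(i := z))) \<in> borel_measurable borel"
      by (intro comp measurable_const) auto
    then show "(\<integral>\<^sup>+z. F (c(i := z)) \<partial>lborel) = G c"
      unfolding G_def by (rule nn_integral_complex)
  qed
  also have "\<dots> = (\<integral>\<^sup>+x. \<integral>\<^sup>+y. G (\<lambda>i\<in>I. Complex (x i) (y i)) \<partial>?R I \<partial>?R I)"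
    by (rule insert.IH[OF Gm])
  also have "\<dots> = (\<integral>\<^sup>+x. \<integral>\<^sup>+s. \<integral>\<^sup>+y. \<integral>\<^sup>+t. F ((\<lambda>i\<in>I. Complex (x i) (y i))(i := Complex s t)) \<partial>lborel \<partial>?R I \<partial>lborel \<partial>?R I)"
  proof (rule nn_integral_cong)
    fix x assume x: "x \<in> space (?R I)"
    have "(\<lambda>p. F ((\<lambda>j\<in>I. Complex (x j) (snd (fst p) j))(i := Complex (fst (fst p)) (snd p)))) \<in> borel_measurable ((lborel \<Otimes>\<^sub>M ?R I) \<Otimes>\<^sub>M lborel)"
      by (rule comp, rule cm[where f="\<lambda>_. x"]) (use x in auto)
    then have m: "(\<lambda>p. \<integral>\<^sup>+t. F ((\<lambda>j\<in>I. Complex (x j) (snd p j))(i := Complex (fst p) t)) \<partial>lborel) \<in> borel_measurable (lborel \<Otimes>\<^sub>M ?R I)"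
      by (intro lborel.borel_measurable_nn_integral) (simp add: split_beta')
    show "(\<integral>\<^sup>+y. G (\<lambda>i\<in>I. Complex (x i) (y i)) \<partial>?R I) =
      (\<integral>\<^sup>+s. \<integral>\<^sup>+y. \<integral>\<^sup>+t. F ((\<lambda>i\<in>I. Complex (x i) (y i))(i := Complex s t)) \<partial>lborel \<partial>?R I \<partial>lborel)"
      unfolding G_def
      by (rule P.Fubini'[where f="\<lambda>s y. \<integral>\<^sup>+t. F ((\<lambda>j\<in>I. Complex (x j) (y j))(i := Complex s t)) \<partial>lborel"])
         (use m in \<open>simp add: split_beta'\<close>)
  qed
  also have "\<dots> = (\<integral>\<^sup>+x. \<integral>\<^sup>+s. \<integral>\<^sup>+y. F (\<lambda>j\<in>insert i I. Complex ((x(i := s)) j) (y j)) \<partial>?R (insert i I) \<partial>lborel \<partial>?R I)"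
  proof (intro nn_integral_cong)
    fix x :: "'i \<Rightarrow> real" and s :: real assume x: "x \<in> space (?R I)"
    have xs: "x(i := s) \<in> space (?R (insert i I))" using x by (auto simp: space_PiM PiE_iff extensional_def)
    have m: "(\<lambda>y. F (\<lambda>j\<in>insert i I. Complex ((x(i := s)) j) (y j))) \<in> borel_measurable (?R (insert i I))"
      by (rule measurable_compose[OF cm[of "\<lambda>_. x(i := s)" _ "insert i I" "\<lambda>y. y"] Fm]) (use xs in auto)
    have "(\<lambda>j\<in>insert i I. Complex ((x(i := s)) j) ((y(i := t)) j)) = (\<lambda>i\<in>I. Complex (x i) (y i))(i := Complex s t)" for y t
      using insert.hyps(2) by (auto simp: fun_eq_iff)
    then show "(\<integral>\<^sup>+y. \<integral>\<^sup>+t. F ((\<lambda>i\<in>I. Complex (x i) (y i))(i := Complex s t)) \<partial>lborel \<partial>?R I) =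
      (\<integral>\<^sup>+y. F (\<lambda>j\<in>insert i I. Complex ((x(i := s)) j) (y j)) \<partial>?R (insert i I))"
      by (subst R.product_nn_integral_insert[OF insert.hyps m]) simp
  qed
  also have "\<dots> = (\<integral>\<^sup>+x. \<integral>\<^sup>+y. F (\<lambda>j\<in>insert i I. Complex (x j) (y j)) \<partial>?R (insert i I) \<partial>?R (insert i I))"
  proof (rule R.product_nn_integral_insert[OF insert.hyps, symmetric])
    interpret RJ: sigma_finite_measure "?R (insert i I)" by (rule R.sigma_finite) (use insert.hyps in simp)
    have "(\<lambda>p. F (\<lambda>j\<in>insert i I. Complex (fst p j) (snd p j))) \<in> borel_measurable (?R (insert i I) \<Otimes>\<^sub>M ?R (insert i I))"
      by (rule measurable_compose[OF cm Fm]) auto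
    then show "(\<lambda>x. \<integral>\<^sup>+y. F (\<lambda>j\<in>insert i I. Complex (x j) (y j)) \<partial>?R (insert i I)) \<in> borel_measurable (?R (insert i I))"
      by (intro RJ.borel_measurable_nn_integral) (simp add: split_beta')
  qed
  finally show ?case .
qed

text \<open>Since z + i = x + i(y + 1), integrating over x first gives a power of det(y + 1). What
  remains is the matrix Beta integral with a = p - n - 1, the -n - 1 being the exponent of the
  density; the condition p > n is a > -1.\<close>

lemma nn_integral_siegel_power:
  fixes p :: real
  assumes p: "p > real CARD('n::{finite,linorder})"
  shows "(\<integral>\<^sup>+z. ennreal (cmod (det (z + mat \<i>)) powr (- 2 * p) * det (Im_matrix z) powr p) \<partial>(siegel_measure :: 'n cmat measure)) =
    ennreal (x_const CARD('n) p * y_const CARD('n) (p - real CARD('n) - 1) (2 * p - (real CARD('n) + 1) / 2))"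
proof -
  define n where "n = CARD('n)"
  let ?I = "upper_pairs :: ('n \<times> 'n) set"
  let ?R = "PiM ?I (\<lambda>_. lborel :: real measure)"
  have IU: "pairs_on UNIV = ?I" by (simp add: pairs_on_def)
  have finI: "finite ?I" using finite_pairs_on[of "UNIV :: 'n set"] by (simp only: IU)
  interpret R: product_sigma_finite "\<lambda>_. lborel :: real measure"
    by (simp add: product_sigma_finite_def lborel.sigma_finite_measure_axioms)
  interpret RI: sigma_finite_measure ?R by (rule R.sigma_finite[OF finI])
  interpret P: pair_sigma_finite ?R ?R
    by (simp add: pair_sigma_finite_def RI.sigma_finite_measure_axioms)
  have [measurable]: "sym_on UNIV \<in> borel_measurable ?R" using measurable_sym_on[of "UNIV :: 'n set"] unfolding IU .
  define f where "f z = ennreal (cmod (det (z + mat \<i>)) powr (- 2 * p) * det (Im_matrix z) powr p)" for z :: "'n cmat"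
  have [measurable]: "f \<in> borel_measurable borel" unfolding f_def by measurable
  define g where "g z = f z * siegel_dens z * indicator siegel z" for z
  have gm [measurable]: "g \<in> borel_measurable borel" unfolding g_def by measurable
  have "(\<integral>\<^sup>+z. f z \<partial>siegel_measure) = (\<integral>\<^sup>+z. g z \<partial>sym_lborel)"
    unfolding g_def by (rule nn_integral_siegel_measure, rule measurable_siegelI') measurable
  also have "\<dots> = (\<integral>\<^sup>+c. g (sym_mat c) \<partial>PiM ?I (\<lambda>_. lborel))" by (rule nn_integral_sym_lborel[OF gm])
  also have "\<dots> = (\<integral>\<^sup>+x. \<integral>\<^sup>+y. g (sym_mat (\<lambda>i\<in>?I. Complex (x i) (y i))) \<partial>?R \<partial>?R)"
    by (rule nn_integral_PiM_complex[OF finI]) (use measurable_sym_mat[where 'b=complex] in measurable)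
  also have "\<dots> = (\<integral>\<^sup>+x. \<integral>\<^sup>+y. g (xiy (sym_on UNIV x) (sym_on UNIV y)) \<partial>?R \<partial>?R)"
  proof -
    have "sym_mat (\<lambda>i\<in>?I. Complex (x i) (y i)) = xiy (sym_on UNIV x) (sym_on UNIV y)" for x y
      by (auto simp: vec_eq_iff xiy_def sym_on_def sorted_pair_def min_le_iff_disj)
    then show ?thesis by simp
  qed
  also have "\<dots> = (\<integral>\<^sup>+y. \<integral>\<^sup>+x. g (xiy (sym_on UNIV x) (sym_on UNIV y)) \<partial>?R \<partial>?R)"
    by (rule P.Fubini'[symmetric]) measurable
  also have "\<dots> = (\<integral>\<^sup>+y. ennreal (x_const n p) * (ennreal (det (sym_on UNIV y + diag_on (- UNIV)) powr (p - real n - 1) *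
      det (sym_on UNIV y + diag_on (- UNIV) + diag_on UNIV) powr (- (2 * p - (real n + 1) / 2))) *
      indicator {Y. pos_def_matrix Y} (sym_on UNIV y + diag_on (- UNIV))) \<partial>?R)"
  proof (rule nn_integral_cong)
    fix y :: "'n \<times> 'n \<Rightarrow> real"
    define Y where "Y = sym_on UNIV y"
    have dU: "diag_on (- UNIV) = (0 :: ((real, 'n) vec, 'n) vec)" "diag_on UNIV = (mat 1 :: ((real, 'n) vec, 'n) vec)"
      by (simp_all add: diag_on_def vec_eq_iff mat_def)
    show "(\<integral>\<^sup>+x. g (xiy (sym_on UNIV x) (sym_on UNIV y)) \<partial>?R) = ennreal (x_const n p) * (ennreal (det (sym_on UNIV y + diag_on (- UNIV)) powr (p - real n - 1) *
      det (sym_on UNIV y + diag_on (- UNIV) + diag_on UNIV) powr (- (2 * p - (real n + 1) / 2))) *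
      indicator {Y. pos_def_matrix Y} (sym_on UNIV y + diag_on (- UNIV)))"
      unfolding dU add_0_right Y_def[symmetric]
    proof (cases "pos_def_matrix Y")
      case False
      then have "xiy X Y \<notin> siegel" for X using siegel_pos[of "xiy X Y"] by auto
      then show "(\<integral>\<^sup>+x. g (xiy (sym_on UNIV x) Y) \<partial>?R) = ennreal (x_const n p) * (ennreal (det Y powr (p - real n - 1) *
        det (Y + mat 1) powr (- (2 * p - (real n + 1) / 2))) * indicator {Y. pos_def_matrix Y} Y)"
        using False by (simp add: g_def)
    next
      case True
      have d0: "det Y > 0" by (rule pos_def_det_pos[OF True])
      have out: "unit_outside UNIV Z" for Z :: "((real, 'n) vec, 'n) vec" by (simp add: unit_outside_def)
      have Y1: "pos_def_matrix (Y + mat 1)"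
        using pos_defD[OF True] pos_def_sym[OF True]
        by (auto simp: pos_def_matrix_def transpose_add matrix_vector_mult_add_rdistrib inner_add_right intro: add_pos_nonneg)
      have gx: "g (xiy (sym_on UNIV x) Y) = ennreal (det Y powr (p - real n - 1)) * ennreal (cmod (det (xiy (sym_on UNIV x) (Y + mat 1))) powr (- 2 * p))" for x
      proof -
        have "xiy (sym_on UNIV x) Y + mat \<i> = xiy (sym_on UNIV x) (Y + mat 1)"
          by (simp add: xiy_def vec_eq_iff mat_def complex_eq_iff)
        moreover have "det Y powr p * (det Y powi (- int CARD('n) - 1)) = det Y powr (p - real n - 1)"
        proof -
          have "det Y powi (- int CARD('n) - 1) = det Y powr (- real n - 1)"
            using d0 by (simp add: n_def powr_real_of_int'[symmetric] powi_neg_Suc powr_minus powr_diff powr_realpow field_simps)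
          then show ?thesis by (simp add: powr_add[symmetric] algebra_simps)
        qed
        moreover have "xiy (sym_on UNIV x) Y \<in> siegel" by (rule xiy_siegel[OF sym_on_props(1) True])
        ultimately show ?thesis using d0
          by (simp add: g_def f_def siegel_dens_def ennreal_mult[symmetric] mult_ac)
      qed
      have "(\<integral>\<^sup>+x. g (xiy (sym_on UNIV x) Y) \<partial>?R) = ennreal (det Y powr (p - real n - 1)) *
          (\<integral>\<^sup>+x. ennreal (cmod (det (xiy (sym_on UNIV x) (Y + mat 1))) powr (- 2 * p)) \<partial>?R)"
        unfolding gx by (rule nn_integral_cmult) measurable
      also have "(\<integral>\<^sup>+x. ennreal (cmod (det (xiy (sym_on UNIV x) (Y + mat 1))) powr (- 2 * p)) \<partial>?R) =
          ennreal (x_const n p * det (Y + mat 1) powr ((real n + 1) / 2 - 2 * p))"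
        using nn_integral_x[OF finite Y1 out, of p] p unfolding IU n_def by simp
      finally show "(\<integral>\<^sup>+x. g (xiy (sym_on UNIV x) Y) \<partial>?R) = ennreal (x_const n p) * (ennreal (det Y powr (p - real n - 1) *
        det (Y + mat 1) powr (- (2 * p - (real n + 1) / 2))) * indicator {Y. pos_def_matrix Y} Y)"
        using True x_const_pos[of n p] p by (simp add: n_def ennreal_mult[symmetric] mult_ac)
    qed
  qed
  also have "\<dots> = ennreal (x_const n p) * ennreal (y_const n (p - real n - 1) (2 * p - (real n + 1) / 2))"
  proof (subst nn_integral_cmult)
    \<comment> \<open>The left side of the next inequality is p + (n - 1)/2.\<close>
    have "n > 0" by (simp add: n_def)
    then have "(2 * p - (real n + 1) / 2) - (p - real n - 1) - 1 > real (card (UNIV :: 'n set)) - 1"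
      using p by (simp add: n_def field_simps)
    from nn_integral_y[OF finite _ this] p
    show "ennreal (x_const n p) * (\<integral>\<^sup>+y. ennreal (det (sym_on UNIV y + diag_on (- UNIV)) powr (p - real n - 1) *
      det (sym_on UNIV y + diag_on (- UNIV) + diag_on UNIV) powr (- (2 * p - (real n + 1) / 2))) *
      indicator {Y. pos_def_matrix Y} (sym_on UNIV y + diag_on (- UNIV)) \<partial>?R) =
      ennreal (x_const n p) * ennreal (y_const n (p - real n - 1) (2 * p - (real n + 1) / 2))"
      unfolding IU by (simp add: n_def)
  qed measurable
  finally show ?thesis
    using x_const_pos[of n p] p by (simp add: f_def n_def ennreal_mult' less_imp_le)
qed

section \<open>The constant\<close>

lemma Gamma_duplication_real:
  fixes x :: real
  assumes x: "x > 0"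
  shows "Gamma x * Gamma (x + 1 / 2) = 2 powr (1 - 2 * x) * sqrt pi * Gamma (2 * x)"
proof -
  have n: "complex_of_real x \<notin> \<int>\<^sub>\<le>\<^sub>0" "complex_of_real x + 1 / 2 \<notin> \<int>\<^sub>\<le>\<^sub>0"
    using x by (auto elim!: nonpos_Ints_cases simp: complex_eq_iff)
  have "complex_of_real (Gamma x * Gamma (x + 1 / 2)) = Gamma (complex_of_real x) * Gamma (complex_of_real x + 1 / 2)"
    using Gamma_complex_of_real[of x] Gamma_complex_of_real[of "x + 1 / 2"] by simp
  also have "\<dots> = exp ((1 - 2 * complex_of_real x) * of_real (ln 2)) * of_real (sqrt pi) * Gamma (2 * complex_of_real x)"
    by (rule Gamma_legendre_duplication[OF n])
  also have "\<dots> = complex_of_real (2 powr (1 - 2 * x) * sqrt pi * Gamma (2 * x))"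
  proof -
    have "exp ((1 - 2 * complex_of_real x) * of_real (ln 2)) = of_real (exp ((1 - 2 * x) * ln 2))"
      by (simp only: exp_of_real[symmetric]) simp
    moreover have "exp ((1 - 2 * x) * ln 2) = 2 powr (1 - 2 * x)" by (simp add: powr_def)
    moreover have "Gamma (2 * complex_of_real x) = of_real (Gamma (2 * x))"
      using Gamma_complex_of_real[of "2 * x"] by simp
    ultimately show ?thesis by simp
  qed
  finally show ?thesis by (simp only: of_real_eq_iff)
qed

text \<open>Unrolls the recursion: the j-th factor for (n, p - 1/2) is factor j + 1 for (n + 1, p),
  and the new step supplies factor 0. The powers of pi add up along triangular numbers.\<close>

lemma x_const_eq:
  assumes "p > real n / 2"
  shows "x_const n p = pi powr (real n * (real n + 1) / 4) *
    (\<Prod>j<n. Gamma (p - (real j + 1) / 2) * Gamma (2 * p - (real n + 1 + real j) / 2) / (Gamma (p - real j / 2) * Gamma (2 * p - real j - 1)))"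
  using assms
proof (induction n arbitrary: p)
  case (Suc n)
  define g where "g n p j = Gamma (p - (real j + 1) / 2) * Gamma (2 * p - (real n + 1 + real j) / 2) / (Gamma (p - real j / 2) * Gamma (2 * p - real j - 1))" for n p j
  have sh: "g n (p - 1 / 2) j = g (Suc n) p (Suc j)" for j
  proof -
    have "p - 1 / 2 - (real j + 1) / 2 = p - (real (Suc j) + 1) / 2"
      "2 * (p - 1 / 2) - (real n + 1 + real j) / 2 = 2 * p - (real (Suc n) + 1 + real (Suc j)) / 2"
      "p - 1 / 2 - real j / 2 = p - real (Suc j) / 2" "2 * (p - 1 / 2) - real j - 1 = 2 * p - real (Suc j) - 1"
      by (simp_all add: field_simps)
    then show ?thesis by (simp only: g_def)
  qed
  have "x_const n (p - 1 / 2) = pi powr (real n * (real n + 1) / 4) * (\<Prod>j<n. g n (p - 1 / 2) j)"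
    unfolding g_def by (rule Suc.IH) (use Suc.prems in \<open>simp add: field_simps\<close>)
  also have "(\<Prod>j<n. g n (p - 1 / 2) j) = (\<Prod>j<n. g (Suc n) p (Suc j))" by (simp only: sh)
  finally have IH: "x_const n (p - 1 / 2) = pi powr (real n * (real n + 1) / 4) * (\<Prod>j<n. g (Suc n) p (Suc j))" .
  have g0: "quad_const p * vec_const n (2 * p - 1) = (pi powr (1 / 2) * pi powr (real n / 2)) * g (Suc n) p 0"
  proof -
    have "2 * p - 1 - real n / 2 = 2 * p - (real (Suc n) + 1 + real 0) / 2" by (simp add: field_simps)
    then show ?thesis unfolding quad_const_def vec_const_def g_def by (simp only:) (simp add: powr_half_sqrt)
  qed
  have "x_const (Suc n) p = (pi powr (1 / 2) * pi powr (real n / 2) * pi powr (real n * (real n + 1) / 4)) * (g (Suc n) p 0 * (\<Prod>j<n. g (Suc n) p (Suc j)))"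
    by (simp add: g0 IH)
  also have "pi powr (1 / 2) * pi powr (real n / 2) * pi powr (real n * (real n + 1) / 4) = pi powr (real (Suc n) * (real (Suc n) + 1) / 4)"
    unfolding powr_add[symmetric] by (rule arg_cong[of _ _ "\<lambda>e. pi powr e"]) (simp add: field_simps)
  also have "g (Suc n) p 0 * (\<Prod>j<n. g (Suc n) p (Suc j)) = (\<Prod>j<Suc n. g (Suc n) p j)"
    by (simp only: prod.lessThan_Suc_shift)
  finally show ?case by (simp only: g_def)
qed simp

text \<open>As for \<open>x_const\<close>, passing from (n, a + 1/2, b - 1/2) to (n + 1, a, b)
  shifts the index of the factors by one.\<close>

lemma y_const_eq:
  assumes "b - a - 1 > real n - 1"
  shows "y_const n a b = pi powr (real n * (real n - 1) / 4) *
    (\<Prod>j<n. Gamma (a + 1 + real j / 2) * Gamma (b - a - 1 - (real n - 1 + real j) / 2) / Gamma (b - real j / 2))"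
  using assms
proof (induction n arbitrary: a b)
  case (Suc n)
  define g where "g n a b j = Gamma (a + 1 + real j / 2) * Gamma (b - a - 1 - (real n - 1 + real j) / 2) / Gamma (b - real j / 2)" for n a b j
  have sh: "g n (a + 1 / 2) (b - 1 / 2) j = g (Suc n) a b (Suc j)" for j
  proof -
    have "a + 1 / 2 + 1 + real j / 2 = a + 1 + real (Suc j) / 2"
      "b - 1 / 2 - (a + 1 / 2) - 1 - (real n - 1 + real j) / 2 = b - a - 1 - (real (Suc n) - 1 + real (Suc j)) / 2"
      "b - 1 / 2 - real j / 2 = b - real (Suc j) / 2"
      by (simp_all add: field_simps)
    then show ?thesis by (simp only: g_def)
  qed
  have "y_const n (a + 1 / 2) (b - 1 / 2) = pi powr (real n * (real n - 1) / 4) * (\<Prod>j<n. g n (a + 1 / 2) (b - 1 / 2) j)"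
    unfolding g_def by (rule Suc.IH) (use Suc.prems in simp)
  also have "(\<Prod>j<n. g n (a + 1 / 2) (b - 1 / 2) j) = (\<Prod>j<n. g (Suc n) a b (Suc j))" by (simp only: sh)
  finally have IH: "y_const n (a + 1 / 2) (b - 1 / 2) = pi powr (real n * (real n - 1) / 4) * (\<Prod>j<n. g (Suc n) a b (Suc j))" .
  have "Gamma (b - a - 1) > 0" using Suc.prems by (intro Gamma_real_pos) auto
  then have g0: "Gamma (a + 1) * Gamma (b - a - 1) / Gamma b * vec_const n (b - a - 1) = pi powr (real n / 2) * g (Suc n) a b 0"
    by (simp add: vec_const_def g_def)
  have "y_const (Suc n) a b = (pi powr (real n / 2) * pi powr (real n * (real n - 1) / 4)) * (g (Suc n) a b 0 * (\<Prod>j<n. g (Suc n) a b (Suc j)))"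
    unfolding y_const.simps g0 IH by (simp only: mult_ac)
  also have "pi powr (real n / 2) * pi powr (real n * (real n - 1) / 4) = pi powr (real (Suc n) * (real (Suc n) - 1) / 4)"
    unfolding powr_add[symmetric] by (rule arg_cong[of _ _ "\<lambda>e. pi powr e"]) (simp add: field_simps)
  also have "g (Suc n) a b 0 * (\<Prod>j<n. g (Suc n) a b (Suc j)) = (\<Prod>j<Suc n. g (Suc n) a b j)"
    by (simp only: prod.lessThan_Suc_shift)
  finally show ?case by (simp only: g_def)
qed simp

text \<open>The Gamma values at 2M - (N + 1 + j)/2 cancel between the two products, and duplication
  removes those at 2M - j - 1. Each j leaves 2^(-2M) sqrt(pi) 2^(j+2) A_j / B_j: the first powers of
  2 cancel the normalization |2i|^(2mn), and the powers 2^(j+2) multiply to 2^(n(n+3)/2).\<close>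

lemma C_const_eq:
  assumes n: "n > 0" and m: "m > n"
  shows "2 ^ (2 * m * n) * (x_const n (real m) * y_const n (real m - real n - 1) (2 * real m - (real n + 1) / 2)) = C_const m n"
proof -
  define M where "M = real m"
  define N where "N = real n"
  have MN: "M > N" "N \<ge> 1" using n m by (simp_all add: M_def N_def)
  define A where "A j = Gamma (M - N + real j / 2)" for j
  define B where "B j = Gamma (M - real j / 2)" for j
  have pos: "Gamma (M - (real j + 1) / 2) > 0" "Gamma (2 * M - (N + 1 + real j) / 2) > 0" "B j > 0"
    "Gamma (2 * M - real j - 1) > 0" if "j < n" for j
  proof -
    have "real j + 1 \<le> N" using that by (simp add: N_def)
    then show "Gamma (M - (real j + 1) / 2) > 0" "Gamma (2 * M - (N + 1 + real j) / 2) > 0" "B j > 0"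
      "Gamma (2 * M - real j - 1) > 0"
      using MN unfolding B_def by (auto intro!: Gamma_real_pos simp: field_simps)
  qed
  have X: "x_const n M = pi powr (N * (N + 1) / 4) *
    (\<Prod>j<n. Gamma (M - (real j + 1) / 2) * Gamma (2 * M - (N + 1 + real j) / 2) / (B j * Gamma (2 * M - real j - 1)))"
    unfolding B_def N_def by (rule x_const_eq) (use MN in \<open>simp add: N_def\<close>)
  have Y: "y_const n (M - N - 1) (2 * M - (N + 1) / 2) = pi powr (N * (N - 1) / 4) *
    (\<Prod>j<n. A j * B j / Gamma (2 * M - (N + 1 + real j) / 2))"
  proof -
    have e: "M - N - 1 + 1 + real j / 2 = M - N + real j / 2"
      "2 * M - (N + 1) / 2 - (M - N - 1) - 1 - (N - 1 + real j) / 2 = M - real j / 2"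
      "2 * M - (N + 1) / 2 - real j / 2 = 2 * M - (N + 1 + real j) / 2" for j
      by (simp_all add: field_simps)
    show ?thesis
      using y_const_eq[of n "2 * M - (N + 1) / 2" "M - N - 1"] MN
      unfolding N_def[symmetric] e A_def B_def by (simp add: field_simps)
  qed
  have tm: "(Gamma (M - (real j + 1) / 2) * Gamma (2 * M - (N + 1 + real j) / 2) / (B j * Gamma (2 * M - real j - 1))) *
      (A j * B j / Gamma (2 * M - (N + 1 + real j) / 2)) = (2 powr (- (2 * M)) * sqrt pi) * 2 ^ (j + 2) * (A j / B j)"
    if j: "j < n" for j
  proof -
    \<comment> \<open>The argument at which the duplication formula pairs Gamma(w) with B_j and
      produces Gamma(2M - j - 1).\<close>
    define w where "w = M - (real j + 1) / 2"
    have w0: "w > 0" using j MN by (simp add: w_def N_def field_simps)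
    have "Gamma w * Gamma (w + 1 / 2) = 2 powr (1 - 2 * w) * sqrt pi * Gamma (2 * w)"
      by (rule Gamma_duplication_real[OF w0])
    moreover have "w + 1 / 2 = M - real j / 2" "2 * w = 2 * M - real j - 1" "1 - 2 * w = real (j + 2) + - (2 * M)"
      by (simp_all add: w_def field_simps)
    ultimately have "Gamma w * B j = 2 powr (real (j + 2) + - (2 * M)) * sqrt pi * Gamma (2 * M - real j - 1)"
      unfolding B_def by (simp only:)
    also have "2 powr (real (j + 2) + - (2 * M)) = 2 ^ (j + 2) * 2 powr (- (2 * M))"
      by (simp only: powr_add) (simp add: powr_realpow powr_add)
    finally have dup: "Gamma w * B j = 2 ^ (j + 2) * 2 powr (- (2 * M)) * sqrt pi * Gamma (2 * M - real j - 1)" .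
    have "x * g / (b * h) * (a * b / g) = x * b / h * (a / b)" if "g \<noteq> 0" "b \<noteq> 0" for x g b h a :: real
      using that by (simp add: field_simps)
    from this[of "Gamma (2 * M - (N + 1 + real j) / 2)" "B j" "Gamma w" "Gamma (2 * M - real j - 1)" "A j"]
    have "(Gamma w * Gamma (2 * M - (N + 1 + real j) / 2) / (B j * Gamma (2 * M - real j - 1))) *
      (A j * B j / Gamma (2 * M - (N + 1 + real j) / 2)) = Gamma w * B j / Gamma (2 * M - real j - 1) * (A j / B j)"
      using pos(2,3)[OF j] by simp
    then show ?thesis unfolding w_def[symmetric] dup using pos(4)[OF j] by simp
  qed
  have tri: "(\<Prod>j<k. (2::real) ^ (j + 2)) = 2 powr (real k * (real k + 3) / 2)" for k
  proof (induction k)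
    case (Suc k)
    have "(2::real) powr (real k * (real k + 3) / 2) * 2 ^ (k + 2) = 2 powr (real k * (real k + 3) / 2 + real (k + 2))"
      by (subst powr_add) (simp add: powr_realpow powr_add)
    also have "real k * (real k + 3) / 2 + real (k + 2) = real (Suc k) * (real (Suc k) + 3) / 2"
      by (simp add: field_simps)
    finally show ?case using Suc by simp
  qed simp
  have "x_const n M * y_const n (M - N - 1) (2 * M - (N + 1) / 2) =
    (pi powr (N * (N + 1) / 4) * pi powr (N * (N - 1) / 4)) * (\<Prod>j<n. (2 powr (- (2 * M)) * sqrt pi) * 2 ^ (j + 2) * (A j / B j))"
  proof -
    have "(\<Prod>j<n. Gamma (M - (real j + 1) / 2) * Gamma (2 * M - (N + 1 + real j) / 2) / (B j * Gamma (2 * M - real j - 1))) *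
      (\<Prod>j<n. A j * B j / Gamma (2 * M - (N + 1 + real j) / 2)) = (\<Prod>j<n. (2 powr (- (2 * M)) * sqrt pi) * 2 ^ (j + 2) * (A j / B j))"
      unfolding prod.distrib[symmetric] by (intro prod.cong refl tm) simp
    then show ?thesis unfolding X Y by (simp only: mult_ac)
  qed
  also have "(\<Prod>j<n. (2 powr (- (2 * M)) * sqrt pi) * 2 ^ (j + 2) * (A j / B j)) =
     ((2 powr (- (2 * M))) ^ n * sqrt pi ^ n) * 2 powr (N * (N + 3) / 2) * ((\<Prod>j<n. A j) / (\<Prod>j<n. B j))"
    by (simp only: prod.distrib prod_dividef prod_constant card_lessThan power_mult_distrib tri N_def)
  also have "sqrt pi ^ n = pi powr (N / 2)"
    by (simp add: powr_half_sqrt[symmetric] powr_realpow[symmetric] powr_powr N_def)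
  also have "(2 powr (- (2 * M))) ^ n = (2::real) powr (- (2 * M * N))"
    by (simp add: powr_realpow[symmetric] powr_powr N_def)
  also have "(pi powr (N * (N + 1) / 4) * pi powr (N * (N - 1) / 4)) * (2 powr (- (2 * M * N)) * pi powr (N / 2) * 2 powr (N * (N + 3) / 2) * ((\<Prod>j<n. A j) / (\<Prod>j<n. B j))) =
    2 powr (- (2 * M * N)) * (2 powr (N * (N + 3) / 2) * (pi powr (N * (N + 1) / 4) * pi powr (N * (N - 1) / 4) * pi powr (N / 2)) * ((\<Prod>j<n. A j) / (\<Prod>j<n. B j)))"
    by (simp only: mult_ac)
  also have "pi powr (N * (N + 1) / 4) * pi powr (N * (N - 1) / 4) * pi powr (N / 2) = pi powr (N * (N + 1) / 2)"
    unfolding powr_add[symmetric] by (rule arg_cong[of _ _ "\<lambda>e. pi powr e"]) (simp add: field_simps)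
  \<comment> \<open>The order is reversed, r = n - j, whereas the denominators below use r = j +
    1.\<close>
  also have "(\<Prod>j<n. A j) = (\<Prod>r = 1..n. Gamma (real m - real (n + r) / 2))"
    by (rule prod.reindex_bij_witness[of _ "\<lambda>r. n - r" "\<lambda>j. n - j"])
       (auto simp: A_def M_def N_def of_nat_diff field_simps)
  also have "(\<Prod>j<n. B j) = (\<Prod>r = 1..n. Gamma (real m - (real r - 1) / 2))"
    by (rule prod.reindex_bij_witness[of _ "\<lambda>r. r - 1" "\<lambda>j. Suc j"])
       (auto simp: B_def M_def of_nat_diff)
  finally have fin0: "x_const n M * y_const n (M - N - 1) (2 * M - (N + 1) / 2) =
    2 powr (- (2 * M * N)) * (2 powr (N * (N + 3) / 2) * pi powr (N * (N + 1) / 2) *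
      ((\<Prod>r = 1..n. Gamma (real m - real (n + r) / 2)) / (\<Prod>r = 1..n. Gamma (real m - (real r - 1) / 2))))" .
  have fin: "x_const n M * y_const n (M - N - 1) (2 * M - (N + 1) / 2) = 2 powr (- (2 * M * N)) * C_const m n"
  proof -
    have "real (n * (n + 3)) / 2 = N * (N + 3) / 2" "real (n * (n + 1)) / 2 = N * (N + 1) / 2" by (simp_all add: N_def algebra_simps)
    then have "C_const m n = 2 powr (N * (N + 3) / 2) * pi powr (N * (N + 1) / 2) *
      ((\<Prod>r = 1..n. Gamma (real m - real (n + r) / 2)) / (\<Prod>r = 1..n. Gamma (real m - (real r - 1) / 2)))"
      by (simp only: C_const_def prod_dividef)
    then show ?thesis using fin0 by (simp only:)
  qed
  have "2 ^ (2 * m * n) = (2::real) powr (2 * M * N)"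
    by (simp add: M_def N_def powr_realpow[symmetric])
  then show ?thesis
    using fin by (simp add: M_def N_def powr_minus mult.assoc[symmetric])
qed

subsection \<open>Norm of the test function\<close>

lemma siegel_power_measurable:
  "(\<lambda>z :: 'n::{finite,linorder} cmat. cmod (det (z + mat \<i>)) powr a * det (Im_matrix z) powr b) \<in> borel_measurable siegel_measure"
  by (rule measurable_siegelI') measurable

lemma C_const_nonneg:
  assumes "m > n"
  shows "C_const m n \<ge> 0"
  unfolding C_const_def using assms
  by (intro mult_nonneg_nonneg prod_nonneg) (auto intro!: divide_nonneg_nonneg Gamma_real_nonneg)

lemma siegel_power_integrable:
  assumes p: "p > real CARD('n::{finite,linorder})"
  shows "integrable siegel_measure (\<lambda>z :: 'n cmat. cmod (det (z + mat \<i>)) powr (- 2 * p) * det (Im_matrix z) powr p)"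
  by (rule integrableI_nonneg[OF siegel_power_measurable]) (simp_all add: nn_integral_siegel_power[OF p, simplified])

lemma f_one_norm:
  assumes m: "m > CARD('n::{finite,linorder})"
  shows "(\<integral>z. (cmod (f_one m z))\<^sup>2 * det (Im_matrix z) ^ m \<partial>(siegel_measure :: 'n cmat measure)) = C_const m CARD('n)"
proof -
  let ?n = "CARD('n)"
  let ?X = "x_const ?n (real m) * y_const ?n (real m - real ?n - 1) (2 * real m - (real ?n + 1) / 2)"
  have p: "real m > real CARD('n)" using m by simp
  have C: "2 ^ (2 * m * ?n) * ?X = C_const m ?n" by (rule C_const_eq) (use m in simp_all)
  \<comment> \<open>The sign of \<open>?X\<close>, needed to return from extended nonnegative reals
    to reals, is read off from the closed form.\<close>
  then have "2 ^ (2 * m * ?n) * ?X \<ge> 0" using C_const_nonneg[OF m] by simp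
  moreover have "(2 ^ (2 * m * ?n) * 0 \<le> 2 ^ (2 * m * ?n) * ?X) = (0 \<le> ?X)" by (rule mult_le_cancel_left_pos) simp
  ultimately have X: "?X \<ge> 0" by (simp only: mult_zero_right)
  have pt: "(cmod (f_one m z))\<^sup>2 * det (Im_matrix z) ^ m =
      2 ^ (2 * m * ?n) * (cmod (det (z + mat \<i>)) powr (- 2 * real m) * det (Im_matrix z) powr real m)"
    if z: "z \<in> siegel" for z :: "'n cmat"
  proof -
    have "(cmod (det (z + mat \<i>)) powr (- real m))\<^sup>2 = cmod (det (z + mat \<i>)) powr (- 2 * real m)"
      by (simp add: power2_eq_square powr_add[symmetric])
    moreover have "((2::real) ^ (m * ?n))\<^sup>2 = 2 ^ (2 * m * ?n)" by (simp add: power_mult[symmetric] mult_ac)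
    ultimately show ?thesis
      unfolding norm_f_one[OF z] power_mult_distrib powr_realpow[OF siegel_det_Im_pos[OF z]] by simp
  qed
  have "(\<integral>z. (cmod (f_one m z))\<^sup>2 * det (Im_matrix z) ^ m \<partial>(siegel_measure :: 'n cmat measure)) =
      (\<integral>z. 2 ^ (2 * m * ?n) * (cmod (det (z + mat \<i>)) powr (- 2 * real m) * det (Im_matrix z) powr real m) \<partial>(siegel_measure :: 'n cmat measure))"
    by (rule Bochner_Integration.integral_cong) (simp_all only: pt space_siegel_measure)
  also have "\<dots> = 2 ^ (2 * m * ?n) * (\<integral>z. cmod (det (z + mat \<i>)) powr (- 2 * real m) * det (Im_matrix z) powr real m \<partial>(siegel_measure :: 'n cmat measure))"
    by (rule integral_mult_right_zero)
  also have "(\<integral>z. cmod (det (z + mat \<i>)) powr (- 2 * real m) * det (Im_matrix z) powr real m \<partial>(siegel_measure :: 'n cmat measure)) = ?X"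
    by (subst integral_eq_nn_integral[OF siegel_power_measurable])
       (simp_all only: nn_integral_siegel_power[OF p] enn2real_ennreal[OF X], simp)
  finally show ?thesis unfolding C .
qed

theorem corollary7p2:
  fixes \<Gamma> :: "'n::{finite,linorder} rmat2 set" and m :: nat
  assumes "m > 0" and "m > 2 * CARD('n)"
    and "congruence_subgroup \<Gamma>"
  shows "\<forall>f \<in> cusp_forms m \<Gamma>.
    petersson m \<Gamma> f (poincare_series m \<Gamma> (f_one m)) =
      complex_of_real (C_const m CARD('n)) * f (mat \<i>)"
proof
  fix f assume f: "f \<in> cusp_forms m \<Gamma>"
  interpret arith_group \<Gamma> by (rule congruence_subgroup_arith[OF assms(3)])
  have h: "siegel_holomorphic f" and b: "bdd_above ((\<lambda>z. norm (f z) * det (Im_matrix z) powr (real m / 2)) ` siegel)"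
    using f by (auto simp: cusp_forms_def)
  \<comment> \<open>Integrability of the kernel uses the exponent p = m/2, the norm of
    \<open>f_one\<close> further down uses p = m.\<close>
  have "real m / 2 > real CARD('n)" using assms(2) by linarith
  from siegel_power_integrable[OF this]
  have k: "integrable siegel_measure (cusp_kernel m f)"
    by (intro cusp_kernel_integrable[OF h b]) simp
  have "m > CARD('n)" using assms(2) by simp
  from f_one_norm[OF this] show "petersson m \<Gamma> f (poincare_series m \<Gamma> (f_one m)) = complex_of_real (C_const m CARD('n)) * f (mat \<i>)"
    unfolding petersson_unfold[OF f k] integral_cusp_kernel[OF h k] by simp
qed

end
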